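(* For all 2-categories $A,B$, the factorisation $$A\star B\xrightarrow{P}A\otimes B\xrightarrow{Q}A\times B$$ of the canonical comparison 2-functor $K:A\star B\to A\times B$ is the factorisation of $K$ into a boba 2-functor followed by an lff 2-functor (that is, $QP=K$, $P$ is boba and $Q$ is lff). Furthermore, $\otimes$ can be extended to a unique closed symmetric monoidal structure on $2\text{-}\mathrm{Cat}$, with unit the terminal 2-category $1$, such that both $P$ and $Q$ (with the identity of $1$ as unit comparison map) are oplax monoidal structures on the identity functor, $(2\text{-}\mathrm{Cat},\star)\to(2\text{-}\mathrm{Cat},\otimes)$ and $(2\text{-}\mathrm{Cat},\otimes)\to(2\text{-}\mathrm{Cat},\times)$ respectively.
   Context: $2\text{-}\mathrm{Cat}$ is the category of small 2-categories and (strict) 2-functors, with cartesian product $\times$ and terminal object $1$. A 2-functor is boba (bijective on objects and bijective on arrows) if it induces an isomorphism of underlying categories, and lff (locally full and faithful) if each $F_{x,y}:A(x,y)\to B(Fx,Fy)$ is full and faithful. Internal homs, each with objects the 2-functors $B\to C$: - $[B,C]$ has 1-cells the 2-natural transformations and 2-cells the modifications. - $[B,C]_f$ has hom-categories $[B,C]_f(F,G)=\prod_{x\in B}C(Fx,Gx)$. - $Ps(B,C)$ has 1-cells the pseudonatural transformations and 2-cells the modifications. A pseudonatural transformation $\alpha:F\Rightarrow G$ consists of 1-cells $\alpha_a:Fa\to Ga$ and invertible 2-cells $\alpha_f:\alpha_b\,Ff\Rightarrow Gf\,\alpha_a$ for $f:a\to b$, with $\alpha_{\mathrm{id}}$ an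 identity, $(G\tau*1)\alpha_f=\alpha_{f'}(1*F\tau)$ for $\tau:f\Rightarrow f'$, and $\alpha_{gf}=(1*\alpha_f)(\alpha_g*1)$. A modification $\Gamma:\eta\to\mu$ is a family of 2-cells $\Gamma_x:\eta_x\Rightarrow\mu_x$ with $(1_{Gf}*\Gamma_a)\eta_f=\mu_f(\Gamma_b*1_{Ff})$ for all $f:a\to b$. There are natural 2-functors $J_1:[B,C]\to Ps(B,C)$ (a 2-natural transformation has identity 2-cell components) and $J_2:Ps(B,C)\to[B,C]_f$ (forget the 2-cell components), with composite $J:[B,C]\to[B,C]_f$. The funny tensor product $A\star B$ is the pushout of $1\times i:obA\times obB\to obA\times B$ and $i\times1:obA\times obB\to A\times obB$ in $2\text{-}\mathrm{Cat}$, where $obD$ is the discrete 2-category on the objects of $D$ and $i:obD\to D$ the inclusion; it satisfies $2\text{-}\mathrm{Cat}(A\star B,C)\cong2\text{-}\mathrm{Cat}(A,[B,C]_f)$ and is part of a symmetric monoidal structure with unit $1$. The comparison $K:A\star B\to A\times B$ is induced from the pushout by $1\times i:A\times obB\to A\times B$ and $i\times1:obA\times B\to A\times B$; equivalently it corresponds by Yoneda to composition with $J$. With the identity of $1$ as unit map, $K$ is an oplax symmetric monoidal structure on the identity functor $(2\text{-}\mathrm{Cat},\star)\to(2\text{-}\mathrm{Cat},\times)$. The Gray tensor product $A\otimes B$ is a representing object for $2\text{-}\mathrm{Cat}(A,Ps(B,-)):2\text{-}\mathrm{Cat}\to\mathrm{Set}$, so $2\text{-}\mathrm{Cat}(A\otimes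 B,C)\cong2\text{-}\mathrm{Cat}(A,Ps(B,C))$ naturally in $C$; $\otimes$ is made a functor of two variables so that this is natural in $A,B$ also. The 2-functors $P:A\star B\to A\otimes B$ and $Q:A\otimes B\to A\times B$ are those for which precomposition $P^*:2\text{-}\mathrm{Cat}(A\otimes B,C)\to2\text{-}\mathrm{Cat}(A\star B,C)$ and $Q^*:2\text{-}\mathrm{Cat}(A\times B,C)\to2\text{-}\mathrm{Cat}(A\otimes B,C)$ correspond, under the adjunction isomorphisms, to $(J_2)_*:2\text{-}\mathrm{Cat}(A,Ps(B,C))\to2\text{-}\mathrm{Cat}(A,[B,C]_f)$ and $(J_1)_*:2\text{-}\mathrm{Cat}(A,[B,C])\to2\text{-}\mathrm{Cat}(A,Ps(B,C))$. An oplax monoidal structure on the identity functor from $(C,\otimes,I,a,l,r)$ to $(C,\otimes',I',a',l',r')$ consists of a natural family $\phi_{x,y}:x\otimes y\to x\otimes' y$ and a map $\phi_0:I\to I'$ with $l'(\phi_0\otimes'1)\phi_{I,x}=l$, $r'(1\otimes'\phi_0)\phi_{x,I}=r$ and $(1\otimes'\phi_{y,z})\phi_{x,y\otimes z}\,a=a'(\phi_{x,y}\otimes'1)\phi_{x\otimes y,z}$. A symmetric monoidal structure is closed if each $-\otimes B$ has a right adjoint. *)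

theory Defs
  imports "HOL-Library.FuncSet" "HOL-Library.Equipollence"
begin

section \<open>2-categories and 2-functors\<close>

text \<open>
  Objects, 1-cells and 2-cells form sets in three possibly different types, so that the internal
  homs below are 2-categories in the same sense. \<open>comp1 g f\<close>, \<open>vcomp \<tau> \<sigma>\<close> and \<open>hcomp \<tau> \<sigma>\<close> are all
  written in the order of composition of functions: the right-hand argument is applied first.
\<close>

record ('o, 'a, 't) twocat =
  Ob :: "'o set"
  Ar :: "'a set"
  Tw :: "'t set"
  src1 :: "'a \<Rightarrow> 'o"
  tgt1 :: "'a \<Rightarrow> 'o"
  id1 :: "'o \<Rightarrow> 'a"
  comp1 :: "'a \<Rightarrow> 'a \<Rightarrow> 'a"
  src2 :: "'t \<Rightarrow> 'a"
  tgt2 :: "'t \<Rightarrow> 'a"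
  id2 :: "'a \<Rightarrow> 't"
  vcomp :: "'t \<Rightarrow> 't \<Rightarrow> 't"
  hcomp :: "'t \<Rightarrow> 't \<Rightarrow> 't"

text \<open>
  All operations are made undefined outside their domain of definition. With \<open>trim C = C\<close> as part
  of the definition of a 2-category, equality of records is equality of 2-categories.
\<close>

definition trim :: "('o, 'a, 't) twocat \<Rightarrow> ('o, 'a, 't) twocat" where
  "trim C = C \<lparr>
     src1 := restrict (src1 C) (Ar C),
     tgt1 := restrict (tgt1 C) (Ar C),
     id1 := restrict (id1 C) (Ob C),
     comp1 := (\<lambda>g f. if g \<in> Ar C \<and> f \<in> Ar C \<and> src1 C g = tgt1 C f
                      then comp1 C g f else undefined),
     src2 := restrict (src2 C) (Tw C),
     tgt2 := restrict (tgt2 C) (Tw C),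
     id2 := restrict (id2 C) (Ar C),
     vcomp := (\<lambda>\<tau> \<sigma>. if \<tau> \<in> Tw C \<and> \<sigma> \<in> Tw C \<and> src2 C \<tau> = tgt2 C \<sigma>
                      then vcomp C \<tau> \<sigma> else undefined),
     hcomp := (\<lambda>\<tau> \<sigma>. if \<tau> \<in> Tw C \<and> \<sigma> \<in> Tw C \<and> src1 C (src2 C \<tau>) = tgt1 C (src2 C \<sigma>)
                      then hcomp C \<tau> \<sigma> else undefined) \<rparr>"

definition hom1 :: "('o, 'a, 't) twocat \<Rightarrow> 'o \<Rightarrow> 'o \<Rightarrow> 'a set" where
  "hom1 C x y = {f \<in> Ar C. src1 C f = x \<and> tgt1 C f = y}"

definition hom2 :: "('o, 'a, 't) twocat \<Rightarrow> 'a \<Rightarrow> 'a \<Rightarrow> 't set" where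
  "hom2 C f g = {\<tau> \<in> Tw C. src2 C \<tau> = f \<and> tgt2 C \<tau> = g}"

locale two_category =
  fixes C :: "('o, 'a, 't) twocat"
  assumes trimmed: "trim C = C"
    and src1_in: "f \<in> Ar C \<Longrightarrow> src1 C f \<in> Ob C"
    and tgt1_in: "f \<in> Ar C \<Longrightarrow> tgt1 C f \<in> Ob C"
    and id1_in: "x \<in> Ob C \<Longrightarrow> id1 C x \<in> hom1 C x x"
    and comp1_in: "\<lbrakk>f \<in> hom1 C x y; g \<in> hom1 C y z\<rbrakk> \<Longrightarrow> comp1 C g f \<in> hom1 C x z"
    and comp1_id_right: "f \<in> hom1 C x y \<Longrightarrow> comp1 C f (id1 C x) = f"
    and comp1_id_left: "f \<in> hom1 C x y \<Longrightarrow> comp1 C (id1 C y) f = f"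
    and comp1_assoc: "\<lbrakk>f \<in> hom1 C w x; g \<in> hom1 C x y; h \<in> hom1 C y z\<rbrakk> \<Longrightarrow>
          comp1 C h (comp1 C g f) = comp1 C (comp1 C h g) f"
    and src2_in: "\<tau> \<in> Tw C \<Longrightarrow> src2 C \<tau> \<in> Ar C"
    and tgt2_in: "\<tau> \<in> Tw C \<Longrightarrow> tgt2 C \<tau> \<in> Ar C"
    and src1_src2: "\<tau> \<in> Tw C \<Longrightarrow> src1 C (src2 C \<tau>) = src1 C (tgt2 C \<tau>)"
    and tgt1_src2: "\<tau> \<in> Tw C \<Longrightarrow> tgt1 C (src2 C \<tau>) = tgt1 C (tgt2 C \<tau>)"
    and id2_in: "f \<in> Ar C \<Longrightarrow> id2 C f \<in> hom2 C f f"
    and vcomp_in: "\<lbrakk>\<sigma> \<in> hom2 C f g; \<tau> \<in> hom2 C g h\<rbrakk> \<Longrightarrow> vcomp C \<tau> \<sigma> \<in> hom2 C f h"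
    and vcomp_id_right: "\<sigma> \<in> hom2 C f g \<Longrightarrow> vcomp C \<sigma> (id2 C f) = \<sigma>"
    and vcomp_id_left: "\<sigma> \<in> hom2 C f g \<Longrightarrow> vcomp C (id2 C g) \<sigma> = \<sigma>"
    and vcomp_assoc: "\<lbrakk>\<rho> \<in> hom2 C e f; \<sigma> \<in> hom2 C f g; \<tau> \<in> hom2 C g h\<rbrakk> \<Longrightarrow>
          vcomp C \<tau> (vcomp C \<sigma> \<rho>) = vcomp C (vcomp C \<tau> \<sigma>) \<rho>"
    and hcomp_in: "\<lbrakk>f \<in> hom1 C x y; g \<in> hom1 C y z; \<sigma> \<in> hom2 C f f'; \<tau> \<in> hom2 C g g'\<rbrakk> \<Longrightarrow>
          hcomp C \<tau> \<sigma> \<in> hom2 C (comp1 C g f) (comp1 C g' f')"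
    and hcomp_id_right: "\<lbrakk>f \<in> hom1 C x y; \<sigma> \<in> hom2 C f f'\<rbrakk> \<Longrightarrow> hcomp C \<sigma> (id2 C (id1 C x)) = \<sigma>"
    and hcomp_id_left: "\<lbrakk>f \<in> hom1 C x y; \<sigma> \<in> hom2 C f f'\<rbrakk> \<Longrightarrow> hcomp C (id2 C (id1 C y)) \<sigma> = \<sigma>"
    and hcomp_assoc: "\<lbrakk>f \<in> hom1 C w x; g \<in> hom1 C x y; h \<in> hom1 C y z;
            \<rho> \<in> hom2 C f f'; \<sigma> \<in> hom2 C g g'; \<tau> \<in> hom2 C h h'\<rbrakk> \<Longrightarrow>
          hcomp C \<tau> (hcomp C \<sigma> \<rho>) = hcomp C (hcomp C \<tau> \<sigma>) \<rho>"
    and hcomp_id2: "\<lbrakk>f \<in> hom1 C x y; g \<in> hom1 C y z\<rbrakk> \<Longrightarrow>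
          hcomp C (id2 C g) (id2 C f) = id2 C (comp1 C g f)"
    and interchange: "\<lbrakk>f \<in> hom1 C x y; g \<in> hom1 C y z;
            \<sigma> \<in> hom2 C f f'; \<sigma>' \<in> hom2 C f' f''; \<tau> \<in> hom2 C g g'; \<tau>' \<in> hom2 C g' g''\<rbrakk> \<Longrightarrow>
          hcomp C (vcomp C \<tau>' \<tau>) (vcomp C \<sigma>' \<sigma>) = vcomp C (hcomp C \<tau>' \<sigma>') (hcomp C \<tau> \<sigma>)"

record ('o, 'a, 't, 'p, 'b, 's) twofun =
  Dom :: "('o, 'a, 't) twocat"
  Cod :: "('p, 'b, 's) twocat"
  on0 :: "'o \<Rightarrow> 'p"
  on1 :: "'a \<Rightarrow> 'b"
  on2 :: "'t \<Rightarrow> 's"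

definition two_functor :: "('o, 'a, 't, 'p, 'b, 's) twofun \<Rightarrow> bool" where
  "two_functor F \<longleftrightarrow>
     (let A = Dom F; B = Cod F in
      on0 F \<in> Ob A \<rightarrow>\<^sub>E Ob B \<and> on1 F \<in> Ar A \<rightarrow>\<^sub>E Ar B \<and> on2 F \<in> Tw A \<rightarrow>\<^sub>E Tw B \<and>
      (\<forall>f \<in> Ar A. src1 B (on1 F f) = on0 F (src1 A f) \<and> tgt1 B (on1 F f) = on0 F (tgt1 A f)) \<and>
      (\<forall>x \<in> Ob A. on1 F (id1 A x) = id1 B (on0 F x)) \<and>
      (\<forall>g \<in> Ar A. \<forall>f \<in> Ar A. src1 A g = tgt1 A f \<longrightarrow>
         on1 F (comp1 A g f) = comp1 B (on1 F g) (on1 F f)) \<and>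
      (\<forall>\<tau> \<in> Tw A. src2 B (on2 F \<tau>) = on1 F (src2 A \<tau>) \<and> tgt2 B (on2 F \<tau>) = on1 F (tgt2 A \<tau>)) \<and>
      (\<forall>f \<in> Ar A. on2 F (id2 A f) = id2 B (on1 F f)) \<and>
      (\<forall>\<tau> \<in> Tw A. \<forall>\<sigma> \<in> Tw A. src2 A \<tau> = tgt2 A \<sigma> \<longrightarrow>
         on2 F (vcomp A \<tau> \<sigma>) = vcomp B (on2 F \<tau>) (on2 F \<sigma>)) \<and>
      (\<forall>\<tau> \<in> Tw A. \<forall>\<sigma> \<in> Tw A. src1 A (src2 A \<tau>) = tgt1 A (src2 A \<sigma>) \<longrightarrow>
         on2 F (hcomp A \<tau> \<sigma>) = hcomp B (on2 F \<tau>) (on2 F \<sigma>)))"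

definition Fun :: "('o, 'a, 't) twocat \<Rightarrow> ('p, 'b, 's) twocat
    \<Rightarrow> ('o, 'a, 't, 'p, 'b, 's) twofun set" where
  "Fun A B = {F. two_functor F \<and> Dom F = A \<and> Cod F = B}"

definition fid :: "('o, 'a, 't) twocat \<Rightarrow> ('o, 'a, 't, 'o, 'a, 't) twofun" where
  "fid A = \<lparr>Dom = A, Cod = A,
     on0 = (\<lambda>x \<in> Ob A. x), on1 = (\<lambda>f \<in> Ar A. f), on2 = (\<lambda>\<tau> \<in> Tw A. \<tau>)\<rparr>"

definition fcomp :: "('p, 'b, 's, 'q, 'c, 'r) twofun \<Rightarrow> ('o, 'a, 't, 'p, 'b, 's) twofun
    \<Rightarrow> ('o, 'a, 't, 'q, 'c, 'r) twofun" (infixr \<open>\<bullet>\<close> 70) where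
  "G \<bullet> F = \<lparr>Dom = Dom F, Cod = Cod G,
     on0 = compose (Ob (Dom F)) (on0 G) (on0 F),
     on1 = compose (Ar (Dom F)) (on1 G) (on1 F),
     on2 = compose (Tw (Dom F)) (on2 G) (on2 F)\<rparr>"

definition boba :: "('o, 'a, 't, 'p, 'b, 's) twofun \<Rightarrow> bool" where
  "boba F \<longleftrightarrow> bij_betw (on0 F) (Ob (Dom F)) (Ob (Cod F)) \<and>
              bij_betw (on1 F) (Ar (Dom F)) (Ar (Cod F))"

definition lff :: "('o, 'a, 't, 'p, 'b, 's) twofun \<Rightarrow> bool" where
  "lff F \<longleftrightarrow> (\<forall>x \<in> Ob (Dom F). \<forall>y \<in> Ob (Dom F).
     \<forall>f \<in> hom1 (Dom F) x y. \<forall>g \<in> hom1 (Dom F) x y.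
       bij_betw (on2 F) (hom2 (Dom F) f g) (hom2 (Cod F) (on1 F f) (on1 F g)))"


section \<open>Internal homs\<close>

text \<open>
  A 1-cell (2-cell) of an internal hom carries its source and target 2-functors (1-cells)
  together with its components.
\<close>

datatype ('f, 'd) cell = Cell (csrc: 'f) (ctgt: 'f) (cdat: 'd)

type_synonym ('o, 'a, 't, 'p, 'b, 's) trans =
  "(('o, 'a, 't, 'p, 'b, 's) twofun, 'o \<Rightarrow> 'b) cell"
type_synonym ('o, 'a, 't, 'p, 'b, 's) pstrans =
  "(('o, 'a, 't, 'p, 'b, 's) twofun, ('o \<Rightarrow> 'b) \<times> ('a \<Rightarrow> 's)) cell"

text \<open>\<open>[B, C]\<^sub>f\<close>: the hom-category from \<open>F\<close> to \<open>G\<close> is the product of the \<open>C(F x, G x)\<close>.\<close>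

definition fun_hom :: "('o, 'a, 't) twocat \<Rightarrow> ('p, 'b, 's) twocat \<Rightarrow>
    (('o, 'a, 't, 'p, 'b, 's) twofun, ('o, 'a, 't, 'p, 'b, 's) trans,
     (('o, 'a, 't, 'p, 'b, 's) trans, 'o \<Rightarrow> 's) cell) twocat" where
  "fun_hom B C =
     (let ar = {\<eta>. csrc \<eta> \<in> Fun B C \<and> ctgt \<eta> \<in> Fun B C \<and>
                   cdat \<eta> \<in> (\<Pi>\<^sub>E x \<in> Ob B. hom1 C (on0 (csrc \<eta>) x) (on0 (ctgt \<eta>) x))};
          cmp = (\<lambda>\<mu> \<eta>. Cell (csrc \<eta>) (ctgt \<mu>) (\<lambda>x \<in> Ob B. comp1 C (cdat \<mu> x) (cdat \<eta> x)))
      in trim \<lparr>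
       Ob = Fun B C,
       Ar = ar,
       Tw = {\<Gamma>. csrc \<Gamma> \<in> ar \<and> ctgt \<Gamma> \<in> ar \<and>
                csrc (csrc \<Gamma>) = csrc (ctgt \<Gamma>) \<and> ctgt (csrc \<Gamma>) = ctgt (ctgt \<Gamma>) \<and>
                cdat \<Gamma> \<in> (\<Pi>\<^sub>E x \<in> Ob B. hom2 C (cdat (csrc \<Gamma>) x) (cdat (ctgt \<Gamma>) x))},
       src1 = csrc,
       tgt1 = ctgt,
       id1 = (\<lambda>F. Cell F F (\<lambda>x \<in> Ob B. id1 C (on0 F x))),
       comp1 = cmp,
       src2 = csrc,
       tgt2 = ctgt,
       id2 = (\<lambda>\<eta>. Cell \<eta> \<eta> (\<lambda>x \<in> Ob B. id2 C (cdat \<eta> x))),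
       vcomp = (\<lambda>\<Delta> \<Gamma>. Cell (csrc \<Gamma>) (ctgt \<Delta>) (\<lambda>x \<in> Ob B. vcomp C (cdat \<Delta> x) (cdat \<Gamma> x))),
       hcomp = (\<lambda>\<Delta> \<Gamma>. Cell (cmp (csrc \<Delta>) (csrc \<Gamma>)) (cmp (ctgt \<Delta>) (ctgt \<Gamma>))
                        (\<lambda>x \<in> Ob B. hcomp C (cdat \<Delta> x) (cdat \<Gamma> x))) \<rparr>)"

definition two_natural ::
    "('o, 'a, 't) twocat \<Rightarrow> ('p, 'b, 's) twocat \<Rightarrow> ('o, 'a, 't, 'p, 'b, 's) trans \<Rightarrow> bool" where
  "two_natural B C \<eta> \<longleftrightarrow>
     \<eta> \<in> Ar (fun_hom B C) \<and>
     (\<forall>a \<in> Ob B. \<forall>b \<in> Ob B. \<forall>f \<in> hom1 B a b.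
        comp1 C (cdat \<eta> b) (on1 (csrc \<eta>) f) = comp1 C (on1 (ctgt \<eta>) f) (cdat \<eta> a)) \<and>
     (\<forall>a \<in> Ob B. \<forall>b \<in> Ob B. \<forall>f \<in> hom1 B a b. \<forall>f' \<in> hom1 B a b. \<forall>\<tau> \<in> hom2 B f f'.
        hcomp C (id2 C (cdat \<eta> b)) (on2 (csrc \<eta>) \<tau>) =
        hcomp C (on2 (ctgt \<eta>) \<tau>) (id2 C (cdat \<eta> a)))"

text \<open>\<open>[B, C]\<close>, with the same operations as \<open>[B, C]\<^sub>f\<close>.\<close>

definition strict_hom :: "('o, 'a, 't) twocat \<Rightarrow> ('p, 'b, 's) twocat \<Rightarrow>
    (('o, 'a, 't, 'p, 'b, 's) twofun, ('o, 'a, 't, 'p, 'b, 's) trans,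
     (('o, 'a, 't, 'p, 'b, 's) trans, 'o \<Rightarrow> 's) cell) twocat" where
  "strict_hom B C = trim ((fun_hom B C) \<lparr>
     Ar := {\<eta>. two_natural B C \<eta>},
     Tw := {\<Gamma> \<in> Tw (fun_hom B C). two_natural B C (csrc \<Gamma>) \<and> two_natural B C (ctgt \<Gamma>) \<and>
             (\<forall>a \<in> Ob B. \<forall>b \<in> Ob B. \<forall>f \<in> hom1 B a b.
                hcomp C (id2 C (on1 (ctgt (csrc \<Gamma>)) f)) (cdat \<Gamma> a) =
                hcomp C (cdat \<Gamma> b) (id2 C (on1 (csrc (csrc \<Gamma>)) f)))} \<rparr>)"

definition invertible2 :: "('o, 'a, 't) twocat \<Rightarrow> 't \<Rightarrow> bool" where
  "invertible2 C \<tau> \<longleftrightarrow> \<tau> \<in> Tw C \<and>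
     (\<exists>\<sigma> \<in> hom2 C (tgt2 C \<tau>) (src2 C \<tau>).
        vcomp C \<sigma> \<tau> = id2 C (src2 C \<tau>) \<and> vcomp C \<tau> \<sigma> = id2 C (tgt2 C \<tau>))"

definition pseudonatural ::
    "('o, 'a, 't) twocat \<Rightarrow> ('p, 'b, 's) twocat \<Rightarrow> ('o, 'a, 't, 'p, 'b, 's) pstrans \<Rightarrow> bool" where
  "pseudonatural B C \<alpha> \<longleftrightarrow>
     (let F = csrc \<alpha>; G = ctgt \<alpha>; \<alpha>0 = fst (cdat \<alpha>); \<alpha>1 = snd (cdat \<alpha>) in
      F \<in> Fun B C \<and> G \<in> Fun B C \<and>
      \<alpha>0 \<in> (\<Pi>\<^sub>E x \<in> Ob B. hom1 C (on0 F x) (on0 G x)) \<and>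
      \<alpha>1 \<in> (\<Pi>\<^sub>E f \<in> Ar B. hom2 C (comp1 C (\<alpha>0 (tgt1 B f)) (on1 F f))
                               (comp1 C (on1 G f) (\<alpha>0 (src1 B f)))) \<and>
      (\<forall>f \<in> Ar B. invertible2 C (\<alpha>1 f)) \<and>
      (\<forall>a \<in> Ob B. \<alpha>1 (id1 B a) = id2 C (\<alpha>0 a)) \<and>
      (\<forall>a \<in> Ob B. \<forall>b \<in> Ob B. \<forall>f \<in> hom1 B a b. \<forall>f' \<in> hom1 B a b. \<forall>\<tau> \<in> hom2 B f f'.
         vcomp C (hcomp C (on2 G \<tau>) (id2 C (\<alpha>0 a))) (\<alpha>1 f) =
         vcomp C (\<alpha>1 f') (hcomp C (id2 C (\<alpha>0 b)) (on2 F \<tau>))) \<and>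
      (\<forall>a \<in> Ob B. \<forall>b \<in> Ob B. \<forall>c \<in> Ob B. \<forall>f \<in> hom1 B a b. \<forall>g \<in> hom1 B b c.
         \<alpha>1 (comp1 B g f) =
         vcomp C (hcomp C (id2 C (on1 G g)) (\<alpha>1 f)) (hcomp C (\<alpha>1 g) (id2 C (on1 F f)))))"

definition ps_modification :: "('o, 'a, 't) twocat \<Rightarrow> ('p, 'b, 's) twocat \<Rightarrow>
    (('o, 'a, 't, 'p, 'b, 's) pstrans, 'o \<Rightarrow> 's) cell \<Rightarrow> bool" where
  "ps_modification B C \<Gamma> \<longleftrightarrow>
     (let \<eta> = csrc \<Gamma>; \<mu> = ctgt \<Gamma> in
      pseudonatural B C \<eta> \<and> pseudonatural B C \<mu> \<and> csrc \<eta> = csrc \<mu> \<and> ctgt \<eta> = ctgt \<mu> \<and>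
      cdat \<Gamma> \<in> (\<Pi>\<^sub>E x \<in> Ob B. hom2 C (fst (cdat \<eta>) x) (fst (cdat \<mu>) x)) \<and>
      (\<forall>a \<in> Ob B. \<forall>b \<in> Ob B. \<forall>f \<in> hom1 B a b.
         vcomp C (hcomp C (id2 C (on1 (ctgt \<eta>) f)) (cdat \<Gamma> a)) (snd (cdat \<eta>) f) =
         vcomp C (snd (cdat \<mu>) f) (hcomp C (cdat \<Gamma> b) (id2 C (on1 (csrc \<eta>) f)))))"

text \<open>
  The 2-cell component of a composite \<open>\<beta>\<alpha>\<close> at \<open>f: a \<rightarrow> b\<close> is the pasting
  \<open>\<beta>\<^sub>b \<alpha>\<^sub>b Ff \<Rightarrow> \<beta>\<^sub>b Gf \<alpha>\<^sub>a \<Rightarrow> Hf \<beta>\<^sub>a \<alpha>\<^sub>a\<close>.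
\<close>

definition ps_hom :: "('o, 'a, 't) twocat \<Rightarrow> ('p, 'b, 's) twocat \<Rightarrow>
    (('o, 'a, 't, 'p, 'b, 's) twofun, ('o, 'a, 't, 'p, 'b, 's) pstrans,
     (('o, 'a, 't, 'p, 'b, 's) pstrans, 'o \<Rightarrow> 's) cell) twocat" where
  "ps_hom B C =
     (let cmp = (\<lambda>\<beta> \<alpha>. Cell (csrc \<alpha>) (ctgt \<beta>)
            (\<lambda>x \<in> Ob B. comp1 C (fst (cdat \<beta>) x) (fst (cdat \<alpha>) x),
             \<lambda>f \<in> Ar B. vcomp C
               (hcomp C (snd (cdat \<beta>) f) (id2 C (fst (cdat \<alpha>) (src1 B f))))
               (hcomp C (id2 C (fst (cdat \<beta>) (tgt1 B f))) (snd (cdat \<alpha>) f))))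
      in trim \<lparr>
       Ob = Fun B C,
       Ar = {\<alpha>. pseudonatural B C \<alpha>},
       Tw = {\<Gamma>. ps_modification B C \<Gamma>},
       src1 = csrc,
       tgt1 = ctgt,
       id1 = (\<lambda>F. Cell F F (\<lambda>x \<in> Ob B. id1 C (on0 F x), \<lambda>f \<in> Ar B. id2 C (on1 F f))),
       comp1 = cmp,
       src2 = csrc,
       tgt2 = ctgt,
       id2 = (\<lambda>\<eta>. Cell \<eta> \<eta> (\<lambda>x \<in> Ob B. id2 C (fst (cdat \<eta>) x))),
       vcomp = (\<lambda>\<Delta> \<Gamma>. Cell (csrc \<Gamma>) (ctgt \<Delta>) (\<lambda>x \<in> Ob B. vcomp C (cdat \<Delta> x) (cdat \<Gamma> x))),
       hcomp = (\<lambda>\<Delta> \<Gamma>. Cell (cmp (csrc \<Delta>) (csrc \<Gamma>)) (cmp (ctgt \<Delta>) (ctgt \<Gamma>))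
                        (\<lambda>x \<in> Ob B. hcomp C (cdat \<Delta> x) (cdat \<Gamma> x))) \<rparr>)"

definition J1 :: "('o, 'a, 't) twocat \<Rightarrow> ('p, 'b, 's) twocat \<Rightarrow> _" where
  "J1 B C =
     (let j = (\<lambda>\<eta>. Cell (csrc \<eta>) (ctgt \<eta>)
            (cdat \<eta>, \<lambda>f \<in> Ar B. id2 C (comp1 C (cdat \<eta> (tgt1 B f)) (on1 (csrc \<eta>) f))))
      in \<lparr>Dom = strict_hom B C, Cod = ps_hom B C,
          on0 = (\<lambda>F \<in> Ob (strict_hom B C). F),
          on1 = (\<lambda>\<eta> \<in> Ar (strict_hom B C). j \<eta>),
          on2 = (\<lambda>\<Gamma> \<in> Tw (strict_hom B C). Cell (j (csrc \<Gamma>)) (j (ctgt \<Gamma>)) (cdat \<Gamma>))\<rparr>)"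

definition J2 :: "('o, 'a, 't) twocat \<Rightarrow> ('p, 'b, 's) twocat \<Rightarrow> _" where
  "J2 B C =
     (let j = (\<lambda>\<alpha>. Cell (csrc \<alpha>) (ctgt \<alpha>) (fst (cdat \<alpha>)))
      in \<lparr>Dom = ps_hom B C, Cod = fun_hom B C,
          on0 = (\<lambda>F \<in> Ob (ps_hom B C). F),
          on1 = (\<lambda>\<alpha> \<in> Ar (ps_hom B C). j \<alpha>),
          on2 = (\<lambda>\<Gamma> \<in> Tw (ps_hom B C). Cell (j (csrc \<Gamma>)) (j (ctgt \<Gamma>)) (cdat \<Gamma>))\<rparr>)"

text \<open>\<open>Ps(G, H): Ps(B, C) \<rightarrow> Ps(B', C')\<close> for \<open>G: B' \<rightarrow> B\<close> and \<open>H: C \<rightarrow> C'\<close>.\<close>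

definition ps_map :: "('o1, 'a1, 't1, 'o, 'a, 't) twofun \<Rightarrow> ('p, 'b, 's, 'p1, 'b1, 's1) twofun \<Rightarrow> _" where
  "ps_map G H =
     (let B' = Dom G; B = Cod G; C = Dom H; C' = Cod H;
          w = (\<lambda>\<alpha>. Cell (H \<bullet> csrc \<alpha> \<bullet> G) (H \<bullet> ctgt \<alpha> \<bullet> G)
                (\<lambda>x \<in> Ob B'. on1 H (fst (cdat \<alpha>) (on0 G x)),
                 \<lambda>f \<in> Ar B'. on2 H (snd (cdat \<alpha>) (on1 G f))))
      in \<lparr>Dom = ps_hom B C, Cod = ps_hom B' C',
          on0 = (\<lambda>F \<in> Ob (ps_hom B C). H \<bullet> F \<bullet> G),
          on1 = (\<lambda>\<alpha> \<in> Ar (ps_hom B C). w \<alpha>),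
          on2 = (\<lambda>\<Gamma> \<in> Tw (ps_hom B C). Cell (w (csrc \<Gamma>)) (w (ctgt \<Gamma>))
                   (\<lambda>x \<in> Ob B'. on2 H (cdat \<Gamma> (on0 G x))))\<rparr>)"


section \<open>Categories, adjoints, monoidal structures\<close>

record ('o, 'm) category =
  Obj :: "'o set"
  Hom :: "'o \<Rightarrow> 'o \<Rightarrow> 'm set"
  Id :: "'o \<Rightarrow> 'm"
  Comp :: "'m \<Rightarrow> 'm \<Rightarrow> 'm"  (infixr \<open>\<cdot>\<index>\<close> 70)

definition iso_in :: "('o, 'm) category \<Rightarrow> 'o \<Rightarrow> 'o \<Rightarrow> 'm \<Rightarrow> bool" where
  "iso_in C A B f \<longleftrightarrow>
     f \<in> Hom C A B \<and> (\<exists>g \<in> Hom C B A. g \<cdot>\<^bsub>C\<^esub> f = Id C A \<and> f \<cdot>\<^bsub>C\<^esub> g = Id C B)"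

definition endofunctor :: "('o, 'm) category \<Rightarrow> ('o \<Rightarrow> 'o) \<Rightarrow> ('m \<Rightarrow> 'm) \<Rightarrow> bool" where
  "endofunctor C F0 F1 \<longleftrightarrow>
     (\<forall>A \<in> Obj C. F0 A \<in> Obj C \<and> F1 (Id C A) = Id C (F0 A)) \<and>
     (\<forall>A \<in> Obj C. \<forall>B \<in> Obj C. \<forall>f \<in> Hom C A B. F1 f \<in> Hom C (F0 A) (F0 B)) \<and>
     (\<forall>X \<in> Obj C. \<forall>Y \<in> Obj C. \<forall>Z \<in> Obj C. \<forall>f \<in> Hom C X Y. \<forall>g \<in> Hom C Y Z.
        F1 (g \<cdot>\<^bsub>C\<^esub> f) = F1 g \<cdot>\<^bsub>C\<^esub> F1 f)"

definition has_right_adjoint :: "('o, 'm) category \<Rightarrow> ('o \<Rightarrow> 'o) \<Rightarrow> ('m \<Rightarrow> 'm) \<Rightarrow> bool" where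
  "has_right_adjoint C F0 F1 \<longleftrightarrow>
     (\<exists>R0 R1 (\<theta> :: 'o \<Rightarrow> 'o \<Rightarrow> 'm \<Rightarrow> 'm). endofunctor C R0 R1 \<and>
        (\<forall>X \<in> Obj C. \<forall>Y \<in> Obj C. bij_betw (\<theta> X Y) (Hom C (F0 X) Y) (Hom C X (R0 Y))) \<and>
        (\<forall>X \<in> Obj C. \<forall>X' \<in> Obj C. \<forall>Y \<in> Obj C. \<forall>Y' \<in> Obj C.
           \<forall>f \<in> Hom C X' X. \<forall>g \<in> Hom C Y Y'. \<forall>h \<in> Hom C (F0 X) Y.
             \<theta> X' Y' (g \<cdot>\<^bsub>C\<^esub> h \<cdot>\<^bsub>C\<^esub> F1 f) = R1 g \<cdot>\<^bsub>C\<^esub> \<theta> X Y h \<cdot>\<^bsub>C\<^esub> f))"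

definition bifunctor :: "('o, 'm) category \<Rightarrow> ('o \<Rightarrow> 'o \<Rightarrow> 'o) \<Rightarrow> ('m \<Rightarrow> 'm \<Rightarrow> 'm) \<Rightarrow> bool" where
  "bifunctor C T0 T1 \<longleftrightarrow>
     (\<forall>A \<in> Obj C. \<forall>B \<in> Obj C. T0 A B \<in> Obj C \<and> T1 (Id C A) (Id C B) = Id C (T0 A B)) \<and>
     (\<forall>A \<in> Obj C. \<forall>A' \<in> Obj C. \<forall>B \<in> Obj C. \<forall>B' \<in> Obj C.
        \<forall>f \<in> Hom C A A'. \<forall>g \<in> Hom C B B'. T1 f g \<in> Hom C (T0 A B) (T0 A' B')) \<and>
     (\<forall>A \<in> Obj C. \<forall>A' \<in> Obj C. \<forall>A'' \<in> Obj C. \<forall>B \<in> Obj C. \<forall>B' \<in> Obj C. \<forall>B'' \<in> Obj C.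
        \<forall>f \<in> Hom C A A'. \<forall>f' \<in> Hom C A' A''. \<forall>g \<in> Hom C B B'. \<forall>g' \<in> Hom C B' B''.
          T1 (f' \<cdot>\<^bsub>C\<^esub> f) (g' \<cdot>\<^bsub>C\<^esub> g) = T1 f' g' \<cdot>\<^bsub>C\<^esub> T1 f g)"

text \<open>The data of a symmetric monoidal structure; the tensor of morphisms is written \<open>\<odot>\<close>.\<close>

record ('o, 'm) smon =
  tens0 :: "'o \<Rightarrow> 'o \<Rightarrow> 'o"  (infixr \<open>\<otimes>\<index>\<close> 75)
  tens1 :: "'m \<Rightarrow> 'm \<Rightarrow> 'm"  (infixr \<open>\<odot>\<index>\<close> 75)
  unit_ob :: 'o
  assoc_map :: "'o \<Rightarrow> 'o \<Rightarrow> 'o \<Rightarrow> 'm"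
  lunit_map :: "'o \<Rightarrow> 'm"
  runit_map :: "'o \<Rightarrow> 'm"
  symm_map :: "'o \<Rightarrow> 'o \<Rightarrow> 'm"

locale symmetric_monoidal =
  fixes C :: "('o, 'm) category" and M :: "('o, 'm) smon"
  assumes tens_bifunctor: "bifunctor C (tens0 M) (tens1 M)"
    and unit_ob_in: "unit_ob M \<in> Obj C"
    and assoc_iso: "\<lbrakk>X \<in> Obj C; Y \<in> Obj C; Z \<in> Obj C\<rbrakk> \<Longrightarrow>
          iso_in C ((X \<otimes>\<^bsub>M\<^esub> Y) \<otimes>\<^bsub>M\<^esub> Z) (X \<otimes>\<^bsub>M\<^esub> (Y \<otimes>\<^bsub>M\<^esub> Z)) (assoc_map M X Y Z)"
    and assoc_natural: "\<lbrakk>X \<in> Obj C; Y \<in> Obj C; Z \<in> Obj C; X' \<in> Obj C; Y' \<in> Obj C; Z' \<in> Obj C;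
            f \<in> Hom C X X'; g \<in> Hom C Y Y'; h \<in> Hom C Z Z'\<rbrakk> \<Longrightarrow>
          assoc_map M X' Y' Z' \<cdot>\<^bsub>C\<^esub> ((f \<odot>\<^bsub>M\<^esub> g) \<odot>\<^bsub>M\<^esub> h) =
          (f \<odot>\<^bsub>M\<^esub> (g \<odot>\<^bsub>M\<^esub> h)) \<cdot>\<^bsub>C\<^esub> assoc_map M X Y Z"
    and lunit_iso: "X \<in> Obj C \<Longrightarrow> iso_in C (unit_ob M \<otimes>\<^bsub>M\<^esub> X) X (lunit_map M X)"
    and lunit_natural: "\<lbrakk>X \<in> Obj C; Y \<in> Obj C; f \<in> Hom C X Y\<rbrakk> \<Longrightarrow>
          lunit_map M Y \<cdot>\<^bsub>C\<^esub> (Id C (unit_ob M) \<odot>\<^bsub>M\<^esub> f) = f \<cdot>\<^bsub>C\<^esub> lunit_map M X"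
    and runit_iso: "X \<in> Obj C \<Longrightarrow> iso_in C (X \<otimes>\<^bsub>M\<^esub> unit_ob M) X (runit_map M X)"
    and runit_natural: "\<lbrakk>X \<in> Obj C; Y \<in> Obj C; f \<in> Hom C X Y\<rbrakk> \<Longrightarrow>
          runit_map M Y \<cdot>\<^bsub>C\<^esub> (f \<odot>\<^bsub>M\<^esub> Id C (unit_ob M)) = f \<cdot>\<^bsub>C\<^esub> runit_map M X"
    and symm_iso: "\<lbrakk>X \<in> Obj C; Y \<in> Obj C\<rbrakk> \<Longrightarrow>
          iso_in C (X \<otimes>\<^bsub>M\<^esub> Y) (Y \<otimes>\<^bsub>M\<^esub> X) (symm_map M X Y)"
    and symm_natural: "\<lbrakk>X \<in> Obj C; Y \<in> Obj C; X' \<in> Obj C; Y' \<in> Obj C;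
            f \<in> Hom C X X'; g \<in> Hom C Y Y'\<rbrakk> \<Longrightarrow>
          symm_map M X' Y' \<cdot>\<^bsub>C\<^esub> (f \<odot>\<^bsub>M\<^esub> g) = (g \<odot>\<^bsub>M\<^esub> f) \<cdot>\<^bsub>C\<^esub> symm_map M X Y"
    and pentagon: "\<lbrakk>W \<in> Obj C; X \<in> Obj C; Y \<in> Obj C; Z \<in> Obj C\<rbrakk> \<Longrightarrow>
          assoc_map M W X (Y \<otimes>\<^bsub>M\<^esub> Z) \<cdot>\<^bsub>C\<^esub> assoc_map M (W \<otimes>\<^bsub>M\<^esub> X) Y Z =
          (Id C W \<odot>\<^bsub>M\<^esub> assoc_map M X Y Z) \<cdot>\<^bsub>C\<^esub> assoc_map M W (X \<otimes>\<^bsub>M\<^esub> Y) Z \<cdot>\<^bsub>C\<^esub>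
            (assoc_map M W X Y \<odot>\<^bsub>M\<^esub> Id C Z)"
    and triangle: "\<lbrakk>X \<in> Obj C; Y \<in> Obj C\<rbrakk> \<Longrightarrow>
          (Id C X \<odot>\<^bsub>M\<^esub> lunit_map M Y) \<cdot>\<^bsub>C\<^esub> assoc_map M X (unit_ob M) Y =
          runit_map M X \<odot>\<^bsub>M\<^esub> Id C Y"
    and hexagon: "\<lbrakk>X \<in> Obj C; Y \<in> Obj C; Z \<in> Obj C\<rbrakk> \<Longrightarrow>
          assoc_map M Y Z X \<cdot>\<^bsub>C\<^esub> symm_map M X (Y \<otimes>\<^bsub>M\<^esub> Z) \<cdot>\<^bsub>C\<^esub> assoc_map M X Y Z =
          (Id C Y \<odot>\<^bsub>M\<^esub> symm_map M X Z) \<cdot>\<^bsub>C\<^esub> assoc_map M Y X Z \<cdot>\<^bsub>C\<^esub>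
            (symm_map M X Y \<odot>\<^bsub>M\<^esub> Id C Z)"
    and symm_symm: "\<lbrakk>X \<in> Obj C; Y \<in> Obj C\<rbrakk> \<Longrightarrow>
          symm_map M Y X \<cdot>\<^bsub>C\<^esub> symm_map M X Y = Id C (X \<otimes>\<^bsub>M\<^esub> Y)"

definition closed_monoidal :: "('o, 'm) category \<Rightarrow> ('o, 'm) smon \<Rightarrow> bool" where
  "closed_monoidal C M \<longleftrightarrow>
     (\<forall>B \<in> Obj C. has_right_adjoint C (\<lambda>X. X \<otimes>\<^bsub>M\<^esub> B) (\<lambda>f. f \<odot>\<^bsub>M\<^esub> Id C B))"

text \<open>
  \<open>\<phi>\<close> and \<open>\<phi>0\<close> form an oplax monoidal structure on the identity functor from \<open>(C, M)\<close>
  to \<open>(C, N)\<close>.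
\<close>

locale oplax_id =
  fixes C :: "('o, 'm) category" and M N :: "('o, 'm) smon"
    and \<phi> :: "'o \<Rightarrow> 'o \<Rightarrow> 'm" and \<phi>0 :: 'm
  assumes comparison_in: "\<lbrakk>X \<in> Obj C; Y \<in> Obj C\<rbrakk> \<Longrightarrow> \<phi> X Y \<in> Hom C (X \<otimes>\<^bsub>M\<^esub> Y) (X \<otimes>\<^bsub>N\<^esub> Y)"
    and comparison_natural: "\<lbrakk>X \<in> Obj C; Y \<in> Obj C; X' \<in> Obj C; Y' \<in> Obj C;
            f \<in> Hom C X X'; g \<in> Hom C Y Y'\<rbrakk> \<Longrightarrow>
          \<phi> X' Y' \<cdot>\<^bsub>C\<^esub> (f \<odot>\<^bsub>M\<^esub> g) = (f \<odot>\<^bsub>N\<^esub> g) \<cdot>\<^bsub>C\<^esub> \<phi> X Y"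
    and unit_comparison_in: "\<phi>0 \<in> Hom C (unit_ob M) (unit_ob N)"
    and lunit_compat: "X \<in> Obj C \<Longrightarrow>
          lunit_map N X \<cdot>\<^bsub>C\<^esub> (\<phi>0 \<odot>\<^bsub>N\<^esub> Id C X) \<cdot>\<^bsub>C\<^esub> \<phi> (unit_ob M) X = lunit_map M X"
    and runit_compat: "X \<in> Obj C \<Longrightarrow>
          runit_map N X \<cdot>\<^bsub>C\<^esub> (Id C X \<odot>\<^bsub>N\<^esub> \<phi>0) \<cdot>\<^bsub>C\<^esub> \<phi> X (unit_ob M) = runit_map M X"
    and assoc_compat: "\<lbrakk>X \<in> Obj C; Y \<in> Obj C; Z \<in> Obj C\<rbrakk> \<Longrightarrow>
          (Id C X \<odot>\<^bsub>N\<^esub> \<phi> Y Z) \<cdot>\<^bsub>C\<^esub> \<phi> X (Y \<otimes>\<^bsub>M\<^esub> Z) \<cdot>\<^bsub>C\<^esub> assoc_map M X Y Z =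
          assoc_map N X Y Z \<cdot>\<^bsub>C\<^esub> (\<phi> X Y \<odot>\<^bsub>N\<^esub> Id C Z) \<cdot>\<^bsub>C\<^esub> \<phi> (X \<otimes>\<^bsub>M\<^esub> Y) Z"

locale oplax_symmetric_id = oplax_id C M N \<phi> \<phi>0
  for C :: "('o, 'm) category" and M N :: "('o, 'm) smon"
    and \<phi> :: "'o \<Rightarrow> 'o \<Rightarrow> 'm" and \<phi>0 :: 'm +
  assumes symm_compat: "\<lbrakk>X \<in> Obj C; Y \<in> Obj C\<rbrakk> \<Longrightarrow>
          symm_map N X Y \<cdot>\<^bsub>C\<^esub> \<phi> X Y = \<phi> Y X \<cdot>\<^bsub>C\<^esub> symm_map M X Y"

definition coherence_agree :: "('o, 'm) category \<Rightarrow> ('o, 'm) smon \<Rightarrow> ('o, 'm) smon \<Rightarrow> bool" where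
  "coherence_agree C M N \<longleftrightarrow>
     (\<forall>X \<in> Obj C. \<forall>Y \<in> Obj C. \<forall>Z \<in> Obj C.
        assoc_map M X Y Z = assoc_map N X Y Z \<and>
        lunit_map M X = lunit_map N X \<and>
        runit_map M X = runit_map N X \<and>
        symm_map M X Y = symm_map N X Y)"

text \<open>\<open>X \<leftarrow> S \<rightarrow> Y\<close> is the span \<open>f, g\<close> and \<open>X \<rightarrow> P \<leftarrow> Y\<close> the cospan \<open>i, j\<close>.\<close>

definition is_pushout ::
    "('o, 'm) category \<Rightarrow> 'o \<Rightarrow> 'o \<Rightarrow> 'o \<Rightarrow> 'm \<Rightarrow> 'm \<Rightarrow> 'o \<Rightarrow> 'm \<Rightarrow> 'm \<Rightarrow> bool" where
  "is_pushout C S X Y f g P i j \<longleftrightarrow>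
     S \<in> Obj C \<and> X \<in> Obj C \<and> Y \<in> Obj C \<and> P \<in> Obj C \<and>
     f \<in> Hom C S X \<and> g \<in> Hom C S Y \<and> i \<in> Hom C X P \<and> j \<in> Hom C Y P \<and>
     i \<cdot>\<^bsub>C\<^esub> f = j \<cdot>\<^bsub>C\<^esub> g \<and>
     (\<forall>Z \<in> Obj C. \<forall>u \<in> Hom C X Z. \<forall>v \<in> Hom C Y Z. u \<cdot>\<^bsub>C\<^esub> f = v \<cdot>\<^bsub>C\<^esub> g \<longrightarrow>
        (\<exists>!w. w \<in> Hom C P Z \<and> w \<cdot>\<^bsub>C\<^esub> i = u \<and> w \<cdot>\<^bsub>C\<^esub> j = v))"


section \<open>The category of small 2-categories and its tensor products\<close>

text \<open>
  A universe is a type of uncountable strong limit cardinality, and its small sets are those of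
  smaller cardinality. Every Grothendieck universe with an infinite member is an instance;
  regularity of the cardinal is not required.
\<close>

definition universe :: "'u itself \<Rightarrow> bool" where
  "universe _ \<longleftrightarrow> (UNIV :: nat set) \<prec> (UNIV :: 'u set) \<and>
     (\<forall>X :: 'u set. X \<prec> (UNIV :: 'u set) \<longrightarrow> Pow X \<prec> (UNIV :: 'u set))"

definition small :: "'u set \<Rightarrow> bool" where
  "small X \<longleftrightarrow> X \<prec> (UNIV :: 'u set)"

type_synonym 'u tcat = "('u, 'u, 'u) twocat"
type_synonym 'u tfun = "('u, 'u, 'u, 'u, 'u, 'u) twofun"
type_synonym 'u ptrans = "('u, 'u, 'u, 'u, 'u, 'u) pstrans"

definition TwoCat :: "('u tcat, 'u tfun) category" where
  "TwoCat = \<lparr>Obj = {A. two_category A \<and> small (Ob A) \<and> small (Ar A) \<and> small (Tw A)},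
             Hom = Fun, Id = fid, Comp = fcomp\<rparr>"

text \<open>Pairs of elements of a universe are encoded as elements by an arbitrary injection.\<close>

definition pair :: "'u \<Rightarrow> 'u \<Rightarrow> 'u" where
  "pair = curry (SOME p. inj p)"

definition pfst :: "'u \<Rightarrow> 'u" where
  "pfst z = (THE x. \<exists>y. z = pair x y)"

definition psnd :: "'u \<Rightarrow> 'u" where
  "psnd z = (THE y. \<exists>x. z = pair x y)"

definition pairs :: "'u set \<Rightarrow> 'u set \<Rightarrow> 'u set" where
  "pairs X Y = {pair x y | x y. x \<in> X \<and> y \<in> Y}"

definition prod_cat :: "'u tcat \<Rightarrow> 'u tcat \<Rightarrow> 'u tcat" where
  "prod_cat A B = trim \<lparr>
     Ob = pairs (Ob A) (Ob B),
     Ar = pairs (Ar A) (Ar B),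
     Tw = pairs (Tw A) (Tw B),
     src1 = (\<lambda>f. pair (src1 A (pfst f)) (src1 B (psnd f))),
     tgt1 = (\<lambda>f. pair (tgt1 A (pfst f)) (tgt1 B (psnd f))),
     id1 = (\<lambda>x. pair (id1 A (pfst x)) (id1 B (psnd x))),
     comp1 = (\<lambda>g f. pair (comp1 A (pfst g) (pfst f)) (comp1 B (psnd g) (psnd f))),
     src2 = (\<lambda>\<tau>. pair (src2 A (pfst \<tau>)) (src2 B (psnd \<tau>))),
     tgt2 = (\<lambda>\<tau>. pair (tgt2 A (pfst \<tau>)) (tgt2 B (psnd \<tau>))),
     id2 = (\<lambda>f. pair (id2 A (pfst f)) (id2 B (psnd f))),
     vcomp = (\<lambda>\<tau> \<sigma>. pair (vcomp A (pfst \<tau>) (pfst \<sigma>)) (vcomp B (psnd \<tau>) (psnd \<sigma>))),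
     hcomp = (\<lambda>\<tau> \<sigma>. pair (hcomp A (pfst \<tau>) (pfst \<sigma>)) (hcomp B (psnd \<tau>) (psnd \<sigma>))) \<rparr>"

definition prod_fun :: "'u tfun \<Rightarrow> 'u tfun \<Rightarrow> 'u tfun" where
  "prod_fun F G =
     (let D = prod_cat (Dom F) (Dom G)
      in \<lparr>Dom = D, Cod = prod_cat (Cod F) (Cod G),
          on0 = (\<lambda>x \<in> Ob D. pair (on0 F (pfst x)) (on0 G (psnd x))),
          on1 = (\<lambda>f \<in> Ar D. pair (on1 F (pfst f)) (on1 G (psnd f))),
          on2 = (\<lambda>\<tau> \<in> Tw D. pair (on2 F (pfst \<tau>)) (on2 G (psnd \<tau>)))\<rparr>)"

definition one_cat :: "'u tcat" where
  "one_cat = trim \<lparr>Ob = {undefined}, Ar = {undefined}, Tw = {undefined},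
     src1 = (\<lambda>_. undefined), tgt1 = (\<lambda>_. undefined),
     id1 = (\<lambda>_. undefined), comp1 = (\<lambda>_ _. undefined),
     src2 = (\<lambda>_. undefined), tgt2 = (\<lambda>_. undefined),
     id2 = (\<lambda>_. undefined), vcomp = (\<lambda>_ _. undefined), hcomp = (\<lambda>_ _. undefined)\<rparr>"

definition cellwise :: "'u tcat \<Rightarrow> 'u tcat \<Rightarrow> ('u \<Rightarrow> 'u) \<Rightarrow> 'u tfun" where
  "cellwise A B h = \<lparr>Dom = A, Cod = B,
     on0 = restrict h (Ob A), on1 = restrict h (Ar A), on2 = restrict h (Tw A)\<rparr>"

definition cartesian :: "('u tcat, 'u tfun) smon" where
  "cartesian = \<lparr>
     tens0 = prod_cat,
     tens1 = prod_fun,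
     unit_ob = one_cat,
     assoc_map = (\<lambda>A B C. cellwise (prod_cat (prod_cat A B) C) (prod_cat A (prod_cat B C))
                   (\<lambda>z. pair (pfst (pfst z)) (pair (psnd (pfst z)) (psnd z)))),
     lunit_map = (\<lambda>A. cellwise (prod_cat one_cat A) A psnd),
     runit_map = (\<lambda>A. cellwise (prod_cat A one_cat) A pfst),
     symm_map = (\<lambda>A B. cellwise (prod_cat A B) (prod_cat B A) (\<lambda>z. pair (psnd z) (pfst z))) \<rparr>"

text \<open>The discrete 2-category \<open>ob A\<close>, realised as the sub-2-category of identities of \<open>A\<close>.\<close>

definition disc :: "'u tcat \<Rightarrow> 'u tcat" where
  "disc A = trim (A \<lparr>Ar := id1 A ` Ob A, Tw := (\<lambda>x. id2 A (id1 A x)) ` Ob A\<rparr>)"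

definition incl :: "'u tcat \<Rightarrow> 'u tfun" where
  "incl A = cellwise (disc A) A (\<lambda>x. x)"

definition disc_fun :: "'u tfun \<Rightarrow> 'u tfun" where
  "disc_fun F =
     (let D = disc (Dom F)
      in \<lparr>Dom = D, Cod = disc (Cod F),
          on0 = restrict (on0 F) (Ob D), on1 = restrict (on1 F) (Ar D),
          on2 = restrict (on2 F) (Tw D)\<rparr>)"

text \<open>
  A 2-functor \<open>A \<rightarrow> X\<close>, for \<open>X\<close> an internal hom out of \<open>B\<close>, from 2-functors \<open>U\<close> on \<open>A \<times> ob B\<close> and
  \<open>V\<close> on \<open>ob A \<times> B\<close> with the same codomain: \<open>a\<close> is sent to \<open>V(a, -)\<close>, and a 1-cell or 2-cell of
  \<open>A\<close> to the family with components \<open>U(-, b)\<close>.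
\<close>

definition curry_into ::
    "('u tfun, ('u, 'u, 'u, 'u, 'u, 'u) trans, (('u, 'u, 'u, 'u, 'u, 'u) trans, 'u \<Rightarrow> 'u) cell) twocat
     \<Rightarrow> 'u tcat \<Rightarrow> 'u tcat \<Rightarrow> 'u tfun \<Rightarrow> 'u tfun \<Rightarrow> _" where
  "curry_into X A B U V =
     (let c0 = (\<lambda>a. \<lparr>Dom = B, Cod = Cod V,
                  on0 = (\<lambda>b \<in> Ob B. on0 V (pair a b)),
                  on1 = (\<lambda>g \<in> Ar B. on1 V (pair (id1 A a) g)),
                  on2 = (\<lambda>\<sigma> \<in> Tw B. on2 V (pair (id2 A (id1 A a)) \<sigma>))\<rparr>);
          c1 = (\<lambda>f. Cell (c0 (src1 A f)) (c0 (tgt1 A f))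
                  (\<lambda>b \<in> Ob B. on1 U (pair f (id1 B b))));
          c2 = (\<lambda>\<tau>. Cell (c1 (src2 A \<tau>)) (c1 (tgt2 A \<tau>))
                  (\<lambda>b \<in> Ob B. on2 U (pair \<tau> (id2 B (id1 B b)))))
      in \<lparr>Dom = A, Cod = X,
          on0 = restrict c0 (Ob A), on1 = restrict c1 (Ar A), on2 = restrict c2 (Tw A)\<rparr>)"

text \<open>The isomorphism from \<open>2-Cat(A \<times> B, C)\<close> to \<open>2-Cat(A, [B, C])\<close>.\<close>

definition curry_prod :: "'u tcat \<Rightarrow> 'u tcat \<Rightarrow> 'u tcat \<Rightarrow> 'u tfun \<Rightarrow> _" where
  "curry_prod A B C F = curry_into (strict_hom B C) A B F F"

text \<open>
  The funny tensor product \<open>A \<star> B\<close> with the coprojections \<open>\<iota>1\<close> of \<open>A \<times> ob B\<close> and \<open>\<iota>2\<close> of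
  \<open>ob A \<times> B\<close>, and its action on 2-functors induced by the universal property.
\<close>

locale funny_tensor =
  fixes st0 :: "'u tcat \<Rightarrow> 'u tcat \<Rightarrow> 'u tcat" and st1 :: "'u tfun \<Rightarrow> 'u tfun \<Rightarrow> 'u tfun"
    and \<iota>1 \<iota>2 :: "'u tcat \<Rightarrow> 'u tcat \<Rightarrow> 'u tfun"
  assumes pushout: "\<lbrakk>A \<in> Obj TwoCat; B \<in> Obj TwoCat\<rbrakk> \<Longrightarrow>
          is_pushout TwoCat (prod_cat (disc A) (disc B))
            (prod_cat (disc A) B) (prod_cat A (disc B))
            (prod_fun (fid (disc A)) (incl B)) (prod_fun (incl A) (fid (disc B)))
            (st0 A B) (\<iota>2 A B) (\<iota>1 A B)"
    and st1_in: "\<lbrakk>A \<in> Obj TwoCat; B \<in> Obj TwoCat; A' \<in> Obj TwoCat; B' \<in> Obj TwoCat;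
            F \<in> Fun A A'; G \<in> Fun B B'\<rbrakk> \<Longrightarrow> st1 F G \<in> Fun (st0 A B) (st0 A' B')"
    and st1_\<iota>1: "\<lbrakk>A \<in> Obj TwoCat; B \<in> Obj TwoCat; A' \<in> Obj TwoCat; B' \<in> Obj TwoCat;
            F \<in> Fun A A'; G \<in> Fun B B'\<rbrakk> \<Longrightarrow>
          st1 F G \<bullet> \<iota>1 A B = \<iota>1 A' B' \<bullet> prod_fun F (disc_fun G)"
    and st1_\<iota>2: "\<lbrakk>A \<in> Obj TwoCat; B \<in> Obj TwoCat; A' \<in> Obj TwoCat; B' \<in> Obj TwoCat;
            F \<in> Fun A A'; G \<in> Fun B B'\<rbrakk> \<Longrightarrow>
          st1 F G \<bullet> \<iota>2 A B = \<iota>2 A' B' \<bullet> prod_fun (disc_fun F) G"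

text \<open>
  The isomorphism from \<open>2-Cat(A \<star> B, C)\<close> to \<open>2-Cat(A, [B, C]\<^sub>f)\<close>; \<open>i1\<close>, \<open>i2\<close> are the
  coprojections of \<open>A \<star> B\<close>.
\<close>

definition curry_funny ::
    "'u tcat \<Rightarrow> 'u tcat \<Rightarrow> 'u tcat \<Rightarrow> 'u tfun \<Rightarrow> 'u tfun \<Rightarrow> 'u tfun \<Rightarrow> _" where
  "curry_funny A B C i1 i2 F = curry_into (fun_hom B C) A B (F \<bullet> i1) (F \<bullet> i2)"

text \<open>The comparison \<open>K: A \<star> B \<rightarrow> A \<times> B\<close> induced from the pushout.\<close>

definition is_comparison_K :: "('u tcat \<Rightarrow> 'u tcat \<Rightarrow> 'u tcat) \<Rightarrow>
    ('u tcat \<Rightarrow> 'u tcat \<Rightarrow> 'u tfun) \<Rightarrow> ('u tcat \<Rightarrow> 'u tcat \<Rightarrow> 'u tfun) \<Rightarrow>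
    ('u tcat \<Rightarrow> 'u tcat \<Rightarrow> 'u tfun) \<Rightarrow> bool" where
  "is_comparison_K st0 \<iota>1 \<iota>2 K \<longleftrightarrow>
     (\<forall>A \<in> Obj TwoCat. \<forall>B \<in> Obj TwoCat.
        K A B \<in> Fun (st0 A B) (prod_cat A B) \<and>
        K A B \<bullet> \<iota>1 A B = prod_fun (fid A) (incl B) \<and>
        K A B \<bullet> \<iota>2 A B = prod_fun (incl A) (fid B))"

text \<open>
  The symmetric monoidal structure of the funny tensor product: it has unit \<open>1\<close> and \<open>K\<close> is an
  oplax symmetric monoidal structure on the identity functor from it to the cartesian one. These
  conditions determine the coherence maps: the unit constraints are \<open>K\<close> followed by those of the
  product, and by naturality the remaining maps are determined on the generating copies of
  \<open>A \<star> 1 \<star> 1\<close>, \<open>1 \<star> B \<star> 1\<close>, \<open>1 \<star> 1 \<star> C\<close>, where they are fixed by coherence.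
\<close>

definition funny_monoidal :: "('u tcat, 'u tfun) smon \<Rightarrow> ('u tcat \<Rightarrow> 'u tcat \<Rightarrow> 'u tfun) \<Rightarrow>
    ('u tcat \<Rightarrow> 'u tcat \<Rightarrow> 'u tfun) \<Rightarrow> ('u tcat \<Rightarrow> 'u tcat \<Rightarrow> 'u tfun) \<Rightarrow> bool" where
  "funny_monoidal S \<iota>1 \<iota>2 K \<longleftrightarrow>
     funny_tensor (tens0 S) (tens1 S) \<iota>1 \<iota>2 \<and>
     is_comparison_K (tens0 S) \<iota>1 \<iota>2 K \<and>
     unit_ob S = one_cat \<and>
     symmetric_monoidal TwoCat S \<and>
     oplax_symmetric_id TwoCat S cartesian K (fid one_cat)"

text \<open>
  The Gray tensor product: \<open>\<theta> A B C\<close> is the representing isomorphism from \<open>2-Cat(A \<otimes> B, C)\<close> to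
  \<open>2-Cat(A, Ps(B, C))\<close>, natural in all three variables.
\<close>

locale gray_tensor =
  fixes g0 :: "'u tcat \<Rightarrow> 'u tcat \<Rightarrow> 'u tcat" and g1 :: "'u tfun \<Rightarrow> 'u tfun \<Rightarrow> 'u tfun"
    and \<theta> :: "'u tcat \<Rightarrow> 'u tcat \<Rightarrow> 'u tcat \<Rightarrow> 'u tfun \<Rightarrow>
      ('u, 'u, 'u, 'u tfun, 'u ptrans, ('u ptrans, 'u \<Rightarrow> 'u) cell) twofun"
  assumes gray_bifunctor: "bifunctor TwoCat g0 g1"
    and represents: "\<lbrakk>A \<in> Obj TwoCat; B \<in> Obj TwoCat; C \<in> Obj TwoCat\<rbrakk> \<Longrightarrow>
          bij_betw (\<theta> A B C) (Fun (g0 A B) C) (Fun A (ps_hom B C))"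
    and \<theta>_natural: "\<lbrakk>A \<in> Obj TwoCat; B \<in> Obj TwoCat; C \<in> Obj TwoCat;
            A' \<in> Obj TwoCat; B' \<in> Obj TwoCat; C' \<in> Obj TwoCat;
            F \<in> Fun A' A; G \<in> Fun B' B; H \<in> Fun C C'; L \<in> Fun (g0 A B) C\<rbrakk> \<Longrightarrow>
          \<theta> A' B' C' (H \<bullet> L \<bullet> g1 F G) = ps_map G H \<bullet> \<theta> A B C L \<bullet> F"

text \<open>Precomposition with \<open>P\<close> corresponds to postcomposition with \<open>J2\<close>.\<close>

definition is_gray_P :: "('u tcat \<Rightarrow> 'u tcat \<Rightarrow> 'u tcat) \<Rightarrow>
    ('u tcat \<Rightarrow> 'u tcat \<Rightarrow> 'u tfun) \<Rightarrow>
    ('u tcat \<Rightarrow> 'u tcat \<Rightarrow> 'u tfun) \<Rightarrow>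
    ('u tcat \<Rightarrow> 'u tcat \<Rightarrow> 'u tcat) \<Rightarrow>
    ('u tcat \<Rightarrow> 'u tcat \<Rightarrow> 'u tcat \<Rightarrow> 'u tfun \<Rightarrow>
      ('u, 'u, 'u, 'u tfun, 'u ptrans, ('u ptrans, 'u \<Rightarrow> 'u) cell) twofun) \<Rightarrow>
    ('u tcat \<Rightarrow> 'u tcat \<Rightarrow> 'u tfun) \<Rightarrow>
    bool" where
  "is_gray_P st0 \<iota>1 \<iota>2 g0 \<theta> P \<longleftrightarrow>
     (\<forall>A \<in> Obj TwoCat. \<forall>B \<in> Obj TwoCat.
        P A B \<in> Fun (st0 A B) (g0 A B) \<and>
        (\<forall>C \<in> Obj TwoCat. \<forall>F \<in> Fun (g0 A B) C.
           curry_funny A B C (\<iota>1 A B) (\<iota>2 A B) (F \<bullet> P A B) = J2 B C \<bullet> \<theta> A B C F))"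

text \<open>Precomposition with \<open>Q\<close> corresponds to postcomposition with \<open>J1\<close>.\<close>

definition is_gray_Q :: "('u tcat \<Rightarrow> 'u tcat \<Rightarrow> 'u tcat) \<Rightarrow>
    ('u tcat \<Rightarrow> 'u tcat \<Rightarrow> 'u tcat \<Rightarrow> 'u tfun \<Rightarrow>
      ('u, 'u, 'u, 'u tfun, 'u ptrans, ('u ptrans, 'u \<Rightarrow> 'u) cell) twofun) \<Rightarrow>
    ('u tcat \<Rightarrow> 'u tcat \<Rightarrow> 'u tfun) \<Rightarrow>
    bool" where
  "is_gray_Q g0 \<theta> Q \<longleftrightarrow>
     (\<forall>A \<in> Obj TwoCat. \<forall>B \<in> Obj TwoCat.
        Q A B \<in> Fun (g0 A B) (prod_cat A B) \<and>
        (\<forall>C \<in> Obj TwoCat. \<forall>F \<in> Fun (prod_cat A B) C.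
           \<theta> A B C (F \<bullet> Q A B) = J1 B C \<bullet> curry_prod A B C F))"

text \<open>
  \<open>M\<close> is a closed symmetric monoidal structure extending the bifunctor \<open>(g0, g1)\<close>, with unit
  \<open>1\<close>, for which \<open>P\<close> and \<open>Q\<close> are oplax monoidal structures.
\<close>

definition gray_monoidal :: "('u tcat, 'u tfun) smon \<Rightarrow>
    ('u tcat \<Rightarrow> 'u tcat \<Rightarrow> 'u tcat) \<Rightarrow>
    ('u tfun \<Rightarrow> 'u tfun \<Rightarrow> 'u tfun) \<Rightarrow>
    ('u tcat \<Rightarrow> 'u tcat \<Rightarrow> 'u tfun) \<Rightarrow>
    ('u tcat \<Rightarrow> 'u tcat \<Rightarrow> 'u tfun) \<Rightarrow>
    ('u tcat, 'u tfun) smon \<Rightarrow>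
    bool" where
  "gray_monoidal S g0 g1 P Q M \<longleftrightarrow>
     tens0 M = g0 \<and> tens1 M = g1 \<and> unit_ob M = one_cat \<and>
     symmetric_monoidal TwoCat M \<and> closed_monoidal TwoCat M \<and>
     oplax_id TwoCat S M P (fid one_cat) \<and>
     oplax_id TwoCat M cartesian Q (fid one_cat)"

end

theory Submission
  imports Defs
begin

text \<open>
  By the representation, a 2-functor \<open>A \<otimes> B \<rightarrow> C\<close> is a family of 2-functors \<open>L\<^sub>b: A \<rightarrow> C\<close> and
  \<open>R\<^sub>a: B \<rightarrow> C\<close> that agree on objects, together with invertible 2-cells \<open>X\<^sub>f\<^sub>,\<^sub>g\<close> comparing the two ways
  around the square of \<open>f\<close> and \<open>g\<close>; \<open>P\<close> corresponds to forgetting the \<open>X\<^sub>f\<^sub>,\<^sub>g\<close> and \<open>Q\<close> to taking them to be identities.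

  Invertible 2-cells lift uniquely along lff 2-functors, so \<open>P\<close> is left orthogonal to these and
  hence boba. Moving all the 1-cells of \<open>B\<close> before those of \<open>A\<close> makes every 1-cell of \<open>A \<otimes> B\<close>
  isomorphic, over \<open>A \<times> B\<close>, to a normal form \<open>T f g\<close>, and \<open>A \<otimes> B\<close> has no 2-cells between normal
  forms but those of \<open>A \<times> B\<close>; hence \<open>Q\<close> is lff.

  Both tensors preserve their half of the factorisation system: \<open>\<star>\<close> the boba and \<open>\<times>\<close> the lff
  2-functors. So each coherence map of \<open>\<otimes>\<close> is the unique diagonal filler between those of \<open>\<star>\<close> and
  \<open>\<times>\<close>, and the axioms for \<open>\<otimes>\<close> follow from those for \<open>\<star>\<close> and \<open>\<times>\<close>. The right adjoints are the
  \<open>Ps(B, -)\<close>, relabelled by elements of the universe. That \<open>P\<close> and \<open>Q\<close> respect the symmetry is not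
  demanded, but it follows: a symmetry is determined by the unit constraints through naturality along
  the maps \<open>A \<rightarrow> 1\<close> and \<open>1 \<rightarrow> A\<close>.
\<close>

section \<open>2-categories and 2-functors\<close>

text \<open>Both tensors are known only through universal properties: the cells of A \<star> B and
  of A \<otimes> B are never described. Every statement about a particular 2-functor is therefore
  turned into existence or uniqueness of 2-functors out of these objects. For boba this uses the
  factorisation itself: the given 2-functor is factored through a 2-category with the objects and
  1-cells of its domain, and a filler then inverts the lff factor. For lff the obstacle is that
  isomorphisms between 1-cells of A \<otimes> B and their normal forms have to be chosen for all
  1-cells at once, compatibly with composition and with 2-cells, and no induction on words is
  available. Taking the isomorphisms themselves as the 1-cells of a 2-category moves the choice into
  a single 2-functor, which the universal property supplies. The test objects built in this way have
  to be small, whence the cardinality estimates; the strong limit condition enters through the sets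
  of functions that make up Ps(B, C).\<close>

context two_category begin

section \<open>Rewrite rules for the operations of a 2-category\<close>

lemma id1_simps [simp]:
  assumes "x \<in> Ob C"
  shows "id1 C x \<in> Ar C" "src1 C (id1 C x) = x" "tgt1 C (id1 C x) = x"
  using id1_in[OF assms] by (auto simp: hom1_def)

lemma src1_Ob [simp]: "f \<in> Ar C \<Longrightarrow> src1 C f \<in> Ob C"
  and tgt1_Ob [simp]: "f \<in> Ar C \<Longrightarrow> tgt1 C f \<in> Ob C"
  by (auto intro: src1_in tgt1_in)

lemma comp1_simps [simp]:
  assumes "g \<in> Ar C" "f \<in> Ar C" "src1 C g = tgt1 C f"
  shows "comp1 C g f \<in> Ar C" "src1 C (comp1 C g f) = src1 C f" "tgt1 C (comp1 C g f) = tgt1 C g"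
  using comp1_in[of f "src1 C f" "tgt1 C f" g "tgt1 C g"] assms by (auto simp: hom1_def)

lemma comp1_id [simp]:
  "f \<in> Ar C \<Longrightarrow> src1 C f = x \<Longrightarrow> comp1 C f (id1 C x) = f"
  "f \<in> Ar C \<Longrightarrow> tgt1 C f = x \<Longrightarrow> comp1 C (id1 C x) f = f"
  using comp1_id_right comp1_id_left by (auto simp: hom1_def)

text \<open>All three compositions are normalised to right-nested form. \<open>interchange'\<close>
  is left for explicit use, since different proofs read it in opposite directions.\<close>

lemma comp1_assoc' [simp]:
  "h \<in> Ar C \<Longrightarrow> g \<in> Ar C \<Longrightarrow> f \<in> Ar C \<Longrightarrow> src1 C h = tgt1 C g \<Longrightarrow> src1 C g = tgt1 C f \<Longrightarrow>
    comp1 C (comp1 C h g) f = comp1 C h (comp1 C g f)"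
  by (rule comp1_assoc[symmetric]) (auto simp: hom1_def)

lemma Tw_simps [simp]:
  assumes "\<tau> \<in> Tw C"
  shows "src2 C \<tau> \<in> Ar C" "tgt2 C \<tau> \<in> Ar C"
    "src1 C (tgt2 C \<tau>) = src1 C (src2 C \<tau>)" "tgt1 C (tgt2 C \<tau>) = tgt1 C (src2 C \<tau>)"
  using assms src2_in tgt2_in src1_src2 tgt1_src2 by auto

lemma id2_simps [simp]:
  assumes "f \<in> Ar C"
  shows "id2 C f \<in> Tw C" "src2 C (id2 C f) = f" "tgt2 C (id2 C f) = f"
  using id2_in[OF assms] by (auto simp: hom2_def)

lemma vcomp_simps [simp]:
  assumes "\<tau> \<in> Tw C" "\<sigma> \<in> Tw C" "src2 C \<tau> = tgt2 C \<sigma>"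
  shows "vcomp C \<tau> \<sigma> \<in> Tw C" "src2 C (vcomp C \<tau> \<sigma>) = src2 C \<sigma>" "tgt2 C (vcomp C \<tau> \<sigma>) = tgt2 C \<tau>"
  using vcomp_in[of \<sigma> "src2 C \<sigma>" "tgt2 C \<sigma>" \<tau> "tgt2 C \<tau>"] assms by (auto simp: hom2_def)

lemma vcomp_id [simp]:
  "\<sigma> \<in> Tw C \<Longrightarrow> src2 C \<sigma> = f \<Longrightarrow> vcomp C \<sigma> (id2 C f) = \<sigma>"
  "\<sigma> \<in> Tw C \<Longrightarrow> tgt2 C \<sigma> = f \<Longrightarrow> vcomp C (id2 C f) \<sigma> = \<sigma>"
  using vcomp_id_right vcomp_id_left by (auto simp: hom2_def)

lemma vcomp_assoc' [simp]:
  "\<tau> \<in> Tw C \<Longrightarrow> \<sigma> \<in> Tw C \<Longrightarrow> \<rho> \<in> Tw C \<Longrightarrow> src2 C \<tau> = tgt2 C \<sigma> \<Longrightarrow> src2 C \<sigma> = tgt2 C \<rho> \<Longrightarrow>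
    vcomp C (vcomp C \<tau> \<sigma>) \<rho> = vcomp C \<tau> (vcomp C \<sigma> \<rho>)"
  by (rule vcomp_assoc[symmetric]) (auto simp: hom2_def)

lemma hcomp_simps [simp]:
  assumes "\<tau> \<in> Tw C" "\<sigma> \<in> Tw C" "src1 C (src2 C \<tau>) = tgt1 C (src2 C \<sigma>)"
  shows "hcomp C \<tau> \<sigma> \<in> Tw C" "src2 C (hcomp C \<tau> \<sigma>) = comp1 C (src2 C \<tau>) (src2 C \<sigma>)"
    "tgt2 C (hcomp C \<tau> \<sigma>) = comp1 C (tgt2 C \<tau>) (tgt2 C \<sigma>)"
  using hcomp_in[of "src2 C \<sigma>" "src1 C (src2 C \<sigma>)" "tgt1 C (src2 C \<sigma>)" "src2 C \<tau>"
      "tgt1 C (src2 C \<tau>)" \<sigma> "tgt2 C \<sigma>" \<tau> "tgt2 C \<tau>"] assms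
  by (auto simp: hom2_def hom1_def)

lemma hcomp_id [simp]:
  "\<sigma> \<in> Tw C \<Longrightarrow> src1 C (src2 C \<sigma>) = x \<Longrightarrow> hcomp C \<sigma> (id2 C (id1 C x)) = \<sigma>"
  "\<sigma> \<in> Tw C \<Longrightarrow> tgt1 C (src2 C \<sigma>) = x \<Longrightarrow> hcomp C (id2 C (id1 C x)) \<sigma> = \<sigma>"
  using hcomp_id_right[of "src2 C \<sigma>"] hcomp_id_left[of "src2 C \<sigma>"]
  by (auto simp: hom2_def hom1_def)

lemma hcomp_assoc' [simp]:
  assumes "\<tau> \<in> Tw C" "\<sigma> \<in> Tw C" "\<rho> \<in> Tw C" "src1 C (src2 C \<tau>) = tgt1 C (src2 C \<sigma>)"
    "src1 C (src2 C \<sigma>) = tgt1 C (src2 C \<rho>)"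
  shows "hcomp C (hcomp C \<tau> \<sigma>) \<rho> = hcomp C \<tau> (hcomp C \<sigma> \<rho>)"
  by (rule hcomp_assoc[symmetric, of "src2 C \<rho>" _ _ "src2 C \<sigma>" _ "src2 C \<tau>"])
    (use assms in \<open>auto simp: hom1_def hom2_def\<close>)

lemma hcomp_id2' [simp]:
  assumes "g \<in> Ar C" "f \<in> Ar C" "src1 C g = tgt1 C f"
  shows "hcomp C (id2 C g) (id2 C f) = id2 C (comp1 C g f)"
  by (rule hcomp_id2) (use assms in \<open>auto simp: hom1_def\<close>)

lemma interchange':
  assumes "\<tau>' \<in> Tw C" "\<tau> \<in> Tw C" "\<sigma>' \<in> Tw C" "\<sigma> \<in> Tw C" "src2 C \<tau>' = tgt2 C \<tau>"
    "src2 C \<sigma>' = tgt2 C \<sigma>" "src1 C (src2 C \<tau>) = tgt1 C (src2 C \<sigma>)"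
  shows "hcomp C (vcomp C \<tau>' \<tau>) (vcomp C \<sigma>' \<sigma>) = vcomp C (hcomp C \<tau>' \<sigma>') (hcomp C \<tau> \<sigma>)"
  by (rule interchange[of "src2 C \<sigma>" _ _ "src2 C \<tau>"]) (use assms in \<open>auto simp: hom1_def hom2_def\<close>)

section \<open>Whiskering\<close>

lemma whisker_left_id:
  assumes "g \<in> Ar C" "f \<in> Ar C" "\<sigma> \<in> Tw C" "src1 C g = tgt1 C f" "src1 C f = tgt1 C (src2 C \<sigma>)"
  shows "hcomp C (id2 C g) (hcomp C (id2 C f) \<sigma>) = hcomp C (id2 C (comp1 C g f)) \<sigma>"
  using assms by (simp flip: hcomp_assoc' hcomp_id2')

lemma whisker_left_vcomp:
  assumes "g \<in> Ar C" "\<sigma>' \<in> Tw C" "\<sigma> \<in> Tw C" "src2 C \<sigma>' = tgt2 C \<sigma>" "src1 C g = tgt1 C (src2 C \<sigma>)"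
  shows "hcomp C (id2 C g) (vcomp C \<sigma>' \<sigma>) = vcomp C (hcomp C (id2 C g) \<sigma>') (hcomp C (id2 C g) \<sigma>)"
  using interchange'[of "id2 C g" "id2 C g" \<sigma>' \<sigma>] assms by simp

lemma whisker_right_vcomp:
  assumes "g \<in> Ar C" "\<sigma>' \<in> Tw C" "\<sigma> \<in> Tw C" "src2 C \<sigma>' = tgt2 C \<sigma>" "tgt1 C g = src1 C (src2 C \<sigma>)"
  shows "hcomp C (vcomp C \<sigma>' \<sigma>) (id2 C g) = vcomp C (hcomp C \<sigma>' (id2 C g)) (hcomp C \<sigma> (id2 C g))"
  using interchange'[of \<sigma>' \<sigma> "id2 C g" "id2 C g"] assms by simp

lemma hcomp_split_left:
  assumes "\<tau> \<in> Tw C" "\<sigma> \<in> Tw C" "src1 C (src2 C \<tau>) = tgt1 C (src2 C \<sigma>)"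
  shows "vcomp C (hcomp C \<tau> (id2 C (tgt2 C \<sigma>))) (hcomp C (id2 C (src2 C \<tau>)) \<sigma>) = hcomp C \<tau> \<sigma>"
  using interchange'[of \<tau> "id2 C (src2 C \<tau>)" "id2 C (tgt2 C \<sigma>)" \<sigma>] assms by simp

lemma hcomp_split_right:
  assumes "\<tau> \<in> Tw C" "\<sigma> \<in> Tw C" "src1 C (src2 C \<tau>) = tgt1 C (src2 C \<sigma>)"
  shows "vcomp C (hcomp C (id2 C (tgt2 C \<tau>)) \<sigma>) (hcomp C \<tau> (id2 C (src2 C \<sigma>))) = hcomp C \<tau> \<sigma>"
  using interchange'[of "id2 C (tgt2 C \<tau>)" \<tau> \<sigma> "id2 C (src2 C \<sigma>)"] assms by simp

end

section \<open>Passing to trimmed records\<close>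

lemma trim_sets [simp]: "Ob (trim C) = Ob C" "Ar (trim C) = Ar C" "Tw (trim C) = Tw C"
  by (simp_all add: trim_def)

lemma trim_ops:
  "f \<in> Ar C \<Longrightarrow> src1 (trim C) f = src1 C f"
  "f \<in> Ar C \<Longrightarrow> tgt1 (trim C) f = tgt1 C f"
  "x \<in> Ob C \<Longrightarrow> id1 (trim C) x = id1 C x"
  "\<lbrakk>g \<in> Ar C; f \<in> Ar C; src1 C g = tgt1 C f\<rbrakk> \<Longrightarrow> comp1 (trim C) g f = comp1 C g f"
  "\<tau> \<in> Tw C \<Longrightarrow> src2 (trim C) \<tau> = src2 C \<tau>"
  "\<tau> \<in> Tw C \<Longrightarrow> tgt2 (trim C) \<tau> = tgt2 C \<tau>"
  "f \<in> Ar C \<Longrightarrow> id2 (trim C) f = id2 C f"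
  "\<lbrakk>\<tau> \<in> Tw C; \<sigma> \<in> Tw C; src2 C \<tau> = tgt2 C \<sigma>\<rbrakk> \<Longrightarrow> vcomp (trim C) \<tau> \<sigma> = vcomp C \<tau> \<sigma>"
  "\<lbrakk>\<tau> \<in> Tw C; \<sigma> \<in> Tw C; src1 C (src2 C \<tau>) = tgt1 C (src2 C \<sigma>)\<rbrakk> \<Longrightarrow> hcomp (trim C) \<tau> \<sigma> = hcomp C \<tau> \<sigma>"
  by (simp_all add: trim_def)

text \<open>On their domains the trimmed operations agree with the raw ones, and the axioms evaluate
  operations only there. Every 2-category constructed below comes from this rule, so extensionality
  is dealt with once.\<close>

lemma two_category_trimI:
  assumes src1: "\<And>f. f \<in> Ar C \<Longrightarrow> src1 C f \<in> Ob C" and tgt1: "\<And>f. f \<in> Ar C \<Longrightarrow> tgt1 C f \<in> Ob C"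
    and id1: "\<And>x. x \<in> Ob C \<Longrightarrow> id1 C x \<in> Ar C" "\<And>x. x \<in> Ob C \<Longrightarrow> src1 C (id1 C x) = x"
      "\<And>x. x \<in> Ob C \<Longrightarrow> tgt1 C (id1 C x) = x"
    and comp1: "\<And>g f. \<lbrakk>g \<in> Ar C; f \<in> Ar C; src1 C g = tgt1 C f\<rbrakk> \<Longrightarrow> comp1 C g f \<in> Ar C"
      "\<And>g f. \<lbrakk>g \<in> Ar C; f \<in> Ar C; src1 C g = tgt1 C f\<rbrakk> \<Longrightarrow> src1 C (comp1 C g f) = src1 C f"
      "\<And>g f. \<lbrakk>g \<in> Ar C; f \<in> Ar C; src1 C g = tgt1 C f\<rbrakk> \<Longrightarrow> tgt1 C (comp1 C g f) = tgt1 C g"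
    and comp1_id: "\<And>f. f \<in> Ar C \<Longrightarrow> comp1 C f (id1 C (src1 C f)) = f"
      "\<And>f. f \<in> Ar C \<Longrightarrow> comp1 C (id1 C (tgt1 C f)) f = f"
    and comp1_assoc: "\<And>h g f. \<lbrakk>h \<in> Ar C; g \<in> Ar C; f \<in> Ar C; src1 C h = tgt1 C g; src1 C g = tgt1 C f\<rbrakk> \<Longrightarrow>
      comp1 C h (comp1 C g f) = comp1 C (comp1 C h g) f"
    and src2: "\<And>\<tau>. \<tau> \<in> Tw C \<Longrightarrow> src2 C \<tau> \<in> Ar C" and tgt2: "\<And>\<tau>. \<tau> \<in> Tw C \<Longrightarrow> tgt2 C \<tau> \<in> Ar C"
    and glob: "\<And>\<tau>. \<tau> \<in> Tw C \<Longrightarrow> src1 C (tgt2 C \<tau>) = src1 C (src2 C \<tau>)"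
      "\<And>\<tau>. \<tau> \<in> Tw C \<Longrightarrow> tgt1 C (tgt2 C \<tau>) = tgt1 C (src2 C \<tau>)"
    and id2: "\<And>f. f \<in> Ar C \<Longrightarrow> id2 C f \<in> Tw C" "\<And>f. f \<in> Ar C \<Longrightarrow> src2 C (id2 C f) = f"
      "\<And>f. f \<in> Ar C \<Longrightarrow> tgt2 C (id2 C f) = f"
    and vcomp: "\<And>\<tau> \<sigma>. \<lbrakk>\<tau> \<in> Tw C; \<sigma> \<in> Tw C; src2 C \<tau> = tgt2 C \<sigma>\<rbrakk> \<Longrightarrow> vcomp C \<tau> \<sigma> \<in> Tw C"
      "\<And>\<tau> \<sigma>. \<lbrakk>\<tau> \<in> Tw C; \<sigma> \<in> Tw C; src2 C \<tau> = tgt2 C \<sigma>\<rbrakk> \<Longrightarrow> src2 C (vcomp C \<tau> \<sigma>) = src2 C \<sigma>"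
      "\<And>\<tau> \<sigma>. \<lbrakk>\<tau> \<in> Tw C; \<sigma> \<in> Tw C; src2 C \<tau> = tgt2 C \<sigma>\<rbrakk> \<Longrightarrow> tgt2 C (vcomp C \<tau> \<sigma>) = tgt2 C \<tau>"
    and vcomp_id: "\<And>\<sigma>. \<sigma> \<in> Tw C \<Longrightarrow> vcomp C \<sigma> (id2 C (src2 C \<sigma>)) = \<sigma>"
      "\<And>\<sigma>. \<sigma> \<in> Tw C \<Longrightarrow> vcomp C (id2 C (tgt2 C \<sigma>)) \<sigma> = \<sigma>"
    and vcomp_assoc: "\<And>\<tau> \<sigma> \<rho>. \<lbrakk>\<tau> \<in> Tw C; \<sigma> \<in> Tw C; \<rho> \<in> Tw C; src2 C \<tau> = tgt2 C \<sigma>; src2 C \<sigma> = tgt2 C \<rho>\<rbrakk> \<Longrightarrow>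
      vcomp C \<tau> (vcomp C \<sigma> \<rho>) = vcomp C (vcomp C \<tau> \<sigma>) \<rho>"
    and hcomp: "\<And>\<tau> \<sigma>. \<lbrakk>\<tau> \<in> Tw C; \<sigma> \<in> Tw C; src1 C (src2 C \<tau>) = tgt1 C (src2 C \<sigma>)\<rbrakk> \<Longrightarrow> hcomp C \<tau> \<sigma> \<in> Tw C"
      "\<And>\<tau> \<sigma>. \<lbrakk>\<tau> \<in> Tw C; \<sigma> \<in> Tw C; src1 C (src2 C \<tau>) = tgt1 C (src2 C \<sigma>)\<rbrakk> \<Longrightarrow>
        src2 C (hcomp C \<tau> \<sigma>) = comp1 C (src2 C \<tau>) (src2 C \<sigma>)"
      "\<And>\<tau> \<sigma>. \<lbrakk>\<tau> \<in> Tw C; \<sigma> \<in> Tw C; src1 C (src2 C \<tau>) = tgt1 C (src2 C \<sigma>)\<rbrakk> \<Longrightarrow>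
        tgt2 C (hcomp C \<tau> \<sigma>) = comp1 C (tgt2 C \<tau>) (tgt2 C \<sigma>)"
    and hcomp_id: "\<And>\<sigma>. \<sigma> \<in> Tw C \<Longrightarrow> hcomp C \<sigma> (id2 C (id1 C (src1 C (src2 C \<sigma>)))) = \<sigma>"
      "\<And>\<sigma>. \<sigma> \<in> Tw C \<Longrightarrow> hcomp C (id2 C (id1 C (tgt1 C (src2 C \<sigma>)))) \<sigma> = \<sigma>"
    and hcomp_assoc: "\<And>\<tau> \<sigma> \<rho>. \<lbrakk>\<tau> \<in> Tw C; \<sigma> \<in> Tw C; \<rho> \<in> Tw C; src1 C (src2 C \<tau>) = tgt1 C (src2 C \<sigma>);
        src1 C (src2 C \<sigma>) = tgt1 C (src2 C \<rho>)\<rbrakk> \<Longrightarrow>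
      hcomp C \<tau> (hcomp C \<sigma> \<rho>) = hcomp C (hcomp C \<tau> \<sigma>) \<rho>"
    and hcomp_id2: "\<And>g f. \<lbrakk>g \<in> Ar C; f \<in> Ar C; src1 C g = tgt1 C f\<rbrakk> \<Longrightarrow>
      hcomp C (id2 C g) (id2 C f) = id2 C (comp1 C g f)"
    and interchange: "\<And>\<tau>' \<tau> \<sigma>' \<sigma>. \<lbrakk>\<tau>' \<in> Tw C; \<tau> \<in> Tw C; \<sigma>' \<in> Tw C; \<sigma> \<in> Tw C; src2 C \<tau>' = tgt2 C \<tau>;
        src2 C \<sigma>' = tgt2 C \<sigma>; src1 C (src2 C \<tau>) = tgt1 C (src2 C \<sigma>)\<rbrakk> \<Longrightarrow>
      hcomp C (vcomp C \<tau>' \<tau>) (vcomp C \<sigma>' \<sigma>) = vcomp C (hcomp C \<tau>' \<sigma>') (hcomp C \<tau> \<sigma>)"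
  shows "two_category (trim C)"
proof -
  \<comment> \<open>Composability of the upper pair in the interchange law follows from that of the
    lower pair, because 2-cells are globular.\<close>
  have eq: "src1 C (src2 C \<tau>') = src1 C (src2 C \<tau>)" "tgt1 C (src2 C \<tau>') = tgt1 C (src2 C \<tau>)"
    if "\<tau> \<in> Tw C" "tgt2 C \<tau> = src2 C \<tau>'" for \<tau>' \<tau>
    using glob[OF that(1)] that(2) by simp_all
  have tt: "trim (trim C) = trim C"
    by (rule twocat.equality) (auto simp: trim_def fun_eq_iff src2)
  note t = trim_ops hom1_def hom2_def
  show ?thesis
    apply unfold_locales
    subgoal by (rule tt)
    subgoal by (simp add: t src1)
    subgoal by (simp add: t tgt1)
    subgoal by (simp add: t id1)
    subgoal by (auto simp: t comp1)
    subgoal by (auto simp: t id1 src1 comp1_id)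
    subgoal by (auto simp: t id1 tgt1 comp1_id)
    subgoal by (auto simp: t comp1 comp1_assoc)
    subgoal by (simp add: t src2)
    subgoal by (simp add: t tgt2)
    subgoal by (simp add: t src2 tgt2 glob)
    subgoal by (simp add: t src2 tgt2 glob)
    subgoal by (simp add: t id2)
    subgoal by (auto simp: t vcomp)
    subgoal by (auto simp: t id2 src2 vcomp_id)
    subgoal by (auto simp: t id2 tgt2 vcomp_id)
    subgoal by (auto simp: t vcomp vcomp_assoc)
    subgoal by (auto simp: t hcomp src2 tgt2 glob)
    subgoal by (auto simp: t id1 id2 src2 src1 hcomp_id)
    subgoal by (auto simp: t id1 id2 src2 tgt1 hcomp_id)
    subgoal by (auto simp: t hcomp src2 tgt2 comp1 hcomp_assoc)
    subgoal by (auto simp: t id2 comp1 hcomp_id2)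
    subgoal for f x y g z \<sigma> f' \<sigma>' f'' \<tau> g' \<tau>' g''
      using eq[of \<sigma> \<sigma>'] eq[of \<tau> \<tau>']
      by (auto simp: t hcomp vcomp comp1 src2 tgt2 interchange)
    done
qed

section \<open>2-functors and their composition\<close>

lemma two_category_Obj: "A \<in> Obj TwoCat \<Longrightarrow> two_category A"
  by (simp add: TwoCat_def)

lemma Fun_Dom: "F \<in> Fun A B \<Longrightarrow> Dom F = A" and Fun_Cod: "F \<in> Fun A B \<Longrightarrow> Cod F = B"
  by (auto simp: Fun_def)

lemma Fun_on:
  assumes "F \<in> Fun A B"
  shows "x \<in> Ob A \<Longrightarrow> on0 F x \<in> Ob B" "f \<in> Ar A \<Longrightarrow> on1 F f \<in> Ar B" "\<tau> \<in> Tw A \<Longrightarrow> on2 F \<tau> \<in> Tw B"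
    "f \<in> Ar A \<Longrightarrow> src1 B (on1 F f) = on0 F (src1 A f)"
    "f \<in> Ar A \<Longrightarrow> tgt1 B (on1 F f) = on0 F (tgt1 A f)"
    "\<tau> \<in> Tw A \<Longrightarrow> src2 B (on2 F \<tau>) = on1 F (src2 A \<tau>)"
    "\<tau> \<in> Tw A \<Longrightarrow> tgt2 B (on2 F \<tau>) = on1 F (tgt2 A \<tau>)"
    "x \<in> Ob A \<Longrightarrow> on1 F (id1 A x) = id1 B (on0 F x)"
    "f \<in> Ar A \<Longrightarrow> on2 F (id2 A f) = id2 B (on1 F f)"
    "g \<in> Ar A \<Longrightarrow> f \<in> Ar A \<Longrightarrow> src1 A g = tgt1 A f \<Longrightarrow>
      on1 F (comp1 A g f) = comp1 B (on1 F g) (on1 F f)"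
    "\<tau> \<in> Tw A \<Longrightarrow> \<sigma> \<in> Tw A \<Longrightarrow> src2 A \<tau> = tgt2 A \<sigma> \<Longrightarrow>
      on2 F (vcomp A \<tau> \<sigma>) = vcomp B (on2 F \<tau>) (on2 F \<sigma>)"
    "\<tau> \<in> Tw A \<Longrightarrow> \<sigma> \<in> Tw A \<Longrightarrow> src1 A (src2 A \<tau>) = tgt1 A (src2 A \<sigma>) \<Longrightarrow>
      on2 F (hcomp A \<tau> \<sigma>) = hcomp B (on2 F \<tau>) (on2 F \<sigma>)"
  using assms by (auto simp: Fun_def two_functor_def Let_def)

lemmas Fun_simps = Fun_Dom Fun_Cod Fun_on

lemma Fun_ext:
  assumes "F \<in> Fun A B"
  shows "on0 F \<in> extensional (Ob A)" "on1 F \<in> extensional (Ar A)" "on2 F \<in> extensional (Tw A)"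
  using assms by (auto simp: Fun_def two_functor_def Let_def PiE_def)

lemma FunI:
  assumes "Dom F = A" "Cod F = B" "on0 F \<in> extensional (Ob A)" "on1 F \<in> extensional (Ar A)"
    "on2 F \<in> extensional (Tw A)"
    "\<And>x. x \<in> Ob A \<Longrightarrow> on0 F x \<in> Ob B" "\<And>f. f \<in> Ar A \<Longrightarrow> on1 F f \<in> Ar B" "\<And>\<tau>. \<tau> \<in> Tw A \<Longrightarrow> on2 F \<tau> \<in> Tw B"
    "\<And>f. f \<in> Ar A \<Longrightarrow> src1 B (on1 F f) = on0 F (src1 A f)"
    "\<And>f. f \<in> Ar A \<Longrightarrow> tgt1 B (on1 F f) = on0 F (tgt1 A f)"
    "\<And>\<tau>. \<tau> \<in> Tw A \<Longrightarrow> src2 B (on2 F \<tau>) = on1 F (src2 A \<tau>)"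
    "\<And>\<tau>. \<tau> \<in> Tw A \<Longrightarrow> tgt2 B (on2 F \<tau>) = on1 F (tgt2 A \<tau>)"
    "\<And>x. x \<in> Ob A \<Longrightarrow> on1 F (id1 A x) = id1 B (on0 F x)"
    "\<And>f. f \<in> Ar A \<Longrightarrow> on2 F (id2 A f) = id2 B (on1 F f)"
    "\<And>g f. \<lbrakk>g \<in> Ar A; f \<in> Ar A; src1 A g = tgt1 A f\<rbrakk> \<Longrightarrow>
      on1 F (comp1 A g f) = comp1 B (on1 F g) (on1 F f)"
    "\<And>\<tau> \<sigma>. \<lbrakk>\<tau> \<in> Tw A; \<sigma> \<in> Tw A; src2 A \<tau> = tgt2 A \<sigma>\<rbrakk> \<Longrightarrow>
      on2 F (vcomp A \<tau> \<sigma>) = vcomp B (on2 F \<tau>) (on2 F \<sigma>)"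
    "\<And>\<tau> \<sigma>. \<lbrakk>\<tau> \<in> Tw A; \<sigma> \<in> Tw A; src1 A (src2 A \<tau>) = tgt1 A (src2 A \<sigma>)\<rbrakk> \<Longrightarrow>
      on2 F (hcomp A \<tau> \<sigma>) = hcomp B (on2 F \<tau>) (on2 F \<sigma>)"
  shows "F \<in> Fun A B"
  using assms by (auto simp: Fun_def two_functor_def Let_def PiE_def)

lemma Fun_eqI:
  assumes "F \<in> Fun A B" "G \<in> Fun A B" "\<And>x. x \<in> Ob A \<Longrightarrow> on0 F x = on0 G x"
    "\<And>f. f \<in> Ar A \<Longrightarrow> on1 F f = on1 G f" "\<And>\<tau>. \<tau> \<in> Tw A \<Longrightarrow> on2 F \<tau> = on2 G \<tau>"
  shows "F = G"
proof -
  have "on0 F = on0 G" "on1 F = on1 G" "on2 F = on2 G"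
    using extensionalityI[OF Fun_ext(1)[OF assms(1)] Fun_ext(1)[OF assms(2)]]
      extensionalityI[OF Fun_ext(2)[OF assms(1)] Fun_ext(2)[OF assms(2)]]
      extensionalityI[OF Fun_ext(3)[OF assms(1)] Fun_ext(3)[OF assms(2)]] assms(3-5) by blast+
  then show ?thesis
    using assms(1,2) by (auto simp: Fun_def)
qed

text \<open>A 1-cell is the source of its identity 2-cell and an object the source of its identity
  1-cell, so the values on 2-cells determine the others.\<close>

lemma Fun_eqI_Tw:
  assumes "F \<in> Fun A B" "G \<in> Fun A B" "two_category A" "two_category B"
    "\<And>\<tau>. \<tau> \<in> Tw A \<Longrightarrow> on2 F \<tau> = on2 G \<tau>"
  shows "F = G"
proof -
  interpret A: two_category A by fact
  interpret B: two_category B by fact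
  have 1: "on1 F f = on1 G f" if "f \<in> Ar A" for f
  proof -
    have "src2 B (on2 F (id2 A f)) = src2 B (on2 G (id2 A f))"
      using that assms(5) by simp
    then show ?thesis using that by (simp add: Fun_simps[OF assms(1)] Fun_simps[OF assms(2)])
  qed
  have 0: "on0 F x = on0 G x" if "x \<in> Ob A" for x
  proof -
    have "src1 B (on1 F (id1 A x)) = src1 B (on1 G (id1 A x))"
      using that 1 by simp
    then show ?thesis using that by (simp add: Fun_simps[OF assms(1)] Fun_simps[OF assms(2)])
  qed
  show ?thesis by (rule Fun_eqI[OF assms(1,2)]) (simp_all add: 0 1 assms(5))
qed

lemma fcomp_simps [simp]:
  "Dom (G \<bullet> F) = Dom F" "Cod (G \<bullet> F) = Cod G"
  "x \<in> Ob (Dom F) \<Longrightarrow> on0 (G \<bullet> F) x = on0 G (on0 F x)"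
  "f \<in> Ar (Dom F) \<Longrightarrow> on1 (G \<bullet> F) f = on1 G (on1 F f)"
  "\<tau> \<in> Tw (Dom F) \<Longrightarrow> on2 (G \<bullet> F) \<tau> = on2 G (on2 F \<tau>)"
  by (auto simp: fcomp_def compose_def)

lemma fid_simps [simp]:
  "Dom (fid A) = A" "Cod (fid A) = A"
  "x \<in> Ob A \<Longrightarrow> on0 (fid A) x = x" "f \<in> Ar A \<Longrightarrow> on1 (fid A) f = f" "\<tau> \<in> Tw A \<Longrightarrow> on2 (fid A) \<tau> = \<tau>"
  by (auto simp: fid_def)

lemma fcomp_in [intro]:
  assumes "two_category A" "F \<in> Fun A B" "G \<in> Fun B C"
  shows "G \<bullet> F \<in> Fun A C"
proof -
  interpret two_category A by fact
  note [simp] = Fun_simps[OF assms(2)] Fun_simps[OF assms(3)]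
  have "on0 (G \<bullet> F) \<in> extensional (Ob A)" "on1 (G \<bullet> F) \<in> extensional (Ar A)"
    "on2 (G \<bullet> F) \<in> extensional (Tw A)"
    by (simp_all add: fcomp_def)
  then show ?thesis by (intro FunI) simp_all
qed

lemma fid_in [intro]: "two_category A \<Longrightarrow> fid A \<in> Fun A A"
  by (rule FunI) (auto simp: two_category.comp1_simps two_category.id1_simps two_category.id2_simps
      two_category.vcomp_simps two_category.hcomp_simps two_category.Tw_simps
      two_category.src1_Ob two_category.tgt1_Ob, auto simp: fid_def)

lemma fcomp_assoc:
  assumes "F \<in> Fun A B" "Dom G = B"
  shows "(H \<bullet> G) \<bullet> F = H \<bullet> (G \<bullet> F)"
  using Fun_simps(1-5)[OF assms(1)] assms(2) by (auto simp: fcomp_def compose_def fun_eq_iff)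

lemma fcomp_fid:
  assumes "F \<in> Fun A B"
  shows "F \<bullet> fid A = F" "fid B \<bullet> F = F"
proof -
  have "compose (Ob A) (on0 F) (\<lambda>x\<in>Ob A. x) = on0 F" "compose (Ar A) (on1 F) (\<lambda>x\<in>Ar A. x) = on1 F"
    "compose (Tw A) (on2 F) (\<lambda>x\<in>Tw A. x) = on2 F"
    using Fun_ext[OF assms] by (auto intro!: ext simp: compose_def extensional_def)
  then show "F \<bullet> fid A = F" using Fun_simps(1-2)[OF assms] by (simp add: fcomp_def fid_def)
  have "compose (Ob A) (\<lambda>x\<in>Ob B. x) (on0 F) = on0 F" "compose (Ar A) (\<lambda>x\<in>Ar B. x) (on1 F) = on1 F"
    "compose (Tw A) (\<lambda>x\<in>Tw B. x) (on2 F) = on2 F"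
    using Fun_ext[OF assms] Fun_simps(1-5)[OF assms]
    by (auto intro!: ext simp: compose_def extensional_def)
  then show "fid B \<bullet> F = F" using Fun_simps(1-2)[OF assms] by (simp add: fcomp_def fid_def)
qed

lemma TwoCat_simps [simp]: "Hom TwoCat = Fun" "Id TwoCat = fid" "Comp TwoCat = fcomp"
  by (simp_all add: TwoCat_def)

section \<open>Invertible 2-cells\<close>

lemma invertible2_inverse:
  assumes "two_category C" "invertible2 C \<tau>"
  obtains \<sigma> where "\<sigma> \<in> Tw C" "src2 C \<sigma> = tgt2 C \<tau>" "tgt2 C \<sigma> = src2 C \<tau>"
    "vcomp C \<sigma> \<tau> = id2 C (src2 C \<tau>)" "vcomp C \<tau> \<sigma> = id2 C (tgt2 C \<tau>)"
  using assms by (auto simp: invertible2_def hom2_def)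

lemma invertible2I:
  assumes "\<tau> \<in> Tw C" "\<sigma> \<in> Tw C" "src2 C \<sigma> = tgt2 C \<tau>" "tgt2 C \<sigma> = src2 C \<tau>"
    "vcomp C \<sigma> \<tau> = id2 C (src2 C \<tau>)" "vcomp C \<tau> \<sigma> = id2 C (tgt2 C \<tau>)"
  shows "invertible2 C \<tau>"
  using assms by (auto simp: invertible2_def hom2_def)

lemma invertible2_Fun:
  assumes F: "F \<in> Fun A B" and "two_category A" "invertible2 A \<tau>"
  shows "invertible2 B (on2 F \<tau>)"
proof -
  interpret A: two_category A by fact
  have \<tau>: "\<tau> \<in> Tw A" using assms(3) by (simp add: invertible2_def)
  obtain \<sigma> where s: "\<sigma> \<in> Tw A" "src2 A \<sigma> = tgt2 A \<tau>" "tgt2 A \<sigma> = src2 A \<tau>"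
    "vcomp A \<sigma> \<tau> = id2 A (src2 A \<tau>)" "vcomp A \<tau> \<sigma> = id2 A (tgt2 A \<tau>)"
    using invertible2_inverse[OF assms(2,3)] by metis
  show ?thesis
    by (rule invertible2I[where \<sigma> = "on2 F \<sigma>"])
      (use \<tau> s in \<open>simp_all add: Fun_simps[OF F] flip: Fun_on(11)[OF F]\<close>)
qed

lemma (in two_category) vcomp_cancel_right:
  assumes "invertible2 C \<tau>" "vcomp C \<sigma> \<tau> = vcomp C \<rho> \<tau>" "\<sigma> \<in> Tw C" "\<rho> \<in> Tw C"
    "src2 C \<sigma> = tgt2 C \<tau>" "src2 C \<rho> = tgt2 C \<tau>"
  shows "\<sigma> = \<rho>"
proof -
  obtain \<tau>' where t: "\<tau>' \<in> Tw C" "src2 C \<tau>' = tgt2 C \<tau>" "tgt2 C \<tau>' = src2 C \<tau>"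
    "vcomp C \<tau> \<tau>' = id2 C (tgt2 C \<tau>)" 
    using invertible2_inverse[OF two_category_axioms assms(1)] by metis
  have "\<tau> \<in> Tw C" using assms(1) by (simp add: invertible2_def)
  have "vcomp C \<sigma> (vcomp C \<tau> \<tau>') = vcomp C \<rho> (vcomp C \<tau> \<tau>')"
    using t(1-3) assms(2-) \<open>\<tau> \<in> Tw C\<close> by (simp flip: vcomp_assoc')
  then show ?thesis using t(4) assms by simp
qed

section \<open>Pseudonatural transformations\<close>

lemma (in two_category) invertible2_id [simp]: "f \<in> Ar C \<Longrightarrow> invertible2 C (id2 C f)"
  by (rule invertible2I[where \<sigma> = "id2 C f"]) simp_all

lemma (in two_category) invertible2_Tw: "invertible2 C \<tau> \<Longrightarrow> \<tau> \<in> Tw C"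
  by (simp add: invertible2_def)

lemma (in two_category) invertible2_vcomp:
  assumes "invertible2 C \<tau>" "invertible2 C \<sigma>" "src2 C \<tau> = tgt2 C \<sigma>"
  shows "invertible2 C (vcomp C \<tau> \<sigma>)"
proof -
  obtain \<tau>' where t: "\<tau>' \<in> Tw C" "src2 C \<tau>' = tgt2 C \<tau>" "tgt2 C \<tau>' = src2 C \<tau>"
    "vcomp C \<tau>' \<tau> = id2 C (src2 C \<tau>)" "vcomp C \<tau> \<tau>' = id2 C (tgt2 C \<tau>)"
    using invertible2_inverse[OF two_category_axioms assms(1)] by metis
  obtain \<sigma>' where s: "\<sigma>' \<in> Tw C" "src2 C \<sigma>' = tgt2 C \<sigma>" "tgt2 C \<sigma>' = src2 C \<sigma>"
    "vcomp C \<sigma>' \<sigma> = id2 C (src2 C \<sigma>)" "vcomp C \<sigma> \<sigma>' = id2 C (tgt2 C \<sigma>)"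
    using invertible2_inverse[OF two_category_axioms assms(2)] by metis
  note [simp] = assms(1,2)[THEN invertible2_Tw]
  have "vcomp C (vcomp C \<sigma>' \<tau>') (vcomp C \<tau> \<sigma>) = vcomp C \<sigma>' (vcomp C (vcomp C \<tau>' \<tau>) \<sigma>)"
    using t(1-3) s(1-3) assms(3) by simp
  also have "\<dots> = id2 C (src2 C \<sigma>)" unfolding t using assms(3) s by simp
  finally have 1: "vcomp C (vcomp C \<sigma>' \<tau>') (vcomp C \<tau> \<sigma>) = id2 C (src2 C \<sigma>)" .
  have "vcomp C (vcomp C \<tau> \<sigma>) (vcomp C \<sigma>' \<tau>') = vcomp C \<tau> (vcomp C (vcomp C \<sigma> \<sigma>') \<tau>')"
    using t(1-3) s(1-3) assms(3) by simp
  also have "\<dots> = id2 C (tgt2 C \<tau>)" unfolding s using assms(3) t by simp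
  finally have 2: "vcomp C (vcomp C \<tau> \<sigma>) (vcomp C \<sigma>' \<tau>') = id2 C (tgt2 C \<tau>)" .
  show ?thesis
    by (rule invertible2I[where \<sigma> = "vcomp C \<sigma>' \<tau>'"]) (use t(1-3) s(1-3) assms(3) 1 2 in simp_all)
qed

lemma (in two_category) invertible2_hcomp:
  assumes "invertible2 C \<tau>" "invertible2 C \<sigma>" "src1 C (src2 C \<tau>) = tgt1 C (src2 C \<sigma>)"
  shows "invertible2 C (hcomp C \<tau> \<sigma>)"
proof -
  obtain \<tau>' where t: "\<tau>' \<in> Tw C" "src2 C \<tau>' = tgt2 C \<tau>" "tgt2 C \<tau>' = src2 C \<tau>"
    "vcomp C \<tau>' \<tau> = id2 C (src2 C \<tau>)" "vcomp C \<tau> \<tau>' = id2 C (tgt2 C \<tau>)"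
    using invertible2_inverse[OF two_category_axioms assms(1)] by metis
  obtain \<sigma>' where s: "\<sigma>' \<in> Tw C" "src2 C \<sigma>' = tgt2 C \<sigma>" "tgt2 C \<sigma>' = src2 C \<sigma>"
    "vcomp C \<sigma>' \<sigma> = id2 C (src2 C \<sigma>)" "vcomp C \<sigma> \<sigma>' = id2 C (tgt2 C \<sigma>)"
    using invertible2_inverse[OF two_category_axioms assms(2)] by metis
  note [simp] = assms(1,2)[THEN invertible2_Tw]
  show ?thesis
    by (rule invertible2I[where \<sigma> = "hcomp C \<tau>' \<sigma>'"])
      (use t s assms(3) in \<open>simp_all flip: interchange'\<close>)
qed

section \<open>Pseudonatural transformations and modifications, law by law\<close>

lemma pseudonatural_simps:
  assumes "pseudonatural B C \<alpha>" and "two_category B"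
  shows "csrc \<alpha> \<in> Fun B C" "ctgt \<alpha> \<in> Fun B C"
    "x \<in> Ob B \<Longrightarrow> fst (cdat \<alpha>) x \<in> Ar C"
    "x \<in> Ob B \<Longrightarrow> src1 C (fst (cdat \<alpha>) x) = on0 (csrc \<alpha>) x"
    "x \<in> Ob B \<Longrightarrow> tgt1 C (fst (cdat \<alpha>) x) = on0 (ctgt \<alpha>) x"
    "f \<in> Ar B \<Longrightarrow> snd (cdat \<alpha>) f \<in> Tw C"
    "f \<in> Ar B \<Longrightarrow> src2 C (snd (cdat \<alpha>) f) = comp1 C (fst (cdat \<alpha>) (tgt1 B f)) (on1 (csrc \<alpha>) f)"
    "f \<in> Ar B \<Longrightarrow> tgt2 C (snd (cdat \<alpha>) f) = comp1 C (on1 (ctgt \<alpha>) f) (fst (cdat \<alpha>) (src1 B f))"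
    "f \<in> Ar B \<Longrightarrow> invertible2 C (snd (cdat \<alpha>) f)"
    "x \<in> Ob B \<Longrightarrow> snd (cdat \<alpha>) (id1 B x) = id2 C (fst (cdat \<alpha>) x)"
  using assms(1) by (auto simp: pseudonatural_def Let_def hom1_def hom2_def PiE_def Pi_def)

lemma pseudonatural_ext:
  assumes "pseudonatural B C \<alpha>"
  shows "fst (cdat \<alpha>) \<in> extensional (Ob B)" "snd (cdat \<alpha>) \<in> extensional (Ar B)"
  using assms by (auto simp: pseudonatural_def Let_def PiE_def)

lemma pseudonatural_natural:
  assumes "pseudonatural B C \<alpha>" and "two_category B" "\<tau> \<in> Tw B"
  shows "vcomp C (hcomp C (on2 (ctgt \<alpha>) \<tau>) (id2 C (fst (cdat \<alpha>) (src1 B (src2 B \<tau>))))) (snd (cdat \<alpha>) (src2 B \<tau>)) =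
      vcomp C (snd (cdat \<alpha>) (tgt2 B \<tau>)) (hcomp C (id2 C (fst (cdat \<alpha>) (tgt1 B (src2 B \<tau>)))) (on2 (csrc \<alpha>) \<tau>))"
proof -
  interpret B: two_category B by fact
  have "src2 B \<tau> \<in> hom1 B (src1 B (src2 B \<tau>)) (tgt1 B (src2 B \<tau>))"
    "tgt2 B \<tau> \<in> hom1 B (src1 B (src2 B \<tau>)) (tgt1 B (src2 B \<tau>))"
    "\<tau> \<in> hom2 B (src2 B \<tau>) (tgt2 B \<tau>)" "src1 B (src2 B \<tau>) \<in> Ob B" "tgt1 B (src2 B \<tau>) \<in> Ob B"
    using assms(3) by (auto simp: hom1_def hom2_def)
  then show ?thesis
    using assms(1) unfolding pseudonatural_def Let_def by blast
qed

lemma pseudonatural_comp: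
  assumes "pseudonatural B C \<alpha>" and "two_category B" "g \<in> Ar B" "f \<in> Ar B" "src1 B g = tgt1 B f"
  shows "snd (cdat \<alpha>) (comp1 B g f) =
      vcomp C (hcomp C (id2 C (on1 (ctgt \<alpha>) g)) (snd (cdat \<alpha>) f)) (hcomp C (snd (cdat \<alpha>) g) (id2 C (on1 (csrc \<alpha>) f)))"
proof -
  interpret B: two_category B by fact
  have "f \<in> hom1 B (src1 B f) (tgt1 B f)" "g \<in> hom1 B (tgt1 B f) (tgt1 B g)"
    "src1 B f \<in> Ob B" "tgt1 B f \<in> Ob B" "tgt1 B g \<in> Ob B"
    using assms(3-5) by (auto simp: hom1_def)
  then show ?thesis
    using assms(1) unfolding pseudonatural_def Let_def by blast
qed

lemma pseudonaturalI:
  assumes "csrc \<alpha> \<in> Fun B C" "ctgt \<alpha> \<in> Fun B C"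
    "fst (cdat \<alpha>) \<in> extensional (Ob B)" "snd (cdat \<alpha>) \<in> extensional (Ar B)"
    "\<And>x. x \<in> Ob B \<Longrightarrow> fst (cdat \<alpha>) x \<in> Ar C"
    "\<And>x. x \<in> Ob B \<Longrightarrow> src1 C (fst (cdat \<alpha>) x) = on0 (csrc \<alpha>) x"
    "\<And>x. x \<in> Ob B \<Longrightarrow> tgt1 C (fst (cdat \<alpha>) x) = on0 (ctgt \<alpha>) x"
    "\<And>f. f \<in> Ar B \<Longrightarrow> src2 C (snd (cdat \<alpha>) f) = comp1 C (fst (cdat \<alpha>) (tgt1 B f)) (on1 (csrc \<alpha>) f)"
    "\<And>f. f \<in> Ar B \<Longrightarrow> tgt2 C (snd (cdat \<alpha>) f) = comp1 C (on1 (ctgt \<alpha>) f) (fst (cdat \<alpha>) (src1 B f))"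
    "\<And>f. f \<in> Ar B \<Longrightarrow> invertible2 C (snd (cdat \<alpha>) f)"
    "\<And>x. x \<in> Ob B \<Longrightarrow> snd (cdat \<alpha>) (id1 B x) = id2 C (fst (cdat \<alpha>) x)"
    "\<And>\<tau>. \<tau> \<in> Tw B \<Longrightarrow> vcomp C (hcomp C (on2 (ctgt \<alpha>) \<tau>) (id2 C (fst (cdat \<alpha>) (src1 B (src2 B \<tau>))))) (snd (cdat \<alpha>) (src2 B \<tau>)) =
      vcomp C (snd (cdat \<alpha>) (tgt2 B \<tau>)) (hcomp C (id2 C (fst (cdat \<alpha>) (tgt1 B (src2 B \<tau>)))) (on2 (csrc \<alpha>) \<tau>))"
    "\<And>g f. \<lbrakk>g \<in> Ar B; f \<in> Ar B; src1 B g = tgt1 B f\<rbrakk> \<Longrightarrow> snd (cdat \<alpha>) (comp1 B g f) =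
      vcomp C (hcomp C (id2 C (on1 (ctgt \<alpha>) g)) (snd (cdat \<alpha>) f)) (hcomp C (snd (cdat \<alpha>) g) (id2 C (on1 (csrc \<alpha>) f)))"
  shows "pseudonatural B C \<alpha>"
proof -
  have nat: "vcomp C (hcomp C (on2 (ctgt \<alpha>) \<tau>) (id2 C (fst (cdat \<alpha>) a))) (snd (cdat \<alpha>) f) =
      vcomp C (snd (cdat \<alpha>) f') (hcomp C (id2 C (fst (cdat \<alpha>) b)) (on2 (csrc \<alpha>) \<tau>))"
    if "f \<in> hom1 B a b" "f' \<in> hom1 B a b" "\<tau> \<in> hom2 B f f'" for \<tau> a b f f'
    using assms(12)[of \<tau>] that by (auto simp: hom1_def hom2_def)
  show ?thesis
    using assms(1-11,13) nat
    by (auto simp: pseudonatural_def Let_def hom1_def hom2_def PiE_def Pi_def invertible2_def)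
qed

lemma cell_eqI: "csrc x = csrc y \<Longrightarrow> ctgt x = ctgt y \<Longrightarrow> cdat x = cdat y \<Longrightarrow> x = y"
  by (cases x; cases y) simp

lemma pseudonatural_eqI:
  assumes "pseudonatural B C \<alpha>" "pseudonatural B C \<beta>" "csrc \<alpha> = csrc \<beta>" "ctgt \<alpha> = ctgt \<beta>"
    "\<And>x. x \<in> Ob B \<Longrightarrow> fst (cdat \<alpha>) x = fst (cdat \<beta>) x"
    "\<And>f. f \<in> Ar B \<Longrightarrow> snd (cdat \<alpha>) f = snd (cdat \<beta>) f"
  shows "\<alpha> = \<beta>"
proof -
  have "fst (cdat \<alpha>) = fst (cdat \<beta>)" "snd (cdat \<alpha>) = snd (cdat \<beta>)"
    using pseudonatural_ext[OF assms(1)] pseudonatural_ext[OF assms(2)] assms(5,6)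
    by (auto intro: extensionalityI)
  then show ?thesis using assms(3,4) by (intro cell_eqI prod_eqI)
qed

lemma ps_modification_simps:
  assumes "ps_modification B C \<Gamma>"
  shows "pseudonatural B C (csrc \<Gamma>)" "pseudonatural B C (ctgt \<Gamma>)"
    "csrc (ctgt \<Gamma>) = csrc (csrc \<Gamma>)" "ctgt (ctgt \<Gamma>) = ctgt (csrc \<Gamma>)"
    "x \<in> Ob B \<Longrightarrow> cdat \<Gamma> x \<in> Tw C"
    "x \<in> Ob B \<Longrightarrow> src2 C (cdat \<Gamma> x) = fst (cdat (csrc \<Gamma>)) x"
    "x \<in> Ob B \<Longrightarrow> tgt2 C (cdat \<Gamma> x) = fst (cdat (ctgt \<Gamma>)) x"
  using assms by (auto simp: ps_modification_def Let_def hom2_def PiE_def Pi_def)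

lemma ps_modification_ext: "ps_modification B C \<Gamma> \<Longrightarrow> cdat \<Gamma> \<in> extensional (Ob B)"
  by (auto simp: ps_modification_def Let_def PiE_def)

lemma ps_modification_natural:
  assumes "ps_modification B C \<Gamma>" and "two_category B" "f \<in> Ar B"
  shows "vcomp C (hcomp C (id2 C (on1 (ctgt (csrc \<Gamma>)) f)) (cdat \<Gamma> (src1 B f))) (snd (cdat (csrc \<Gamma>)) f) =
         vcomp C (snd (cdat (ctgt \<Gamma>)) f) (hcomp C (cdat \<Gamma> (tgt1 B f)) (id2 C (on1 (csrc (csrc \<Gamma>)) f)))"
proof -
  interpret B: two_category B by fact
  show ?thesis using assms(1,3) unfolding ps_modification_def Let_def hom1_def by auto
qed

lemma ps_modificationI:
  assumes "pseudonatural B C (csrc \<Gamma>)" "pseudonatural B C (ctgt \<Gamma>)"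
    "csrc (ctgt \<Gamma>) = csrc (csrc \<Gamma>)" "ctgt (ctgt \<Gamma>) = ctgt (csrc \<Gamma>)" "cdat \<Gamma> \<in> extensional (Ob B)"
    "\<And>x. x \<in> Ob B \<Longrightarrow> cdat \<Gamma> x \<in> Tw C"
    "\<And>x. x \<in> Ob B \<Longrightarrow> src2 C (cdat \<Gamma> x) = fst (cdat (csrc \<Gamma>)) x"
    "\<And>x. x \<in> Ob B \<Longrightarrow> tgt2 C (cdat \<Gamma> x) = fst (cdat (ctgt \<Gamma>)) x"
    "\<And>f. f \<in> Ar B \<Longrightarrow> vcomp C (hcomp C (id2 C (on1 (ctgt (csrc \<Gamma>)) f)) (cdat \<Gamma> (src1 B f))) (snd (cdat (csrc \<Gamma>)) f) =
         vcomp C (snd (cdat (ctgt \<Gamma>)) f) (hcomp C (cdat \<Gamma> (tgt1 B f)) (id2 C (on1 (csrc (csrc \<Gamma>)) f)))"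
  shows "ps_modification B C \<Gamma>"
  using assms by (auto simp: ps_modification_def Let_def hom1_def hom2_def PiE_def Pi_def)

lemma ps_modification_eqI:
  assumes "ps_modification B C \<Gamma>" "ps_modification B C \<Delta>" "csrc \<Gamma> = csrc \<Delta>" "ctgt \<Gamma> = ctgt \<Delta>"
    "\<And>x. x \<in> Ob B \<Longrightarrow> cdat \<Gamma> x = cdat \<Delta> x"
  shows "\<Gamma> = \<Delta>"
  using extensionalityI[OF ps_modification_ext[OF assms(1)] ps_modification_ext[OF assms(2)]] assms(3-5)
  by (intro cell_eqI) auto

section \<open>Identities and composition in Ps(B, C)\<close>

definition ps_id :: "('o, 'a, 't) twocat \<Rightarrow> ('p, 'b, 's) twocat \<Rightarrow>
    ('o, 'a, 't, 'p, 'b, 's) twofun \<Rightarrow> ('o, 'a, 't, 'p, 'b, 's) pstrans" where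
  "ps_id B C F = Cell F F (\<lambda>x \<in> Ob B. id1 C (on0 F x), \<lambda>f \<in> Ar B. id2 C (on1 F f))"

definition ps_comp :: "('o, 'a, 't) twocat \<Rightarrow> ('p, 'b, 's) twocat \<Rightarrow> ('o, 'a, 't, 'p, 'b, 's) pstrans \<Rightarrow>
    ('o, 'a, 't, 'p, 'b, 's) pstrans \<Rightarrow> ('o, 'a, 't, 'p, 'b, 's) pstrans" where
  "ps_comp B C \<beta> \<alpha> = Cell (csrc \<alpha>) (ctgt \<beta>)
     (\<lambda>x \<in> Ob B. comp1 C (fst (cdat \<beta>) x) (fst (cdat \<alpha>) x),
      \<lambda>f \<in> Ar B. vcomp C
        (hcomp C (snd (cdat \<beta>) f) (id2 C (fst (cdat \<alpha>) (src1 B f))))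
        (hcomp C (id2 C (fst (cdat \<beta>) (tgt1 B f))) (snd (cdat \<alpha>) f)))"

lemma ps_comp_sel [simp]:
  "csrc (ps_comp B C \<beta> \<alpha>) = csrc \<alpha>" "ctgt (ps_comp B C \<beta> \<alpha>) = ctgt \<beta>"
  "x \<in> Ob B \<Longrightarrow> fst (cdat (ps_comp B C \<beta> \<alpha>)) x = comp1 C (fst (cdat \<beta>) x) (fst (cdat \<alpha>) x)"
  "f \<in> Ar B \<Longrightarrow> snd (cdat (ps_comp B C \<beta> \<alpha>)) f = vcomp C
        (hcomp C (snd (cdat \<beta>) f) (id2 C (fst (cdat \<alpha>) (src1 B f))))
        (hcomp C (id2 C (fst (cdat \<beta>) (tgt1 B f))) (snd (cdat \<alpha>) f))"
  by (simp_all add: ps_comp_def)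

lemma ps_id_sel [simp]:
  "csrc (ps_id B C F) = F" "ctgt (ps_id B C F) = F"
  "x \<in> Ob B \<Longrightarrow> fst (cdat (ps_id B C F)) x = id1 C (on0 F x)"
  "f \<in> Ar B \<Longrightarrow> snd (cdat (ps_id B C F)) f = id2 C (on1 F f)"
  by (simp_all add: ps_id_def)

lemma pseudonatural_ps_id:
  assumes "two_category B" "two_category C" and F: "F \<in> Fun B C"
  shows "pseudonatural B C (ps_id B C F)"
proof -
  interpret B: two_category B by fact
  interpret C: two_category C by fact
  note [simp] = Fun_simps[OF F]
  show ?thesis
    by (rule pseudonaturalI) (use F in \<open>simp_all add: ps_id_def\<close>)
qed

text \<open>A pasting argument. A 2-cell \<tau> of B is pushed first through the cell of \<beta> and
  then through that of \<alpha>. For a composite gf the same four component cells occur on both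
  sides, up to the order of the middle two.\<close>

lemma pseudonatural_ps_comp:
  assumes "two_category B" "two_category C" and \<alpha>: "pseudonatural B C \<alpha>" and \<beta>: "pseudonatural B C \<beta>"
    and eq: "csrc \<beta> = ctgt \<alpha>"
  shows "pseudonatural B C (ps_comp B C \<beta> \<alpha>)"
proof -
  interpret B: two_category B by fact
  interpret C: two_category C by fact
  note a = pseudonatural_simps[OF \<alpha> assms(1)] and b = pseudonatural_simps[OF \<beta> assms(1)]
  note [simp] = a(3-8,10) b(3-8,10) Fun_simps[OF a(1)] Fun_simps[OF a(2)] Fun_simps[OF b(2)] eq
  let ?c = "snd (cdat (ps_comp B C \<beta> \<alpha>))"
  let ?a0 = "fst (cdat \<alpha>)" and ?b0 = "fst (cdat \<beta>)" and ?a1 = "snd (cdat \<alpha>)" and ?b1 = "snd (cdat \<beta>)"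
  let ?F = "csrc \<alpha>" and ?G = "ctgt \<alpha>" and ?H = "ctgt \<beta>"
  note W = C.whisker_left_vcomp C.whisker_right_vcomp C.whisker_left_id
  have nat: "vcomp C (hcomp C (on2 ?H \<tau>) (id2 C (comp1 C (?b0 (src1 B (src2 B \<tau>))) (?a0 (src1 B (src2 B \<tau>)))))) (?c (src2 B \<tau>)) =
      vcomp C (?c (tgt2 B \<tau>)) (hcomp C (id2 C (comp1 C (?b0 (tgt1 B (src2 B \<tau>))) (?a0 (tgt1 B (src2 B \<tau>))))) (on2 ?F \<tau>))"
    if [simp]: "\<tau> \<in> Tw B" for \<tau>
  proof -
    let ?s = "src1 B (src2 B \<tau>)" and ?t = "tgt1 B (src2 B \<tau>)"
    note na = pseudonatural_natural[OF \<alpha> assms(1) that] and nb = pseudonatural_natural[OF \<beta> assms(1) that]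
    have "vcomp C (hcomp C (on2 ?H \<tau>) (id2 C (comp1 C (?b0 ?s) (?a0 ?s)))) (?c (src2 B \<tau>)) =
      vcomp C (hcomp C (vcomp C (hcomp C (on2 ?H \<tau>) (id2 C (?b0 ?s))) (?b1 (src2 B \<tau>))) (id2 C (?a0 ?s)))
        (hcomp C (id2 C (?b0 ?t)) (?a1 (src2 B \<tau>)))"
      by (simp add: W)
    also have "\<dots> = vcomp C (hcomp C (?b1 (tgt2 B \<tau>)) (id2 C (?a0 ?s)))
        (hcomp C (id2 C (?b0 ?t)) (vcomp C (hcomp C (on2 ?G \<tau>) (id2 C (?a0 ?s))) (?a1 (src2 B \<tau>))))"
      unfolding nb by (simp add: W)
    also have "\<dots> = vcomp C (?c (tgt2 B \<tau>)) (hcomp C (id2 C (comp1 C (?b0 ?t) (?a0 ?t))) (on2 ?F \<tau>))"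
      unfolding na by (simp add: W)
    finally show ?thesis .
  qed
  have comp: "?c (comp1 B g f) = vcomp C (hcomp C (id2 C (on1 ?H g)) (?c f)) (hcomp C (?c g) (id2 C (on1 ?F f)))"
    if [simp]: "g \<in> Ar B" "f \<in> Ar B" "src1 B g = tgt1 B f" for g f
  proof -
    note ca = pseudonatural_comp[OF \<alpha> assms(1) that] and cb = pseudonatural_comp[OF \<beta> assms(1) that]
    \<comment> \<open>\<open>?b1 g\<close> and \<open>?a1 f\<close> sit on adjacent factors, so
      interchange exchanges them; this is the only reordering that the composition law
      requires.\<close>
    have m: "vcomp C (hcomp C (?b1 g) (id2 C (comp1 C (on1 ?G f) (?a0 (src1 B f))))) (hcomp C (id2 C (comp1 C (?b0 (tgt1 B g)) (on1 ?G g))) (?a1 f))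
      = vcomp C (hcomp C (id2 C (comp1 C (on1 ?H g) (?b0 (tgt1 B f)))) (?a1 f)) (hcomp C (?b1 g) (id2 C (comp1 C (?a0 (tgt1 B f)) (on1 ?F f))))"
      using C.hcomp_split_left[of "?b1 g" "?a1 f"] C.hcomp_split_right[of "?b1 g" "?a1 f"] by simp
    have "?c (comp1 B g f) = vcomp C (hcomp C (id2 C (on1 ?H g)) (hcomp C (?b1 f) (id2 C (?a0 (src1 B f)))))
      (vcomp C (vcomp C (hcomp C (?b1 g) (id2 C (comp1 C (on1 ?G f) (?a0 (src1 B f))))) (hcomp C (id2 C (comp1 C (?b0 (tgt1 B g)) (on1 ?G g))) (?a1 f)))
       (hcomp C (id2 C (?b0 (tgt1 B g))) (hcomp C (?a1 g) (id2 C (on1 ?F f)))))"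
      by (simp add: W ca cb)
    also have "\<dots> = vcomp C (hcomp C (id2 C (on1 ?H g)) (?c f)) (hcomp C (?c g) (id2 C (on1 ?F f)))"
      unfolding m by (simp add: W)
    finally show ?thesis .
  qed
  show ?thesis
  proof (rule pseudonaturalI)
    show "fst (cdat (ps_comp B C \<beta> \<alpha>)) \<in> extensional (Ob B)" "?c \<in> extensional (Ar B)"
      by (simp_all add: ps_comp_def)
    show "invertible2 C (?c f)" if "f \<in> Ar B" for f
      using that a(9) b(9) by (auto intro!: C.invertible2_vcomp C.invertible2_hcomp)
  qed (use a(1) b(2) nat comp in simp_all)
qed

definition ps_vcomp :: "('o, 'a, 't) twocat \<Rightarrow> ('p, 'b, 's) twocat \<Rightarrow>
    (('o, 'a, 't, 'p, 'b, 's) pstrans, 'o \<Rightarrow> 's) cell \<Rightarrow> (('o, 'a, 't, 'p, 'b, 's) pstrans, 'o \<Rightarrow> 's) cell \<Rightarrow>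
    (('o, 'a, 't, 'p, 'b, 's) pstrans, 'o \<Rightarrow> 's) cell" where
  "ps_vcomp B C \<Delta> \<Gamma> = Cell (csrc \<Gamma>) (ctgt \<Delta>) (\<lambda>x \<in> Ob B. vcomp C (cdat \<Delta> x) (cdat \<Gamma> x))"

definition ps_hcomp :: "('o, 'a, 't) twocat \<Rightarrow> ('p, 'b, 's) twocat \<Rightarrow>
    (('o, 'a, 't, 'p, 'b, 's) pstrans, 'o \<Rightarrow> 's) cell \<Rightarrow> (('o, 'a, 't, 'p, 'b, 's) pstrans, 'o \<Rightarrow> 's) cell \<Rightarrow>
    (('o, 'a, 't, 'p, 'b, 's) pstrans, 'o \<Rightarrow> 's) cell" where
  "ps_hcomp B C \<Delta> \<Gamma> = Cell (ps_comp B C (csrc \<Delta>) (csrc \<Gamma>)) (ps_comp B C (ctgt \<Delta>) (ctgt \<Gamma>))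
     (\<lambda>x \<in> Ob B. hcomp C (cdat \<Delta> x) (cdat \<Gamma> x))"

definition ps_id2 :: "('o, 'a, 't) twocat \<Rightarrow> ('p, 'b, 's) twocat \<Rightarrow> ('o, 'a, 't, 'p, 'b, 's) pstrans \<Rightarrow>
    (('o, 'a, 't, 'p, 'b, 's) pstrans, 'o \<Rightarrow> 's) cell" where
  "ps_id2 B C \<eta> = Cell \<eta> \<eta> (\<lambda>x \<in> Ob B. id2 C (fst (cdat \<eta>) x))"

lemma ps_2_sel [simp]:
  "csrc (ps_vcomp B C \<Delta> \<Gamma>) = csrc \<Gamma>" "ctgt (ps_vcomp B C \<Delta> \<Gamma>) = ctgt \<Delta>"
  "x \<in> Ob B \<Longrightarrow> cdat (ps_vcomp B C \<Delta> \<Gamma>) x = vcomp C (cdat \<Delta> x) (cdat \<Gamma> x)"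
  "csrc (ps_hcomp B C \<Delta> \<Gamma>) = ps_comp B C (csrc \<Delta>) (csrc \<Gamma>)"
  "ctgt (ps_hcomp B C \<Delta> \<Gamma>) = ps_comp B C (ctgt \<Delta>) (ctgt \<Gamma>)"
  "x \<in> Ob B \<Longrightarrow> cdat (ps_hcomp B C \<Delta> \<Gamma>) x = hcomp C (cdat \<Delta> x) (cdat \<Gamma> x)"
  "csrc (ps_id2 B C \<eta>) = \<eta>" "ctgt (ps_id2 B C \<eta>) = \<eta>"
  "x \<in> Ob B \<Longrightarrow> cdat (ps_id2 B C \<eta>) x = id2 C (fst (cdat \<eta>) x)"
  by (simp_all add: ps_vcomp_def ps_hcomp_def ps_id2_def)

lemma ps_modification_ps_id2:
  assumes "two_category B" "two_category C" and \<alpha>: "pseudonatural B C \<alpha>"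
  shows "ps_modification B C (ps_id2 B C \<alpha>)"
proof -
  interpret B: two_category B by fact
  interpret C: two_category C by fact
  note a = pseudonatural_simps[OF \<alpha> assms(1)]
  note [simp] = a(3-8,10) Fun_simps[OF a(1)] Fun_simps[OF a(2)]
  show ?thesis by (rule ps_modificationI) (use \<alpha> in \<open>simp_all add: ps_id2_def\<close>)
qed

lemma ps_modification_ps_vcomp:
  assumes "two_category B" "two_category C" and \<Gamma>: "ps_modification B C \<Gamma>" and \<Delta>: "ps_modification B C \<Delta>"
    and eq: "csrc \<Delta> = ctgt \<Gamma>"
  shows "ps_modification B C (ps_vcomp B C \<Delta> \<Gamma>)"
proof -
  interpret B: two_category B by fact
  interpret C: two_category C by fact
  note g = ps_modification_simps[OF \<Gamma>] and d = ps_modification_simps[OF \<Delta>]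
  note a = pseudonatural_simps[OF g(1) assms(1)] and b = pseudonatural_simps[OF g(2) assms(1)]
    and c = pseudonatural_simps[OF d(2) assms(1)]
  note [simp] = g(3-7) d(3-7) a(3-8,10) b(3-8,10) c(3-8,10) Fun_simps[OF a(1)] Fun_simps[OF a(2)] eq
  let ?F = "csrc (csrc \<Gamma>)" and ?G = "ctgt (csrc \<Gamma>)"
  note W = C.whisker_left_vcomp C.whisker_right_vcomp C.whisker_left_id
  have nat: "vcomp C (hcomp C (id2 C (on1 ?G f)) (vcomp C (cdat \<Delta> (src1 B f)) (cdat \<Gamma> (src1 B f)))) (snd (cdat (csrc \<Gamma>)) f) =
         vcomp C (snd (cdat (ctgt \<Delta>)) f) (hcomp C (vcomp C (cdat \<Delta> (tgt1 B f)) (cdat \<Gamma> (tgt1 B f))) (id2 C (on1 ?F f)))"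
    if [simp]: "f \<in> Ar B" for f
  proof -
    note ng = ps_modification_natural[OF \<Gamma> assms(1) that] and nd = ps_modification_natural[OF \<Delta> assms(1) that, simplified]
    have "vcomp C (hcomp C (id2 C (on1 ?G f)) (vcomp C (cdat \<Delta> (src1 B f)) (cdat \<Gamma> (src1 B f)))) (snd (cdat (csrc \<Gamma>)) f) =
      vcomp C (hcomp C (id2 C (on1 ?G f)) (cdat \<Delta> (src1 B f))) (vcomp C (hcomp C (id2 C (on1 ?G f)) (cdat \<Gamma> (src1 B f))) (snd (cdat (csrc \<Gamma>)) f))"
      by (simp add: W)
    also have "\<dots> = vcomp C (vcomp C (hcomp C (id2 C (on1 ?G f)) (cdat \<Delta> (src1 B f))) (snd (cdat (ctgt \<Gamma>)) f))
       (hcomp C (cdat \<Gamma> (tgt1 B f)) (id2 C (on1 ?F f)))"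
      unfolding ng by simp
    also have "\<dots> = vcomp C (snd (cdat (ctgt \<Delta>)) f) (hcomp C (vcomp C (cdat \<Delta> (tgt1 B f)) (cdat \<Gamma> (tgt1 B f))) (id2 C (on1 ?F f)))"
      unfolding nd by (simp add: W)
    finally show ?thesis .
  qed
  show ?thesis
    by (rule ps_modificationI) (use g d nat in \<open>simp_all, simp add: ps_vcomp_def\<close>)
qed

text \<open>Interchange separates the two factors, so that the square of \<Delta> and then the
  square of \<Gamma> can be applied, each on its own factor.\<close>

lemma ps_modification_ps_hcomp:
  assumes "two_category B" "two_category C" and \<Gamma>: "ps_modification B C \<Gamma>" and \<Delta>: "ps_modification B C \<Delta>"
    and eq: "csrc (csrc \<Delta>) = ctgt (csrc \<Gamma>)"
  shows "ps_modification B C (ps_hcomp B C \<Delta> \<Gamma>)"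
proof -
  interpret B: two_category B by fact
  interpret C: two_category C by fact
  note g = ps_modification_simps[OF \<Gamma>] and d = ps_modification_simps[OF \<Delta>]
  note a = pseudonatural_simps[OF g(1) assms(1)] and b = pseudonatural_simps[OF g(2) assms(1)]
    and c = pseudonatural_simps[OF d(1) assms(1)] and e = pseudonatural_simps[OF d(2) assms(1)]
  note [simp] = g(3-7) d(3-7) a(3-8,10) b(3-8,10) c(3-8,10) e(3-8,10) Fun_simps[OF a(1)] Fun_simps[OF a(2)] Fun_simps[OF c(2)] eq
  let ?F = "csrc (csrc \<Gamma>)" and ?G = "ctgt (csrc \<Gamma>)" and ?H = "ctgt (csrc \<Delta>)"
  note W = C.whisker_left_vcomp C.whisker_right_vcomp C.whisker_left_id
  let ?c1 = "snd (cdat (csrc \<Gamma>))" and ?c2 = "snd (cdat (ctgt \<Gamma>))" and ?d1 = "snd (cdat (csrc \<Delta>))" and ?d2 = "snd (cdat (ctgt \<Delta>))"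
  let ?e1 = "fst (cdat (csrc \<Gamma>))" and ?e2 = "fst (cdat (ctgt \<Gamma>))" and ?f1 = "fst (cdat (csrc \<Delta>))" and ?f2 = "fst (cdat (ctgt \<Delta>))"
  have nat: "vcomp C (hcomp C (id2 C (on1 ?H f)) (hcomp C (cdat \<Delta> (src1 B f)) (cdat \<Gamma> (src1 B f)))) 
        (vcomp C (hcomp C (?d1 f) (id2 C (?e1 (src1 B f)))) (hcomp C (id2 C (?f1 (tgt1 B f))) (?c1 f))) =
       vcomp C (vcomp C (hcomp C (?d2 f) (id2 C (?e2 (src1 B f)))) (hcomp C (id2 C (?f2 (tgt1 B f))) (?c2 f)))
        (hcomp C (hcomp C (cdat \<Delta> (tgt1 B f)) (cdat \<Gamma> (tgt1 B f))) (id2 C (on1 ?F f)))"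
    if [simp]: "f \<in> Ar B" for f
  proof -
    note ng = ps_modification_natural[OF \<Gamma> assms(1) that] and nd = ps_modification_natural[OF \<Delta> assms(1) that, simplified]
    let ?s = "src1 B f" and ?t = "tgt1 B f"
    have "vcomp C (hcomp C (id2 C (on1 ?H f)) (hcomp C (cdat \<Delta> ?s) (cdat \<Gamma> ?s))) 
        (vcomp C (hcomp C (?d1 f) (id2 C (?e1 ?s))) (hcomp C (id2 C (?f1 ?t)) (?c1 f))) =
      vcomp C (hcomp C (vcomp C (hcomp C (id2 C (on1 ?H f)) (cdat \<Delta> ?s)) (?d1 f)) (vcomp C (cdat \<Gamma> ?s) (id2 C (?e1 ?s))))
        (hcomp C (id2 C (?f1 ?t)) (?c1 f))"
      \<comment> \<open>The identity written as a second vertical factor gives interchange a pair to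
        act on; with \<open>vcomp_id\<close> active it would be simplified away first.\<close>
      by (subst C.interchange') (simp_all del: C.vcomp_id)
    also have "\<dots> = vcomp C (hcomp C (vcomp C (?d2 f) (hcomp C (cdat \<Delta> ?t) (id2 C (on1 ?G f)))) (vcomp C (id2 C (?e2 ?s)) (cdat \<Gamma> ?s)))
        (hcomp C (id2 C (?f1 ?t)) (?c1 f))"
      unfolding nd by simp
    also have "\<dots> = vcomp C (hcomp C (?d2 f) (id2 C (?e2 ?s)))
       (vcomp C (hcomp C (cdat \<Delta> ?t) (hcomp C (id2 C (on1 ?G f)) (cdat \<Gamma> ?s))) (hcomp C (id2 C (?f1 ?t)) (?c1 f)))"
      by (subst C.interchange') (simp_all del: C.vcomp_id)
    also have "vcomp C (hcomp C (cdat \<Delta> ?t) (hcomp C (id2 C (on1 ?G f)) (cdat \<Gamma> ?s))) (hcomp C (id2 C (?f1 ?t)) (?c1 f)) =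
       hcomp C (vcomp C (cdat \<Delta> ?t) (id2 C (?f1 ?t))) (vcomp C (hcomp C (id2 C (on1 ?G f)) (cdat \<Gamma> ?s)) (?c1 f))"
      by (subst C.interchange') (simp_all del: C.vcomp_id)
    also have "\<dots> = hcomp C (vcomp C (id2 C (?f2 ?t)) (cdat \<Delta> ?t)) (vcomp C (?c2 f) (hcomp C (cdat \<Gamma> ?t) (id2 C (on1 ?F f))))"
      unfolding ng by simp
    also have "\<dots> = vcomp C (hcomp C (id2 C (?f2 ?t)) (?c2 f)) (hcomp C (hcomp C (cdat \<Delta> ?t) (cdat \<Gamma> ?t)) (id2 C (on1 ?F f)))"
      by (subst C.interchange') (simp_all del: C.vcomp_id)
    finally show ?thesis by simp
  qed
  show ?thesis
    by (rule ps_modificationI)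
      (use g d nat in \<open>simp_all add: pseudonatural_ps_comp[OF assms(1,2)], simp add: ps_hcomp_def\<close>)
qed

text \<open>The record that \<open>ps_hom\<close> trims, with named operations, so that the axioms
  can be checked on the raw operations by \<open>two_category_trimI\<close>.\<close>

definition ps_pre :: "('o, 'a, 't) twocat \<Rightarrow> ('p, 'b, 's) twocat \<Rightarrow>
    (('o, 'a, 't, 'p, 'b, 's) twofun, ('o, 'a, 't, 'p, 'b, 's) pstrans,
     (('o, 'a, 't, 'p, 'b, 's) pstrans, 'o \<Rightarrow> 's) cell) twocat" where
  "ps_pre B C = \<lparr>Ob = Fun B C, Ar = {\<alpha>. pseudonatural B C \<alpha>}, Tw = {\<Gamma>. ps_modification B C \<Gamma>},
       src1 = csrc, tgt1 = ctgt, id1 = ps_id B C, comp1 = ps_comp B C,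
       src2 = csrc, tgt2 = ctgt, id2 = ps_id2 B C, vcomp = ps_vcomp B C, hcomp = ps_hcomp B C\<rparr>"

lemma ps_hom_eq_trim: "ps_hom B C = trim (ps_pre B C)"
  unfolding ps_hom_def ps_pre_def ps_id_def ps_comp_def ps_id2_def ps_vcomp_def ps_hcomp_def Let_def
  by (rule refl)

lemma ps_hom_sets [simp]:
  "Ob (ps_hom B C) = Fun B C" "\<alpha> \<in> Ar (ps_hom B C) \<longleftrightarrow> pseudonatural B C \<alpha>"
  "\<Gamma> \<in> Tw (ps_hom B C) \<longleftrightarrow> ps_modification B C \<Gamma>"
  by (simp_all add: ps_hom_eq_trim, simp_all add: ps_pre_def)

lemma ps_hom_ops [simp]:
  "pseudonatural B C \<alpha> \<Longrightarrow> src1 (ps_hom B C) \<alpha> = csrc \<alpha>"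
  "pseudonatural B C \<alpha> \<Longrightarrow> tgt1 (ps_hom B C) \<alpha> = ctgt \<alpha>"
  "F \<in> Fun B C \<Longrightarrow> id1 (ps_hom B C) F = ps_id B C F"
  "pseudonatural B C \<beta> \<Longrightarrow> pseudonatural B C \<alpha> \<Longrightarrow> csrc \<beta> = ctgt \<alpha> \<Longrightarrow>
    comp1 (ps_hom B C) \<beta> \<alpha> = ps_comp B C \<beta> \<alpha>"
  "ps_modification B C \<Gamma> \<Longrightarrow> src2 (ps_hom B C) \<Gamma> = csrc \<Gamma>"
  "ps_modification B C \<Gamma> \<Longrightarrow> tgt2 (ps_hom B C) \<Gamma> = ctgt \<Gamma>"
  "pseudonatural B C \<alpha> \<Longrightarrow> id2 (ps_hom B C) \<alpha> = ps_id2 B C \<alpha>"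
  "ps_modification B C \<Delta> \<Longrightarrow> ps_modification B C \<Gamma> \<Longrightarrow> csrc \<Delta> = ctgt \<Gamma> \<Longrightarrow>
    vcomp (ps_hom B C) \<Delta> \<Gamma> = ps_vcomp B C \<Delta> \<Gamma>"
  "ps_modification B C \<Delta> \<Longrightarrow> ps_modification B C \<Gamma> \<Longrightarrow> csrc (csrc \<Delta>) = ctgt (csrc \<Gamma>) \<Longrightarrow>
    hcomp (ps_hom B C) \<Delta> \<Gamma> = ps_hcomp B C \<Delta> \<Gamma>"
  unfolding ps_hom_eq_trim by (subst trim_ops; simp add: ps_pre_def)+

lemma ps_comp_id:
  assumes "two_category B" "two_category C" and \<alpha>: "pseudonatural B C \<alpha>"
  shows "ps_comp B C \<alpha> (ps_id B C (csrc \<alpha>)) = \<alpha>" "ps_comp B C (ps_id B C (ctgt \<alpha>)) \<alpha> = \<alpha>"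
proof -
  interpret B: two_category B by fact
  interpret C: two_category C by fact
  note a = pseudonatural_simps[OF \<alpha> assms(1)]
  note [simp] = a(3-8,10) Fun_simps[OF a(1)] Fun_simps[OF a(2)] pseudonatural_ps_id[OF assms(1,2)]
  show "ps_comp B C \<alpha> (ps_id B C (csrc \<alpha>)) = \<alpha>"
    by (rule pseudonatural_eqI[OF pseudonatural_ps_comp[OF assms(1,2)] \<alpha>]) (use a(1,2) \<alpha> in simp_all)
  show "ps_comp B C (ps_id B C (ctgt \<alpha>)) \<alpha> = \<alpha>"
    by (rule pseudonatural_eqI[OF pseudonatural_ps_comp[OF assms(1,2)] \<alpha>]) (use a(1,2) \<alpha> in simp_all)
qed

lemma ps_comp_assoc:
  assumes "two_category B" "two_category C" and \<alpha>: "pseudonatural B C \<alpha>" and \<beta>: "pseudonatural B C \<beta>"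
    and \<gamma>: "pseudonatural B C \<gamma>" and eq: "csrc \<beta> = ctgt \<alpha>" "csrc \<gamma> = ctgt \<beta>"
  shows "ps_comp B C \<gamma> (ps_comp B C \<beta> \<alpha>) = ps_comp B C (ps_comp B C \<gamma> \<beta>) \<alpha>"
proof -
  interpret B: two_category B by fact
  interpret C: two_category C by fact
  note a = pseudonatural_simps[OF \<alpha> assms(1)] and b = pseudonatural_simps[OF \<beta> assms(1)]
    and c = pseudonatural_simps[OF \<gamma> assms(1)]
  note [simp] = a(3-8,10) b(3-8,10) c(3-8,10) Fun_simps[OF a(1)] Fun_simps[OF a(2)] Fun_simps[OF b(2)]
    Fun_simps[OF c(2)] eq
  note W = C.whisker_left_vcomp C.whisker_right_vcomp C.whisker_left_id
  show ?thesis
    by (rule pseudonatural_eqI[of B C]) (use assms in \<open>simp_all add: pseudonatural_ps_comp W\<close>)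
qed

lemma two_category_ps_hom:
  assumes B: "two_category B" and C: "two_category C"
  shows "two_category (ps_hom B C)"
proof -
  interpret B: two_category B by fact
  interpret C: two_category C by fact
  note ps = pseudonatural_simps[of B C, OF _ B] and md = ps_modification_simps[of B C]
  note clo = pseudonatural_ps_comp[OF B C] pseudonatural_ps_id[OF B C] ps_modification_ps_id2[OF B C]
    ps_modification_ps_vcomp[OF B C] ps_modification_ps_hcomp[OF B C]
  have ids1: "ps_comp B C \<alpha> (ps_id B C F) = \<alpha>" if "pseudonatural B C \<alpha>" "csrc \<alpha> = F" for \<alpha> F
    using ps_comp_id(1)[OF B C that(1)] that(2) by simp
  have ids2: "ps_comp B C (ps_id B C F) \<alpha> = \<alpha>" if "pseudonatural B C \<alpha>" "ctgt \<alpha> = F" for \<alpha> F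
    using ps_comp_id(2)[OF B C that(1)] that(2) by simp
  note ids = ids1 ids2 ps_comp_assoc[OF B C]
  show ?thesis
    unfolding ps_hom_eq_trim
    apply (rule two_category_trimI)
                        apply (simp_all add: ps_pre_def clo ps md ids)
        \<comment> \<open>What remains are equations between modifications; they hold because they
          hold in C at each component.\<close>
        apply (rule ps_modification_eqI[of B C]; simp add: clo md ps ids C.interchange')+
    done
qed

section \<open>Functoriality of Ps in both arguments\<close>

lemma ps_map_sel:
  assumes "G \<in> Fun B' B" "H \<in> Fun C C'"
  shows "Dom (ps_map G H) = ps_hom B C" "Cod (ps_map G H) = ps_hom B' C'"
    "F \<in> Fun B C \<Longrightarrow> on0 (ps_map G H) F = H \<bullet> F \<bullet> G"
    "pseudonatural B C \<alpha> \<Longrightarrow> csrc (on1 (ps_map G H) \<alpha>) = H \<bullet> csrc \<alpha> \<bullet> G"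
    "pseudonatural B C \<alpha> \<Longrightarrow> ctgt (on1 (ps_map G H) \<alpha>) = H \<bullet> ctgt \<alpha> \<bullet> G"
    "pseudonatural B C \<alpha> \<Longrightarrow> x \<in> Ob B' \<Longrightarrow>
      fst (cdat (on1 (ps_map G H) \<alpha>)) x = on1 H (fst (cdat \<alpha>) (on0 G x))"
    "pseudonatural B C \<alpha> \<Longrightarrow> f \<in> Ar B' \<Longrightarrow>
      snd (cdat (on1 (ps_map G H) \<alpha>)) f = on2 H (snd (cdat \<alpha>) (on1 G f))"
    "ps_modification B C \<Gamma> \<Longrightarrow> csrc (on2 (ps_map G H) \<Gamma>) = on1 (ps_map G H) (csrc \<Gamma>)"
    "ps_modification B C \<Gamma> \<Longrightarrow> ctgt (on2 (ps_map G H) \<Gamma>) = on1 (ps_map G H) (ctgt \<Gamma>)"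
    "ps_modification B C \<Gamma> \<Longrightarrow> x \<in> Ob B' \<Longrightarrow>
      cdat (on2 (ps_map G H) \<Gamma>) x = on2 H (cdat \<Gamma> (on0 G x))"
  using Fun_simps(1,2)[OF assms(1)] Fun_simps(1,2)[OF assms(2)]
  by (simp_all add: ps_map_def Let_def ps_modification_simps(1,2))

lemma ps_map_ext:
  assumes "G \<in> Fun B' B" "H \<in> Fun C C'"
  shows "on0 (ps_map G H) \<in> extensional (Fun B C)" "on1 (ps_map G H) \<in> extensional {\<alpha>. pseudonatural B C \<alpha>}"
    "on2 (ps_map G H) \<in> extensional {\<Gamma>. ps_modification B C \<Gamma>}"
    "pseudonatural B C \<alpha> \<Longrightarrow> fst (cdat (on1 (ps_map G H) \<alpha>)) \<in> extensional (Ob B')"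
    "pseudonatural B C \<alpha> \<Longrightarrow> snd (cdat (on1 (ps_map G H) \<alpha>)) \<in> extensional (Ar B')"
    "ps_modification B C \<Gamma> \<Longrightarrow> cdat (on2 (ps_map G H) \<Gamma>) \<in> extensional (Ob B')"
  using Fun_simps(1,2)[OF assms(1)] Fun_simps(1,2)[OF assms(2)]
  by (auto simp: ps_map_def Let_def extensional_def ps_modification_simps(1,2))

text \<open>Each law is the image under H of a law of \<alpha>, taken at the cells of B that G picks
  out.\<close>

lemma pseudonatural_ps_map:
  assumes "two_category B" "two_category B'" "two_category C" "two_category C'"
    and G: "G \<in> Fun B' B" and H: "H \<in> Fun C C'" and \<alpha>: "pseudonatural B C \<alpha>"
  shows "pseudonatural B' C' (on1 (ps_map G H) \<alpha>)"
proof -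
  interpret B: two_category B by fact
  interpret C: two_category C by fact
  interpret B': two_category B' by fact
  interpret C': two_category C' by fact
  note a = pseudonatural_simps[OF \<alpha> assms(1)]
  note [simp] = a(3-8,10) Fun_simps[OF a(1)] Fun_simps[OF a(2)] Fun_simps[OF G] Fun_simps[OF H]
    ps_map_sel[OF G H]
  have F: "H \<bullet> F \<bullet> G \<in> Fun B' C'" if "F \<in> Fun B C" for F
    using that G H assms(1-4) by (intro fcomp_in)
  have nat: "vcomp C' (hcomp C' (on2 H (on2 (ctgt \<alpha>) \<tau>)) (id2 C' (on1 H (fst (cdat \<alpha>) (src1 B (src2 B \<tau>)))))) (on2 H (snd (cdat \<alpha>) (src2 B \<tau>))) =
      vcomp C' (on2 H (snd (cdat \<alpha>) (tgt2 B \<tau>))) (hcomp C' (id2 C' (on1 H (fst (cdat \<alpha>) (tgt1 B (src2 B \<tau>))))) (on2 H (on2 (csrc \<alpha>) \<tau>)))"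
    if \<tau>: "\<tau> \<in> Tw B" for \<tau>
    using arg_cong[OF pseudonatural_natural[OF \<alpha> assms(1) \<tau>], of "on2 H"] \<tau> by simp
  show ?thesis
  proof (rule pseudonaturalI, goal_cases)
    case (10 f)
    then show ?case using invertible2_Fun[OF H assms(3) a(9)] \<alpha> by simp
  next
    case (12 \<tau>)
    then show ?case using nat[of "on2 G \<tau>"] \<alpha> by simp
  qed (use F a \<alpha> in \<open>simp_all add: ps_map_ext[OF G H] pseudonatural_comp[OF \<alpha> assms(1)]\<close>)
qed

lemma ps_map_in:
  assumes "two_category B" "two_category B'" "two_category C" "two_category C'"
    and G: "G \<in> Fun B' B" and H: "H \<in> Fun C C'"
  shows "ps_map G H \<in> Fun (ps_hom B C) (ps_hom B' C')"
proof -
  interpret B: two_category B by fact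
  interpret C: two_category C by fact
  interpret B': two_category B' by fact
  interpret C': two_category C' by fact
  interpret PS: two_category "ps_hom B C" by (rule two_category_ps_hom) fact+
  interpret PS': two_category "ps_hom B' C'" by (rule two_category_ps_hom) fact+
  note ps = pseudonatural_simps[of B C, OF _ assms(1)] and md = ps_modification_simps[of B C]
  note ps' = pseudonatural_simps[of B' C', OF _ assms(2)] and md' = ps_modification_simps[of B' C']
  note [simp] = Fun_simps[OF G] Fun_simps[OF H] ps_map_sel[OF G H]
  have F [simp]: "H \<bullet> F \<bullet> G \<in> Fun B' C'" if "F \<in> Fun B C" for F
    using that G H assms(1-4) by (intro fcomp_in)
  have P [simp]: "pseudonatural B' C' (on1 (ps_map G H) \<alpha>)" if "pseudonatural B C \<alpha>" for \<alpha>
    using pseudonatural_ps_map[OF assms that] .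
  have M [simp]: "ps_modification B' C' (on2 (ps_map G H) \<Gamma>)" if \<Gamma>: "ps_modification B C \<Gamma>" for \<Gamma>
  proof -
    note g = md[OF \<Gamma>]
    note a = ps[OF g(1)] and b = ps[OF g(2)]
    note [simp] = g(1-7) a(3-8,10) b(3-8,10) Fun_simps[OF a(1)] Fun_simps[OF a(2)] 
    have nat: "vcomp C' (hcomp C' (id2 C' (on1 H (on1 (ctgt (csrc \<Gamma>)) f))) (on2 H (cdat \<Gamma> (src1 B f)))) (on2 H (snd (cdat (csrc \<Gamma>)) f)) =
         vcomp C' (on2 H (snd (cdat (ctgt \<Gamma>)) f)) (hcomp C' (on2 H (cdat \<Gamma> (tgt1 B f))) (id2 C' (on1 H (on1 (csrc (csrc \<Gamma>)) f))))"
      if f: "f \<in> Ar B" for f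
      using arg_cong[OF ps_modification_natural[OF \<Gamma> assms(1) f], of "on2 H"] f by simp
    show ?thesis
    proof (rule ps_modificationI, goal_cases)
      case (9 f)
      then show ?case using \<Gamma> nat[of "on1 G f"] by simp
    qed (use \<Gamma> in \<open>simp_all add: ps_map_ext[OF G H]\<close>)
  qed
  note clo = pseudonatural_ps_comp[of B C] pseudonatural_ps_id[of B C] ps_modification_ps_id2[of B C]
    ps_modification_ps_vcomp[of B C] ps_modification_ps_hcomp[of B C]
  note clo' = pseudonatural_ps_comp[of B' C'] pseudonatural_ps_id[of B' C'] ps_modification_ps_id2[of B' C']
    ps_modification_ps_vcomp[of B' C'] ps_modification_ps_hcomp[of B' C']
  have Fs: "on0 F x \<in> Ob C" "on1 F f \<in> Ar C" "src1 C (on1 F f) = on0 F (src1 B f)" "tgt1 C (on1 F f) = on0 F (tgt1 B f)"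
    if "F \<in> Fun B C" "x \<in> Ob B" "f \<in> Ar B" for F x f
    using Fun_simps[OF that(1)] that(2-) by simp_all
  have [simp]: "on1 (ps_map G H) (ps_id B C F) = ps_id B' C' (H \<bullet> F \<bullet> G)" if "F \<in> Fun B C" for F
    by (rule pseudonatural_eqI[of B' C'])
      (use that assms(1-4) Fun_simps[OF that] in \<open>simp_all add: clo clo'\<close>)
  have [simp]: "on1 (ps_map G H) (ps_comp B C \<beta> \<alpha>) = ps_comp B' C' (on1 (ps_map G H) \<beta>) (on1 (ps_map G H) \<alpha>)"
    if a: "pseudonatural B C \<alpha>" and b: "pseudonatural B C \<beta>" and eq: "csrc \<beta> = ctgt \<alpha>" for \<alpha> \<beta>
    by (rule pseudonatural_eqI[of B' C'])
      (use that assms(1-4) Fun_simps[OF ps(1)[OF a]] Fun_simps[OF ps(2)[OF a]] Fun_simps[OF ps(2)[OF b]]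
        in \<open>simp_all add: clo clo' ps\<close>)
  show ?thesis
  proof (rule FunI, goal_cases)
    case (14 f)
    then show ?case by (auto intro!: ps_modification_eqI[of B' C'] simp: clo clo' assms(1-4) ps)
  next
    case (16 \<tau> \<sigma>)
    then show ?case by (auto intro!: ps_modification_eqI[of B' C'] simp: clo clo' assms(1-4) ps md)
  next
    case (17 \<tau> \<sigma>)
    then show ?case by (auto intro!: ps_modification_eqI[of B' C'] simp: clo clo' assms(1-4) ps md)
  qed (use ps_map_ext[OF G H] in \<open>simp_all add: ps md clo clo' assms(1-4) extensional_def\<close>)
qed

text \<open>Needed, with \<open>ps_map_fid\<close>, for the right adjoint of - \<otimes> B, which
  has to be a functor.\<close>

lemma ps_map_fcomp:
  assumes "two_category B" "two_category C" "two_category C'" "two_category C''"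
    and H: "H \<in> Fun C C'" and H': "H' \<in> Fun C' C''"
  shows "ps_map (fid B) (H' \<bullet> H) = ps_map (fid B) H' \<bullet> ps_map (fid B) H"
proof -
  interpret B: two_category B by fact
  note I = fid_in[OF assms(1)]
  have HH: "H' \<bullet> H \<in> Fun C C''" using assms by (intro fcomp_in)
  have two: "two_category (ps_hom B C)" by (rule two_category_ps_hom) fact+
  note [simp] = ps_map_sel[OF I H] ps_map_sel[OF I H'] ps_map_sel[OF I HH] pseudonatural_ps_map[OF assms(1) assms(1) assms(2,3) I H]
  have c: "H \<bullet> F \<bullet> fid B \<in> Fun B C'" if "F \<in> Fun B C" for F
    using that I H assms(1) by (intro fcomp_in)
  have e: "(H' \<bullet> H) \<bullet> F \<bullet> fid B = H' \<bullet> (H \<bullet> F \<bullet> fid B) \<bullet> fid B" if "F \<in> Fun B C" for F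
    using that c[OF that] H H' by (simp add: fcomp_fid(1) fcomp_fid(1)[OF that] fcomp_assoc[OF that] Fun_simps(1)[OF H])
  note ps = pseudonatural_simps[of B C, OF _ assms(1)] and md = ps_modification_simps[of B C]
  have p: "on1 (ps_map (fid B) (H' \<bullet> H)) \<alpha> = on1 (ps_map (fid B) H') (on1 (ps_map (fid B) H) \<alpha>)"
    if "pseudonatural B C \<alpha>" for \<alpha>
    by (rule pseudonatural_eqI[of B C''])
      (use that assms in \<open>simp_all add: ps Fun_simps[OF H] pseudonatural_ps_map[OF _ _ _ _ I] HH e\<close>)
  note PM = ps_map_in[OF assms(1) assms(1) assms(2,3) I H] ps_map_in[OF assms(1) assms(1) assms(3,4) I H']
    ps_map_in[OF assms(1) assms(1) assms(2,4) I HH]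
  have M: "ps_modification B C' (on2 (ps_map (fid B) H) \<Gamma>)" "ps_modification B C'' (on2 (ps_map (fid B) (H' \<bullet> H)) \<Gamma>)"
    if "ps_modification B C \<Gamma>" for \<Gamma>
    using Fun_on(3)[OF PM(1)] Fun_on(3)[OF PM(3)] that by simp_all
  have M': "ps_modification B C'' (on2 (ps_map (fid B) H') \<Gamma>)"
    if "ps_modification B C' \<Gamma>" for \<Gamma>
    using Fun_on(3)[OF PM(2)] that by simp
  show ?thesis
  proof (rule Fun_eqI[OF PM(3) fcomp_in[OF two PM(1,2)]])
    fix \<Gamma> assume "\<Gamma> \<in> Tw (ps_hom B C)"
    then show "on2 (ps_map (fid B) (H' \<bullet> H)) \<Gamma> = on2 (ps_map (fid B) H' \<bullet> ps_map (fid B) H) \<Gamma>"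
      by (auto intro!: ps_modification_eqI[of B C''] simp: M M' p md Fun_simps[OF H])
  qed (simp_all add: e p c)
qed

lemma ps_map_fid:
  assumes "two_category B" "two_category C"
  shows "ps_map (fid B) (fid C) = fid (ps_hom B C)"
proof -
  note I = fid_in[OF assms(1)] fid_in[OF assms(2)]
  interpret PS: two_category "ps_hom B C" by (rule two_category_ps_hom) fact+
  note ps = pseudonatural_simps[of B C, OF _ assms(1)] and md = ps_modification_simps[of B C]
  note PM = ps_map_in[OF assms(1,1,2,2) I]
  note [simp] = ps_map_sel[OF I] pseudonatural_ps_map[OF assms(1,1,2,2) I]
  have p: "on1 (ps_map (fid B) (fid C)) \<alpha> = \<alpha>" if "pseudonatural B C \<alpha>" for \<alpha>
    by (rule pseudonatural_eqI[of B C]) (use that ps[OF that] in \<open>simp_all add: fcomp_fid\<close>)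
  have M: "ps_modification B C (on2 (ps_map (fid B) (fid C)) \<Gamma>)" if "ps_modification B C \<Gamma>" for \<Gamma>
    using Fun_on(3)[OF PM] that by simp_all
  show ?thesis
  proof (rule Fun_eqI[OF PM fid_in[OF PS.two_category_axioms]])
    fix \<Gamma> assume "\<Gamma> \<in> Tw (ps_hom B C)"
    then show "on2 (ps_map (fid B) (fid C)) \<Gamma> = on2 (fid (ps_hom B C)) \<Gamma>"
      by (auto intro!: ps_modification_eqI[of B C] simp: M p md)
  qed (simp_all add: p fcomp_fid)
qed

section \<open>Cubical families and the Gray tensor product\<close>

text \<open>A 2-functor from A to Ps(B, C) written out: \<open>RF a\<close> is its value at a,
  \<open>on1 (LF b) f\<close> and \<open>on2 (LF b) \<tau>\<close> are components at b, and
  \<open>X f g\<close> is the structure 2-cell of the transformation at f. In this form A and B play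
  nearly symmetric roles. \<open>X_id_right\<close>, \<open>X_comp_right\<close> and
  \<open>X_nat_right\<close> say that each \<open>X f\<close> is pseudonatural,
  \<open>X_id_left\<close> and \<open>X_comp_left\<close> that f is treated functorially, and
  \<open>X_nat_left\<close> that \<tau> gives a modification.\<close>

locale cubical = A: two_category A + B: two_category B + C: two_category C
  for A B C :: "'u tcat" +
  fixes LF RF :: "'u \<Rightarrow> 'u tfun" and X :: "'u \<Rightarrow> 'u \<Rightarrow> 'u"
  assumes LF_in: "b \<in> Ob B \<Longrightarrow> LF b \<in> Fun A C"
    and RF_in: "a \<in> Ob A \<Longrightarrow> RF a \<in> Fun B C"
    and on0_eq: "a \<in> Ob A \<Longrightarrow> b \<in> Ob B \<Longrightarrow> on0 (LF b) a = on0 (RF a) b"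
    and X_inv: "f \<in> Ar A \<Longrightarrow> g \<in> Ar B \<Longrightarrow> invertible2 C (X f g)"
    and X_src: "f \<in> Ar A \<Longrightarrow> g \<in> Ar B \<Longrightarrow>
      src2 C (X f g) = comp1 C (on1 (LF (tgt1 B g)) f) (on1 (RF (src1 A f)) g)"
    and X_tgt: "f \<in> Ar A \<Longrightarrow> g \<in> Ar B \<Longrightarrow>
      tgt2 C (X f g) = comp1 C (on1 (RF (tgt1 A f)) g) (on1 (LF (src1 B g)) f)"
    and X_id_right: "f \<in> Ar A \<Longrightarrow> b \<in> Ob B \<Longrightarrow> X f (id1 B b) = id2 C (on1 (LF b) f)"
    and X_id_left: "a \<in> Ob A \<Longrightarrow> g \<in> Ar B \<Longrightarrow> X (id1 A a) g = id2 C (on1 (RF a) g)"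
    and X_comp_right: "f \<in> Ar A \<Longrightarrow> g \<in> Ar B \<Longrightarrow> g' \<in> Ar B \<Longrightarrow> src1 B g' = tgt1 B g \<Longrightarrow>
      X f (comp1 B g' g) = vcomp C (hcomp C (id2 C (on1 (RF (tgt1 A f)) g')) (X f g))
        (hcomp C (X f g') (id2 C (on1 (RF (src1 A f)) g)))"
    and X_comp_left: "f \<in> Ar A \<Longrightarrow> f' \<in> Ar A \<Longrightarrow> g \<in> Ar B \<Longrightarrow> src1 A f' = tgt1 A f \<Longrightarrow>
      X (comp1 A f' f) g = vcomp C (hcomp C (X f' g) (id2 C (on1 (LF (src1 B g)) f)))
        (hcomp C (id2 C (on1 (LF (tgt1 B g)) f')) (X f g))"
    and X_nat_right: "f \<in> Ar A \<Longrightarrow> \<sigma> \<in> Tw B \<Longrightarrow>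
      vcomp C (hcomp C (on2 (RF (tgt1 A f)) \<sigma>) (id2 C (on1 (LF (src1 B (src2 B \<sigma>))) f))) (X f (src2 B \<sigma>)) =
      vcomp C (X f (tgt2 B \<sigma>)) (hcomp C (id2 C (on1 (LF (tgt1 B (src2 B \<sigma>))) f)) (on2 (RF (src1 A f)) \<sigma>))"
    and X_nat_left: "\<tau> \<in> Tw A \<Longrightarrow> g \<in> Ar B \<Longrightarrow>
      vcomp C (hcomp C (id2 C (on1 (RF (tgt1 A (src2 A \<tau>))) g)) (on2 (LF (src1 B g)) \<tau>)) (X (src2 A \<tau>) g) =
      vcomp C (X (tgt2 A \<tau>) g) (hcomp C (on2 (LF (tgt1 B g)) \<tau>) (id2 C (on1 (RF (src1 A (src2 A \<tau>))) g)))"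
begin

lemma X_Tw: "f \<in> Ar A \<Longrightarrow> g \<in> Ar B \<Longrightarrow> X f g \<in> Tw C"
  using X_inv C.invertible2_Tw by blast

lemmas L_simps = Fun_simps[OF LF_in]
lemmas R_simps = Fun_simps[OF RF_in]
lemmas X_simps = X_Tw X_src X_tgt on0_eq

end

section \<open>2-functors into Ps(B, C) as cubical families\<close>

definition mkps :: "'u tcat \<Rightarrow> 'u tcat \<Rightarrow> 'u tcat \<Rightarrow> ('u \<Rightarrow> 'u tfun) \<Rightarrow> ('u \<Rightarrow> 'u tfun) \<Rightarrow> ('u \<Rightarrow> 'u \<Rightarrow> 'u)
    \<Rightarrow> ('u, 'u, 'u, 'u tfun, 'u ptrans, ('u ptrans, 'u \<Rightarrow> 'u) cell) twofun" where
  "mkps A B C LF RF X =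
     (let c1 = (\<lambda>f. Cell (RF (src1 A f)) (RF (tgt1 A f)) (\<lambda>b \<in> Ob B. on1 (LF b) f, \<lambda>g \<in> Ar B. X f g))
      in \<lparr>Dom = A, Cod = ps_hom B C, on0 = restrict RF (Ob A), on1 = restrict c1 (Ar A),
          on2 = (\<lambda>\<tau> \<in> Tw A. Cell (c1 (src2 A \<tau>)) (c1 (tgt2 A \<tau>)) (\<lambda>b \<in> Ob B. on2 (LF b) \<tau>))\<rparr>)"

lemma mkps_sel:
  "Dom (mkps A B C LF RF X) = A" "Cod (mkps A B C LF RF X) = ps_hom B C"
  "a \<in> Ob A \<Longrightarrow> on0 (mkps A B C LF RF X) a = RF a"
  "f \<in> Ar A \<Longrightarrow> csrc (on1 (mkps A B C LF RF X) f) = RF (src1 A f)"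
  "f \<in> Ar A \<Longrightarrow> ctgt (on1 (mkps A B C LF RF X) f) = RF (tgt1 A f)"
  "f \<in> Ar A \<Longrightarrow> b \<in> Ob B \<Longrightarrow> fst (cdat (on1 (mkps A B C LF RF X) f)) b = on1 (LF b) f"
  "f \<in> Ar A \<Longrightarrow> g \<in> Ar B \<Longrightarrow> snd (cdat (on1 (mkps A B C LF RF X) f)) g = X f g"
  "two_category A \<Longrightarrow> \<tau> \<in> Tw A \<Longrightarrow> csrc (on2 (mkps A B C LF RF X) \<tau>) = on1 (mkps A B C LF RF X) (src2 A \<tau>)"
  "two_category A \<Longrightarrow> \<tau> \<in> Tw A \<Longrightarrow> ctgt (on2 (mkps A B C LF RF X) \<tau>) = on1 (mkps A B C LF RF X) (tgt2 A \<tau>)"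
  "\<tau> \<in> Tw A \<Longrightarrow> b \<in> Ob B \<Longrightarrow> cdat (on2 (mkps A B C LF RF X) \<tau>) b = on2 (LF b) \<tau>"
  by (simp_all add: mkps_def Let_def two_category.Tw_simps)

lemma mkps_ext:
  "f \<in> Ar A \<Longrightarrow> fst (cdat (on1 (mkps A B C LF RF X) f)) \<in> extensional (Ob B)"
  "f \<in> Ar A \<Longrightarrow> snd (cdat (on1 (mkps A B C LF RF X) f)) \<in> extensional (Ar B)"
  "\<tau> \<in> Tw A \<Longrightarrow> cdat (on2 (mkps A B C LF RF X) \<tau>) \<in> extensional (Ob B)"
  "on0 (mkps A B C LF RF X) \<in> extensional (Ob A)"
  "on1 (mkps A B C LF RF X) \<in> extensional (Ar A)"
  "on2 (mkps A B C LF RF X) \<in> extensional (Tw A)"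
  by (auto simp: mkps_def Let_def)

lemma (in cubical) mkps_in: "mkps A B C LF RF X \<in> Fun A (ps_hom B C)"
proof -
  let ?H = "mkps A B C LF RF X"
  note [simp] = L_simps R_simps X_simps mkps_sel X_id_right X_id_left
  note two = B.two_category_axioms C.two_category_axioms
  interpret PS: two_category "ps_hom B C" by (rule two_category_ps_hom[OF two])
  have p [simp]: "pseudonatural B C (on1 ?H f)" if "f \<in> Ar A" for f
    by (rule pseudonaturalI)
      (use that LF_in RF_in X_inv in \<open>simp_all add: mkps_ext X_nat_right X_comp_right\<close>)
  have m [simp]: "ps_modification B C (on2 ?H \<tau>)" if "\<tau> \<in> Tw A" for \<tau>
    by (rule ps_modificationI)
      (use that A.two_category_axioms in \<open>simp_all add: mkps_ext X_nat_left\<close>)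
  note clo = pseudonatural_ps_comp[OF two] pseudonatural_ps_id[OF two] ps_modification_ps_id2[OF two]
    ps_modification_ps_vcomp[OF two] ps_modification_ps_hcomp[OF two]
  have [simp]: "on1 ?H (comp1 A g f) = ps_comp B C (on1 ?H g) (on1 ?H f)"
    if "g \<in> Ar A" "f \<in> Ar A" "src1 A g = tgt1 A f" for g f
    by (rule pseudonatural_eqI[of B C]) (use that in \<open>simp_all add: clo X_comp_left\<close>)
  note [simp] = A.two_category_axioms
  show ?thesis
  proof (rule FunI, goal_cases)
    case (13 x)
    then show ?case by (auto intro!: pseudonatural_eqI[of B C] simp: clo RF_in)
  next
    case (14 f)
    then show ?case by (auto intro!: ps_modification_eqI[of B C] simp: clo)
  next
    case (16 \<tau> \<sigma>)
    then show ?case by (auto intro!: ps_modification_eqI[of B C] simp: clo)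
  next
    case (17 \<tau> \<sigma>)
    then show ?case by (auto intro!: ps_modification_eqI[of B C] simp: clo)
  qed (simp_all add: mkps_ext RF_in)
qed

text \<open>H followed by evaluation of transformations and modifications at the object b.\<close>

definition psL :: "('u, 'u, 'u, 'u tfun, 'u ptrans, ('u ptrans, 'u \<Rightarrow> 'u) cell) twofun \<Rightarrow> 'u tcat \<Rightarrow> 'u \<Rightarrow> 'u tfun" where
  "psL H C b = \<lparr>Dom = Dom H, Cod = C, on0 = (\<lambda>a \<in> Ob (Dom H). on0 (on0 H a) b),
     on1 = (\<lambda>f \<in> Ar (Dom H). fst (cdat (on1 H f)) b), on2 = (\<lambda>\<tau> \<in> Tw (Dom H). cdat (on2 H \<tau>) b)\<rparr>"

definition psX :: "('u, 'u, 'u, 'u tfun, 'u ptrans, ('u ptrans, 'u \<Rightarrow> 'u) cell) twofun \<Rightarrow> 'u \<Rightarrow> 'u \<Rightarrow> 'u" where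
  "psX H f g = snd (cdat (on1 H f)) g"

lemma psL_sel:
  assumes "H \<in> Fun A (ps_hom B C)"
  shows "Dom (psL H C b) = A" "Cod (psL H C b) = C" "a \<in> Ob A \<Longrightarrow> on0 (psL H C b) a = on0 (on0 H a) b"
    "f \<in> Ar A \<Longrightarrow> on1 (psL H C b) f = fst (cdat (on1 H f)) b" "\<tau> \<in> Tw A \<Longrightarrow> on2 (psL H C b) \<tau> = cdat (on2 H \<tau>) b"
  using Fun_Dom[OF assms] by (simp_all add: psL_def)

text \<open>Each law is read off from one place: functoriality of H for identities and composites in
  A, pseudonaturality of \<open>on1 H f\<close> for the laws in B, and the modification law of
  \<open>on2 H \<tau>\<close> for \<open>X_nat_left\<close>.\<close>

lemma cubical_of_ps:
  assumes two: "two_category A" "two_category B" "two_category C" and H: "H \<in> Fun A (ps_hom B C)"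
  shows "cubical A B C (psL H C) (on0 H) (psX H)"
proof -
  interpret A: two_category A by fact
  interpret B: two_category B by fact
  interpret C: two_category C by fact
  interpret PS: two_category "ps_hom B C" by (rule two_category_ps_hom) fact+
  note [simp] = psL_sel[OF H]
  have p: "pseudonatural B C (on1 H f)" if "f \<in> Ar A" for f
    using Fun_on(2)[OF H that] by simp
  have m: "ps_modification B C (on2 H \<tau>)" if "\<tau> \<in> Tw A" for \<tau>
    using Fun_on(3)[OF H that] by simp
  have R: "on0 H a \<in> Fun B C" if "a \<in> Ob A" for a
    using Fun_on(1)[OF H that] by simp
  note [simp] = p m R Fun_simps[OF R]
  have bd [simp]: "csrc (on1 H f) = on0 H (src1 A f)" "ctgt (on1 H f) = on0 H (tgt1 A f)" if "f \<in> Ar A" for f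
    using Fun_on(4,5)[OF H that] that by simp_all
  have bd2 [simp]: "csrc (on2 H \<tau>) = on1 H (src2 A \<tau>)" "ctgt (on2 H \<tau>) = on1 H (tgt2 A \<tau>)" if "\<tau> \<in> Tw A" for \<tau>
    using Fun_on(6,7)[OF H that] that by simp_all
  note ps = pseudonatural_simps[OF p two(2)] and md = ps_modification_simps[OF m]
  note [simp] = ps(3-10) md(5-7)
  have ops: "x \<in> Ob A \<Longrightarrow> on1 H (id1 A x) = ps_id B C (on0 H x)"
    "f \<in> Ar A \<Longrightarrow> on2 H (id2 A f) = ps_id2 B C (on1 H f)"
    "g \<in> Ar A \<Longrightarrow> f \<in> Ar A \<Longrightarrow> src1 A g = tgt1 A f \<Longrightarrow> on1 H (comp1 A g f) = ps_comp B C (on1 H g) (on1 H f)"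
    "\<tau> \<in> Tw A \<Longrightarrow> \<sigma> \<in> Tw A \<Longrightarrow> src2 A \<tau> = tgt2 A \<sigma> \<Longrightarrow> on2 H (vcomp A \<tau> \<sigma>) = ps_vcomp B C (on2 H \<tau>) (on2 H \<sigma>)"
    "\<tau> \<in> Tw A \<Longrightarrow> \<sigma> \<in> Tw A \<Longrightarrow> src1 A (src2 A \<tau>) = tgt1 A (src2 A \<sigma>) \<Longrightarrow>
      on2 H (hcomp A \<tau> \<sigma>) = ps_hcomp B C (on2 H \<tau>) (on2 H \<sigma>)"
    for x f g \<tau> \<sigma>
    using Fun_on(8-12)[OF H] by simp_all
  show ?thesis
  proof (unfold_locales, goal_cases)
    case (1 b)
    show ?case by (rule FunI) (use 1 in \<open>simp_all add: ops, simp_all add: psL_def Fun_Dom[OF H]\<close>)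
  next
    case (9 f g g')
    then show ?case using pseudonatural_comp[OF p two(2), of f g' g] by (simp add: psX_def)
  next
    case (11 f \<sigma>)
    then show ?case using pseudonatural_natural[OF p two(2), of f \<sigma>] by (simp add: psX_def)
  next
    case (12 \<tau> g)
    then show ?case using ps_modification_natural[OF m two(2), of \<tau> g] by (simp add: psX_def)
  qed (simp_all add: psX_def ops)
qed

lemma mkps_of_ps:
  assumes two: "two_category A" "two_category B" "two_category C" and H: "H \<in> Fun A (ps_hom B C)"
  shows "mkps A B C (psL H C) (on0 H) (psX H) = H"
proof -
  interpret cubical A B C "psL H C" "on0 H" "psX H" by (rule cubical_of_ps[OF assms])
  note [simp] = mkps_sel psL_sel[OF H] two
  have p: "pseudonatural B C (on1 H f)" if "f \<in> Ar A" for f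
    using Fun_on(2)[OF H that] by simp
  have m: "ps_modification B C (on2 H \<tau>)" if "\<tau> \<in> Tw A" for \<tau>
    using Fun_on(3)[OF H that] by simp
  have p': "pseudonatural B C (on1 (mkps A B C (psL H C) (on0 H) (psX H)) f)" if "f \<in> Ar A" for f
    using Fun_on(2)[OF mkps_in that] by simp
  have m': "ps_modification B C (on2 (mkps A B C (psL H C) (on0 H) (psX H)) \<tau>)" if "\<tau> \<in> Tw A" for \<tau>
    using Fun_on(3)[OF mkps_in that] by simp
  have 1: "on1 (mkps A B C (psL H C) (on0 H) (psX H)) f = on1 H f" if "f \<in> Ar A" for f
    by (rule pseudonatural_eqI[OF p' p])
      (use that Fun_on(4,5)[OF H that] p[OF that] in \<open>simp_all add: psX_def\<close>)
  show ?thesis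
  proof (rule Fun_eqI[OF mkps_in H])
    fix \<tau> assume "\<tau> \<in> Tw A"
    then show "on2 (mkps A B C (psL H C) (on0 H) (psX H)) \<tau> = on2 H \<tau>"
      using Fun_on(6,7)[OF H] m by (intro ps_modification_eqI[OF m' m]) (simp_all add: 1)
  qed (simp_all add: 1)
qed

text \<open>With \<open>psX_mkps\<close> and \<open>mkps_of_ps\<close> this makes
  \<open>mkps\<close> a bijection between cubical families, compared on their domains, and
  2-functors from A to Ps(B, C).\<close>

lemma (in cubical) psL_mkps: "b \<in> Ob B \<Longrightarrow> psL (mkps A B C LF RF X) C b = LF b"
proof (rule Fun_eqI)
  assume b: "b \<in> Ob B"
  interpret H: cubical A B C "psL (mkps A B C LF RF X) C" "on0 (mkps A B C LF RF X)" "psX (mkps A B C LF RF X)"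
    by (rule cubical_of_ps[OF _ _ _ mkps_in]; unfold_locales)
  show "psL (mkps A B C LF RF X) C b \<in> Fun A C" using H.LF_in[OF b] .
  show "LF b \<in> Fun A C" using LF_in[OF b] .
qed (simp_all add: psL_sel[OF mkps_in] mkps_sel on0_eq)

lemma (in cubical) psX_mkps: "f \<in> Ar A \<Longrightarrow> g \<in> Ar B \<Longrightarrow> psX (mkps A B C LF RF X) f g = X f g"
  by (simp add: psX_def mkps_sel)

lemma mkps_cong:
  assumes "two_category A" "\<And>a. a \<in> Ob A \<Longrightarrow> RF a = RF' a" "\<And>b. b \<in> Ob B \<Longrightarrow> LF b = LF' b"
    "\<And>f g. f \<in> Ar A \<Longrightarrow> g \<in> Ar B \<Longrightarrow> X f g = X' f g"
  shows "mkps A B C LF RF X = mkps A B C LF' RF' X'"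
proof -
  interpret two_category A by fact
  show ?thesis using assms(2-) by (auto simp: mkps_def Let_def restrict_def fun_eq_iff)
qed

text \<open>Reindexing along F and G and pushing forward along H act on a family term by term.
  Naturality of the representing isomorphism thereby becomes a formula for families.\<close>

lemma ps_map_mkps:
  assumes cub: "cubical A B C LF RF X" and "two_category A'" "two_category B'" "two_category C'"
    and F: "F \<in> Fun A' A" and G: "G \<in> Fun B' B" and H: "H \<in> Fun C C'"
  shows "ps_map G H \<bullet> mkps A B C LF RF X \<bullet> F =
    mkps A' B' C' (\<lambda>b. H \<bullet> LF (on0 G b) \<bullet> F) (\<lambda>a. H \<bullet> RF (on0 F a) \<bullet> G) (\<lambda>f g. on2 H (X (on1 F f) (on1 G g)))"
    (is "?l = ?r")
proof -
  interpret cubical A B C LF RF X by fact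
  interpret A': two_category A' by fact
  interpret B': two_category B' by fact
  interpret C': two_category C' by fact
  note PM = ps_map_in[OF B.two_category_axioms B'.two_category_axioms C.two_category_axioms C'.two_category_axioms G H]
  have MF: "mkps A B C LF RF X \<bullet> F \<in> Fun A' (ps_hom B C)"
    by (rule fcomp_in[OF A'.two_category_axioms F mkps_in])
  have "?l \<in> Fun A' (ps_hom B' C')"
    by (rule fcomp_in[OF A'.two_category_axioms MF PM])
  from mkps_of_ps[OF A'.two_category_axioms B'.two_category_axioms C'.two_category_axioms this]
  have "mkps A' B' C' (psL ?l C') (on0 ?l) (psX ?l) = ?l" .
  moreover have "mkps A' B' C' (psL ?l C') (on0 ?l) (psX ?l) = ?r"
  proof (rule mkps_cong[OF A'.two_category_axioms])
    fix b assume b: "b \<in> Ob B'"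
    interpret l: cubical A' B' C' "psL ?l C'" "on0 ?l" "psX ?l"
      by (rule cubical_of_ps) fact+
    have Gb: "on0 G b \<in> Ob B" using b by (simp add: Fun_simps[OF G])
    have LFin: "LF (on0 G b) \<bullet> F \<in> Fun A' C"
      by (rule fcomp_in[OF A'.two_category_axioms F LF_in[OF Gb]])
    have pn: "pseudonatural B C (on1 (mkps A B C LF RF X) f)" if "f \<in> Ar A" for f
      using Fun_on(2)[OF mkps_in that] by simp
    have mn: "ps_modification B C (on2 (mkps A B C LF RF X) f)" if "f \<in> Tw A" for f
      using Fun_on(3)[OF mkps_in that] by simp
    show "psL ?l C' b = H \<bullet> LF (on0 G b) \<bullet> F"
      by (rule Fun_eqI[OF l.LF_in[OF b] fcomp_in[OF A'.two_category_axioms LFin H]])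
        (use b Gb in \<open>simp_all add: psL_sel[OF \<open>?l \<in> _\<close>] mkps_sel Fun_simps[OF F] Fun_simps[OF G] ps_map_sel[OF G H] pn mn
         L_simps R_simps RF_in on0_eq\<close>)
  next
    fix f g assume fg: "f \<in> Ar A'" "g \<in> Ar B'"
    have pn: "pseudonatural B C (on1 (mkps A B C LF RF X) f)" if "f \<in> Ar A" for f
      using Fun_on(2)[OF mkps_in that] by simp
    show "psX ?l f g = on2 H (X (on1 F f) (on1 G g))"
      using fg by (simp add: psX_def mkps_sel Fun_simps[OF F] Fun_simps[OF G] ps_map_sel[OF G H] pn)
  qed (simp add: Fun_simps[OF F] mkps_sel ps_map_sel[OF G H] RF_in)
  ultimately show ?thesis by simp
qed

lemma cubical_comp:
  assumes cub: "cubical A B C LF RF X" and "two_category A'" "two_category B'" "two_category C'"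
    and F: "F \<in> Fun A' A" and G: "G \<in> Fun B' B" and H: "H \<in> Fun C C'"
  shows "cubical A' B' C' (\<lambda>b. H \<bullet> LF (on0 G b) \<bullet> F) (\<lambda>a. H \<bullet> RF (on0 F a) \<bullet> G) (\<lambda>f g. on2 H (X (on1 F f) (on1 G g)))"
proof -
  interpret cubical A B C LF RF X by fact
  interpret A': two_category A' by fact
  interpret B': two_category B' by fact
  interpret C': two_category C' by fact
  note [simp] = Fun_simps[OF F] Fun_simps[OF G] Fun_simps[OF H] L_simps R_simps X_simps
  have LL: "LF b \<bullet> F \<in> Fun A' C" if "b \<in> Ob B" for b
    by (rule fcomp_in[OF A'.two_category_axioms F LF_in[OF that]])
  have RR: "RF a \<bullet> G \<in> Fun B' C" if "a \<in> Ob A" for a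
    by (rule fcomp_in[OF B'.two_category_axioms G RF_in[OF that]])
  show ?thesis
  proof (unfold_locales, goal_cases)
    case 1
    then show ?case by (auto intro!: fcomp_in[OF A'.two_category_axioms LL H])
  next
    case 2
    then show ?case by (auto intro!: fcomp_in[OF B'.two_category_axioms RR H])
  next
    case (4 f g)
    then show ?case using invertible2_Fun[OF H C.two_category_axioms X_inv] by simp
  next
    case (11 f \<sigma>)
    then show ?case
      using arg_cong[OF X_nat_right, of "on1 F f" "on2 G \<sigma>" "on2 H"] by simp
  next
    case (12 \<tau> g)
    then show ?case
      using arg_cong[OF X_nat_left, of "on2 F \<tau>" "on1 G g" "on2 H"] by simp
  qed (simp_all add: X_id_right X_id_left X_comp_right X_comp_left)
qed

lemma cubical_cong:
  assumes cub: "cubical A B C LF RF X"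
    and "\<And>b. b \<in> Ob B \<Longrightarrow> LF b = LF' b" "\<And>a. a \<in> Ob A \<Longrightarrow> RF a = RF' a"
    "\<And>f g. f \<in> Ar A \<Longrightarrow> g \<in> Ar B \<Longrightarrow> X f g = X' f g"
  shows "cubical A B C LF' RF' X'"
proof -
  interpret cubical A B C LF RF X by fact
  show ?thesis
    by unfold_locales (simp_all flip: assms(2-4) add: LF_in RF_in X_simps X_inv X_id_left X_id_right
        X_comp_left X_comp_right X_nat_left X_nat_right)
qed

lemma mkps_inject:
  assumes "cubical A B C LF RF X" "cubical A B C LF' RF' X'" "mkps A B C LF RF X = mkps A B C LF' RF' X'"
  shows "a \<in> Ob A \<Longrightarrow> RF a = RF' a" "b \<in> Ob B \<Longrightarrow> LF b = LF' b"
    "f \<in> Ar A \<Longrightarrow> g \<in> Ar B \<Longrightarrow> X f g = X' f g"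
  using cubical.psL_mkps[OF assms(1), of b] cubical.psL_mkps[OF assms(2), of b]
    cubical.psX_mkps[OF assms(1), of f g] cubical.psX_mkps[OF assms(2), of f g]
    mkps_sel(3)[of a A B C LF RF X] mkps_sel(3)[of a A B C LF' RF' X'] assms(3) by auto

section \<open>The universal cubical family on A \<otimes> B\<close>

context gray_tensor begin

text \<open>The Yoneda element: the 2-functor from A to Ps(B, A \<otimes> B) that represents the
  identity. The three definitions after it are its constituents as a cubical family.\<close>

definition "gU A B = \<theta> A B (g0 A B) (fid (g0 A B))"
definition "gL A B = psL (gU A B) (g0 A B)"
definition "gR A B = on0 (gU A B)"
definition "gX A B = psX (gU A B)"

lemma g0_Obj: "A \<in> Obj TwoCat \<Longrightarrow> B \<in> Obj TwoCat \<Longrightarrow> g0 A B \<in> Obj TwoCat"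
  using gray_bifunctor by (simp add: bifunctor_def)

lemma g1_in: "\<lbrakk>A \<in> Obj TwoCat; B \<in> Obj TwoCat; A' \<in> Obj TwoCat; B' \<in> Obj TwoCat;
    F \<in> Fun A A'; G \<in> Fun B B'\<rbrakk> \<Longrightarrow> g1 F G \<in> Fun (g0 A B) (g0 A' B')"
  using gray_bifunctor by (simp add: bifunctor_def)

lemma g1_fid: "A \<in> Obj TwoCat \<Longrightarrow> B \<in> Obj TwoCat \<Longrightarrow> g1 (fid A) (fid B) = fid (g0 A B)"
  using gray_bifunctor by (simp add: bifunctor_def)

context
  fixes A B :: "'u tcat" assumes A: "A \<in> Obj TwoCat" and B: "B \<in> Obj TwoCat"
begin

lemma two_AB: "two_category A" "two_category B" "two_category (g0 A B)"
  using two_category_Obj A B g0_Obj[OF A B] by auto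

lemma gU_in: "gU A B \<in> Fun A (ps_hom B (g0 A B))"
  unfolding gU_def using bij_betwE[OF represents[OF A B g0_Obj[OF A B]]] fid_in[OF two_AB(3)] by blast

lemma g_cubical: "cubical A B (g0 A B) (gL A B) (gR A B) (gX A B)"
  unfolding gL_def gR_def gX_def by (rule cubical_of_ps[OF two_AB gU_in])

lemma gU_mkps: "gU A B = mkps A B (g0 A B) (gL A B) (gR A B) (gX A B)"
  unfolding gL_def gR_def gX_def using mkps_of_ps[OF two_AB gU_in] by simp

text \<open>Yoneda: L is L after the identity, so naturality in the codomain exhibits the transpose
  of L as the universal family pushed forward along L.\<close>

lemma \<theta>_mkps:
  assumes C: "C \<in> Obj TwoCat" and L: "L \<in> Fun (g0 A B) C"
  shows "\<theta> A B C L = mkps A B C (\<lambda>b. L \<bullet> gL A B b) (\<lambda>a. L \<bullet> gR A B a) (\<lambda>f g. on2 L (gX A B f g))"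
proof -
  interpret G: cubical A B "g0 A B" "gL A B" "gR A B" "gX A B" by (rule g_cubical)
  note C2 = two_category_Obj[OF C]
  \<comment> \<open>L is padded with identities to match the shape of
    \<open>\<theta>_natural\<close>.\<close>
  have "\<theta> A B C (L \<bullet> fid (g0 A B) \<bullet> g1 (fid A) (fid B)) = ps_map (fid B) L \<bullet> gU A B \<bullet> fid A"
    unfolding gU_def
    by (rule \<theta>_natural[OF A B g0_Obj[OF A B] A B C]) (use L two_AB in auto)
  moreover have "L \<bullet> fid (g0 A B) \<bullet> g1 (fid A) (fid B) = L"
    using L fid_in[OF two_AB(3)] by (simp add: g1_fid[OF A B] fcomp_fid)
  ultimately have "\<theta> A B C L = ps_map (fid B) L \<bullet> gU A B \<bullet> fid A" by simp
  also have "\<dots> = mkps A B C (\<lambda>b. L \<bullet> gL A B (on0 (fid B) b) \<bullet> fid A) (\<lambda>a. L \<bullet> gR A B (on0 (fid A) a) \<bullet> fid B)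
      (\<lambda>f g. on2 L (gX A B (on1 (fid A) f) (on1 (fid B) g)))"
    unfolding gU_mkps by (rule ps_map_mkps[OF g_cubical two_AB(1,2) C2 fid_in fid_in L]) (fact two_AB)+
  also have "\<dots> = mkps A B C (\<lambda>b. L \<bullet> gL A B b) (\<lambda>a. L \<bullet> gR A B a) (\<lambda>f g. on2 L (gX A B f g))"
    by (rule mkps_cong[OF two_AB(1)]) (simp_all add: fcomp_fid[OF G.LF_in] fcomp_fid[OF G.RF_in])
  finally show ?thesis .
qed

lemma g_cubical_comp:
  assumes C: "C \<in> Obj TwoCat" and L: "L \<in> Fun (g0 A B) C"
  shows "cubical A B C (\<lambda>b. L \<bullet> gL A B b) (\<lambda>a. L \<bullet> gR A B a) (\<lambda>f g. on2 L (gX A B f g))"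
proof -
  have "\<theta> A B C L \<in> Fun A (ps_hom B C)"
    using bij_betwE[OF represents[OF A B C]] L by blast
  interpret M: cubical A B C "psL (\<theta> A B C L) C" "on0 (\<theta> A B C L)" "psX (\<theta> A B C L)"
    by (rule cubical_of_ps) (fact | rule two_AB two_category_Obj[OF C])+
  interpret G: cubical A B "g0 A B" "gL A B" "gR A B" "gX A B" by (rule g_cubical)
  interpret D: cubical A B C "\<lambda>b. L \<bullet> gL A B (on0 (fid B) b) \<bullet> fid A" "\<lambda>a. L \<bullet> gR A B (on0 (fid A) a) \<bullet> fid B"
     "\<lambda>f g. on2 L (gX A B (on1 (fid A) f) (on1 (fid B) g))"
    by (rule cubical_comp[OF g_cubical two_AB(1,2) two_category_Obj[OF C] fid_in fid_in L]) (fact two_AB)+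
  have e: "L \<bullet> gL A B b \<bullet> fid A = L \<bullet> gL A B b" if "b \<in> Ob B" for b
    using that by (simp add: fcomp_fid[OF G.LF_in])
  have e': "L \<bullet> gR A B a \<bullet> fid B = L \<bullet> gR A B a" if "a \<in> Ob A" for a
    using that by (simp add: fcomp_fid[OF G.RF_in])
  show ?thesis
    by (rule cubical_cong[OF D.cubical_axioms]) (simp_all add: e e')
qed

text \<open>Surjectivity of \<theta> gives L, and comparing constituents identifies its effect on
  the universal family. With \<open>g_unique\<close>, which is injectivity of \<theta>, this is the
  universal property of A \<otimes> B in the form used from here on.\<close>

lemma g_ex:
  assumes C: "C \<in> Obj TwoCat" and cub: "cubical A B C LF RF X"
  obtains L where "L \<in> Fun (g0 A B) C" "\<And>b. b \<in> Ob B \<Longrightarrow> L \<bullet> gL A B b = LF b"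
    "\<And>a. a \<in> Ob A \<Longrightarrow> L \<bullet> gR A B a = RF a"
    "\<And>f g. f \<in> Ar A \<Longrightarrow> g \<in> Ar B \<Longrightarrow> on2 L (gX A B f g) = X f g"
proof -
  interpret cubical A B C LF RF X by fact
  interpret G: cubical A B "g0 A B" "gL A B" "gR A B" "gX A B" by (rule g_cubical)
  obtain L where L: "L \<in> Fun (g0 A B) C" "\<theta> A B C L = mkps A B C LF RF X"
    using mkps_in represents[OF A B C] unfolding bij_betw_def by (metis imageE)
  have *: "mkps A B C (\<lambda>b. L \<bullet> gL A B b) (\<lambda>a. L \<bullet> gR A B a) (\<lambda>f g. on2 L (gX A B f g)) = mkps A B C LF RF X"
    using \<theta>_mkps[OF C L(1)] L(2) by simp
  show ?thesis
    using that[OF L(1)] mkps_inject[OF g_cubical_comp[OF C L(1)] cub *] by blast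
qed

lemma g_unique:
  fixes C :: "'u tcat"
  assumes C: "C \<in> Obj TwoCat" and L: "L \<in> Fun (g0 A B) C" and L': "L' \<in> Fun (g0 A B) C"
    and "\<And>b. b \<in> Ob B \<Longrightarrow> L \<bullet> gL A B b = L' \<bullet> gL A B b"
    "\<And>a. a \<in> Ob A \<Longrightarrow> L \<bullet> gR A B a = L' \<bullet> gR A B a"
    "\<And>f g. f \<in> Ar A \<Longrightarrow> g \<in> Ar B \<Longrightarrow> on2 L (gX A B f g) = on2 L' (gX A B f g)"
  shows "L = L'"
proof -
  have "\<theta> A B C L = \<theta> A B C L'"
    unfolding \<theta>_mkps[OF C L] \<theta>_mkps[OF C L'] using assms by (intro mkps_cong two_AB(1)) auto
  then show ?thesis
    using represents[OF A B C] L L' unfolding bij_betw_def inj_on_def by blast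
qed

end

text \<open>The tensor of two 2-functors is given abstractly. Naturality of \<theta> in A and B,
  taken at the identity of A \<otimes> B, determines it on the universal family.\<close>

lemma g1_on:
  assumes A: "A \<in> Obj TwoCat" and B: "B \<in> Obj TwoCat" and A': "A' \<in> Obj TwoCat" and B': "B' \<in> Obj TwoCat"
    and F: "F \<in> Fun A' A" and G: "G \<in> Fun B' B"
  shows "b \<in> Ob B' \<Longrightarrow> g1 F G \<bullet> gL A' B' b = gL A B (on0 G b) \<bullet> F"
    "a \<in> Ob A' \<Longrightarrow> g1 F G \<bullet> gR A' B' a = gR A B (on0 F a) \<bullet> G"
    "f \<in> Ar A' \<Longrightarrow> g \<in> Ar B' \<Longrightarrow> on2 (g1 F G) (gX A' B' f g) = gX A B (on1 F f) (on1 G g)"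
proof -
  note GG = g0_Obj[OF A B] and g1 = g1_in[OF A' B' A B F G]
  note two = two_AB[OF A B] two_AB[OF A' B']
  interpret G: cubical A B "g0 A B" "gL A B" "gR A B" "gX A B" by (rule g_cubical[OF A B])
  let ?I = "fid (g0 A B)"
  note I = fid_in[OF two(3)]
  have "\<theta> A' B' (g0 A B) (?I \<bullet> ?I \<bullet> g1 F G) = ps_map G ?I \<bullet> gU A B \<bullet> F"
    unfolding gU_def
    by (rule \<theta>_natural[OF A B GG A' B' GG F G I I])
  moreover have "?I \<bullet> ?I \<bullet> g1 F G = g1 F G"
    using g1 by (simp add: fcomp_fid)
  ultimately have "\<theta> A' B' (g0 A B) (g1 F G) = ps_map G ?I \<bullet> gU A B \<bullet> F" by simp
  also have "\<dots> = mkps A' B' (g0 A B) (\<lambda>b. ?I \<bullet> gL A B (on0 G b) \<bullet> F) (\<lambda>a. ?I \<bullet> gR A B (on0 F a) \<bullet> G)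
      (\<lambda>f g. on2 ?I (gX A B (on1 F f) (on1 G g)))"
    unfolding gU_mkps[OF A B] by (rule ps_map_mkps[OF G.cubical_axioms two(4,5) two(3) F G I])
  finally have *: "mkps A' B' (g0 A B) (\<lambda>b. g1 F G \<bullet> gL A' B' b) (\<lambda>a. g1 F G \<bullet> gR A' B' a) (\<lambda>f g. on2 (g1 F G) (gX A' B' f g)) = \<dots>"
    by (simp only: \<theta>_mkps[OF A' B' GG g1])
  note inj = mkps_inject[OF g_cubical_comp[OF A' B' GG g1] cubical_comp[OF G.cubical_axioms two(4,5) two(3) F G I] *]
  note [simp] = Fun_simps[OF F] Fun_simps[OF G] G.X_simps fcomp_fid(2)[OF fcomp_in[OF two(4) F G.LF_in]]
    fcomp_fid(2)[OF fcomp_in[OF two(5) G G.RF_in]]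
  show "b \<in> Ob B' \<Longrightarrow> g1 F G \<bullet> gL A' B' b = gL A B (on0 G b) \<bullet> F"
    "a \<in> Ob A' \<Longrightarrow> g1 F G \<bullet> gR A' B' a = gR A B (on0 F a) \<bullet> G"
    "f \<in> Ar A' \<Longrightarrow> g \<in> Ar B' \<Longrightarrow> on2 (g1 F G) (gX A' B' f g) = gX A B (on1 F f) (on1 G g)"
    using inj(2)[of b] inj(1)[of a] inj(3)[of f g] by simp_all
qed


end

section \<open>The cartesian product\<close>

lemma lepoll_linear: "A \<lesssim> B \<or> B \<lesssim> A"
  using ordLeq_total[OF card_of_Well_order[of A] card_of_Well_order[of B]]
  by (auto simp: lepoll_def simp flip: card_of_ordLeq)

lemma infinite_times_self: "infinite A \<Longrightarrow> A \<times> A \<approx> A"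
  using card_of_Times_same_infinite by (simp add: eqpoll_iff_card_of_ordIso)

definition proj1 :: "'u tcat \<Rightarrow> 'u tcat \<Rightarrow> 'u tfun" where "proj1 A B = cellwise (prod_cat A B) A pfst"
definition proj2 :: "'u tcat \<Rightarrow> 'u tcat \<Rightarrow> 'u tfun" where "proj2 A B = cellwise (prod_cat A B) B psnd"

locale univ =
  fixes u :: "'u itself"
  assumes universe: "universe u"
begin

lemma infinite_univ: "infinite (UNIV :: 'u set)"
  using universe by (auto simp: universe_def infinite_le_lepoll intro: lesspoll_imp_lepoll)

lemma finite_lt: "finite X \<Longrightarrow> X \<prec> (UNIV :: 'u set)"
  using finite_lesspoll_infinite infinite_univ by blast

text \<open>The larger factor bounds the product by its own square, and an infinite set is
  equipotent to its square.\<close>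

lemma Times_lt:
  assumes "X \<prec> (UNIV :: 'u set)" "Y \<prec> (UNIV :: 'u set)"
  shows "X \<times> Y \<prec> (UNIV :: 'u set)"
proof -
  have sq: "Z \<times> Z \<prec> (UNIV :: 'u set)" if "Z \<prec> (UNIV :: 'u set)" for Z :: "'z set"
  proof (cases "finite Z")
    case True
    then show ?thesis by (simp add: finite_lt)
  next
    case False
    then show ?thesis using infinite_times_self that eq_lesspoll_trans by blast
  qed
  show ?thesis
  proof (cases "X \<lesssim> Y")
    case True
    then have "X \<times> Y \<lesssim> Y \<times> Y" by (rule times_lepoll_mono) simp
    then show ?thesis using sq[OF assms(2)] lesspoll_trans1 by blast
  next
    case False
    then have "Y \<lesssim> X" using lepoll_linear by blast
    then have "X \<times> Y \<lesssim> X \<times> X" by (intro times_lepoll_mono) simp_all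
    then show ?thesis using sq[OF assms(1)] lesspoll_trans1 by blast
  qed
qed

text \<open>The strong limit condition speaks of subsets of \<open>'u\<close> only. A set of another
  type is moved there along an injection, and its subsets with it.\<close>

lemma Pow_lt:
  assumes "X \<prec> (UNIV :: 'u set)"
  shows "Pow X \<prec> (UNIV :: 'u set)"
proof -
  obtain f :: "_ \<Rightarrow> 'u" where f: "inj_on f X"
    using assms lesspoll_imp_lepoll unfolding lepoll_def by blast
  have "f ` X \<prec> (UNIV :: 'u set)" using assms f by simp
  then have "Pow (f ` X) \<prec> (UNIV :: 'u set)" using universe by (simp add: universe_def)
  moreover have "Pow X \<lesssim> Pow (f ` X)"
    unfolding lepoll_def by (rule exI[of _ "image f"]) (use inj_on_image_Pow[OF f] in auto)
  ultimately show ?thesis using lesspoll_trans1 by blast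
qed

lemma subset_lt: "X \<subseteq> Y \<Longrightarrow> Y \<prec> (UNIV :: 'u set) \<Longrightarrow> X \<prec> (UNIV :: 'u set)"
  by (meson lesspoll_trans1 subset_imp_lepoll)

lemma image_lt: "X \<prec> (UNIV :: 'u set) \<Longrightarrow> f ` X \<prec> (UNIV :: 'u set)"
  by (meson lesspoll_trans1 image_lepoll)

text \<open>An extensional function is recovered from its graph, which is a subset of X x Y.\<close>

lemma PiE_lt:
  assumes "X \<prec> (UNIV :: 'u set)" "Y \<prec> (UNIV :: 'u set)"
  shows "X \<rightarrow>\<^sub>E Y \<prec> (UNIV :: 'u set)"
proof -
  let ?g = "\<lambda>f. (\<lambda>x. (x, f x)) ` X"
  have "inj_on ?g (X \<rightarrow>\<^sub>E Y)"
  proof (rule inj_onI)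
    fix f g assume fg: "f \<in> X \<rightarrow>\<^sub>E Y" "g \<in> X \<rightarrow>\<^sub>E Y" "?g f = ?g g"
    have "f x = g x" if "x \<in> X" for x
    proof -
      have "(x, f x) \<in> ?g g" using fg(3) that by blast
      then show ?thesis by auto
    qed
    then show "f = g" using fg(1,2) by (auto intro: PiE_ext)
  qed
  moreover have "?g ` (X \<rightarrow>\<^sub>E Y) \<subseteq> Pow (X \<times> Y)" by auto
  ultimately have "X \<rightarrow>\<^sub>E Y \<lesssim> Pow (X \<times> Y)" unfolding lepoll_def by blast
  then show ?thesis using lesspoll_trans1 Pow_lt[OF Times_lt[OF assms]] by blast
qed

text \<open>\<open>pair\<close> is an arbitrary choice, so the existence of an injection has to be
  proved: an infinite type is equipotent to its square.\<close>

lemma inj_pair: "inj (case_prod (pair :: 'u \<Rightarrow> 'u \<Rightarrow> 'u))"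
proof -
  have "\<exists>p :: 'u \<times> 'u \<Rightarrow> 'u. inj p"
    using infinite_times_self[OF infinite_univ] by (auto simp: eqpoll_def bij_betw_def)
  then have "inj (SOME p :: 'u \<times> 'u \<Rightarrow> 'u. inj p)" by (rule someI_ex)
  then show ?thesis by (simp add: pair_def)
qed

lemma pair_eq [simp]: "pair x y = pair x' y' \<longleftrightarrow> x = x' \<and> (y :: 'u) = y'"
  using inj_eq[OF inj_pair, of "(x, y)" "(x', y')"] by simp

lemma pfst_pair [simp]: "pfst (pair x (y :: 'u)) = x"
  by (simp add: pfst_def)

lemma psnd_pair [simp]: "psnd (pair x (y :: 'u)) = y"
  by (simp add: psnd_def)

lemma pair_in_pairs [simp]: "pair x (y :: 'u) \<in> pairs X Y \<longleftrightarrow> x \<in> X \<and> y \<in> Y"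
  by (auto simp: pairs_def)

lemma small_pairs: "small X \<Longrightarrow> small Y \<Longrightarrow> small (pairs X (Y :: 'u set))"
proof -
  have "pairs X Y = case_prod pair ` (X \<times> Y)" by (auto simp: pairs_def)
  then show "small X \<Longrightarrow> small Y \<Longrightarrow> small (pairs X Y)"
    unfolding small_def by (simp add: image_lt Times_lt)
qed

section \<open>The product 2-category and its projections\<close>

lemma prod_cat_mem [simp]:
  fixes A B :: "'u tcat"
  shows "pair x y \<in> Ob (prod_cat A B) \<longleftrightarrow> x \<in> Ob A \<and> y \<in> Ob B"
    "pair f g \<in> Ar (prod_cat A B) \<longleftrightarrow> f \<in> Ar A \<and> g \<in> Ar B"
    "pair \<tau> \<sigma> \<in> Tw (prod_cat A B) \<longleftrightarrow> \<tau> \<in> Tw A \<and> \<sigma> \<in> Tw B"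
  by (simp_all add: prod_cat_def)

lemma prod_catE:
  fixes A B :: "'u tcat"
  shows "z \<in> Ob (prod_cat A B) \<Longrightarrow> (\<And>x y. z = pair x y \<Longrightarrow> x \<in> Ob A \<Longrightarrow> y \<in> Ob B \<Longrightarrow> thesis) \<Longrightarrow> thesis"
    "z \<in> Ar (prod_cat A B) \<Longrightarrow> (\<And>x y. z = pair x y \<Longrightarrow> x \<in> Ar A \<Longrightarrow> y \<in> Ar B \<Longrightarrow> thesis) \<Longrightarrow> thesis"
    "z \<in> Tw (prod_cat A B) \<Longrightarrow> (\<And>x y. z = pair x y \<Longrightarrow> x \<in> Tw A \<Longrightarrow> y \<in> Tw B \<Longrightarrow> thesis) \<Longrightarrow> thesis"
  by (auto simp: prod_cat_def pairs_def)

lemma prod_cat_ops [simp]: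
  fixes A B :: "'u tcat"
  shows "f \<in> Ar A \<Longrightarrow> g \<in> Ar B \<Longrightarrow> src1 (prod_cat A B) (pair f g) = pair (src1 A f) (src1 B g)"
    "f \<in> Ar A \<Longrightarrow> g \<in> Ar B \<Longrightarrow> tgt1 (prod_cat A B) (pair f g) = pair (tgt1 A f) (tgt1 B g)"
    "x \<in> Ob A \<Longrightarrow> y \<in> Ob B \<Longrightarrow> id1 (prod_cat A B) (pair x y) = pair (id1 A x) (id1 B y)"
    "\<lbrakk>f \<in> Ar A; g \<in> Ar B; f' \<in> Ar A; g' \<in> Ar B; src1 A f' = tgt1 A f; src1 B g' = tgt1 B g\<rbrakk> \<Longrightarrow>
      comp1 (prod_cat A B) (pair f' g') (pair f g) = pair (comp1 A f' f) (comp1 B g' g)"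
    "\<tau> \<in> Tw A \<Longrightarrow> \<sigma> \<in> Tw B \<Longrightarrow> src2 (prod_cat A B) (pair \<tau> \<sigma>) = pair (src2 A \<tau>) (src2 B \<sigma>)"
    "\<tau> \<in> Tw A \<Longrightarrow> \<sigma> \<in> Tw B \<Longrightarrow> tgt2 (prod_cat A B) (pair \<tau> \<sigma>) = pair (tgt2 A \<tau>) (tgt2 B \<sigma>)"
    "f \<in> Ar A \<Longrightarrow> g \<in> Ar B \<Longrightarrow> id2 (prod_cat A B) (pair f g) = pair (id2 A f) (id2 B g)"
    "\<lbrakk>\<tau> \<in> Tw A; \<sigma> \<in> Tw B; \<tau>' \<in> Tw A; \<sigma>' \<in> Tw B; src2 A \<tau>' = tgt2 A \<tau>; src2 B \<sigma>' = tgt2 B \<sigma>\<rbrakk> \<Longrightarrow>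
      vcomp (prod_cat A B) (pair \<tau>' \<sigma>') (pair \<tau> \<sigma>) = pair (vcomp A \<tau>' \<tau>) (vcomp B \<sigma>' \<sigma>)"
    "\<lbrakk>\<tau> \<in> Tw A; \<sigma> \<in> Tw B; \<tau>' \<in> Tw A; \<sigma>' \<in> Tw B; src1 A (src2 A \<tau>') = tgt1 A (src2 A \<tau>);
      src1 B (src2 B \<sigma>') = tgt1 B (src2 B \<sigma>); src2 A \<tau> \<in> Ar A; src2 B \<sigma> \<in> Ar B; src2 A \<tau>' \<in> Ar A; src2 B \<sigma>' \<in> Ar B\<rbrakk> \<Longrightarrow>
      hcomp (prod_cat A B) (pair \<tau>' \<sigma>') (pair \<tau> \<sigma>) = pair (hcomp A \<tau>' \<tau>) (hcomp B \<sigma>' \<sigma>)"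
  by (simp_all add: prod_cat_def trim_def)

lemma two_category_prod_cat:
  fixes A B :: "'u tcat"
  assumes "two_category A" "two_category B"
  shows "two_category (prod_cat A B)"
proof -
  interpret A: two_category A by fact
  interpret B: two_category B by fact
  show ?thesis
    unfolding prod_cat_def
    by (rule two_category_trimI)
      (auto simp: pairs_def A.interchange' B.interchange')
qed

lemma prod_cat_Obj: "A \<in> Obj TwoCat \<Longrightarrow> B \<in> Obj TwoCat \<Longrightarrow> prod_cat A (B :: 'u tcat) \<in> Obj TwoCat"
  by (simp add: TwoCat_def two_category_prod_cat) (simp add: prod_cat_def small_pairs)

lemma prod_fun_sel [simp]:
  fixes F G :: "'u tfun"
  shows "Dom (prod_fun F G) = prod_cat (Dom F) (Dom G)" "Cod (prod_fun F G) = prod_cat (Cod F) (Cod G)"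
    "x \<in> Ob (Dom F) \<Longrightarrow> y \<in> Ob (Dom G) \<Longrightarrow> on0 (prod_fun F G) (pair x y) = pair (on0 F x) (on0 G y)"
    "f \<in> Ar (Dom F) \<Longrightarrow> g \<in> Ar (Dom G) \<Longrightarrow> on1 (prod_fun F G) (pair f g) = pair (on1 F f) (on1 G g)"
    "\<tau> \<in> Tw (Dom F) \<Longrightarrow> \<sigma> \<in> Tw (Dom G) \<Longrightarrow> on2 (prod_fun F G) (pair \<tau> \<sigma>) = pair (on2 F \<tau>) (on2 G \<sigma>)"
  by (simp_all add: prod_fun_def Let_def)

lemma prod_fun_in:
  fixes F G :: "'u tfun"
  assumes "two_category A" "two_category B" and F: "F \<in> Fun A A'" and G: "G \<in> Fun B B'"
    and "two_category A'" "two_category B'"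
  shows "prod_fun F G \<in> Fun (prod_cat A B) (prod_cat A' B')"
proof -
  interpret A: two_category A by fact
  interpret B: two_category B by fact
  interpret A': two_category A' by fact
  interpret B': two_category B' by fact
  note [simp] = Fun_simps[OF F] Fun_simps[OF G]
  show ?thesis
    by (rule FunI) (auto elim!: prod_catE, auto simp: prod_fun_def Let_def)
qed

lemma cellwise_sel [simp]:
  "Dom (cellwise A B h) = A" "Cod (cellwise A B h) = B"
  "x \<in> Ob A \<Longrightarrow> on0 (cellwise A B h) x = h x" "f \<in> Ar A \<Longrightarrow> on1 (cellwise A B h) f = h f"
  "\<tau> \<in> Tw A \<Longrightarrow> on2 (cellwise A B h) \<tau> = h \<tau>"
  by (simp_all add: cellwise_def)

lemma cellwise_ext [simp]:
  "on0 (cellwise A B h) \<in> extensional (Ob A)" "on1 (cellwise A B h) \<in> extensional (Ar A)"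
  "on2 (cellwise A B h) \<in> extensional (Tw A)"
  by (simp_all add: cellwise_def)

lemma one_cat_sel [simp]:
  "x \<in> Ob one_cat \<longleftrightarrow> x = undefined" "x \<in> Ar one_cat \<longleftrightarrow> x = undefined" "x \<in> Tw one_cat \<longleftrightarrow> x = undefined"
  "src1 one_cat x = undefined" "tgt1 one_cat x = undefined" "id1 one_cat x = undefined"
  "comp1 one_cat x y = undefined" "src2 one_cat x = undefined" "tgt2 one_cat x = undefined"
  "id2 one_cat x = undefined" "vcomp one_cat x y = undefined" "hcomp one_cat x y = undefined"
  by (simp_all add: one_cat_def trim_def)

lemma two_category_one_cat [simp]: "two_category (one_cat :: 'u tcat)"
  unfolding one_cat_def by (rule two_category_trimI) simp_all

lemma one_cat_Obj [simp]: "one_cat \<in> Obj (TwoCat :: ('u tcat, 'u tfun) category)"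
proof -
  have "Ob one_cat = {undefined :: 'u}" "Ar one_cat = {undefined :: 'u}" "Tw one_cat = {undefined :: 'u}"
    by auto
  then show ?thesis by (simp add: TwoCat_def small_def finite_lt)
qed

lemma proj_in:
  fixes A B :: "'u tcat"
  assumes "two_category A" "two_category B"
  shows "proj1 A B \<in> Fun (prod_cat A B) A" "proj2 A B \<in> Fun (prod_cat A B) B"
proof -
  interpret A: two_category A by fact
  interpret B: two_category B by fact
  show "proj1 A B \<in> Fun (prod_cat A B) A" "proj2 A B \<in> Fun (prod_cat A B) B"
    unfolding proj1_def proj2_def by (rule FunI; (simp; fail | auto elim!: prod_catE))+
qed

text \<open>The projections are jointly monic; symmetries will be compared in this way.\<close>

lemma prod_cat_eqI:
  fixes A B :: "'u tcat"
  assumes "two_category A" "two_category B" and F: "F \<in> Fun X (prod_cat A B)" and G: "G \<in> Fun X (prod_cat A B)"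
    and e: "proj1 A B \<bullet> F = proj1 A B \<bullet> G" "proj2 A B \<bullet> F = proj2 A B \<bullet> G"
  shows "F = G"
proof (rule Fun_eqI[OF F G])
  have D: "Dom F = X" "Dom G = X" using F G by (auto simp: Fun_Dom)
  have eq: "z = z'" if "z \<in> pairs S T" "z' \<in> pairs S' T'" "pfst z = pfst z'" "psnd z = psnd z'" for z z' :: 'u and S T S' T'
    using that by (auto simp: pairs_def)
  fix x assume x: "x \<in> Ob X"
  have "on0 F x \<in> Ob (prod_cat A B)" "on0 G x \<in> Ob (prod_cat A B)" using x F G by (auto simp: Fun_on)
  then show "on0 F x = on0 G x"
    using arg_cong[OF e(1), of "\<lambda>H. on0 H x"] arg_cong[OF e(2), of "\<lambda>H. on0 H x"] x D
    by (auto simp: proj1_def proj2_def elim!: prod_catE)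
next
  have D: "Dom F = X" "Dom G = X" using F G by (auto simp: Fun_Dom)
  fix x assume x: "x \<in> Ar X"
  have "on1 F x \<in> Ar (prod_cat A B)" "on1 G x \<in> Ar (prod_cat A B)" using x F G by (auto simp: Fun_on)
  then show "on1 F x = on1 G x"
    using arg_cong[OF e(1), of "\<lambda>H. on1 H x"] arg_cong[OF e(2), of "\<lambda>H. on1 H x"] x D
    by (auto simp: proj1_def proj2_def elim!: prod_catE)
next
  have D: "Dom F = X" "Dom G = X" using F G by (auto simp: Fun_Dom)
  fix x assume x: "x \<in> Tw X"
  have "on2 F x \<in> Tw (prod_cat A B)" "on2 G x \<in> Tw (prod_cat A B)" using x F G by (auto simp: Fun_on)
  then show "on2 F x = on2 G x"
    using arg_cong[OF e(1), of "\<lambda>H. on2 H x"] arg_cong[OF e(2), of "\<lambda>H. on2 H x"] x D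
    by (auto simp: proj1_def proj2_def elim!: prod_catE)
qed

lemma iso_inI:
  assumes "F \<in> Fun A B" "G \<in> Fun B A" "G \<bullet> F = fid A" "F \<bullet> G = fid B"
  shows "iso_in TwoCat A B F"
  using assms by (auto simp: iso_in_def)

lemma prod_fun_fid: "prod_fun (fid A) (fid B) = fid (prod_cat A (B :: 'u tcat))"
  unfolding prod_fun_def fid_def Let_def
  by (auto simp: fun_eq_iff restrict_def elim!: prod_catE)

lemma prod_fun_fcomp:
  fixes F F' G G' :: "'u tfun"
  assumes two: "two_category A" "two_category A'" "two_category A''" "two_category B" "two_category B'" "two_category B''"
    and F: "F \<in> Fun A A'" and F': "F' \<in> Fun A' A''" and G: "G \<in> Fun B B'" and G': "G' \<in> Fun B' B''"
  shows "prod_fun (F' \<bullet> F) (G' \<bullet> G) = prod_fun F' G' \<bullet> prod_fun F G"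
proof -
  note P = prod_fun_in[OF two(1,4) F G two(2,5)] prod_fun_in[OF two(2,5) F' G' two(3,6)]
    prod_fun_in[OF two(1,4) fcomp_in[OF two(1) F F'] fcomp_in[OF two(4) G G'] two(3,6)]
  note [simp] = Fun_simps[OF F] Fun_simps[OF F'] Fun_simps[OF G] Fun_simps[OF G']
  show ?thesis
    by (rule Fun_eqI[OF P(3) fcomp_in[OF two_category_prod_cat[OF two(1,4)] P(1,2)]])
      (auto elim!: prod_catE)
qed

section \<open>Coherence of the cartesian product\<close>

lemma assoc_cell_in:
  fixes A B C :: "'u tcat"
  assumes "two_category A" "two_category B" "two_category C"
  shows "cellwise (prod_cat (prod_cat A B) C) (prod_cat A (prod_cat B C))
      (\<lambda>z. pair (pfst (pfst z)) (pair (psnd (pfst z)) (psnd z))) \<in> Fun (prod_cat (prod_cat A B) C) (prod_cat A (prod_cat B C))"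
    "cellwise (prod_cat A (prod_cat B C)) (prod_cat (prod_cat A B) C)
      (\<lambda>z. pair (pair (pfst z) (pfst (psnd z))) (psnd (psnd z))) \<in> Fun (prod_cat A (prod_cat B C)) (prod_cat (prod_cat A B) C)"
proof -
  interpret A: two_category A by fact
  interpret B: two_category B by fact
  interpret C: two_category C by fact
  interpret AB: two_category "prod_cat A B" by (rule two_category_prod_cat) fact+
  interpret BC: two_category "prod_cat B C" by (rule two_category_prod_cat) fact+
  show "cellwise (prod_cat (prod_cat A B) C) (prod_cat A (prod_cat B C))
      (\<lambda>z. pair (pfst (pfst z)) (pair (psnd (pfst z)) (psnd z))) \<in> Fun (prod_cat (prod_cat A B) C) (prod_cat A (prod_cat B C))"
    by (rule FunI; (simp; fail | auto elim!: prod_catE))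
  show "cellwise (prod_cat A (prod_cat B C)) (prod_cat (prod_cat A B) C)
      (\<lambda>z. pair (pair (pfst z) (pfst (psnd z))) (psnd (psnd z))) \<in> Fun (prod_cat A (prod_cat B C)) (prod_cat (prod_cat A B) C)"
    by (rule FunI; (simp; fail | auto elim!: prod_catE))
qed

lemma swap_cell_in:
  fixes A B :: "'u tcat"
  assumes "two_category A" "two_category B"
  shows "cellwise (prod_cat A B) (prod_cat B A) (\<lambda>z. pair (psnd z) (pfst z)) \<in> Fun (prod_cat A B) (prod_cat B A)"
proof -
  interpret A: two_category A by fact
  interpret B: two_category B by fact
  show ?thesis by (rule FunI; (simp; fail | auto elim!: prod_catE))
qed

lemma unit_cell_in:
  fixes A :: "'u tcat"
  assumes "two_category A"
  shows "cellwise A (prod_cat one_cat A) (\<lambda>z. pair undefined z) \<in> Fun A (prod_cat one_cat A)"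
   "cellwise A (prod_cat A one_cat) (\<lambda>z. pair z undefined) \<in> Fun A (prod_cat A one_cat)"
   "cellwise (prod_cat one_cat A) A psnd \<in> Fun (prod_cat one_cat A) A"
   "cellwise (prod_cat A one_cat) A pfst \<in> Fun (prod_cat A one_cat) A"
proof -
  interpret A: two_category A by fact
  interpret U: two_category "one_cat :: 'u tcat" by simp
  show "cellwise A (prod_cat one_cat A) (\<lambda>z. pair undefined z) \<in> Fun A (prod_cat one_cat A)"
   "cellwise A (prod_cat A one_cat) (\<lambda>z. pair z undefined) \<in> Fun A (prod_cat A one_cat)"
   "cellwise (prod_cat one_cat A) A psnd \<in> Fun (prod_cat one_cat A) A"
   "cellwise (prod_cat A one_cat) A pfst \<in> Fun (prod_cat A one_cat) A"
    by (rule FunI; (simp; fail | auto elim!: prod_catE))+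
qed

lemma cartesian_sel [simp]:
  "tens0 cartesian = prod_cat" "tens1 cartesian = prod_fun" "unit_ob cartesian = one_cat"
  "assoc_map cartesian = (\<lambda>A B C. cellwise (prod_cat (prod_cat A B) C) (prod_cat A (prod_cat B C))
                   (\<lambda>z. pair (pfst (pfst z)) (pair (psnd (pfst z)) (psnd z))))"
  "lunit_map cartesian = (\<lambda>A. cellwise (prod_cat one_cat A) A psnd)"
  "runit_map cartesian = (\<lambda>A. cellwise (prod_cat A one_cat) A pfst)"
  "symm_map cartesian = (\<lambda>A B. cellwise (prod_cat A B) (prod_cat B A) (\<lambda>z. pair (psnd z) (pfst z)))"
  by (simp_all add: cartesian_def)

lemma iso_inI':
  assumes "two_category A" "two_category B" "F \<in> Fun A B" "G \<in> Fun B A"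
    "\<And>x. x \<in> Ob A \<Longrightarrow> on0 G (on0 F x) = x" "\<And>x. x \<in> Ar A \<Longrightarrow> on1 G (on1 F x) = x" "\<And>x. x \<in> Tw A \<Longrightarrow> on2 G (on2 F x) = x"
    "\<And>x. x \<in> Ob B \<Longrightarrow> on0 F (on0 G x) = x" "\<And>x. x \<in> Ar B \<Longrightarrow> on1 F (on1 G x) = x" "\<And>x. x \<in> Tw B \<Longrightarrow> on2 F (on2 G x) = x"
  shows "iso_in TwoCat A B F"
proof (rule iso_inI[OF assms(3,4)])
  note [simp] = Fun_simps(1,2)[OF assms(3)] Fun_simps(1,2)[OF assms(4)]
  show "G \<bullet> F = fid A"
    by (rule Fun_eqI[OF fcomp_in[OF assms(1,3,4)] fid_in[OF assms(1)]]) (simp_all add: assms)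
  show "F \<bullet> G = fid B"
    by (rule Fun_eqI[OF fcomp_in[OF assms(2,4,3)] fid_in[OF assms(2)]]) (simp_all add: assms)
qed

text \<open>The coherence maps only rearrange nested pairs, so each law becomes an identity of pairs
  once the two 2-categories between which its sides run have been named.\<close>

lemma symmetric_monoidal_cartesian: "symmetric_monoidal (TwoCat :: ('u tcat, 'u tfun) category) cartesian"
proof -
  note T = two_category_Obj and P = two_category_prod_cat and c = fcomp_in and p = prod_fun_in
    and m = assoc_cell_in swap_cell_in unit_cell_in and i = fid_in
  show ?thesis
  proof (unfold_locales, goal_cases)
    case 1
    show ?case
      unfolding bifunctor_def cartesian_sel TwoCat_simps
    proof (intro conjI ballI)
      fix A A' A'' B B' B'' :: "'u tcat" and f f' g g' :: "'u tfun"
      assume "A \<in> Obj TwoCat" "A' \<in> Obj TwoCat" "A'' \<in> Obj TwoCat" "B \<in> Obj TwoCat" "B' \<in> Obj TwoCat" "B'' \<in> Obj TwoCat"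
      note T6 = this[THEN T]
      assume "f \<in> Fun A A'" "f' \<in> Fun A' A''" "g \<in> Fun B B'" "g' \<in> Fun B' B''"
      then show "prod_fun (f' \<bullet> f) (g' \<bullet> g) = prod_fun f' g' \<bullet> prod_fun f g"
        by (rule prod_fun_fcomp[OF T6])
    qed (simp_all add: prod_cat_Obj prod_fun_fid prod_fun_in T)
  next
    case 2
    show ?case by simp
  next
    case (3 X Y Z)
    note tt = 3[THEN T]
    note [simp] = tt P
    show ?case unfolding cartesian_sel
      by (rule iso_inI'[OF _ _ assoc_cell_in(1) assoc_cell_in(2)]) (simp; fail | auto elim!: prod_catE)+
  next
    case (4 X Y Z X' Y' Z' f g h)
    note tt = 4(1-6)[THEN T]
    note [simp] = tt P
    from 4 have f: "f \<in> Fun X X'" by simp_all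
    from 4 have g: "g \<in> Fun Y Y'" by simp_all
    from 4 have h: "h \<in> Fun Z Z'" by simp_all
    note [simp] = Fun_simps[OF f] Fun_simps[OF g] Fun_simps[OF h]
    show ?case unfolding cartesian_sel TwoCat_simps
      apply (rule Fun_eqI[where A = "prod_cat (prod_cat X Y) Z" and B = "prod_cat X' (prod_cat Y' Z')"])
          apply (rule c p i m P two_category_one_cat tt f g h)+
      by (auto elim!: prod_catE)
  next
    case (5 X)
    note tt = 5[THEN T]
    note [simp] = tt P
    show ?case unfolding cartesian_sel
      by (rule iso_inI'[OF _ _ unit_cell_in(3) unit_cell_in(1)]) (simp; fail | auto elim!: prod_catE)+
  next
    case (6 X Y f)
    note tt = 6(1,2)[THEN T]
    note [simp] = tt P
    from 6 have f: "f \<in> Fun X Y" by simp_all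
    note [simp] = Fun_simps[OF f]
    show ?case unfolding cartesian_sel TwoCat_simps
      apply (rule Fun_eqI[where A = "prod_cat one_cat X" and B = "Y"])
          apply (rule c p i m P two_category_one_cat tt f)+
      by (auto elim!: prod_catE)
  next
    case (7 X)
    note tt = 7[THEN T]
    note [simp] = tt P
    show ?case unfolding cartesian_sel
      by (rule iso_inI'[OF _ _ unit_cell_in(4) unit_cell_in(2)]) (simp; fail | auto elim!: prod_catE)+
  next
    case (8 X Y f)
    note tt = 8(1,2)[THEN T]
    note [simp] = tt P
    from 8 have f: "f \<in> Fun X Y" by simp_all
    note [simp] = Fun_simps[OF f]
    show ?case unfolding cartesian_sel TwoCat_simps
      apply (rule Fun_eqI[where A = "prod_cat X one_cat" and B = "Y"])
          apply (rule c p i m P two_category_one_cat tt f)+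
      by (auto elim!: prod_catE)
  next
    case (9 X Y)
    note tt = 9[THEN T]
    note [simp] = tt P
    show ?case unfolding cartesian_sel
      by (rule iso_inI'[OF _ _ swap_cell_in swap_cell_in]) (simp; fail | auto elim!: prod_catE)+
  next
    case (10 X Y X' Y' f g)
    note tt = 10(1-4)[THEN T]
    note [simp] = tt P
    from 10 have f: "f \<in> Fun X X'" by simp_all
    from 10 have g: "g \<in> Fun Y Y'" by simp_all
    note [simp] = Fun_simps[OF f] Fun_simps[OF g]
    show ?case unfolding cartesian_sel TwoCat_simps
      apply (rule Fun_eqI[where A = "prod_cat X Y" and B = "prod_cat Y' X'"])
          apply (rule c p i m P two_category_one_cat tt f g)+
      by (auto elim!: prod_catE)
  next
    case (11 W X Y Z)
    note tt = 11[THEN T]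
    note [simp] = tt P
    show ?case unfolding cartesian_sel TwoCat_simps
      apply (rule Fun_eqI[where A = "prod_cat (prod_cat (prod_cat W X) Y) Z" and B = "prod_cat W (prod_cat X (prod_cat Y Z))"])
          apply (rule c p i m P two_category_one_cat tt)+
      by (auto elim!: prod_catE)
  next
    case (12 X Y)
    note tt = 12[THEN T]
    note [simp] = tt P
    show ?case unfolding cartesian_sel TwoCat_simps
      apply (rule Fun_eqI[where A = "prod_cat (prod_cat X one_cat) Y" and B = "prod_cat X Y"])
          apply (rule c p i m P two_category_one_cat tt)+
      by (auto elim!: prod_catE)
  next
    case (13 X Y Z)
    note tt = 13[THEN T]
    note [simp] = tt P
    show ?case unfolding cartesian_sel TwoCat_simps
      apply (rule Fun_eqI[where A = "prod_cat (prod_cat X Y) Z" and B = "prod_cat Y (prod_cat Z X)"])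
          apply (rule c p i m P two_category_one_cat tt)+
      by (auto elim!: prod_catE)
  next
    case (14 X Y)
    note tt = 14[THEN T]
    note [simp] = tt P
    show ?case unfolding cartesian_sel TwoCat_simps
      apply (rule Fun_eqI[where A = "prod_cat X Y" and B = "prod_cat X Y"])
          apply (rule c p i m P two_category_one_cat tt)+
      by (auto elim!: prod_catE)
  qed
qed

end

section \<open>The funny tensor product\<close>

text \<open>\<open>disc\<close> is defined only for 2-categories whose three kinds of cells share
  one type, so its rules live in this instance of \<open>two_category\<close>.\<close>

locale ucat = two_category C for C :: "'u tcat"
begin

lemma disc_mem:
  "Ob (disc C) = Ob C" "f \<in> Ar (disc C) \<longleftrightarrow> f \<in> id1 C ` Ob C"
  "\<tau> \<in> Tw (disc C) \<longleftrightarrow> \<tau> \<in> (\<lambda>x. id2 C (id1 C x)) ` Ob C"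
  by (simp_all add: disc_def)

lemma disc_simps [simp]:
  "Ob (disc C) = Ob C" "x \<in> Ob C \<Longrightarrow> id1 C x \<in> Ar (disc C)" "x \<in> Ob C \<Longrightarrow> id2 C (id1 C x) \<in> Tw (disc C)"
  "x \<in> Ob C \<Longrightarrow> src1 (disc C) (id1 C x) = x" "x \<in> Ob C \<Longrightarrow> tgt1 (disc C) (id1 C x) = x"
  "x \<in> Ob C \<Longrightarrow> id1 (disc C) x = id1 C x"
  "x \<in> Ob C \<Longrightarrow> comp1 (disc C) (id1 C x) (id1 C x) = id1 C x"
  "x \<in> Ob C \<Longrightarrow> src2 (disc C) (id2 C (id1 C x)) = id1 C x"
  "x \<in> Ob C \<Longrightarrow> tgt2 (disc C) (id2 C (id1 C x)) = id1 C x"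
  "x \<in> Ob C \<Longrightarrow> id2 (disc C) (id1 C x) = id2 C (id1 C x)"
  "x \<in> Ob C \<Longrightarrow> vcomp (disc C) (id2 C (id1 C x)) (id2 C (id1 C x)) = id2 C (id1 C x)"
  "x \<in> Ob C \<Longrightarrow> hcomp (disc C) (id2 C (id1 C x)) (id2 C (id1 C x)) = id2 C (id1 C x)"
  by (simp_all add: disc_def trim_def)

lemma id1_eq_iff [simp]: "x \<in> Ob C \<Longrightarrow> y \<in> Ob C \<Longrightarrow> id1 C x = id1 C y \<longleftrightarrow> x = y"
  by (metis id1_simps(2))

lemma id2_eq_iff [simp]: "f \<in> Ar C \<Longrightarrow> g \<in> Ar C \<Longrightarrow> id2 C f = id2 C g \<longleftrightarrow> f = g"
  by (metis id2_simps(2))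

lemma discE:
  "f \<in> Ar (disc C) \<Longrightarrow> (\<And>x. x \<in> Ob C \<Longrightarrow> f = id1 C x \<Longrightarrow> thesis) \<Longrightarrow> thesis"
  "\<tau> \<in> Tw (disc C) \<Longrightarrow> (\<And>x. x \<in> Ob C \<Longrightarrow> \<tau> = id2 C (id1 C x) \<Longrightarrow> thesis) \<Longrightarrow> thesis"
  by (auto simp: disc_mem)

lemma two_category_disc [simp]: "two_category (disc C)"
  unfolding disc_def by (rule two_category_trimI) auto

lemma incl_in: "incl C \<in> Fun (disc C) C"
  unfolding incl_def by (rule FunI; (simp add: cellwise_def; fail | auto simp: cellwise_def elim!: discE))

end

lemma two_category_disc': "two_category C \<Longrightarrow> two_category (disc C)"
  by (rule ucat.two_category_disc) (simp add: ucat_def)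

lemma Ob_disc: "Ob (disc C) = Ob C"
  by (simp add: disc_def)

section \<open>2-functors on a product with a discrete factor\<close>

definition secL :: "'u tcat \<Rightarrow> 'u tcat \<Rightarrow> 'u \<Rightarrow> 'u tfun" where
  "secL A B b = \<lparr>Dom = A, Cod = prod_cat A B, on0 = (\<lambda>a \<in> Ob A. pair a b),
     on1 = (\<lambda>f \<in> Ar A. pair f (id1 B b)), on2 = (\<lambda>\<tau> \<in> Tw A. pair \<tau> (id2 B (id1 B b)))\<rparr>"

definition secR :: "'u tcat \<Rightarrow> 'u tcat \<Rightarrow> 'u \<Rightarrow> 'u tfun" where
  "secR A B a = \<lparr>Dom = B, Cod = prod_cat A B, on0 = (\<lambda>b \<in> Ob B. pair a b),
     on1 = (\<lambda>g \<in> Ar B. pair (id1 A a) g), on2 = (\<lambda>\<tau> \<in> Tw B. pair (id2 A (id1 A a)) \<tau>)\<rparr>"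

text \<open>A 2-functor out of \<open>A \<times> ob B\<close> is a family of 2-functors out of \<open>A\<close> indexed by the objects of
  \<open>B\<close>, read off from the identities in the second component.\<close>

definition glueL :: "'u tcat \<Rightarrow> 'u tcat \<Rightarrow> 'u tcat \<Rightarrow> ('u \<Rightarrow> 'u tfun) \<Rightarrow> 'u tfun" where
  "glueL A B C LF = \<lparr>Dom = prod_cat A (disc B), Cod = C,
     on0 = (\<lambda>z \<in> Ob (prod_cat A (disc B)). on0 (LF (psnd z)) (pfst z)),
     on1 = (\<lambda>z \<in> Ar (prod_cat A (disc B)). on1 (LF (src1 B (psnd z))) (pfst z)),
     on2 = (\<lambda>z \<in> Tw (prod_cat A (disc B)). on2 (LF (src1 B (src2 B (psnd z)))) (pfst z))\<rparr>"

definition glueR :: "'u tcat \<Rightarrow> 'u tcat \<Rightarrow> 'u tcat \<Rightarrow> ('u \<Rightarrow> 'u tfun) \<Rightarrow> 'u tfun" where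
  "glueR A B C RF = \<lparr>Dom = prod_cat (disc A) B, Cod = C,
     on0 = (\<lambda>z \<in> Ob (prod_cat (disc A) B). on0 (RF (pfst z)) (psnd z)),
     on1 = (\<lambda>z \<in> Ar (prod_cat (disc A) B). on1 (RF (src1 A (pfst z))) (psnd z)),
     on2 = (\<lambda>z \<in> Tw (prod_cat (disc A) B). on2 (RF (src1 A (src2 A (pfst z)))) (psnd z))\<rparr>"

context univ begin

lemma sec_sel [simp]:
  "Dom (secL A B b) = A" "Cod (secL A B b) = prod_cat A B" "a \<in> Ob A \<Longrightarrow> on0 (secL A B b) a = pair a b"
  "f \<in> Ar A \<Longrightarrow> on1 (secL A B b) f = pair f (id1 B b)" "\<tau> \<in> Tw A \<Longrightarrow> on2 (secL A B b) \<tau> = pair \<tau> (id2 B (id1 B b))"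
  "Dom (secR A B a) = B" "Cod (secR A B a) = prod_cat A B" "b \<in> Ob B \<Longrightarrow> on0 (secR A B a) b = pair a b"
  "g \<in> Ar B \<Longrightarrow> on1 (secR A B a) g = pair (id1 A a) g" "\<sigma> \<in> Tw B \<Longrightarrow> on2 (secR A B a) \<sigma> = pair (id2 A (id1 A a)) \<sigma>"
  by (simp_all add: secL_def secR_def)

lemma sec_in:
  fixes A B :: "'u tcat"
  assumes "two_category A" "two_category B"
  shows "b \<in> Ob B \<Longrightarrow> secL A B b \<in> Fun A (prod_cat A B)" "a \<in> Ob A \<Longrightarrow> secR A B a \<in> Fun B (prod_cat A B)"
proof -
  interpret A: ucat A using assms by (simp add: ucat_def)
  interpret B: ucat B using assms by (simp add: ucat_def)
  show "b \<in> Ob B \<Longrightarrow> secL A B b \<in> Fun A (prod_cat A B)" "a \<in> Ob A \<Longrightarrow> secR A B a \<in> Fun B (prod_cat A B)"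
    by (rule FunI; (simp; fail | simp add: secL_def secR_def))+
qed

lemma glueL_in:
  fixes A B C :: "'u tcat"
  assumes "two_category A" "two_category B" "two_category C" and LF: "\<And>b. b \<in> Ob B \<Longrightarrow> LF b \<in> Fun A C"
  shows "glueL A B C LF \<in> Fun (prod_cat A (disc B)) C"
    "b \<in> Ob B \<Longrightarrow> glueL A B C LF \<bullet> secL A (disc B) b = LF b"
proof -
  interpret A: ucat A using assms by (simp add: ucat_def)
  interpret B: ucat B using assms by (simp add: ucat_def)
  interpret C: two_category C by fact
  note [simp] = Fun_simps[OF LF]
  show "glueL A B C LF \<in> Fun (prod_cat A (disc B)) C"
    by (rule FunI; (simp add: glueL_def; fail | auto simp: glueL_def elim!: prod_catE B.discE))
  then show "b \<in> Ob B \<Longrightarrow> glueL A B C LF \<bullet> secL A (disc B) b = LF b"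
    by (intro Fun_eqI[OF fcomp_in[OF assms(1) sec_in(1)[OF assms(1)]] LF]; simp add: glueL_def)
qed

lemma glueR_in:
  fixes A B C :: "'u tcat"
  assumes "two_category A" "two_category B" "two_category C" and RF: "\<And>a. a \<in> Ob A \<Longrightarrow> RF a \<in> Fun B C"
  shows "glueR A B C RF \<in> Fun (prod_cat (disc A) B) C"
    "a \<in> Ob A \<Longrightarrow> glueR A B C RF \<bullet> secR (disc A) B a = RF a"
proof -
  interpret A: ucat A using assms by (simp add: ucat_def)
  interpret B: ucat B using assms by (simp add: ucat_def)
  interpret C: two_category C by fact
  note [simp] = Fun_simps[OF RF]
  show "glueR A B C RF \<in> Fun (prod_cat (disc A) B) C"
    by (rule FunI; (simp add: glueR_def; fail | auto simp: glueR_def elim!: prod_catE A.discE))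
  then show "a \<in> Ob A \<Longrightarrow> glueR A B C RF \<bullet> secR (disc A) B a = RF a"
    by (intro Fun_eqI[OF fcomp_in[OF assms(2) sec_in(2)[OF _ assms(2)]] RF]; simp add: glueR_def)
qed

text \<open>The cells of \<open>disc B\<close> are identities, so every cell of the product lies on
  the copy of A at some object b.\<close>

lemma prod_discR_eqI:
  fixes A B C :: "'u tcat"
  assumes "two_category A" "two_category B" and F: "F \<in> Fun (prod_cat A (disc B)) C" and G: "G \<in> Fun (prod_cat A (disc B)) C"
    and eq: "\<And>b. b \<in> Ob B \<Longrightarrow> F \<bullet> secL A (disc B) b = G \<bullet> secL A (disc B) b"
  shows "F = G"
proof -
  interpret A: ucat A using assms by (simp add: ucat_def)
  interpret B: ucat B using assms by (simp add: ucat_def)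
  have "on0 F (pair a b) = on0 G (pair a b)" if "a \<in> Ob A" "b \<in> Ob B" for a b
    using arg_cong[OF eq[OF that(2)], of "\<lambda>H. on0 H a"] that by simp
  moreover have "on1 F (pair a (id1 B b)) = on1 G (pair a (id1 B b))" if "a \<in> Ar A" "b \<in> Ob B" for a b
    using arg_cong[OF eq[OF that(2)], of "\<lambda>H. on1 H a"] that by simp
  moreover have "on2 F (pair a (id2 B (id1 B b))) = on2 G (pair a (id2 B (id1 B b)))" if "a \<in> Tw A" "b \<in> Ob B" for a b
    using arg_cong[OF eq[OF that(2)], of "\<lambda>H. on2 H a"] that by simp
  ultimately show ?thesis by (intro Fun_eqI[OF F G]) (auto elim!: prod_catE B.discE)
qed

lemma prod_discL_eqI:
  fixes A B C :: "'u tcat"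
  assumes "two_category A" "two_category B" and F: "F \<in> Fun (prod_cat (disc A) B) C" and G: "G \<in> Fun (prod_cat (disc A) B) C"
    and eq: "\<And>a. a \<in> Ob A \<Longrightarrow> F \<bullet> secR (disc A) B a = G \<bullet> secR (disc A) B a"
  shows "F = G"
proof -
  interpret A: ucat A using assms by (simp add: ucat_def)
  interpret B: ucat B using assms by (simp add: ucat_def)
  have "on0 F (pair a b) = on0 G (pair a b)" if "a \<in> Ob A" "b \<in> Ob B" for a b
    using arg_cong[OF eq[OF that(1)], of "\<lambda>H. on0 H b"] that by simp
  moreover have "on1 F (pair (id1 A a) b) = on1 G (pair (id1 A a) b)" if "a \<in> Ob A" "b \<in> Ar B" for a b
    using arg_cong[OF eq[OF that(1)], of "\<lambda>H. on1 H b"] that by simp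
  moreover have "on2 F (pair (id2 A (id1 A a)) b) = on2 G (pair (id2 A (id1 A a)) b)" if "a \<in> Ob A" "b \<in> Tw B" for a b
    using arg_cong[OF eq[OF that(1)], of "\<lambda>H. on2 H b"] that by simp
  ultimately show ?thesis by (intro Fun_eqI[OF F G]) (auto elim!: prod_catE A.discE)
qed

lemma disc_fun_in:
  fixes A A' :: "'u tcat"
  assumes "two_category A" "two_category A'" and F: "F \<in> Fun A A'"
  shows "disc_fun F \<in> Fun (disc A) (disc A')"
proof -
  interpret A: ucat A using assms by (simp add: ucat_def)
  interpret A': ucat A' using assms by (simp add: ucat_def)
  note [simp] = Fun_simps[OF F]
  show ?thesis by (rule FunI; (simp add: disc_fun_def Let_def; fail | auto simp: disc_fun_def Let_def elim!: A.discE))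
qed

lemma prod_fun_sec:
  fixes A A' B B' :: "'u tcat"
  assumes "two_category A" "two_category A'" "two_category B" "two_category B'" and F: "F \<in> Fun A A'" and G: "G \<in> Fun B B'"
  shows "b \<in> Ob B \<Longrightarrow> prod_fun F G \<bullet> secL A B b = secL A' B' (on0 G b) \<bullet> F"
    "a \<in> Ob A \<Longrightarrow> prod_fun F G \<bullet> secR A B a = secR A' B' (on0 F a) \<bullet> G"
proof -
  interpret A: ucat A using assms by (simp add: ucat_def)
  interpret B: ucat B using assms by (simp add: ucat_def)
  note [simp] = Fun_simps[OF F] Fun_simps[OF G]
  note P = prod_fun_in[OF assms(1,3) F G assms(2,4)]
  show "b \<in> Ob B \<Longrightarrow> prod_fun F G \<bullet> secL A B b = secL A' B' (on0 G b) \<bullet> F"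
    by (rule Fun_eqI[OF fcomp_in[OF assms(1) sec_in(1)[OF assms(1,3)] P] fcomp_in[OF assms(1) F sec_in(1)[OF assms(2,4)]]])
      simp_all
  show "a \<in> Ob A \<Longrightarrow> prod_fun F G \<bullet> secR A B a = secR A' B' (on0 F a) \<bullet> G"
    by (rule Fun_eqI[OF fcomp_in[OF assms(3) sec_in(2)[OF assms(1,3)] P] fcomp_in[OF assms(3) G sec_in(2)[OF assms(2,4)]]])
      simp_all
qed

end

section \<open>The universal property of A \<star> B\<close>

locale funny = univ "TYPE('u)" + funny_tensor st0 st1 \<iota>1 \<iota>2
  for st0 :: "'u tcat \<Rightarrow> 'u tcat \<Rightarrow> 'u tcat" and st1 :: "'u tfun \<Rightarrow> 'u tfun \<Rightarrow> 'u tfun"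
    and \<iota>1 \<iota>2 :: "'u tcat \<Rightarrow> 'u tcat \<Rightarrow> 'u tfun"
begin

text \<open>The copies of A and of B inside A \<star> B, one for each object of the other factor.
  They correspond to \<open>gL\<close> and \<open>gR\<close> under P.\<close>

definition "iL A B b = \<iota>1 A B \<bullet> secL A (disc B) b"
definition "iR A B a = \<iota>2 A B \<bullet> secR (disc A) B a"

context
  fixes A B :: "'u tcat" assumes A: "A \<in> Obj TwoCat" and B: "B \<in> Obj TwoCat"
begin

interpretation A: ucat A using two_category_Obj[OF A] by (simp add: ucat_def)
interpretation B: ucat B using two_category_Obj[OF B] by (simp add: ucat_def)

lemma st0_Obj: "st0 A B \<in> Obj TwoCat"
  and \<iota>_in: "\<iota>1 A B \<in> Fun (prod_cat A (disc B)) (st0 A B)" "\<iota>2 A B \<in> Fun (prod_cat (disc A) B) (st0 A B)"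
  and \<iota>_eq: "\<iota>2 A B \<bullet> prod_fun (fid (disc A)) (incl B) = \<iota>1 A B \<bullet> prod_fun (incl A) (fid (disc B))"
  and \<iota>_univ: "\<lbrakk>(C :: 'u tcat) \<in> Obj TwoCat; U \<in> Fun (prod_cat A (disc B)) C; V \<in> Fun (prod_cat (disc A) B) C;
    V \<bullet> prod_fun (fid (disc A)) (incl B) = U \<bullet> prod_fun (incl A) (fid (disc B))\<rbrakk> \<Longrightarrow>
    \<exists>!W. W \<in> Fun (st0 A B) C \<and> W \<bullet> \<iota>2 A B = V \<and> W \<bullet> \<iota>1 A B = U"
  using pushout[OF A B] unfolding is_pushout_def TwoCat_simps by blast+

lemma i_in: "b \<in> Ob B \<Longrightarrow> iL A B b \<in> Fun A (st0 A B)" "a \<in> Ob A \<Longrightarrow> iR A B a \<in> Fun B (st0 A B)"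
  unfolding iL_def iR_def
  using fcomp_in[OF A.two_category_axioms sec_in(1)[OF A.two_category_axioms B.two_category_disc] \<iota>_in(1)]
   fcomp_in[OF B.two_category_axioms sec_in(2)[OF A.two_category_disc B.two_category_axioms] \<iota>_in(2)] by simp_all

lemma i_on0: "a \<in> Ob A \<Longrightarrow> b \<in> Ob B \<Longrightarrow> on0 (iL A B b) a = on0 (iR A B a) b"
  using arg_cong[OF \<iota>_eq, of "\<lambda>H. on0 H (pair a b)"]
  by (simp add: iL_def iR_def Fun_simps[OF A.incl_in] Fun_simps[OF B.incl_in], simp add: incl_def)

text \<open>The apex of the pushout is ob A x ob B, all of whose 1-cells and 2-cells are identities,
  so a cocone amounts to two families that agree on objects.\<close>

lemma f_ex:
  fixes C :: "'u tcat"
  assumes C: "C \<in> Obj TwoCat" and LF: "\<And>b. b \<in> Ob B \<Longrightarrow> LF b \<in> Fun A C" and RF: "\<And>a. a \<in> Ob A \<Longrightarrow> RF a \<in> Fun B C"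
    and eq: "\<And>a b. a \<in> Ob A \<Longrightarrow> b \<in> Ob B \<Longrightarrow> on0 (LF b) a = on0 (RF a) b"
  obtains W where "W \<in> Fun (st0 A B) C" "\<And>b. b \<in> Ob B \<Longrightarrow> W \<bullet> iL A B b = LF b" "\<And>a. a \<in> Ob A \<Longrightarrow> W \<bullet> iR A B a = RF a"
proof -
  interpret C: two_category C by (rule two_category_Obj[OF C])
  note U = glueL_in[OF A.two_category_axioms B.two_category_axioms C.two_category_axioms LF]
   and V = glueR_in[OF A.two_category_axioms B.two_category_axioms C.two_category_axioms RF]
  note [simp] = Fun_simps[OF LF] Fun_simps[OF RF]
  have D: "two_category (prod_cat (disc A) (disc B))" by (simp add: two_category_prod_cat)
  have "glueR A B C RF \<bullet> prod_fun (fid (disc A)) (incl B) = glueL A B C LF \<bullet> prod_fun (incl A) (fid (disc B))"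
    by (rule Fun_eqI[OF fcomp_in[OF D prod_fun_in V(1)] fcomp_in[OF D prod_fun_in U(1)]])
      (auto intro!: A.incl_in B.incl_in fid_in A.two_category_axioms B.two_category_axioms
        simp: Fun_simps[OF A.incl_in] Fun_simps[OF B.incl_in] elim!: prod_catE A.discE B.discE,
       auto simp: incl_def glueL_def glueR_def eq)
  from \<iota>_univ[OF C U(1) V(1) this] obtain W where W: "W \<in> Fun (st0 A B) C"
    "W \<bullet> \<iota>2 A B = glueR A B C RF" "W \<bullet> \<iota>1 A B = glueL A B C LF" by auto
  show ?thesis
  proof (rule that[OF W(1)])
    show "W \<bullet> iL A B b = LF b" if "b \<in> Ob B" for b
      unfolding iL_def using U(2)[OF _ that] W(3) that
      by (subst fcomp_assoc[OF sec_in(1)[OF A.two_category_axioms B.two_category_disc], symmetric]) (simp_all add: Fun_simps[OF \<iota>_in(1)])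
    show "W \<bullet> iR A B a = RF a" if "a \<in> Ob A" for a
      unfolding iR_def using V(2)[OF _ that] W(2) that
      by (subst fcomp_assoc[OF sec_in(2)[OF A.two_category_disc B.two_category_axioms], symmetric]) (simp_all add: Fun_simps[OF \<iota>_in(2)])
  qed
qed

lemma f_unique:
  fixes C :: "'u tcat"
  assumes C: "C \<in> Obj TwoCat" and W: "W \<in> Fun (st0 A B) C" and W': "W' \<in> Fun (st0 A B) C"
    and eqL: "\<And>b. b \<in> Ob B \<Longrightarrow> W \<bullet> iL A B b = W' \<bullet> iL A B b" and eqR: "\<And>a. a \<in> Ob A \<Longrightarrow> W \<bullet> iR A B a = W' \<bullet> iR A B a"
  shows "W = W'"
proof -
  note AB = A.two_category_axioms B.two_category_axioms
  note DD = two_category_prod_cat[OF AB(1) B.two_category_disc] two_category_prod_cat[OF A.two_category_disc AB(2)]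
  note c = fcomp_in[OF DD(1) \<iota>_in(1)] fcomp_in[OF DD(2) \<iota>_in(2)]
  have 1: "W \<bullet> \<iota>1 A B = W' \<bullet> \<iota>1 A B"
    by (rule prod_discR_eqI[OF AB c(1)[OF W] c(1)[OF W']])
     (use eqL in \<open>simp add: iL_def fcomp_assoc[OF sec_in(1)[OF AB(1) B.two_category_disc]] Fun_simps[OF \<iota>_in(1)]\<close>)
  have 2: "W \<bullet> \<iota>2 A B = W' \<bullet> \<iota>2 A B"
    by (rule prod_discL_eqI[OF AB c(2)[OF W] c(2)[OF W']])
     (use eqR in \<open>simp add: iR_def fcomp_assoc[OF sec_in(2)[OF A.two_category_disc AB(2)]] Fun_simps[OF \<iota>_in(2)]\<close>)
  have "(W \<bullet> \<iota>2 A B) \<bullet> prod_fun (fid (disc A)) (incl B) = (W \<bullet> \<iota>1 A B) \<bullet> prod_fun (incl A) (fid (disc B))"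
    by (subst fcomp_assoc[OF prod_fun_in[OF A.two_category_disc B.two_category_disc fid_in B.incl_in]],
        (simp add: Fun_simps[OF \<iota>_in(2)] AB)+,
        subst fcomp_assoc[OF prod_fun_in[OF A.two_category_disc B.two_category_disc A.incl_in fid_in]])
      (simp_all add: Fun_simps[OF \<iota>_in(1)] AB \<iota>_eq)
  from \<iota>_univ[OF C c(1)[OF W] c(2)[OF W] this] W W' 1 2 show ?thesis by metis
qed

end

text \<open>The counterpart of \<open>g1_on\<close>. On objects \<open>disc_fun\<close> acts as the
  2-functor that it restricts, which is why the copies are reindexed by \<open>on0\<close>.\<close>

lemma st1_on:
  assumes A: "A \<in> Obj TwoCat" and B: "B \<in> Obj TwoCat" and A': "A' \<in> Obj TwoCat" and B': "B' \<in> Obj TwoCat"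
    and F: "F \<in> Fun A A'" and G: "G \<in> Fun B B'"
  shows "b \<in> Ob B \<Longrightarrow> st1 F G \<bullet> iL A B b = iL A' B' (on0 G b) \<bullet> F"
    "a \<in> Ob A \<Longrightarrow> st1 F G \<bullet> iR A B a = iR A' B' (on0 F a) \<bullet> G"
proof -
  note two = A[THEN two_category_Obj] B[THEN two_category_Obj] A'[THEN two_category_Obj] B'[THEN two_category_Obj]
  note d = two[THEN two_category_disc']
  note on = Fun_simps[OF F] Fun_simps[OF G]
  have dG: "on0 (disc_fun G) b = on0 G b" if "b \<in> Ob B" for b
    using that by (simp add: disc_fun_def Let_def on Ob_disc)
  have dF: "on0 (disc_fun F) b = on0 F b" if "b \<in> Ob A" for b
    using that by (simp add: disc_fun_def Let_def on Ob_disc)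
  note Ob = Ob_disc
  show "st1 F G \<bullet> iL A B b = iL A' B' (on0 G b) \<bullet> F" if b: "b \<in> Ob B"
  proof -
    have b': "b \<in> Ob (disc B)" "on0 G b \<in> Ob (disc B')" using b by (simp_all add: Ob on)
    have "st1 F G \<bullet> iL A B b = (st1 F G \<bullet> \<iota>1 A B) \<bullet> secL A (disc B) b"
      unfolding iL_def by (rule fcomp_assoc[symmetric, OF sec_in(1)[OF two(1) d(2) b'(1)] Fun_Dom[OF \<iota>_in(1)[OF A B]]])
    also have "\<dots> = (\<iota>1 A' B' \<bullet> prod_fun F (disc_fun G)) \<bullet> secL A (disc B) b"
      by (simp add: st1_\<iota>1[OF A B A' B' F G])
    also have "\<dots> = \<iota>1 A' B' \<bullet> prod_fun F (disc_fun G) \<bullet> secL A (disc B) b"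
      by (rule fcomp_assoc[OF sec_in(1)[OF two(1) d(2) b'(1)]])
        (simp add: Fun_simps[OF F] Fun_simps[OF disc_fun_in[OF two(2,4) G]])
    also have "prod_fun F (disc_fun G) \<bullet> secL A (disc B) b = secL A' (disc B') (on0 G b) \<bullet> F"
      using prod_fun_sec(1)[OF two(1,3) d(2,4) F disc_fun_in[OF two(2,4) G] b'(1)] dG[OF b] by simp
    also have "\<iota>1 A' B' \<bullet> secL A' (disc B') (on0 G b) \<bullet> F = iL A' B' (on0 G b) \<bullet> F"
      unfolding iL_def by (rule fcomp_assoc[symmetric, OF F]) simp
    finally show ?thesis .
  qed
  show "st1 F G \<bullet> iR A B a = iR A' B' (on0 F a) \<bullet> G" if a: "a \<in> Ob A"
  proof -
    have a': "a \<in> Ob (disc A)" "on0 F a \<in> Ob (disc A')" using a by (simp_all add: Ob on)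
    have "st1 F G \<bullet> iR A B a = (st1 F G \<bullet> \<iota>2 A B) \<bullet> secR (disc A) B a"
      unfolding iR_def by (rule fcomp_assoc[symmetric, OF sec_in(2)[OF d(1) two(2) a'(1)] Fun_Dom[OF \<iota>_in(2)[OF A B]]])
    also have "\<dots> = (\<iota>2 A' B' \<bullet> prod_fun (disc_fun F) G) \<bullet> secR (disc A) B a"
      by (simp add: st1_\<iota>2[OF A B A' B' F G])
    also have "\<dots> = \<iota>2 A' B' \<bullet> prod_fun (disc_fun F) G \<bullet> secR (disc A) B a"
      by (rule fcomp_assoc[OF sec_in(2)[OF d(1) two(2) a'(1)]])
        (simp add: Fun_simps[OF G] Fun_simps[OF disc_fun_in[OF two(1,3) F]])
    also have "prod_fun (disc_fun F) G \<bullet> secR (disc A) B a = secR (disc A') B' (on0 F a) \<bullet> G"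
      using prod_fun_sec(2)[OF d(1,3) two(2,4) disc_fun_in[OF two(1,3) F] G a'(1)] dF[OF a] by simp
    also have "\<iota>2 A' B' \<bullet> secR (disc A') B' (on0 F a) \<bullet> G = iR A' B' (on0 F a) \<bullet> G"
      unfolding iR_def by (rule fcomp_assoc[symmetric, OF G]) simp
    finally show ?thesis .
  qed
qed

end

section \<open>The factorisation system of boba and lff 2-functors\<close>

lemma lff_bij:
  assumes G: "G \<in> Fun X Y" and "lff G" and X: "two_category X"
    and "f \<in> Ar X" "g \<in> Ar X" "src1 X f = src1 X g" "tgt1 X f = tgt1 X g"
  shows "bij_betw (on2 G) (hom2 X f g) (hom2 Y (on1 G f) (on1 G g))"
proof -
  interpret two_category X by fact
  have "f \<in> hom1 X (src1 X f) (tgt1 X f)" "g \<in> hom1 X (src1 X f) (tgt1 X f)" "src1 X f \<in> Ob X" "tgt1 X f \<in> Ob X"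
    using assms(4-) by (auto simp: hom1_def)
  then show ?thesis
    using assms(2) unfolding lff_def Fun_Dom[OF G] Fun_Cod[OF G] by blast
qed

lemma lff_inj:
  assumes G: "G \<in> Fun X Y" and "lff G" and X: "two_category X"
    and "\<tau> \<in> Tw X" "\<sigma> \<in> Tw X" "src2 X \<tau> = src2 X \<sigma>" "tgt2 X \<tau> = tgt2 X \<sigma>" "on2 G \<tau> = on2 G \<sigma>"
  shows "\<tau> = \<sigma>"
proof -
  interpret two_category X by fact
  have "inj_on (on2 G) (hom2 X (src2 X \<sigma>) (tgt2 X \<sigma>))"
    using lff_bij[OF G assms(2) X, of "src2 X \<sigma>" "tgt2 X \<sigma>"] assms(5) by (simp add: bij_betw_def)
  then show ?thesis using assms(4-) by (auto simp: hom2_def inj_on_def)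
qed

lemma lff_ex:
  assumes G: "G \<in> Fun X Y" and "lff G" and X: "two_category X"
    and "f \<in> Ar X" "g \<in> Ar X" "src1 X f = src1 X g" "tgt1 X f = tgt1 X g"
    and "\<rho> \<in> Tw Y" "src2 Y \<rho> = on1 G f" "tgt2 Y \<rho> = on1 G g"
  obtains \<tau> where "\<tau> \<in> Tw X" "src2 X \<tau> = f" "tgt2 X \<tau> = g" "on2 G \<tau> = \<rho>"
proof -
  interpret two_category X by fact
  have "on2 G ` hom2 X f g = hom2 Y (on1 G f) (on1 G g)"
    using lff_bij[OF assms(1-7)] by (simp add: bij_betw_def)
  moreover have "\<rho> \<in> hom2 Y (on1 G f) (on1 G g)" using assms(8-) by (simp add: hom2_def)
  ultimately obtain \<tau> where "\<tau> \<in> hom2 X f g" "\<rho> = on2 G \<tau>" by (metis imageE)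
  then show ?thesis using that[of \<tau>] by (simp add: hom2_def)
qed

lemma lffI:
  assumes G: "G \<in> Fun X Y" and X: "two_category X"
    and inj: "\<And>\<tau> \<sigma>. \<lbrakk>\<tau> \<in> Tw X; \<sigma> \<in> Tw X; src2 X \<tau> = src2 X \<sigma>; tgt2 X \<tau> = tgt2 X \<sigma>; on2 G \<tau> = on2 G \<sigma>\<rbrakk> \<Longrightarrow> \<tau> = \<sigma>"
    and ex: "\<And>f g \<rho>. \<lbrakk>f \<in> Ar X; g \<in> Ar X; src1 X f = src1 X g; tgt1 X f = tgt1 X g; \<rho> \<in> Tw Y;
      src2 Y \<rho> = on1 G f; tgt2 Y \<rho> = on1 G g\<rbrakk> \<Longrightarrow> \<exists>\<tau>. \<tau> \<in> Tw X \<and> src2 X \<tau> = f \<and> tgt2 X \<tau> = g \<and> on2 G \<tau> = \<rho>"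
  shows "lff G"
  unfolding lff_def Fun_Dom[OF G] Fun_Cod[OF G]
proof (intro ballI)
  fix x y f g assume fg: "f \<in> hom1 X x y" "g \<in> hom1 X x y"
  show "bij_betw (on2 G) (hom2 X f g) (hom2 Y (on1 G f) (on1 G g))"
    unfolding bij_betw_def
  proof
    show "inj_on (on2 G) (hom2 X f g)"
      by (rule inj_onI) (auto simp: hom2_def intro: inj)
    show "on2 G ` hom2 X f g = hom2 Y (on1 G f) (on1 G g)"
      using ex[of f g] fg by (auto simp: hom2_def hom1_def Fun_simps[OF G] image_iff)
  qed
qed

lemma bobaD:
  assumes F: "F \<in> Fun A B" and "boba F"
  shows "bij_betw (on0 F) (Ob A) (Ob B)" "bij_betw (on1 F) (Ar A) (Ar B)"
  using assms(2) Fun_Dom[OF F] Fun_Cod[OF F] by (auto simp: boba_def)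

text \<open>Every 1-cell of B comes from A, where the first equation decides. A 2-cell is then
  caught between fixed 1-cells, and G is faithful on those.\<close>

lemma boba_lff_unique:
  assumes two: "two_category A" "two_category B" "two_category X" "two_category Y"
    and F: "F \<in> Fun A B" "boba F" and G: "G \<in> Fun X Y" "lff G"
    and W: "W \<in> Fun B X" and W': "W' \<in> Fun B X" and e: "W \<bullet> F = W' \<bullet> F" "G \<bullet> W = G \<bullet> W'"
  shows "W = W'"
proof -
  interpret B: two_category B by fact
  have 1: "on1 W f = on1 W' f" if f: "f \<in> Ar B" for f
  proof -
    obtain f0 where f0: "f0 \<in> Ar A" "f = on1 F f0"
      using bobaD(2)[OF F] f by (auto simp: bij_betw_def)
    then show ?thesis using arg_cong[OF e(1), of "\<lambda>H. on1 H f0"] Fun_Dom[OF F(1)] by simp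
  qed
  show ?thesis
  proof (rule Fun_eqI_Tw[OF W W' two(2,3)])
    fix \<tau> assume t: "\<tau> \<in> Tw B"
    show "on2 W \<tau> = on2 W' \<tau>"
      by (rule lff_inj[OF G two(3)])
        (use t arg_cong[OF e(2), of "\<lambda>H. on2 H \<tau>"] in \<open>simp_all add: Fun_simps[OF W] Fun_simps[OF W'] 1\<close>)
  qed
qed

text \<open>On objects and 1-cells the filler is U transported along the inverse of F. On a 2-cell
  it is the unique lift along G with the resulting boundaries, and the laws for 2-cells are checked
  after applying G.\<close>

lemma boba_lff_filler:
  assumes two: "two_category A" "two_category B" "two_category X" "two_category Y"
    and F: "F \<in> Fun A B" "boba F" and G: "G \<in> Fun X Y" "lff G"
    and U: "U \<in> Fun A X" and V: "V \<in> Fun B Y" and sq: "G \<bullet> U = V \<bullet> F"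
  obtains W where "W \<in> Fun B X" "W \<bullet> F = U" "G \<bullet> W = V"
proof -
  interpret A: two_category A by fact
  interpret B: two_category B by fact
  interpret X: two_category X by fact
  interpret Y: two_category Y by fact
  note on = Fun_simps[OF F(1)] Fun_simps[OF G(1)] Fun_simps[OF U] Fun_simps[OF V]
  note [simp] = on
  define i0 where "i0 = inv_into (Ob A) (on0 F)"
  define i1 where "i1 = inv_into (Ar A) (on1 F)"
  note b0 = bobaD(1)[OF F] and b1 = bobaD(2)[OF F]
  have i0 [simp]: "y \<in> Ob B \<Longrightarrow> i0 y \<in> Ob A" "y \<in> Ob B \<Longrightarrow> on0 F (i0 y) = y" "x \<in> Ob A \<Longrightarrow> i0 (on0 F x) = x" for x y
    using b0 by (auto simp: i0_def bij_betw_def inv_into_into f_inv_into_f inv_into_f_f)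
  have i1 [simp]: "y \<in> Ar B \<Longrightarrow> i1 y \<in> Ar A" "y \<in> Ar B \<Longrightarrow> on1 F (i1 y) = y" "x \<in> Ar A \<Longrightarrow> i1 (on1 F x) = x" for x y
    using b1 by (auto simp: i1_def bij_betw_def inv_into_into f_inv_into_f inv_into_f_f)
  have inj0: "x = y" if "x \<in> Ob A" "y \<in> Ob A" "on0 F x = on0 F y" for x y
    using b0 that by (auto simp: bij_betw_def inj_on_def)
  have inj1: "x = y" if "x \<in> Ar A" "y \<in> Ar A" "on1 F x = on1 F y" for x y
    using b1 that by (auto simp: bij_betw_def inj_on_def)
  have [simp]: "src1 A (i1 f) = i0 (src1 B f)" "tgt1 A (i1 f) = i0 (tgt1 B f)" if "f \<in> Ar B" for f
    using that Fun_on(4,5)[OF F(1), of "i1 f"] by (auto intro!: inj0)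
  have [simp]: "i1 (id1 B y) = id1 A (i0 y)" if "y \<in> Ob B" for y
    using that by (auto intro!: inj1)
  have [simp]: "i1 (comp1 B g f) = comp1 A (i1 g) (i1 f)" if "g \<in> Ar B" "f \<in> Ar B" "src1 B g = tgt1 B f" for g f
    using that by (auto intro!: inj1)
  have sq1: "on1 G (on1 U f) = on1 V (on1 F f)" if "f \<in> Ar A" for f
    using arg_cong[OF sq, of "\<lambda>H. on1 H f"] that by simp
  have sq0: "on0 G (on0 U f) = on0 V (on0 F f)" if "f \<in> Ob A" for f
    using arg_cong[OF sq, of "\<lambda>H. on0 H f"] that by simp
  have sq2: "on2 G (on2 U f) = on2 V (on2 F f)" if "f \<in> Tw A" for f
    using arg_cong[OF sq, of "\<lambda>H. on2 H f"] that by simp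
  have ex: "\<exists>\<rho>. \<rho> \<in> Tw X \<and> src2 X \<rho> = on1 U (i1 (src2 B \<tau>)) \<and> tgt2 X \<rho> = on1 U (i1 (tgt2 B \<tau>)) \<and> on2 G \<rho> = on2 V \<tau>"
    if "\<tau> \<in> Tw B" for \<tau>
    by (rule lff_ex[OF G two(3), of "on1 U (i1 (src2 B \<tau>))" "on1 U (i1 (tgt2 B \<tau>))" "on2 V \<tau>"])
      (use that in \<open>auto simp: sq1\<close>)
  define w where "w = (\<lambda>\<tau>. SOME \<rho>. \<rho> \<in> Tw X \<and> src2 X \<rho> = on1 U (i1 (src2 B \<tau>)) \<and> tgt2 X \<rho> = on1 U (i1 (tgt2 B \<tau>)) \<and> on2 G \<rho> = on2 V \<tau>)"
  have w [simp]: "w \<tau> \<in> Tw X" "src2 X (w \<tau>) = on1 U (i1 (src2 B \<tau>))" "tgt2 X (w \<tau>) = on1 U (i1 (tgt2 B \<tau>))" "on2 G (w \<tau>) = on2 V \<tau>"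
    if "\<tau> \<in> Tw B" for \<tau>
    using someI_ex[OF ex[OF that]] unfolding w_def by blast+
  note inj2 = lff_inj[OF G two(3)]
  define W where "W = \<lparr>Dom = B, Cod = X, on0 = (\<lambda>y \<in> Ob B. on0 U (i0 y)), on1 = (\<lambda>f \<in> Ar B. on1 U (i1 f)), on2 = restrict w (Tw B)\<rparr>"
  have W: "W \<in> Fun B X"
  proof (rule FunI, goal_cases)
    case 14
    then show ?case by (auto simp: W_def sq1 intro!: inj2)
  next
    case 16
    then show ?case by (auto simp: W_def intro!: inj2)
  next
    case 17
    then show ?case by (auto simp: W_def intro!: inj2)
  qed (simp_all add: W_def)
  have 1: "W \<bullet> F = U"
    by (rule Fun_eqI[OF fcomp_in[OF two(1) F(1) W] U]) (auto simp: W_def sq2 intro!: inj2)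
  have 2: "G \<bullet> W = V"
    by (rule Fun_eqI[OF fcomp_in[OF two(2) W G(1)] V]) (auto simp: W_def sq1 sq0 Fun_simps(1)[OF W])
  show ?thesis by (rule that[OF W 1 2])
qed

text \<open>A 2-category over \<open>B\<close> with prescribed objects and 1-cells; a 2-cell from \<open>f\<close> to \<open>g\<close> is a 2-cell
  \<open>\<tau>\<close> of \<open>B\<close> between their images with \<open>R f g \<tau>\<close>, encoded as the triple \<open>(f, g, \<tau>)\<close>.\<close>

locale over_cat = univ "TYPE('u)" + B: two_category B for B :: "'u tcat" +
  fixes D :: "'u tcat" and p0 p1 :: "'u \<Rightarrow> 'u" and R :: "'u \<Rightarrow> 'u \<Rightarrow> 'u \<Rightarrow> bool"
  assumes D1: "f \<in> Ar D \<Longrightarrow> src1 D f \<in> Ob D" "f \<in> Ar D \<Longrightarrow> tgt1 D f \<in> Ob D"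
    "x \<in> Ob D \<Longrightarrow> id1 D x \<in> Ar D" "x \<in> Ob D \<Longrightarrow> src1 D (id1 D x) = x" "x \<in> Ob D \<Longrightarrow> tgt1 D (id1 D x) = x"
    and D2: "\<lbrakk>g \<in> Ar D; f \<in> Ar D; src1 D g = tgt1 D f\<rbrakk> \<Longrightarrow> comp1 D g f \<in> Ar D"
    "\<lbrakk>g \<in> Ar D; f \<in> Ar D; src1 D g = tgt1 D f\<rbrakk> \<Longrightarrow> src1 D (comp1 D g f) = src1 D f"
    "\<lbrakk>g \<in> Ar D; f \<in> Ar D; src1 D g = tgt1 D f\<rbrakk> \<Longrightarrow> tgt1 D (comp1 D g f) = tgt1 D g"
    and D_id: "f \<in> Ar D \<Longrightarrow> comp1 D f (id1 D (src1 D f)) = f" "f \<in> Ar D \<Longrightarrow> comp1 D (id1 D (tgt1 D f)) f = f"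
    and D_assoc: "\<lbrakk>h \<in> Ar D; g \<in> Ar D; f \<in> Ar D; src1 D h = tgt1 D g; src1 D g = tgt1 D f\<rbrakk> \<Longrightarrow>
      comp1 D h (comp1 D g f) = comp1 D (comp1 D h g) f"
    and p: "x \<in> Ob D \<Longrightarrow> p0 x \<in> Ob B" "f \<in> Ar D \<Longrightarrow> p1 f \<in> Ar B"
    "f \<in> Ar D \<Longrightarrow> src1 B (p1 f) = p0 (src1 D f)" "f \<in> Ar D \<Longrightarrow> tgt1 B (p1 f) = p0 (tgt1 D f)"
    "x \<in> Ob D \<Longrightarrow> p1 (id1 D x) = id1 B (p0 x)"
    "\<lbrakk>g \<in> Ar D; f \<in> Ar D; src1 D g = tgt1 D f\<rbrakk> \<Longrightarrow> p1 (comp1 D g f) = comp1 B (p1 g) (p1 f)"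
    and R_id: "f \<in> Ar D \<Longrightarrow> R f f (id2 B (p1 f))"
    and R_vcomp: "\<lbrakk>f \<in> Ar D; g \<in> Ar D; h \<in> Ar D; src1 D f = src1 D g; src1 D g = src1 D h; tgt1 D f = tgt1 D g;
      tgt1 D g = tgt1 D h; \<sigma> \<in> Tw B; \<tau> \<in> Tw B; src2 B \<sigma> = p1 f; tgt2 B \<sigma> = p1 g; src2 B \<tau> = p1 g;
      tgt2 B \<tau> = p1 h; R f g \<sigma>; R g h \<tau>\<rbrakk> \<Longrightarrow> R f h (vcomp B \<tau> \<sigma>)"
    and R_hcomp: "\<lbrakk>f \<in> Ar D; g \<in> Ar D; f' \<in> Ar D; g' \<in> Ar D; src1 D f = src1 D g; tgt1 D f = tgt1 D g;
      src1 D f' = src1 D g'; tgt1 D f' = tgt1 D g'; src1 D f' = tgt1 D f; \<sigma> \<in> Tw B; \<tau> \<in> Tw B;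
      src2 B \<sigma> = p1 f; tgt2 B \<sigma> = p1 g; src2 B \<tau> = p1 f'; tgt2 B \<tau> = p1 g'; R f g \<sigma>; R f' g' \<tau>\<rbrakk> \<Longrightarrow>
      R (comp1 D f' f) (comp1 D g' g) (hcomp B \<tau> \<sigma>)"
begin

text \<open>The boundary is stored with the 2-cell, because one 2-cell of B may lie under several
  pairs of 1-cells.\<close>

definition tri :: "'u \<Rightarrow> 'u \<Rightarrow> 'u \<Rightarrow> 'u" where "tri f g \<tau> = pair f (pair g \<tau>)"

definition mid :: "'u \<Rightarrow> 'u" where "mid z = pfst (psnd z)"
definition lst :: "'u \<Rightarrow> 'u" where "lst z = psnd (psnd z)"

lemma tri_simps [simp]: "pfst (tri f g \<tau>) = f" "mid (tri f g \<tau>) = g" "lst (tri f g \<tau>) = \<tau>"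
  "tri f g \<tau> = tri f' g' \<tau>' \<longleftrightarrow> f = f' \<and> g = g' \<and> \<tau> = \<tau>'"
  by (auto simp: tri_def mid_def lst_def)

definition cells where
  "cells = {tri f g \<tau> | f g \<tau>. f \<in> Ar D \<and> g \<in> Ar D \<and> src1 D f = src1 D g \<and> tgt1 D f = tgt1 D g \<and>
    \<tau> \<in> Tw B \<and> src2 B \<tau> = p1 f \<and> tgt2 B \<tau> = p1 g \<and> R f g \<tau>}"

definition E :: "'u tcat" where
  "E = trim (D \<lparr>Tw := cells, src2 := pfst, tgt2 := mid, id2 := (\<lambda>f. tri f f (id2 B (p1 f))),
    vcomp := (\<lambda>\<tau> \<sigma>. tri (pfst \<sigma>) (mid \<tau>) (vcomp B (lst \<tau>) (lst \<sigma>))),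
    hcomp := (\<lambda>\<tau> \<sigma>. tri (comp1 D (pfst \<tau>) (pfst \<sigma>)) (comp1 D (mid \<tau>) (mid \<sigma>)) (hcomp B (lst \<tau>) (lst \<sigma>)))\<rparr>)"

lemma cellsI: "\<lbrakk>f \<in> Ar D; g \<in> Ar D; src1 D f = src1 D g; tgt1 D f = tgt1 D g; \<tau> \<in> Tw B; src2 B \<tau> = p1 f;
    tgt2 B \<tau> = p1 g; R f g \<tau>\<rbrakk> \<Longrightarrow> tri f g \<tau> \<in> cells"
  by (auto simp: cells_def)

lemma cellsE:
  assumes "z \<in> cells"
  obtains f g \<tau> where "z = tri f g \<tau>" "f \<in> Ar D" "g \<in> Ar D" "src1 D f = src1 D g" "tgt1 D f = tgt1 D g"
    "\<tau> \<in> Tw B" "src2 B \<tau> = p1 f" "tgt2 B \<tau> = p1 g" "R f g \<tau>"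
  using assms by (auto simp: cells_def)

lemma cellsD:
  assumes "z \<in> cells"
  shows "pfst z \<in> Ar D" "mid z \<in> Ar D" "src1 D (mid z) = src1 D (pfst z)" "tgt1 D (mid z) = tgt1 D (pfst z)"
    "lst z \<in> Tw B" "src2 B (lst z) = p1 (pfst z)" "tgt2 B (lst z) = p1 (mid z)" "R (pfst z) (mid z) (lst z)"
    "tri (pfst z) (mid z) (lst z) = z"
  using assms by (auto elim!: cellsE)

lemma cells_eqI: "z \<in> cells \<Longrightarrow> z' \<in> cells \<Longrightarrow> pfst z = pfst z' \<Longrightarrow> mid z = mid z' \<Longrightarrow> lst z = lst z' \<Longrightarrow> z = z'"
  by (auto elim!: cellsE)

lemma two_category_E: "two_category E"
proof -
  note c = cellsD
  have bd: "src1 D (pfst \<tau>') = src1 D (pfst \<tau>)" "tgt1 D (pfst \<tau>') = tgt1 D (pfst \<tau>)"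
    if "\<tau> \<in> cells" "pfst \<tau>' = mid \<tau>" for \<tau> \<tau>'
    using that c by simp_all
  have ids: "comp1 D f (id1 D x) = f" if "f \<in> Ar D" "src1 D f = x" for f x
    using D_id(1) that by auto
  have ids': "comp1 D (id1 D x) f = f" if "f \<in> Ar D" "tgt1 D f = x" for f x
    using D_id(2) that by auto
  show ?thesis
    unfolding E_def
  proof (rule two_category_trimI, goal_cases)
    case (19 \<tau> \<sigma>)
    then show ?case using bd[of \<sigma> \<tau>] c(8)[of \<tau>]
      by (auto intro!: cellsI R_vcomp[of "pfst \<sigma>" "mid \<sigma>" "mid \<tau>"] simp: c)
  next
    case (25 \<tau> \<sigma>)
    then show ?case by (auto intro!: cellsI R_hcomp simp: c D2 p)
  next
    case (32 \<tau>' \<tau> \<sigma>' \<sigma>)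
    then show ?case using bd[of \<sigma> \<sigma>'] bd[of \<tau> \<tau>'] by (simp add: c p B.interchange')
  qed (simp_all add: D1 D2 ids ids' D_assoc c p R_id cellsI)
qed

lemma E_simps [simp]:
  "Ob E = Ob D" "Ar E = Ar D" "Tw E = cells"
  "f \<in> Ar D \<Longrightarrow> src1 E f = src1 D f" "f \<in> Ar D \<Longrightarrow> tgt1 E f = tgt1 D f" "x \<in> Ob D \<Longrightarrow> id1 E x = id1 D x"
  "\<lbrakk>g \<in> Ar D; f \<in> Ar D; src1 D g = tgt1 D f\<rbrakk> \<Longrightarrow> comp1 E g f = comp1 D g f"
  "\<tau> \<in> cells \<Longrightarrow> src2 E \<tau> = pfst \<tau>" "\<tau> \<in> cells \<Longrightarrow> tgt2 E \<tau> = mid \<tau>"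
  "f \<in> Ar D \<Longrightarrow> id2 E f = tri f f (id2 B (p1 f))"
  "\<lbrakk>\<tau> \<in> cells; \<sigma> \<in> cells; pfst \<tau> = mid \<sigma>\<rbrakk> \<Longrightarrow> vcomp E \<tau> \<sigma> = tri (pfst \<sigma>) (mid \<tau>) (vcomp B (lst \<tau>) (lst \<sigma>))"
  "\<lbrakk>\<tau> \<in> cells; \<sigma> \<in> cells; src1 D (pfst \<tau>) = tgt1 D (pfst \<sigma>)\<rbrakk> \<Longrightarrow>
    hcomp E \<tau> \<sigma> = tri (comp1 D (pfst \<tau>) (pfst \<sigma>)) (comp1 D (mid \<tau>) (mid \<sigma>)) (hcomp B (lst \<tau>) (lst \<sigma>))"
  by (simp_all add: E_def trim_def cellsD)

lemma E_Obj:
  assumes "B \<in> Obj TwoCat" "small (Ob D)" "small (Ar D)"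
  shows "E \<in> Obj TwoCat"
proof -
  have "cells \<subseteq> pairs (Ar D) (pairs (Ar D) (Tw B))"
    by (auto simp: cells_def tri_def)
  moreover have "small (pairs (Ar D) (pairs (Ar D) (Tw B)))"
    using assms by (intro small_pairs) (simp_all add: TwoCat_def)
  ultimately have "small cells" using subset_lt unfolding small_def by blast
  then show ?thesis using assms(2,3) by (simp add: TwoCat_def two_category_E)
qed

definition V :: "'u tfun" where
  "V = \<lparr>Dom = E, Cod = B, on0 = restrict p0 (Ob D), on1 = restrict p1 (Ar D), on2 = restrict lst cells\<rparr>"

lemma V_sel [simp]: "Dom V = E" "Cod V = B" "x \<in> Ob D \<Longrightarrow> on0 V x = p0 x" "f \<in> Ar D \<Longrightarrow> on1 V f = p1 f"
  "z \<in> cells \<Longrightarrow> on2 V z = lst z"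
  by (simp_all add: V_def)

lemma V_in: "V \<in> Fun E B"
proof -
  interpret E: two_category E by (rule two_category_E)
  \<comment> \<open>Closure of the triples under both compositions is read off from \<open>E\<close>
    being a 2-category.\<close>
  have cl: "g \<in> cells \<Longrightarrow> f \<in> cells \<Longrightarrow> pfst g = mid f \<Longrightarrow> tri (pfst f) (mid g) (vcomp B (lst g) (lst f)) \<in> cells"
    "g \<in> cells \<Longrightarrow> f \<in> cells \<Longrightarrow> src1 D (pfst g) = tgt1 D (pfst f) \<Longrightarrow>
      tri (comp1 D (pfst g) (pfst f)) (comp1 D (mid g) (mid f)) (hcomp B (lst g) (lst f)) \<in> cells" for g f
    using E.vcomp_simps(1)[of g f] E.hcomp_simps(1)[of g f] by (simp_all add: cellsD)
  show ?thesis
    by (rule FunI; (simp add: D1 D2 p cellsD R_id cellsI cl; fail | simp add: V_def))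
qed

end

text \<open>Objects and 1-cells are kept from A, and the 2-cells are all those of B between the
  images; this is \<open>over_cat\<close> with the condition on 2-cells always true.\<close>

lemma (in univ) factorisation:
  fixes F :: "'u tfun"
  assumes A: "A \<in> Obj TwoCat" and B: "B \<in> Obj TwoCat" and F: "F \<in> Fun A B"
  obtains E :: "'u tcat" and I V :: "'u tfun" where "E \<in> Obj TwoCat" "I \<in> Fun A E" "boba I" "V \<in> Fun E B" "lff V" "V \<bullet> I = F"
proof -
  interpret A: two_category A by (rule two_category_Obj[OF A])
  interpret B: two_category B by (rule two_category_Obj[OF B])
  note [simp] = Fun_simps[OF F]
  interpret over_cat B A "on0 F" "on1 F" "\<lambda>_ _ _. True"
    by unfold_locales (use universe in \<open>simp_all add: universe_def\<close>)
  have EO: "E \<in> Obj TwoCat" using A by (intro E_Obj[OF B]) (simp_all add: TwoCat_def)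
  define I where "I = \<lparr>Dom = A, Cod = E, on0 = (\<lambda>x \<in> Ob A. x), on1 = (\<lambda>f \<in> Ar A. f),
    on2 = (\<lambda>\<tau> \<in> Tw A. tri (src2 A \<tau>) (tgt2 A \<tau>) (on2 F \<tau>))\<rparr>"
  have [simp]: "tri f (tgt2 A \<tau>) (on2 F \<tau>) \<in> cells" if "\<tau> \<in> Tw A" "src2 A \<tau> = f" for \<tau> f
    using that by (intro cellsI) auto
  have I: "I \<in> Fun A E"
    by (rule FunI; simp add: I_def)
  have "boba I" by (simp add: boba_def I_def bij_betw_def inj_on_def)
  moreover have "lff V"
  proof (rule lffI[OF V_in two_category_E])
    fix f g \<rho> assume "f \<in> Ar E" "g \<in> Ar E" "src1 E f = src1 E g" "tgt1 E f = tgt1 E g" "\<rho> \<in> Tw B"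
      "src2 B \<rho> = on1 V f" "tgt2 B \<rho> = on1 V g"
    then show "\<exists>\<tau>. \<tau> \<in> Tw E \<and> src2 E \<tau> = f \<and> tgt2 E \<tau> = g \<and> on2 V \<tau> = \<rho>"
      using cellsI[of f g \<rho>] by (intro exI[of _ "tri f g \<rho>"]) simp
  qed (auto intro: cells_eqI)
  moreover have "V \<bullet> I = F"
    by (rule Fun_eqI[OF fcomp_in[OF A.two_category_axioms I V_in] F]) (simp_all add: I_def)
  ultimately show ?thesis using that EO I V_in by blast
qed

text \<open>Existence of fillers against lff 2-functors between small 2-categories. The test objects
  are restricted to small ones because the universal properties of the tensors speak only of
  these.\<close>

definition lorth :: "'u tfun \<Rightarrow> bool" where
  "lorth F \<longleftrightarrow> (\<forall>X \<in> (Obj TwoCat :: 'u tcat set). \<forall>Y \<in> (Obj TwoCat :: 'u tcat set). \<forall>G \<in> Fun X Y. \<forall>U \<in> Fun (Dom F) X. \<forall>V \<in> Fun (Cod F) Y.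
     lff G \<longrightarrow> G \<bullet> U = V \<bullet> F \<longrightarrow> (\<exists>W \<in> Fun (Cod F) X. W \<bullet> F = U \<and> G \<bullet> W = V))"

text \<open>Factor F as I followed by V, with I boba and V lff. A filler W with WF = I and VW = 1
  also satisfies WV = 1, because WV and 1 agree after I and before V. So V is bijective on objects
  and 1-cells, and F with it. This characterises boba 2-functors without access to the cells of
  their codomain.\<close>

lemma (in univ) lorth_imp_boba:
  fixes F :: "'u tfun"
  assumes A: "A \<in> Obj TwoCat" and B: "B \<in> Obj TwoCat" and F: "F \<in> Fun A B" and "lorth F"
  shows "boba F"
proof -
  note two = two_category_Obj[OF A] two_category_Obj[OF B]
  obtain E :: "'u tcat" and I V :: "'u tfun" where E: "E \<in> Obj TwoCat" "I \<in> Fun A E" "boba I" "V \<in> Fun E B" "lff V" "V \<bullet> I = F"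
    using factorisation[OF A B F] by metis
  note twoE = two_category_Obj[OF E(1)]
  note i = fid_in[OF two(2)]
  have "\<exists>W\<in>Fun B E. W \<bullet> F = I \<and> V \<bullet> W = fid B"
    using assms(4)[unfolded lorth_def Fun_Dom[OF F] Fun_Cod[OF F], rule_format, OF E(1) B E(4) E(2) i E(5)]
      E(6) fcomp_fid(2)[OF F] by simp
  then obtain W where W: "W \<in> Fun B E" "W \<bullet> F = I" "V \<bullet> W = fid B" by blast
  have "W \<bullet> V = fid E"
  proof (rule boba_lff_unique[OF two(1) twoE twoE two(2) E(2,3) E(4,5) fcomp_in[OF twoE E(4) W(1)] fid_in[OF twoE]])
    show "(W \<bullet> V) \<bullet> I = fid E \<bullet> I"
      using E(6) W by (simp add: fcomp_assoc[OF E(2) Fun_Dom[OF E(4)]] fcomp_fid(2)[OF E(2)])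
    have "V \<bullet> (W \<bullet> V) = (V \<bullet> W) \<bullet> V"
      by (rule fcomp_assoc[OF E(4) Fun_Dom[OF W(1)], symmetric])
    then show "V \<bullet> (W \<bullet> V) = V \<bullet> fid E"
      by (simp add: W fcomp_fid[OF E(4)])
  qed
  note WV = this and VW = W(3)
  note on = Fun_simps[OF E(4)] Fun_simps[OF W(1)]
  have "bij_betw (on0 V) (Ob E) (Ob B)"
    by (rule bij_betw_byWitness[where f' = "on0 W"])
      (use on arg_cong[OF WV, of on0] arg_cong[OF VW, of on0] in \<open>auto simp: fun_eq_iff fcomp_def compose_def fid_def split: if_splits\<close>)
  moreover have "bij_betw (on1 V) (Ar E) (Ar B)"
    by (rule bij_betw_byWitness[where f' = "on1 W"])
      (use on arg_cong[OF WV, of on1] arg_cong[OF VW, of on1] in \<open>auto simp: fun_eq_iff fcomp_def compose_def fid_def split: if_splits\<close>)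
  ultimately have "bij_betw (on0 V \<circ> on0 I) (Ob A) (Ob B)" "bij_betw (on1 V \<circ> on1 I) (Ar A) (Ar B)"
    using bobaD[OF E(2,3)] by (auto intro: bij_betw_trans)
  then have "bij_betw (on0 F) (Ob A) (Ob B)" "bij_betw (on1 F) (Ar A) (Ar B)"
    using Fun_Dom[OF E(2)] by (auto simp flip: E(6) cong: bij_betw_cong)
  then show ?thesis
    using Fun_Dom[OF F] Fun_Cod[OF F] by (simp add: boba_def)
qed

text \<open>To fill a square out of \<open>A \<star> B\<close>, fill the squares \<open>A \<rightarrow> A'\<close> and \<open>B \<rightarrow> B'\<close> for each fixed object of the other factor.\<close>

lemma (in funny) boba_st1:
  assumes A: "A \<in> Obj TwoCat" and B: "B \<in> Obj TwoCat" and A': "A' \<in> Obj TwoCat" and B': "B' \<in> Obj TwoCat"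
    and F: "F \<in> Fun A A'" "boba F" and G: "G \<in> Fun B B'" "boba G"
  shows "boba (st1 F G)"
proof (rule lorth_imp_boba[OF st0_Obj[OF A B] st0_Obj[OF A' B'] st1_in[OF A B A' B' F(1) G(1)]])
  note two = A[THEN two_category_Obj] B[THEN two_category_Obj] A'[THEN two_category_Obj] B'[THEN two_category_Obj]
  note S = st1_in[OF A B A' B' F(1) G(1)]
  note on = Fun_simps[OF F(1)] Fun_simps[OF G(1)]
  define iF where "iF = inv_into (Ob A) (on0 F)"
  define iG where "iG = inv_into (Ob B) (on0 G)"
  have iF [simp]: "y \<in> Ob A' \<Longrightarrow> iF y \<in> Ob A" "y \<in> Ob A' \<Longrightarrow> on0 F (iF y) = y" "x \<in> Ob A \<Longrightarrow> iF (on0 F x) = x" for x y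
    using bobaD(1)[OF F] by (auto simp: iF_def bij_betw_def inv_into_into f_inv_into_f inv_into_f_f)
  have iG [simp]: "y \<in> Ob B' \<Longrightarrow> iG y \<in> Ob B" "y \<in> Ob B' \<Longrightarrow> on0 G (iG y) = y" "x \<in> Ob B \<Longrightarrow> iG (on0 G x) = x" for x y
    using bobaD(1)[OF G] by (auto simp: iG_def bij_betw_def inv_into_into f_inv_into_f inv_into_f_f)
  note st = st1_on[OF A B A' B' F(1) G(1)]
  show "lorth (st1 F G)"
    unfolding lorth_def Fun_Dom[OF S] Fun_Cod[OF S]
  proof (intro ballI impI)
    fix X Y :: "'u tcat" and H U V :: "'u tfun" assume X: "X \<in> Obj TwoCat" and Y: "Y \<in> Obj TwoCat" and H: "H \<in> Fun X Y"
      and U: "U \<in> Fun (st0 A B) X" and V: "V \<in> Fun (st0 A' B') Y" and lff: "lff H" and sq: "H \<bullet> U = V \<bullet> st1 F G"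
    note XY = X[THEN two_category_Obj] Y[THEN two_category_Obj]
    note i = i_in[OF A B] and i' = i_in[OF A' B']
    have Ui: "b \<in> Ob B \<Longrightarrow> U \<bullet> iL A B b \<in> Fun A X" "a \<in> Ob A \<Longrightarrow> U \<bullet> iR A B a \<in> Fun B X" for a b
      using fcomp_in[OF two(1) i(1) U] fcomp_in[OF two(2) i(2) U] by simp_all
    have Vi: "b \<in> Ob B' \<Longrightarrow> V \<bullet> iL A' B' b \<in> Fun A' Y" "a \<in> Ob A' \<Longrightarrow> V \<bullet> iR A' B' a \<in> Fun B' Y" for a b
      using fcomp_in[OF two(3) i'(1) V] fcomp_in[OF two(4) i'(2) V] by simp_all
    have sqL: "H \<bullet> (U \<bullet> iL A B b) = (V \<bullet> iL A' B' (on0 G b)) \<bullet> F" if b: "b \<in> Ob B" for b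
    proof -
      have b': "on0 G b \<in> Ob B'" using b by (simp add: on)
      have "H \<bullet> (U \<bullet> iL A B b) = (H \<bullet> U) \<bullet> iL A B b"
        by (rule fcomp_assoc[OF i(1)[OF b] Fun_Dom[OF U], symmetric])
      also have "\<dots> = V \<bullet> st1 F G \<bullet> iL A B b"
        unfolding sq by (rule fcomp_assoc[OF i(1)[OF b] Fun_Dom[OF S]])
      also have "\<dots> = V \<bullet> iL A' B' (on0 G b) \<bullet> F" by (simp only: st(1)[OF b])
      also have "\<dots> = (V \<bullet> iL A' B' (on0 G b)) \<bullet> F"
        by (rule fcomp_assoc[OF F(1) Fun_Dom[OF i'(1)[OF b']], symmetric])
      finally show ?thesis .
    qed
    have sqR: "H \<bullet> (U \<bullet> iR A B a) = (V \<bullet> iR A' B' (on0 F a)) \<bullet> G" if a: "a \<in> Ob A" for a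
    proof -
      have a': "on0 F a \<in> Ob A'" using a by (simp add: on)
      have "H \<bullet> (U \<bullet> iR A B a) = (H \<bullet> U) \<bullet> iR A B a"
        by (rule fcomp_assoc[OF i(2)[OF a] Fun_Dom[OF U], symmetric])
      also have "\<dots> = V \<bullet> st1 F G \<bullet> iR A B a"
        unfolding sq by (rule fcomp_assoc[OF i(2)[OF a] Fun_Dom[OF S]])
      also have "\<dots> = V \<bullet> iR A' B' (on0 F a) \<bullet> G" by (simp only: st(2)[OF a])
      also have "\<dots> = (V \<bullet> iR A' B' (on0 F a)) \<bullet> G"
        by (rule fcomp_assoc[OF G(1) Fun_Dom[OF i'(2)[OF a']], symmetric])
      finally show ?thesis .
    qed
    have "\<exists>W. W \<in> Fun A' X \<and> W \<bullet> F = U \<bullet> iL A B (iG b) \<and> H \<bullet> W = V \<bullet> iL A' B' b" if b: "b \<in> Ob B'" for b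
      by (rule boba_lff_filler[OF two(1,3) XY F H lff Ui(1) Vi(1)[OF b]]) (use b sqL[of "iG b"] in auto)
    then obtain LF where LF: "LF b \<in> Fun A' X" "LF b \<bullet> F = U \<bullet> iL A B (iG b)" "H \<bullet> LF b = V \<bullet> iL A' B' b"
      if "b \<in> Ob B'" for b by metis
    have "\<exists>W. W \<in> Fun B' X \<and> W \<bullet> G = U \<bullet> iR A B (iF a) \<and> H \<bullet> W = V \<bullet> iR A' B' a" if a: "a \<in> Ob A'" for a
      by (rule boba_lff_filler[OF two(2,4) XY G H lff Ui(2) Vi(2)[OF a]]) (use a sqR[of "iF a"] in auto)
    then obtain RF where RF: "RF a \<in> Fun B' X" "RF a \<bullet> G = U \<bullet> iR A B (iF a)" "H \<bullet> RF a = V \<bullet> iR A' B' a"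
      if "a \<in> Ob A'" for a by metis
    \<comment> \<open>Objects of A' and B' come from unique objects of A and B, and over those both
      fillers restrict to U, whose two families agree on objects.\<close>
    have eq: "on0 (LF b) a = on0 (RF a) b" if "a \<in> Ob A'" "b \<in> Ob B'" for a b
    proof -
      have "on0 (LF b) a = on0 U (on0 (iL A B (iG b)) (iF a))"
        using arg_cong[OF LF(2)[OF that(2)], of "\<lambda>H. on0 H (iF a)"] that Fun_Dom[OF i(1)] by (simp add: on)
      also have "\<dots> = on0 U (on0 (iR A B (iF a)) (iG b))"
        using i_on0[OF A B] that by simp
      also have "\<dots> = on0 (RF a) b"
        using arg_cong[OF RF(2)[OF that(1)], of "\<lambda>H. on0 H (iG b)"] that Fun_Dom[OF i(2)] by (simp add: on)
      finally show ?thesis .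
    qed
    obtain W where W: "W \<in> Fun (st0 A' B') X" "\<And>b. b \<in> Ob B' \<Longrightarrow> W \<bullet> iL A' B' b = LF b" "\<And>a. a \<in> Ob A' \<Longrightarrow> W \<bullet> iR A' B' a = RF a"
      by (rule f_ex[where LF = LF and RF = RF, OF A' B' X]) (use LF(1) RF(1) eq in auto)
    have "W \<bullet> st1 F G = U"
    proof (rule f_unique[OF A B X fcomp_in[OF two_category_Obj[OF st0_Obj[OF A B]] S W(1)] U])
      fix b assume b: "b \<in> Ob B"
      have "(W \<bullet> st1 F G) \<bullet> iL A B b = (W \<bullet> iL A' B' (on0 G b)) \<bullet> F"
        using b by (simp add: fcomp_assoc[OF i(1)[OF b] Fun_Dom[OF S]] st(1) fcomp_assoc[OF F(1)] Fun_Dom[OF i'(1)] on)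
      then show "(W \<bullet> st1 F G) \<bullet> iL A B b = U \<bullet> iL A B b"
        using b W(2) LF(2) by (simp add: on)
    next
      fix a assume a: "a \<in> Ob A"
      have "(W \<bullet> st1 F G) \<bullet> iR A B a = (W \<bullet> iR A' B' (on0 F a)) \<bullet> G"
        using a by (simp add: fcomp_assoc[OF i(2)[OF a] Fun_Dom[OF S]] st(2) fcomp_assoc[OF G(1)] Fun_Dom[OF i'(2)] on)
      then show "(W \<bullet> st1 F G) \<bullet> iR A B a = U \<bullet> iR A B a"
        using a W(3) RF(2) by (simp add: on)
    qed
    moreover have "H \<bullet> W = V"
      by (rule f_unique[OF A' B' Y fcomp_in[OF two_category_Obj[OF st0_Obj[OF A' B']] W(1) H] V])
        (simp_all add: fcomp_assoc[OF i'(1) Fun_Dom[OF W(1)]] fcomp_assoc[OF i'(2) Fun_Dom[OF W(1)]] W LF RF)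
    ultimately show "\<exists>W\<in>Fun (st0 A' B') X. W \<bullet> st1 F G = U \<and> H \<bullet> W = V" using W(1) by blast
  qed
qed

lemma (in univ) lff_prod_fun:
  fixes F G :: "'u tfun"
  assumes "two_category A" "two_category B" "two_category A'" "two_category B'"
    and F: "F \<in> Fun A A'" "lff F" and G: "G \<in> Fun B B'" "lff G"
  shows "lff (prod_fun F G)"
proof -
  interpret A: two_category A by fact
  interpret B: two_category B by fact
  interpret A': two_category A' by fact
  interpret B': two_category B' by fact
  note [simp] = Fun_simps[OF F(1)] Fun_simps[OF G(1)]
  show ?thesis
  proof (rule lffI[OF prod_fun_in[OF assms(1,2) F(1) G(1) assms(3,4)] two_category_prod_cat[OF assms(1,2)]], goal_cases)
    case (1 \<tau> \<sigma>)
    then show ?case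
      by (auto elim!: prod_catE intro: lff_inj[OF F assms(1)] lff_inj[OF G assms(2)])
  next
    case (2 f g \<rho>)
    then obtain f1 f2 g1 g2 r1 r2 where [simp]: "f = pair f1 f2" "f1 \<in> Ar A" "f2 \<in> Ar B" "g = pair g1 g2" "g1 \<in> Ar A" "g2 \<in> Ar B"
      "\<rho> = pair r1 r2" "r1 \<in> Tw A'" "r2 \<in> Tw B'"
      by (auto elim!: prod_catE)
    obtain t1 where "t1 \<in> Tw A" "src2 A t1 = f1" "tgt2 A t1 = g1" "on2 F t1 = r1"
      by (rule lff_ex[OF F assms(1), of f1 g1 r1]) (use 2 in auto)
    moreover obtain t2 where "t2 \<in> Tw B" "src2 B t2 = f2" "tgt2 B t2 = g2" "on2 G t2 = r2"
      by (rule lff_ex[OF G assms(2), of f2 g2 r2]) (use 2 in auto)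
    ultimately show ?case by (intro exI[of _ "pair t1 t2"]) simp
  qed
qed

section \<open>Normal forms for cubical families\<close>

text \<open>The equational laws compare parallel 2-cells, so a locally faithful V reflects them.
  This is used once for the fillers that make P boba and once for the family lifted to the normal
  forms.\<close>

lemma cubical_lift:
  assumes two: "two_category A" "two_category B" "two_category C'" and V: "V \<in> Fun C' C"
    and faithful: "\<And>\<tau> \<sigma>. \<lbrakk>\<tau> \<in> Tw C'; \<sigma> \<in> Tw C'; src2 C' \<tau> = src2 C' \<sigma>; tgt2 C' \<tau> = tgt2 C' \<sigma>; on2 V \<tau> = on2 V \<sigma>\<rbrakk> \<Longrightarrow> \<tau> = \<sigma>"
    and cub: "cubical A B C (\<lambda>b. V \<bullet> LF b) (\<lambda>a. V \<bullet> RF a) (\<lambda>f g. on2 V (X f g))"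
    and LF: "\<And>b. b \<in> Ob B \<Longrightarrow> LF b \<in> Fun A C'" and RF: "\<And>a. a \<in> Ob A \<Longrightarrow> RF a \<in> Fun B C'"
    and on0_eq: "\<And>a b. a \<in> Ob A \<Longrightarrow> b \<in> Ob B \<Longrightarrow> on0 (LF b) a = on0 (RF a) b"
    and X_inv: "\<And>f g. f \<in> Ar A \<Longrightarrow> g \<in> Ar B \<Longrightarrow> invertible2 C' (X f g)"
    and X_src: "\<And>f g. f \<in> Ar A \<Longrightarrow> g \<in> Ar B \<Longrightarrow>
      src2 C' (X f g) = comp1 C' (on1 (LF (tgt1 B g)) f) (on1 (RF (src1 A f)) g)"
    and X_tgt: "\<And>f g. f \<in> Ar A \<Longrightarrow> g \<in> Ar B \<Longrightarrow>
      tgt2 C' (X f g) = comp1 C' (on1 (RF (tgt1 A f)) g) (on1 (LF (src1 B g)) f)"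
  shows "cubical A B C' LF RF X"
proof -
  interpret c: cubical A B C "\<lambda>b. V \<bullet> LF b" "\<lambda>a. V \<bullet> RF a" "\<lambda>f g. on2 V (X f g)" by fact
  interpret C': two_category C' by fact
  have X_Tw: "f \<in> Ar A \<Longrightarrow> g \<in> Ar B \<Longrightarrow> X f g \<in> Tw C'" for f g
    using X_inv C'.invertible2_Tw by blast
  note [simp] = Fun_simps[OF V] Fun_simps[OF LF] Fun_simps[OF RF] on0_eq X_src X_tgt X_Tw
  show ?thesis
  proof (unfold_locales, goal_cases)
    case 7 then show ?case using c.X_id_right by - (rule faithful, simp_all)
  next
    case 8 then show ?case using c.X_id_left by - (rule faithful, simp_all)
  next
    case (9 f g g') then show ?case using c.X_comp_right[of f g g'] by - (rule faithful, simp_all)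
  next
    case (10 f f' g) then show ?case using c.X_comp_left[of f f' g] by - (rule faithful, simp_all)
  next
    case (11 f \<sigma>) then show ?case using c.X_nat_right[of f \<sigma>] by - (rule faithful, simp_all)
  next
    case (12 \<tau> g) then show ?case using c.X_nat_left[of \<tau> g] by - (rule faithful, simp_all)
  qed (use LF RF X_inv in simp_all)
qed

text \<open>
  Every 1-cell \<open>c\<close> of the 2-category \<open>C\<close> carrying the universal cubical family is isomorphic,
  by a 2-cell trivial in \<open>A\<close> and \<open>B\<close>, to the normal form \<open>T f g\<close> built from its two
  projections. The isomorphisms \<open>\<phi>: T f g \<Rightarrow> c\<close> are taken as the 1-cells of a 2-category over \<open>C\<close>,
  whose 2-cells are those of \<open>C\<close> compatible with the chosen isomorphisms; a section of it makes the
  choice coherent.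
\<close>

locale retract_cubical = univ "TYPE('u)" + cubical A B C LF RF X
  for A B C :: "'u tcat" and LF RF X +
  fixes QA QB :: "'u tfun"
  assumes QA_in: "QA \<in> Fun C A" and QB_in: "QB \<in> Fun C B"
    and QA_L: "b \<in> Ob B \<Longrightarrow> f \<in> Ar A \<Longrightarrow> on1 QA (on1 (LF b) f) = f"
      "b \<in> Ob B \<Longrightarrow> \<tau> \<in> Tw A \<Longrightarrow> on2 QA (on2 (LF b) \<tau>) = \<tau>"
    and QA_R: "a \<in> Ob A \<Longrightarrow> b \<in> Ob B \<Longrightarrow> on0 QA (on0 (RF a) b) = a"
      "a \<in> Ob A \<Longrightarrow> g \<in> Ar B \<Longrightarrow> on1 QA (on1 (RF a) g) = id1 A a"
      "a \<in> Ob A \<Longrightarrow> \<sigma> \<in> Tw B \<Longrightarrow> on2 QA (on2 (RF a) \<sigma>) = id2 A (id1 A a)"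
    and QA_X: "f \<in> Ar A \<Longrightarrow> g \<in> Ar B \<Longrightarrow> on2 QA (X f g) = id2 A f"
    and QB_L: "b \<in> Ob B \<Longrightarrow> f \<in> Ar A \<Longrightarrow> on1 QB (on1 (LF b) f) = id1 B b"
      "b \<in> Ob B \<Longrightarrow> \<tau> \<in> Tw A \<Longrightarrow> on2 QB (on2 (LF b) \<tau>) = id2 B (id1 B b)"
    and QB_R: "a \<in> Ob A \<Longrightarrow> b \<in> Ob B \<Longrightarrow> on0 QB (on0 (RF a) b) = b"
      "a \<in> Ob A \<Longrightarrow> g \<in> Ar B \<Longrightarrow> on1 QB (on1 (RF a) g) = g"
      "a \<in> Ob A \<Longrightarrow> \<sigma> \<in> Tw B \<Longrightarrow> on2 QB (on2 (RF a) \<sigma>) = \<sigma>"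
    and QB_X: "f \<in> Ar A \<Longrightarrow> g \<in> Ar B \<Longrightarrow> on2 QB (X f g) = id2 B g"
begin

lemmas Q_on = Fun_simps[OF QA_in] Fun_simps[OF QB_in] QA_L QA_R QA_X QB_L QB_R QB_X
declare L_simps [simp] R_simps [simp] X_simps [simp] Q_on [simp]

section \<open>Normal forms as a pseudofunctor from A x B to C\<close>

definition "T f g = comp1 C (on1 (LF (tgt1 B g)) f) (on1 (RF (src1 A f)) g)"
definition "T2 \<tau> \<sigma> = hcomp C (on2 (LF (tgt1 B (src2 B \<sigma>))) \<tau>) (on2 (RF (src1 A (src2 A \<tau>))) \<sigma>)"

lemma T_simps [simp]:
  assumes "f \<in> Ar A" "g \<in> Ar B"
  shows "T f g \<in> Ar C" "src1 C (T f g) = on0 (RF (src1 A f)) (src1 B g)" "tgt1 C (T f g) = on0 (RF (tgt1 A f)) (tgt1 B g)"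
    "on1 QA (T f g) = f" "on1 QB (T f g) = g"
  using assms by (simp_all add: T_def)

lemma T2_simps [simp]:
  assumes "\<tau> \<in> Tw A" "\<sigma> \<in> Tw B"
  shows "T2 \<tau> \<sigma> \<in> Tw C" "src2 C (T2 \<tau> \<sigma>) = T (src2 A \<tau>) (src2 B \<sigma>)" "tgt2 C (T2 \<tau> \<sigma>) = T (tgt2 A \<tau>) (tgt2 B \<sigma>)"
    "on2 QA (T2 \<tau> \<sigma>) = \<tau>" "on2 QB (T2 \<tau> \<sigma>) = \<sigma>"
  using assms by (simp_all add: T_def T2_def)

lemma T2_id: "f \<in> Ar A \<Longrightarrow> g \<in> Ar B \<Longrightarrow> T2 (id2 A f) (id2 B g) = id2 C (T f g)"
  by (simp add: T2_def T_def)

lemma T2_vcomp: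
  assumes "\<tau> \<in> Tw A" "\<tau>' \<in> Tw A" "\<sigma> \<in> Tw B" "\<sigma>' \<in> Tw B" "src2 A \<tau>' = tgt2 A \<tau>" "src2 B \<sigma>' = tgt2 B \<sigma>"
  shows "T2 (vcomp A \<tau>' \<tau>) (vcomp B \<sigma>' \<sigma>) = vcomp C (T2 \<tau>' \<sigma>') (T2 \<tau> \<sigma>)"
  using assms by (simp add: T2_def C.interchange')

text \<open>The compositor from T(f'f, g'g) to the composite of T(f', g') and T(f, g): the only
  rearrangement required is to move f past g'. With \<open>\<mu>_id\<close>,
  \<open>\<mu>_assoc\<close> and \<open>\<mu>_nat\<close> it makes \<open>T\<close> and
  \<open>T2\<close> a pseudofunctor, strictly retracted by QA and QB.\<close>

definition "\<mu> f' f g' g = hcomp C (id2 C (on1 (LF (tgt1 B g')) f')) (hcomp C (X f g') (id2 C (on1 (RF (src1 A f)) g)))"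

lemma \<mu>_simps [simp]:
  assumes "f \<in> Ar A" "f' \<in> Ar A" "g \<in> Ar B" "g' \<in> Ar B" "src1 A f' = tgt1 A f" "src1 B g' = tgt1 B g"
  shows "\<mu> f' f g' g \<in> Tw C" "src2 C (\<mu> f' f g' g) = T (comp1 A f' f) (comp1 B g' g)"
    "tgt2 C (\<mu> f' f g' g) = comp1 C (T f' g') (T f g)" "invertible2 C (\<mu> f' f g' g)"
    "on2 QA (\<mu> f' f g' g) = id2 A (comp1 A f' f)" "on2 QB (\<mu> f' f g' g) = id2 B (comp1 B g' g)"
  using assms by (simp_all add: \<mu>_def T_def C.invertible2_hcomp X_inv)

text \<open>Both sides first move f past g''; what is left is f past g' and f' past g'', in one
  order on the left and in the other on the right. These two moves are independent, so interchange
  exchanges them.\<close>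

lemma \<mu>_assoc:
  assumes "f \<in> Ar A" "f' \<in> Ar A" "f'' \<in> Ar A" "g \<in> Ar B" "g' \<in> Ar B" "g'' \<in> Ar B" "src1 A f' = tgt1 A f" "src1 B g' = tgt1 B g"
    "src1 A f'' = tgt1 A f'" "src1 B g'' = tgt1 B g'"
  shows "vcomp C (hcomp C (id2 C (T f'' g'')) (\<mu> f' f g' g)) (\<mu> f'' (comp1 A f' f) g'' (comp1 B g' g)) =
    vcomp C (hcomp C (\<mu> f'' f' g'' g') (id2 C (T f g))) (\<mu> (comp1 A f'' f') f (comp1 B g'' g') g)"
proof -
  note W = C.whisker_left_vcomp C.whisker_right_vcomp C.whisker_left_id
  note [simp] = assms
  let ?L = "\<lambda>b f. id2 C (on1 (LF b) f)" and ?R = "\<lambda>a g. id2 C (on1 (RF a) g)"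
  let ?a = "src1 A f" and ?a' = "tgt1 A f" and ?a'' = "tgt1 A f'" and ?b = "src1 B g" and ?b' = "tgt1 B g" and ?b'' = "tgt1 B g'" and ?b3 = "tgt1 B g''"
  let ?z = "hcomp C (?L ?b3 (comp1 A f'' f')) (hcomp C (X f g'') (?R ?a (comp1 B g' g)))"
  have sw: "vcomp C (hcomp C (id2 C (comp1 C (on1 (RF ?a'') g'') (on1 (LF ?b'') f'))) (X f g'))
       (hcomp C (X f' g'') (id2 C (comp1 C (on1 (LF ?b'') f) (on1 (RF ?a) g')))) =
     vcomp C (hcomp C (X f' g'') (id2 C (comp1 C (on1 (RF ?a') g') (on1 (LF ?b') f))))
       (hcomp C (id2 C (comp1 C (on1 (LF ?b3) f') (on1 (RF ?a') g''))) (X f g'))"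
    using C.hcomp_split_left[of "X f' g''" "X f g'"] C.hcomp_split_right[of "X f' g''" "X f g'"] by simp
  have "vcomp C (hcomp C (id2 C (T f'' g'')) (\<mu> f' f g' g)) (\<mu> f'' (comp1 A f' f) g'' (comp1 B g' g)) =
    vcomp C (hcomp C (?L ?b3 f'') (hcomp C (vcomp C (hcomp C (id2 C (comp1 C (on1 (RF ?a'') g'') (on1 (LF ?b'') f'))) (X f g'))
       (hcomp C (X f' g'') (id2 C (comp1 C (on1 (LF ?b'') f) (on1 (RF ?a) g'))))) (?R ?a g))) ?z"
    by (simp add: \<mu>_def T_def W X_comp_left)
  also have "\<dots> = vcomp C (hcomp C (\<mu> f'' f' g'' g') (id2 C (T f g))) (\<mu> (comp1 A f'' f') f (comp1 B g'' g') g)"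
    unfolding sw by (simp add: \<mu>_def T_def W X_comp_right)
  finally show ?thesis .
qed

text \<open>Naturality in A followed by naturality in B, with \<sigma> and \<tau> separated and
  joined again by interchange.\<close>

lemma X_nat:
  assumes "\<tau> \<in> Tw A" "\<sigma> \<in> Tw B"
  shows "vcomp C (hcomp C (on2 (RF (tgt1 A (src2 A \<tau>))) \<sigma>) (on2 (LF (src1 B (src2 B \<sigma>))) \<tau>)) (X (src2 A \<tau>) (src2 B \<sigma>)) =
    vcomp C (X (tgt2 A \<tau>) (tgt2 B \<sigma>)) (hcomp C (on2 (LF (tgt1 B (src2 B \<sigma>))) \<tau>) (on2 (RF (src1 A (src2 A \<tau>))) \<sigma>))"
proof -
  note [simp] = assms
  let ?a = "src1 A (src2 A \<tau>)" and ?a' = "tgt1 A (src2 A \<tau>)" and ?b = "src1 B (src2 B \<sigma>)" and ?b' = "tgt1 B (src2 B \<sigma>)"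
  have "vcomp C (hcomp C (on2 (RF ?a') \<sigma>) (on2 (LF ?b) \<tau>)) (X (src2 A \<tau>) (src2 B \<sigma>)) =
    vcomp C (hcomp C (on2 (RF ?a') \<sigma>) (id2 C (on1 (LF ?b) (tgt2 A \<tau>)))) (vcomp C (hcomp C (id2 C (on1 (RF ?a') (src2 B \<sigma>))) (on2 (LF ?b) \<tau>)) (X (src2 A \<tau>) (src2 B \<sigma>)))"
    using C.hcomp_split_left[of "on2 (RF ?a') \<sigma>" "on2 (LF ?b) \<tau>"] by (simp flip: C.vcomp_assoc')
  also have "\<dots> = vcomp C (vcomp C (hcomp C (on2 (RF ?a') \<sigma>) (id2 C (on1 (LF ?b) (tgt2 A \<tau>)))) (X (tgt2 A \<tau>) (src2 B \<sigma>)))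
      (hcomp C (on2 (LF ?b') \<tau>) (id2 C (on1 (RF ?a) (src2 B \<sigma>))))"
    using X_nat_left[of \<tau> "src2 B \<sigma>"] by simp
  also have "\<dots> = vcomp C (X (tgt2 A \<tau>) (tgt2 B \<sigma>)) (vcomp C (hcomp C (id2 C (on1 (LF ?b') (tgt2 A \<tau>))) (on2 (RF ?a) \<sigma>)) (hcomp C (on2 (LF ?b') \<tau>) (id2 C (on1 (RF ?a) (src2 B \<sigma>)))))"
    using X_nat_right[of "tgt2 A \<tau>" \<sigma>] by simp
  also have "vcomp C (hcomp C (id2 C (on1 (LF ?b') (tgt2 A \<tau>))) (on2 (RF ?a) \<sigma>)) (hcomp C (on2 (LF ?b') \<tau>) (id2 C (on1 (RF ?a) (src2 B \<sigma>)))) =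
     hcomp C (on2 (LF ?b') \<tau>) (on2 (RF ?a) \<sigma>)"
    using C.hcomp_split_right[of "on2 (LF ?b') \<tau>" "on2 (RF ?a) \<sigma>"] by simp
  finally show ?thesis .
qed

lemma \<mu>_nat:
  assumes "\<tau> \<in> Tw A" "\<tau>' \<in> Tw A" "\<sigma> \<in> Tw B" "\<sigma>' \<in> Tw B" "src1 A (src2 A \<tau>') = tgt1 A (src2 A \<tau>)" "src1 B (src2 B \<sigma>') = tgt1 B (src2 B \<sigma>)"
  shows "vcomp C (hcomp C (T2 \<tau>' \<sigma>') (T2 \<tau> \<sigma>)) (\<mu> (src2 A \<tau>') (src2 A \<tau>) (src2 B \<sigma>') (src2 B \<sigma>)) =
    vcomp C (\<mu> (tgt2 A \<tau>') (tgt2 A \<tau>) (tgt2 B \<sigma>') (tgt2 B \<sigma>)) (T2 (hcomp A \<tau>' \<tau>) (hcomp B \<sigma>' \<sigma>))"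
proof -
  note [simp] = assms
  let ?b = "tgt1 B (src2 B \<sigma>')" and ?a = "src1 A (src2 A \<tau>)"
  let ?l = "on2 (LF ?b) \<tau>'" and ?r = "on2 (RF ?a) \<sigma>"
  note n = X_nat[of \<tau> \<sigma>', simplified]
  have "vcomp C (hcomp C (T2 \<tau>' \<sigma>') (T2 \<tau> \<sigma>)) (\<mu> (src2 A \<tau>') (src2 A \<tau>) (src2 B \<sigma>') (src2 B \<sigma>)) =
    hcomp C (vcomp C ?l (id2 C (on1 (LF ?b) (src2 A \<tau>')))) (hcomp C (vcomp C
      (hcomp C (on2 (RF (tgt1 A (src2 A \<tau>))) \<sigma>') (on2 (LF (src1 B (src2 B \<sigma>'))) \<tau>)) (X (src2 A \<tau>) (src2 B \<sigma>'))) (vcomp C ?r (id2 C (on1 (RF ?a) (src2 B \<sigma>)))))"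
    by (subst C.interchange', simp_all del: C.vcomp_id)+ (simp add: T2_def \<mu>_def)
  also have "\<dots> = hcomp C (vcomp C (id2 C (on1 (LF ?b) (tgt2 A \<tau>'))) ?l) (hcomp C (vcomp C (X (tgt2 A \<tau>) (tgt2 B \<sigma>'))
     (hcomp C (on2 (LF ?b) \<tau>) (on2 (RF ?a) \<sigma>'))) (vcomp C (id2 C (on1 (RF ?a) (tgt2 B \<sigma>))) ?r))"
    using n by simp
  also have "\<dots> = vcomp C (\<mu> (tgt2 A \<tau>') (tgt2 A \<tau>) (tgt2 B \<sigma>') (tgt2 B \<sigma>)) (T2 (hcomp A \<tau>' \<tau>) (hcomp B \<sigma>' \<sigma>))"
    by (subst C.interchange', simp_all del: C.vcomp_id)+ (simp add: T2_def \<mu>_def)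
  finally show ?thesis .
qed

text \<open>No universality is assumed at this point, so an object of C need not come from a pair of
  objects. Only between objects that do can a 1-cell be parallel to its normal form.\<close>

definition good :: "'u \<Rightarrow> bool" where
  "good x \<longleftrightarrow> x \<in> Ob C \<and> on0 (RF (on0 QA x)) (on0 QB x) = x"

text \<open>One 2-cell carries all the data: the 1-cell c is its target, and f, g are the two
  projections of c.\<close>

definition norm :: "'u \<Rightarrow> bool" where
  "norm \<phi> \<longleftrightarrow> invertible2 C \<phi> \<and> good (src1 C (tgt2 C \<phi>)) \<and> good (tgt1 C (tgt2 C \<phi>)) \<and>
    src2 C \<phi> = T (on1 QA (tgt2 C \<phi>)) (on1 QB (tgt2 C \<phi>)) \<and>
    on2 QA \<phi> = id2 A (on1 QA (tgt2 C \<phi>)) \<and> on2 QB \<phi> = id2 B (on1 QB (tgt2 C \<phi>))"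

text \<open>The normal form of the composite is first split by \<mu> into two normal forms, and then
  the two isomorphisms are applied side by side.\<close>

definition ncomp :: "'u \<Rightarrow> 'u \<Rightarrow> 'u" where
  "ncomp \<phi>' \<phi> = vcomp C (hcomp C \<phi>' \<phi>)
     (\<mu> (on1 QA (tgt2 C \<phi>')) (on1 QA (tgt2 C \<phi>)) (on1 QB (tgt2 C \<phi>')) (on1 QB (tgt2 C \<phi>)))"

text \<open>Only the part of this record in dimensions 0 and 1 matters. The 2-cell fields are
  inherited from C and are replaced when \<open>over_cat\<close> forms its 2-category
  \<open>N.E\<close>.\<close>

definition nform :: "'u tcat" where
  "nform = C \<lparr>Ob := Collect good, Ar := Collect norm, src1 := \<lambda>\<phi>. src1 C (tgt2 C \<phi>),
    tgt1 := \<lambda>\<phi>. tgt1 C (tgt2 C \<phi>), id1 := \<lambda>x. id2 C (id1 C x), comp1 := ncomp\<rparr>"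

lemma goodD: "good x \<Longrightarrow> x \<in> Ob C" "good x \<Longrightarrow> on0 (RF (on0 QA x)) (on0 QB x) = x"
  by (simp_all add: good_def)

lemma good_O: "a \<in> Ob A \<Longrightarrow> b \<in> Ob B \<Longrightarrow> good (on0 (RF a) b)"
  by (simp add: good_def)

lemma normD:
  assumes "norm \<phi>"
  shows "\<phi> \<in> Tw C" "good (src1 C (tgt2 C \<phi>))" "good (tgt1 C (tgt2 C \<phi>))"
    "src2 C \<phi> = T (on1 QA (tgt2 C \<phi>)) (on1 QB (tgt2 C \<phi>))"
    "on2 QA \<phi> = id2 A (on1 QA (tgt2 C \<phi>))" "on2 QB \<phi> = id2 B (on1 QB (tgt2 C \<phi>))"
  using assms C.invertible2_Tw unfolding norm_def by blast+

lemma normD': "norm \<phi> \<Longrightarrow> invertible2 C \<phi>" unfolding norm_def by blast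

lemma norm_src [simp]:
  assumes "norm \<phi>"
  shows "on0 (RF (on0 QA (src1 C (src2 C \<phi>)))) (on0 QB (src1 C (src2 C \<phi>))) = src1 C (src2 C \<phi>)"
    "on0 (RF (on0 QA (tgt1 C (src2 C \<phi>)))) (on0 QB (tgt1 C (src2 C \<phi>))) = tgt1 C (src2 C \<phi>)"
  using normD(1-3)[OF assms] by (simp_all add: good_def)

lemma ncomp_simps:
  assumes "norm \<phi>" "norm \<phi>'" and eq: "src1 C (tgt2 C \<phi>') = tgt1 C (tgt2 C \<phi>)"
  shows "norm (ncomp \<phi>' \<phi>)" "tgt2 C (ncomp \<phi>' \<phi>) = comp1 C (tgt2 C \<phi>') (tgt2 C \<phi>)"
proof -
  note p = normD(1)[OF assms(1)] normD(1)[OF assms(2)]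
  have eq': "src1 C (src2 C \<phi>') = tgt1 C (src2 C \<phi>)" using eq p by simp
  note [simp] = p eq'
  let ?f = "on1 QA (tgt2 C \<phi>)" and ?f' = "on1 QA (tgt2 C \<phi>')" and ?g = "on1 QB (tgt2 C \<phi>)" and ?g' = "on1 QB (tgt2 C \<phi>')"
  let ?m = "\<mu> ?f' ?f ?g' ?g"
  have m: "?m \<in> Tw C" "src2 C ?m = T (comp1 A ?f' ?f) (comp1 B ?g' ?g)" "tgt2 C ?m = comp1 C (T ?f' ?g') (T ?f ?g)"
    "invertible2 C ?m" "on2 QA ?m = id2 A (comp1 A ?f' ?f)" "on2 QB ?m = id2 B (comp1 B ?g' ?g)"
    by simp_all
  have "src2 C (hcomp C \<phi>' \<phi>) = comp1 C (src2 C \<phi>') (src2 C \<phi>)" by simp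
  also have "\<dots> = comp1 C (T ?f' ?g') (T ?f ?g)"
    by (simp only: normD(4)[OF assms(1)] normD(4)[OF assms(2)])
  also have "\<dots> = tgt2 C (\<mu> ?f' ?f ?g' ?g)" by (rule m(3)[symmetric])
  finally have h: "src2 C (hcomp C \<phi>' \<phi>) = tgt2 C (\<mu> ?f' ?f ?g' ?g)" .
  have t: "tgt2 C (ncomp \<phi>' \<phi>) = comp1 C (tgt2 C \<phi>') (tgt2 C \<phi>)" "ncomp \<phi>' \<phi> \<in> Tw C"
      "src2 C (ncomp \<phi>' \<phi>) = src2 C (\<mu> ?f' ?f ?g' ?g)"
    using C.vcomp_simps[OF C.hcomp_simps(1)[OF p(2,1) eq'] m(1) h] C.hcomp_simps(3)[OF p(2,1) eq'] unfolding ncomp_def by metis+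
  have "invertible2 C (ncomp \<phi>' \<phi>)"
    unfolding ncomp_def by (rule C.invertible2_vcomp[OF C.invertible2_hcomp[OF normD'[OF assms(2)] normD'[OF assms(1)] eq'] m(4) h])
  moreover have "src2 C (ncomp \<phi>' \<phi>) = T (on1 QA (tgt2 C (ncomp \<phi>' \<phi>))) (on1 QB (tgt2 C (ncomp \<phi>' \<phi>)))"
    unfolding t m(2) by simp
  moreover have "on2 QA (ncomp \<phi>' \<phi>) = id2 A (on1 QA (tgt2 C (ncomp \<phi>' \<phi>)))"
  proof -
    have "on2 QA (ncomp \<phi>' \<phi>) = vcomp A (on2 QA (hcomp C \<phi>' \<phi>)) (on2 QA ?m)"
      unfolding ncomp_def by (rule Fun_on(11)[OF QA_in C.hcomp_simps(1)[OF p(2,1) eq'] m(1) h])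
    then show ?thesis
      unfolding t m(5) by (simp add: normD(5)[OF assms(1)] normD(5)[OF assms(2)])
  qed
  moreover have "on2 QB (ncomp \<phi>' \<phi>) = id2 B (on1 QB (tgt2 C (ncomp \<phi>' \<phi>)))"
  proof -
    have "on2 QB (ncomp \<phi>' \<phi>) = vcomp B (on2 QB (hcomp C \<phi>' \<phi>)) (on2 QB ?m)"
      unfolding ncomp_def by (rule Fun_on(11)[OF QB_in C.hcomp_simps(1)[OF p(2,1) eq'] m(1) h])
    then show ?thesis
      unfolding t m(6) by (simp add: normD(6)[OF assms(1)] normD(6)[OF assms(2)])
  qed
  ultimately show "norm (ncomp \<phi>' \<phi>)"
    using normD(2)[OF assms(1)] normD(3)[OF assms(2)] C.comp1_simps(2,3)[of "tgt2 C \<phi>'" "tgt2 C \<phi>"] eq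
    unfolding norm_def t(1) by simp
  show "tgt2 C (ncomp \<phi>' \<phi>) = comp1 C (tgt2 C \<phi>') (tgt2 C \<phi>)" by (rule t)
qed

lemma good_src2:
  assumes "norm \<phi>"
  shows "good (src1 C (src2 C \<phi>))" "good (tgt1 C (src2 C \<phi>))"
  using normD(1-3)[OF assms] by simp_all

lemma norm_id2: "f \<in> Ar C \<Longrightarrow> good (src1 C f) \<Longrightarrow> good (tgt1 C f) \<Longrightarrow> T (on1 QA f) (on1 QB f) = f \<Longrightarrow> norm (id2 C f)"
  by (simp add: norm_def)

lemma T_id: "good x \<Longrightarrow> T (id1 A (on0 QA x)) (id1 B (on0 QB x)) = id1 C x"
  using goodD[of x] by (simp add: T_def)

lemma \<mu>_id:
  assumes "f \<in> Ar A" "g \<in> Ar B"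
  shows "\<mu> f (id1 A (src1 A f)) g (id1 B (src1 B g)) = id2 C (T f g)"
    "\<mu> (id1 A (tgt1 A f)) f (id1 B (tgt1 B g)) g = id2 C (T f g)"
  using assms by (simp_all add: \<mu>_def T_def X_id_left X_id_right)

lemma ncomp_id:
  assumes "norm \<phi>"
  shows "ncomp \<phi> (id2 C (id1 C (src1 C (tgt2 C \<phi>)))) = \<phi>" "ncomp (id2 C (id1 C (tgt1 C (tgt2 C \<phi>)))) \<phi> = \<phi>"
proof -
  note [simp] = normD(1)[OF assms]
  let ?f = "on1 QA (tgt2 C \<phi>)" and ?g = "on1 QB (tgt2 C \<phi>)"
  have m: "\<mu> ?f (id1 A (on0 QA (src1 C (src2 C \<phi>)))) ?g (id1 B (on0 QB (src1 C (src2 C \<phi>)))) = id2 C (src2 C \<phi>)"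
    "\<mu> (id1 A (on0 QA (tgt1 C (src2 C \<phi>)))) ?f (id1 B (on0 QB (tgt1 C (src2 C \<phi>)))) ?g = id2 C (src2 C \<phi>)"
    unfolding normD(4)[OF assms] using \<mu>_id[of ?f ?g] by simp_all
  show "ncomp \<phi> (id2 C (id1 C (src1 C (tgt2 C \<phi>)))) = \<phi>" "ncomp (id2 C (id1 C (tgt1 C (tgt2 C \<phi>)))) \<phi> = \<phi>"
    by (simp_all add: ncomp_def m)
qed

text \<open>Interchange collects the three isomorphisms into one horizontal composite on either
  side; what remains is the associativity of \<mu>.\<close>

lemma ncomp_assoc:
  assumes n: "norm \<phi>" "norm \<phi>'" "norm \<phi>''" and eq: "src1 C (tgt2 C \<phi>') = tgt1 C (tgt2 C \<phi>)" "src1 C (tgt2 C \<phi>'') = tgt1 C (tgt2 C \<phi>')"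
  shows "ncomp \<phi>'' (ncomp \<phi>' \<phi>) = ncomp (ncomp \<phi>'' \<phi>') \<phi>"
proof -
  note p [simp] = n[THEN normD(1)]
  have eq' [simp]: "src1 C (src2 C \<phi>') = tgt1 C (src2 C \<phi>)" "src1 C (src2 C \<phi>'') = tgt1 C (src2 C \<phi>')" using eq by simp_all
  let ?f = "on1 QA (tgt2 C \<phi>)" and ?f' = "on1 QA (tgt2 C \<phi>')" and ?f'' = "on1 QA (tgt2 C \<phi>'')"
  let ?g = "on1 QB (tgt2 C \<phi>)" and ?g' = "on1 QB (tgt2 C \<phi>')" and ?g'' = "on1 QB (tgt2 C \<phi>'')"
  have s: "T ?f ?g = src2 C \<phi>" "T ?f' ?g' = src2 C \<phi>'" "T ?f'' ?g'' = src2 C \<phi>''"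
    using n[THEN normD(4)] by simp_all
  note m1 = \<mu>_simps[of ?f ?f' ?g ?g', unfolded s] and m2 = \<mu>_simps[of ?f' ?f'' ?g' ?g'', unfolded s]
    and m3 = \<mu>_simps[of "comp1 A ?f' ?f" ?f'' "comp1 B ?g' ?g" ?g''] and m4 = \<mu>_simps[of ?f "comp1 A ?f'' ?f'" ?g "comp1 B ?g'' ?g'"]
  have m3t: "tgt2 C (\<mu> ?f'' (comp1 A ?f' ?f) ?g'' (comp1 B ?g' ?g)) = comp1 C (src2 C \<phi>'') (src2 C (\<mu> ?f' ?f ?g' ?g))"
    using m3(3) m1(2) s(3) by simp
  have m4t: "tgt2 C (\<mu> (comp1 A ?f'' ?f') ?f (comp1 B ?g'' ?g') ?g) = comp1 C (src2 C (\<mu> ?f'' ?f' ?g'' ?g')) (src2 C \<phi>)"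
    using m4(3) m2(2) s(1) by simp
  have b: "src1 C (src2 C (\<mu> ?f' ?f ?g' ?g)) = src1 C (src2 C \<phi>)" "tgt1 C (src2 C (\<mu> ?f' ?f ?g' ?g)) = tgt1 C (src2 C \<phi>')"
    "src1 C (src2 C (\<mu> ?f'' ?f' ?g'' ?g')) = src1 C (src2 C \<phi>')" "tgt1 C (src2 C (\<mu> ?f'' ?f' ?g'' ?g')) = tgt1 C (src2 C \<phi>'')"
    using C.Tw_simps(3,4)[of "\<mu> ?f' ?f ?g' ?g"] C.Tw_simps(3,4)[of "\<mu> ?f'' ?f' ?g'' ?g'"] m1(1,3) m2(1,3) by (simp_all add: n)
  note tg = ncomp_simps(2)[OF n(1,2) eq(1)] ncomp_simps(2)[OF n(2,3) eq(2)]
  have "ncomp \<phi>'' (ncomp \<phi>' \<phi>) = vcomp C (hcomp C (vcomp C \<phi>'' (id2 C (src2 C \<phi>''))) (vcomp C (hcomp C \<phi>' \<phi>) (\<mu> ?f' ?f ?g' ?g)))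
      (\<mu> ?f'' (comp1 A ?f' ?f) ?g'' (comp1 B ?g' ?g))"
    unfolding ncomp_def[of \<phi>''] tg by (simp add: ncomp_def)
  also have "\<dots> = vcomp C (hcomp C \<phi>'' (hcomp C \<phi>' \<phi>)) (vcomp C (hcomp C (id2 C (src2 C \<phi>'')) (\<mu> ?f' ?f ?g' ?g))
      (\<mu> ?f'' (comp1 A ?f' ?f) ?g'' (comp1 B ?g' ?g)))"
    by (subst C.interchange') (use m1(1,3) m3(1) m3t b in \<open>simp_all del: C.vcomp_id\<close>)
  also have "vcomp C (hcomp C (id2 C (src2 C \<phi>'')) (\<mu> ?f' ?f ?g' ?g)) (\<mu> ?f'' (comp1 A ?f' ?f) ?g'' (comp1 B ?g' ?g)) =
     vcomp C (hcomp C (\<mu> ?f'' ?f' ?g'' ?g') (id2 C (src2 C \<phi>))) (\<mu> (comp1 A ?f'' ?f') ?f (comp1 B ?g'' ?g') ?g)"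
    using \<mu>_assoc[of ?f ?f' ?f'' ?g ?g' ?g'', unfolded s] by simp
  also have "vcomp C (hcomp C \<phi>'' (hcomp C \<phi>' \<phi>)) \<dots> = vcomp C (hcomp C (vcomp C (hcomp C \<phi>'' \<phi>') (\<mu> ?f'' ?f' ?g'' ?g')) (vcomp C \<phi> (id2 C (src2 C \<phi>))))
     (\<mu> (comp1 A ?f'' ?f') ?f (comp1 B ?g'' ?g') ?g)"
    by (subst C.interchange') (use m2(1,3) m4(1) m4t b in \<open>simp_all del: C.vcomp_id\<close>)
  also have "\<dots> = ncomp (ncomp \<phi>'' \<phi>') \<phi>"
    unfolding ncomp_def[of _ \<phi>] tg by (simp add: ncomp_def)
  finally show ?thesis .
qed

text \<open>\<theta> corresponds under \<phi> and \<psi> to the 2-cell between normal forms that its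
  projections determine. As \<phi> is invertible, such a \<theta> is fixed by its projections, which
  is the faithfulness wanted of Q.\<close>

definition compat :: "'u \<Rightarrow> 'u \<Rightarrow> 'u \<Rightarrow> bool" where
  "compat \<phi> \<psi> \<theta> \<longleftrightarrow> vcomp C \<theta> \<phi> = vcomp C \<psi> (T2 (on2 QA \<theta>) (on2 QB \<theta>))"

lemma compat_id: "norm \<phi> \<Longrightarrow> compat \<phi> \<phi> (id2 C (tgt2 C \<phi>))"
  using normD(1,4)[of \<phi>] by (simp add: compat_def T2_id flip: normD(4))

lemma compat_vcomp:
  assumes n: "norm \<phi>" "norm \<psi>" "norm \<chi>" and t: "\<theta> \<in> Tw C" "\<theta>' \<in> Tw C" "src2 C \<theta> = tgt2 C \<phi>" "tgt2 C \<theta> = tgt2 C \<psi>"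
    "src2 C \<theta>' = tgt2 C \<psi>" "tgt2 C \<theta>' = tgt2 C \<chi>" and c: "compat \<phi> \<psi> \<theta>" "compat \<psi> \<chi> \<theta>'"
  shows "compat \<phi> \<chi> (vcomp C \<theta>' \<theta>)"
proof -
  note p = n[THEN normD(1)]
  let ?t = "T2 (on2 QA \<theta>) (on2 QB \<theta>)" and ?t' = "T2 (on2 QA \<theta>') (on2 QB \<theta>')"
  have T: "?t \<in> Tw C" "?t' \<in> Tw C" "tgt2 C ?t = src2 C \<psi>" "src2 C ?t' = src2 C \<psi>" "tgt2 C ?t' = src2 C \<chi>"
    using t n[THEN normD(4)] by simp_all
  have "vcomp C (vcomp C \<theta>' \<theta>) \<phi> = vcomp C \<theta>' (vcomp C \<theta> \<phi>)" using p t by simp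
  also have "\<dots> = vcomp C (vcomp C \<theta>' \<psi>) ?t" using p t c(1) T by (simp add: compat_def)
  also have "\<dots> = vcomp C \<chi> (vcomp C ?t' ?t)" using p T c(2) by (simp add: compat_def)
  also have "vcomp C ?t' ?t = T2 (on2 QA (vcomp C \<theta>' \<theta>)) (on2 QB (vcomp C \<theta>' \<theta>))"
    using t by (simp add: T2_vcomp)
  finally show ?thesis by (simp add: compat_def)
qed

text \<open>Compatibility in each factor leaves a horizontal composite of two \<open>T2\<close>
  cells before \<mu>, and \<open>\<mu>_nat\<close> moves it to the other side.\<close>

lemma compat_hcomp:
  assumes n: "norm \<phi>" "norm \<psi>" "norm \<phi>'" "norm \<psi>'" and t: "\<theta> \<in> Tw C" "\<theta>' \<in> Tw C" "src2 C \<theta> = tgt2 C \<phi>" "tgt2 C \<theta> = tgt2 C \<psi>"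
    "src2 C \<theta>' = tgt2 C \<phi>'" "tgt2 C \<theta>' = tgt2 C \<psi>'" and c: "compat \<phi> \<psi> \<theta>" "compat \<phi>' \<psi>' \<theta>'"
    and eq: "src1 C (tgt2 C \<phi>') = tgt1 C (tgt2 C \<phi>)"
  shows "compat (ncomp \<phi>' \<phi>) (ncomp \<psi>' \<psi>) (hcomp C \<theta>' \<theta>)"
proof -
  note p = n[THEN normD(1)]
  let ?t = "T2 (on2 QA \<theta>) (on2 QB \<theta>)" and ?t' = "T2 (on2 QA \<theta>') (on2 QB \<theta>')"
  let ?m = "\<mu> (on1 QA (src2 C \<theta>')) (on1 QA (src2 C \<theta>)) (on1 QB (src2 C \<theta>')) (on1 QB (src2 C \<theta>))"
  let ?n = "\<mu> (on1 QA (tgt2 C \<theta>')) (on1 QA (tgt2 C \<theta>)) (on1 QB (tgt2 C \<theta>')) (on1 QB (tgt2 C \<theta>))"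
  have eqt [simp]: "src1 C (src2 C \<theta>') = tgt1 C (src2 C \<theta>)" using eq t by simp
  have T: "?t \<in> Tw C" "?t' \<in> Tw C" "src2 C ?t = src2 C \<phi>" "tgt2 C ?t = src2 C \<psi>" "src2 C ?t' = src2 C \<phi>'" "tgt2 C ?t' = src2 C \<psi>'"
    using t n[THEN normD(4)] by simp_all
  have e1: "src1 C (src2 C \<phi>') = tgt1 C (src2 C \<phi>)" using eq p by simp
  have e2: "src1 C (src2 C \<psi>') = tgt1 C (src2 C \<psi>)"
    using eqt t p C.Tw_simps(3)[of \<theta>'] C.Tw_simps(4)[of \<theta>] C.Tw_simps(3)[of \<psi>'] C.Tw_simps(4)[of \<psi>] by simp
  have M: "?m \<in> Tw C" "?n \<in> Tw C" "tgt2 C ?m = comp1 C (src2 C \<phi>') (src2 C \<phi>)" "tgt2 C ?n = comp1 C (src2 C \<psi>') (src2 C \<psi>)"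
  proof -
    show "?m \<in> Tw C" "?n \<in> Tw C" using t(1,2) eqt by (intro \<mu>_simps; simp)+
    have "tgt2 C ?m = comp1 C (src2 C ?t') (src2 C ?t)" "tgt2 C ?n = comp1 C (tgt2 C ?t') (tgt2 C ?t)"
      using t(1,2) eqt by simp_all
    then show "tgt2 C ?m = comp1 C (src2 C \<phi>') (src2 C \<phi>)" "tgt2 C ?n = comp1 C (src2 C \<psi>') (src2 C \<psi>)"
      by (simp_all only: T)
  qed
  have nat: "vcomp C (hcomp C ?t' ?t) ?m = vcomp C ?n (T2 (on2 QA (hcomp C \<theta>' \<theta>)) (on2 QB (hcomp C \<theta>' \<theta>)))"
    using \<mu>_nat[of "on2 QA \<theta>" "on2 QA \<theta>'" "on2 QB \<theta>" "on2 QB \<theta>'"] t(1,2) eqt by simp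
  have tt: "T2 (on2 QA (hcomp C \<theta>' \<theta>)) (on2 QB (hcomp C \<theta>' \<theta>)) \<in> Tw C"
     "tgt2 C (T2 (on2 QA (hcomp C \<theta>' \<theta>)) (on2 QB (hcomp C \<theta>' \<theta>))) = src2 C ?n"
    using t(1,2) eqt by simp_all
  have nc: "ncomp \<psi>' \<psi> = vcomp C (hcomp C \<psi>' \<psi>) ?n"
    unfolding ncomp_def t ..
  have "vcomp C (hcomp C \<theta>' \<theta>) (ncomp \<phi>' \<phi>) = vcomp C (hcomp C \<theta>' \<theta>) (vcomp C (hcomp C \<phi>' \<phi>) ?m)"
    unfolding ncomp_def t ..
  also have "\<dots> = vcomp C (hcomp C (vcomp C \<theta>' \<phi>') (vcomp C \<theta> \<phi>)) ?m"
    by (subst C.interchange') (use t p e1 M in simp_all)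
  also have "\<dots> = vcomp C (hcomp C (vcomp C \<psi>' ?t') (vcomp C \<psi> ?t)) ?m"
    using c by (simp add: compat_def)
  also have "\<dots> = vcomp C (hcomp C \<psi>' \<psi>) (vcomp C (hcomp C ?t' ?t) ?m)"
    by (subst C.interchange') (use T p e1 e2 M in simp_all)
  also have "\<dots> = vcomp C (ncomp \<psi>' \<psi>) (T2 (on2 QA (hcomp C \<theta>' \<theta>)) (on2 QB (hcomp C \<theta>' \<theta>)))"
    unfolding nat nc by (rule C.vcomp_assoc'[symmetric])
      (rule C.hcomp_simps(1)[OF p(4,2) e2] M(2) tt(1) trans[OF C.hcomp_simps(2)[OF p(4,2) e2] M(4)[symmetric]] tt(2)[symmetric])+
  finally show ?thesis by (simp add: compat_def)
qed

text \<open>The projection to C forgets the isomorphism and keeps its target, so a section of it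
  chooses an isomorphism for every 1-cell of C.\<close>

sublocale N: over_cat C nform "\<lambda>x. x" "tgt2 C" compat
proof (unfold_locales, goal_cases)
  case (9 f)
  then show ?case by (simp add: nform_def ncomp_id)
next
  case (10 f)
  then show ?case by (simp add: nform_def ncomp_id)
next
  case 11
  then show ?case unfolding nform_def by simp (rule ncomp_assoc; simp)
next
  case (18 f)
  then show ?case by (simp add: nform_def compat_id)
next
  case (19 f g h \<sigma> \<tau>)
  then show ?case by (intro compat_vcomp[of f g h]) (simp_all add: nform_def)
next
  case (20 f g f' g' \<sigma> \<tau>)
  then show ?case unfolding nform_def by simp (rule compat_hcomp[of f g f' g']; simp)
qed (simp_all add: nform_def ncomp_simps(1) ncomp_simps(2) normD(1-3) goodD T_id norm_id2 good_src2)

lemma nform_sel [simp]: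
  "Ob nform = Collect good" "Ar nform = Collect norm" "src1 nform \<phi> = src1 C (tgt2 C \<phi>)"
  "tgt1 nform \<phi> = tgt1 C (tgt2 C \<phi>)" "id1 nform x = id2 C (id1 C x)" "comp1 nform = ncomp"
  by (simp_all add: nform_def)

section \<open>Lifting the cubical family to the 2-category of normal forms\<close>

lemma norm_L: "b \<in> Ob B \<Longrightarrow> f \<in> Ar A \<Longrightarrow> norm (id2 C (on1 (LF b) f))"
  by (rule norm_id2) (simp_all add: good_O T_def)

lemma norm_R: "a \<in> Ob A \<Longrightarrow> g \<in> Ar B \<Longrightarrow> norm (id2 C (on1 (RF a) g))"
  by (rule norm_id2) (simp_all add: good_O T_def)

lemma norm_X: "f \<in> Ar A \<Longrightarrow> g \<in> Ar B \<Longrightarrow> norm (X f g)"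
  by (simp add: norm_def X_inv good_O, simp add: T_def)

lemma norm_T: "f \<in> Ar A \<Longrightarrow> g \<in> Ar B \<Longrightarrow> norm (id2 C (T f g))"
  by (rule norm_id2) (simp_all add: good_O)

lemma ncomp_id2:
  assumes "h \<in> Ar C" "k \<in> Ar C" "src1 C h = tgt1 C k" "T (on1 QA h) (on1 QB h) = h" "T (on1 QA k) (on1 QB k) = k"
  shows "ncomp (id2 C h) (id2 C k) = \<mu> (on1 QA h) (on1 QA k) (on1 QB h) (on1 QB k)"
  using \<mu>_simps(1,3)[of "on1 QA k" "on1 QA h" "on1 QB k" "on1 QB h"] assms by (simp add: ncomp_def)

text \<open>The 1-cells of the two copies are in normal form, so they lift with identities. In the
  square of f and g this gives one path the identity as its isomorphism and the other path
  \<open>X f g\<close>, and between these the 2-cell \<open>X f g\<close> is compatible.\<close>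

lemma ncomp_LR:
  "b \<in> Ob B \<Longrightarrow> f' \<in> Ar A \<Longrightarrow> f \<in> Ar A \<Longrightarrow> src1 A f' = tgt1 A f \<Longrightarrow>
    ncomp (id2 C (on1 (LF b) f')) (id2 C (on1 (LF b) f)) = id2 C (on1 (LF b) (comp1 A f' f))"
  "a \<in> Ob A \<Longrightarrow> g' \<in> Ar B \<Longrightarrow> g \<in> Ar B \<Longrightarrow> src1 B g' = tgt1 B g \<Longrightarrow>
    ncomp (id2 C (on1 (RF a) g')) (id2 C (on1 (RF a) g)) = id2 C (on1 (RF a) (comp1 B g' g))"
  "f \<in> Ar A \<Longrightarrow> g \<in> Ar B \<Longrightarrow> ncomp (id2 C (on1 (LF (tgt1 B g)) f)) (id2 C (on1 (RF (src1 A f)) g)) = id2 C (T f g)"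
  "f \<in> Ar A \<Longrightarrow> g \<in> Ar B \<Longrightarrow> ncomp (id2 C (on1 (RF (tgt1 A f)) g)) (id2 C (on1 (LF (src1 B g)) f)) = X f g"
  by (subst ncomp_id2; simp add: T_def; simp add: \<mu>_def X_id_left X_id_right)+

definition "sL b = \<lparr>Dom = A, Cod = N.E, on0 = (\<lambda>a \<in> Ob A. on0 (RF a) b), on1 = (\<lambda>f \<in> Ar A. id2 C (on1 (LF b) f)),
  on2 = (\<lambda>\<tau> \<in> Tw A. N.tri (id2 C (on1 (LF b) (src2 A \<tau>))) (id2 C (on1 (LF b) (tgt2 A \<tau>))) (on2 (LF b) \<tau>))\<rparr>"
definition "sR a = \<lparr>Dom = B, Cod = N.E, on0 = (\<lambda>b \<in> Ob B. on0 (RF a) b), on1 = (\<lambda>g \<in> Ar B. id2 C (on1 (RF a) g)),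
  on2 = (\<lambda>\<sigma> \<in> Tw B. N.tri (id2 C (on1 (RF a) (src2 B \<sigma>))) (id2 C (on1 (RF a) (tgt2 B \<sigma>))) (on2 (RF a) \<sigma>))\<rparr>"
definition "sX f g = N.tri (id2 C (T f g)) (X f g) (X f g)"

lemma cell_L:
  assumes "b \<in> Ob B" "\<tau> \<in> Tw A" "src2 A \<tau> = f"
  shows "N.tri (id2 C (on1 (LF b) f)) (id2 C (on1 (LF b) (tgt2 A \<tau>))) (on2 (LF b) \<tau>) \<in> N.cells"
  using assms by (auto intro!: N.cellsI simp: norm_L compat_def T2_def)

lemma cell_R:
  assumes "a \<in> Ob A" "\<sigma> \<in> Tw B" "src2 B \<sigma> = g"
  shows "N.tri (id2 C (on1 (RF a) g)) (id2 C (on1 (RF a) (tgt2 B \<sigma>))) (on2 (RF a) \<sigma>) \<in> N.cells"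
  using assms by (auto intro!: N.cellsI simp: norm_R compat_def T2_def)

lemma cell_X:
  assumes "f \<in> Ar A" "g \<in> Ar B"
  shows "sX f g \<in> N.cells"
  unfolding sX_def using assms
  by (intro N.cellsI) (simp_all add: norm_X norm_T compat_def T2_id, simp_all add: T_def)

lemma sL_in: "b \<in> Ob B \<Longrightarrow> sL b \<in> Fun A N.E"
  by (rule FunI; simp add: sL_def cell_L norm_L good_O ncomp_LR)

lemma sR_in: "a \<in> Ob A \<Longrightarrow> sR a \<in> Fun B N.E"
  by (rule FunI; simp add: sR_def cell_R norm_R good_O ncomp_LR)

lemma V_s:
  "b \<in> Ob B \<Longrightarrow> N.V \<bullet> sL b = LF b" "a \<in> Ob A \<Longrightarrow> N.V \<bullet> sR a = RF a"
  "f \<in> Ar A \<Longrightarrow> g \<in> Ar B \<Longrightarrow> on2 N.V (sX f g) = X f g"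
proof -
  show "b \<in> Ob B \<Longrightarrow> N.V \<bullet> sL b = LF b"
    by (rule Fun_eqI[OF fcomp_in[OF A.two_category_axioms sL_in N.V_in] LF_in])
      (simp_all add: sL_def cell_L norm_L good_O)
  show "a \<in> Ob A \<Longrightarrow> N.V \<bullet> sR a = RF a"
    by (rule Fun_eqI[OF fcomp_in[OF B.two_category_axioms sR_in N.V_in] RF_in])
      (simp_all add: sR_def cell_R norm_R good_O)
  show "f \<in> Ar A \<Longrightarrow> g \<in> Ar B \<Longrightarrow> on2 N.V (sX f g) = X f g"
    using cell_X[of f g] by simp (simp add: sX_def)
qed

lemma s_cubical: "cubical A B N.E sL sR sX"
proof (rule cubical_lift[OF A.two_category_axioms B.two_category_axioms N.two_category_E N.V_in])
  show "cubical A B C (\<lambda>b. N.V \<bullet> sL b) (\<lambda>a. N.V \<bullet> sR a) (\<lambda>f g. on2 N.V (sX f g))"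
    by (rule cubical_cong[OF cubical_axioms]) (simp_all add: V_s)
  show "\<tau> = \<sigma>" if "\<tau> \<in> Tw N.E" "\<sigma> \<in> Tw N.E" "src2 N.E \<tau> = src2 N.E \<sigma>" "tgt2 N.E \<tau> = tgt2 N.E \<sigma>" "on2 N.V \<tau> = on2 N.V \<sigma>" for \<tau> \<sigma>
    using that by (auto intro: N.cells_eqI)
  fix f g assume fg [simp]: "f \<in> Ar A" "g \<in> Ar B"
  note [simp] = cell_X norm_X norm_T norm_L norm_R
  obtain Y where Y: "Y \<in> Tw C" "src2 C Y = tgt2 C (X f g)" "tgt2 C Y = src2 C (X f g)"
    "vcomp C Y (X f g) = id2 C (src2 C (X f g))" "vcomp C (X f g) Y = id2 C (tgt2 C (X f g))"
    using invertible2_inverse[OF C.two_category_axioms X_inv[OF fg]] by metis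
  \<comment> \<open>X lies over identities, hence so does its inverse Y. This makes Y compatible as
    well, and it becomes the inverse in \<open>N.E\<close>.\<close>
  have "on2 QA (vcomp C Y (X f g)) = on2 QA Y" "on2 QB (vcomp C Y (X f g)) = on2 QB Y"
    using Y(1-3) by simp_all
  then have QY: "on2 QA Y = id2 A f" "on2 QB Y = id2 B g"
    unfolding Y(4) by simp_all
  have "N.tri (X f g) (id2 C (T f g)) Y \<in> N.cells"
    using Y(1-4) by (intro N.cellsI) (simp_all add: compat_def QY T2_id, simp_all add: T_def)
  moreover have "vcomp N.E (N.tri (X f g) (id2 C (T f g)) Y) (sX f g) = id2 N.E (id2 C (T f g))"
    using calculation cell_X[OF fg] Y(4) by (simp, simp add: sX_def T_def)
  moreover have "vcomp N.E (sX f g) (N.tri (X f g) (id2 C (T f g)) Y) = id2 N.E (X f g)"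
    using calculation(1) cell_X[OF fg] Y(5) by (simp, simp add: sX_def)
  ultimately show "invertible2 N.E (sX f g)"
    by (intro invertible2I[where \<sigma> = "N.tri (X f g) (id2 C (T f g)) Y"]) (simp_all, simp_all add: sX_def)
  show "src2 N.E (sX f g) = comp1 N.E (on1 (sL (tgt1 B g)) f) (on1 (sR (src1 A f)) g)"
    by (simp add: sL_def sR_def ncomp_LR) (simp add: sX_def)
  show "tgt2 N.E (sX f g) = comp1 N.E (on1 (sR (tgt1 A f)) g) (on1 (sL (src1 B g)) f)"
    by (simp add: sL_def sR_def ncomp_LR) (simp add: sX_def)
qed (simp_all add: sL_in sR_in, simp add: sL_def sR_def)

section \<open>Consequences of a section of the projection\<close>

context
  fixes S assumes S: "S \<in> Fun C N.E" and VS: "N.V \<bullet> S = fid C"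
begin

lemma S_on1: "c \<in> Ar C \<Longrightarrow> norm (on1 S c)" "c \<in> Ar C \<Longrightarrow> tgt2 C (on1 S c) = c"
proof -
  assume c: "c \<in> Ar C"
  show n: "norm (on1 S c)" using Fun_on(2)[OF S c] by simp
  show "tgt2 C (on1 S c) = c"
    using arg_cong[OF VS, of "\<lambda>H. on1 H c"] c n Fun_Dom[OF S] by simp
qed

lemma S_on2: "\<tau> \<in> Tw C \<Longrightarrow> compat (on1 S (src2 C \<tau>)) (on1 S (tgt2 C \<tau>)) \<tau>"
proof -
  assume t: "\<tau> \<in> Tw C"
  have s: "on2 S \<tau> \<in> N.cells" using Fun_on(3)[OF S t] by simp
  have "lst (on2 S \<tau>) = \<tau>" if "lst = N.lst" for lst
    using arg_cong[OF VS, of "\<lambda>H. on2 H \<tau>"] t s Fun_Dom[OF S] that by simp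
  moreover have "pfst (on2 S \<tau>) = on1 S (src2 C \<tau>)" "N.mid (on2 S \<tau>) = on1 S (tgt2 C \<tau>)"
    using Fun_on(6,7)[OF S t] s by simp_all
  ultimately show ?thesis using N.cellsD(8)[OF s] by simp
qed

text \<open>Compatibility expresses the 2-cell, precomposed with the isomorphism chosen for its
  source, through its projections alone; that isomorphism cancels.\<close>

lemma Q_faithful:
  assumes t: "\<tau> \<in> Tw C" "\<sigma> \<in> Tw C" and e: "src2 C \<tau> = src2 C \<sigma>" "tgt2 C \<tau> = tgt2 C \<sigma>"
    and Q: "on2 QA \<tau> = on2 QA \<sigma>" "on2 QB \<tau> = on2 QB \<sigma>"
  shows "\<tau> = \<sigma>"
proof -
  have n: "norm (on1 S (src2 C \<sigma>))" "tgt2 C (on1 S (src2 C \<sigma>)) = src2 C \<sigma>" using t S_on1 by simp_all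
  have "vcomp C \<tau> (on1 S (src2 C \<sigma>)) = vcomp C \<sigma> (on1 S (src2 C \<sigma>))"
    using S_on2[OF t(1)] S_on2[OF t(2)] e Q by (simp add: compat_def)
  then show ?thesis
    by (rule C.vcomp_cancel_right[OF normD'[OF n(1)]]) (use n t e in simp_all)
qed

text \<open>Conjugate \<open>T2 \<tau> \<sigma>\<close> by the isomorphisms that S chooses for c and
  d. They lie over identities, so the projections are still \<tau> and \<sigma>.\<close>

lemma Q_full:
  assumes c: "c \<in> Ar C" "d \<in> Ar C" "src1 C c = src1 C d" "tgt1 C c = tgt1 C d"
    and t: "\<tau> \<in> Tw A" "\<sigma> \<in> Tw B" "src2 A \<tau> = on1 QA c" "tgt2 A \<tau> = on1 QA d" "src2 B \<sigma> = on1 QB c" "tgt2 B \<sigma> = on1 QB d"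
  shows "\<exists>\<theta>. \<theta> \<in> Tw C \<and> src2 C \<theta> = c \<and> tgt2 C \<theta> = d \<and> on2 QA \<theta> = \<tau> \<and> on2 QB \<theta> = \<sigma>"
proof -
  let ?c = "on1 S c" and ?d = "on1 S d"
  have n: "norm ?c" "tgt2 C ?c = c" "norm ?d" "tgt2 C ?d = d" using c S_on1 by simp_all
  note p = normD(1)[OF n(1)] normD(1)[OF n(3)]
  have s: "src2 C ?c = T (on1 QA c) (on1 QB c)" "src2 C ?d = T (on1 QA d) (on1 QB d)"
    using normD(4)[OF n(1)] normD(4)[OF n(3)] unfolding n by simp_all
  have q: "on2 QA ?d = id2 A (on1 QA d)" "on2 QB ?d = id2 B (on1 QB d)" "on2 QA ?c = id2 A (on1 QA c)" "on2 QB ?c = id2 B (on1 QB c)"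
    using normD(5,6)[OF n(1)] normD(5,6)[OF n(3)] unfolding n by simp_all
  obtain Y where Y: "Y \<in> Tw C" "src2 C Y = c" "tgt2 C Y = T (on1 QA c) (on1 QB c)" "vcomp C ?c Y = id2 C c"
    using invertible2_inverse[OF C.two_category_axioms normD'[OF n(1)]] unfolding s n by metis
  have "on2 QA (vcomp C ?c Y) = on2 QA Y" "on2 QB (vcomp C ?c Y) = on2 QB Y"
    using Y(1-3) p s q c(1) by simp_all
  then have QY: "on2 QA Y = id2 A (on1 QA c)" "on2 QB Y = id2 B (on1 QB c)"
    unfolding Y(4) using c(1) by simp_all
  let ?\<theta> = "vcomp C ?d (vcomp C (T2 \<tau> \<sigma>) Y)"
  have T: "T2 \<tau> \<sigma> \<in> Tw C" "src2 C (T2 \<tau> \<sigma>) = T (on1 QA c) (on1 QB c)" "tgt2 C (T2 \<tau> \<sigma>) = T (on1 QA d) (on1 QB d)"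
    using t by simp_all
  have "?\<theta> \<in> Tw C" "src2 C ?\<theta> = c" "tgt2 C ?\<theta> = d" using T Y(1-3) p(2) s(2) n(4) by simp_all
  moreover have "on2 QA ?\<theta> = \<tau>" "on2 QB ?\<theta> = \<sigma>"
    using T Y(1-3) p(2) s(2) n(4) t QY q by simp_all
  ultimately show ?thesis by blast
qed

end

end

section \<open>The factorisation of the comparison\<close>

lemma fun_hom_sets:
  "Ob (fun_hom B C) = Fun B C"
  "\<eta> \<in> Ar (fun_hom B C) \<longleftrightarrow> csrc \<eta> \<in> Fun B C \<and> ctgt \<eta> \<in> Fun B C \<and>
     cdat \<eta> \<in> (\<Pi>\<^sub>E x \<in> Ob B. hom1 C (on0 (csrc \<eta>) x) (on0 (ctgt \<eta>) x))"
  "\<Gamma> \<in> Tw (fun_hom B C) \<longleftrightarrow> csrc \<Gamma> \<in> Ar (fun_hom B C) \<and> ctgt \<Gamma> \<in> Ar (fun_hom B C) \<and>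
     csrc (csrc \<Gamma>) = csrc (ctgt \<Gamma>) \<and> ctgt (csrc \<Gamma>) = ctgt (ctgt \<Gamma>) \<and>
     cdat \<Gamma> \<in> (\<Pi>\<^sub>E x \<in> Ob B. hom2 C (cdat (csrc \<Gamma>) x) (cdat (ctgt \<Gamma>) x))"
  by (simp_all add: fun_hom_def Let_def)

lemma strict_hom_sets:
  "Ob (strict_hom B C) = Fun B C" "\<eta> \<in> Ar (strict_hom B C) \<longleftrightarrow> two_natural B C \<eta>"
  "\<Gamma> \<in> Tw (strict_hom B C) \<longleftrightarrow> \<Gamma> \<in> Tw (fun_hom B C) \<and> two_natural B C (csrc \<Gamma>) \<and> two_natural B C (ctgt \<Gamma>) \<and>
             (\<forall>a \<in> Ob B. \<forall>b \<in> Ob B. \<forall>f \<in> hom1 B a b.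
                hcomp C (id2 C (on1 (ctgt (csrc \<Gamma>)) f)) (cdat \<Gamma> a) =
                hcomp C (cdat \<Gamma> b) (id2 C (on1 (csrc (csrc \<Gamma>)) f)))"
  by (simp_all add: strict_hom_def fun_hom_sets)

lemma J_sel:
  "Dom (J1 B C) = strict_hom B C" "Cod (J1 B C) = ps_hom B C" "Dom (J2 B C) = ps_hom B C" "Cod (J2 B C) = fun_hom B C"
  "F \<in> Fun B C \<Longrightarrow> on0 (J1 B C) F = F" "F \<in> Fun B C \<Longrightarrow> on0 (J2 B C) F = F"
  "two_natural B C \<eta> \<Longrightarrow> g \<in> Ar B \<Longrightarrow> snd (cdat (on1 (J1 B C) \<eta>)) g = id2 C (comp1 C (cdat \<eta> (tgt1 B g)) (on1 (csrc \<eta>) g))"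
  "\<Gamma> \<in> Tw (strict_hom B C) \<Longrightarrow> cdat (on2 (J1 B C) \<Gamma>) = cdat \<Gamma>"
  "ps_modification B C \<Delta> \<Longrightarrow> cdat (on2 (J2 B C) \<Delta>) = cdat \<Delta>"
  by (simp_all add: J1_def J2_def Let_def strict_hom_sets)

locale gray = funny st0 st1 \<iota>1 \<iota>2 + gray_tensor g0 g1 \<theta>
  for st0 :: "'u tcat \<Rightarrow> 'u tcat \<Rightarrow> 'u tcat" and st1 \<iota>1 \<iota>2 and g0 :: "'u tcat \<Rightarrow> 'u tcat \<Rightarrow> 'u tcat" and g1 \<theta> +
  fixes P Q K :: "'u tcat \<Rightarrow> 'u tcat \<Rightarrow> 'u tfun"
  assumes isP: "is_gray_P st0 \<iota>1 \<iota>2 g0 \<theta> P" and isQ: "is_gray_Q g0 \<theta> Q" and isK: "is_comparison_K st0 \<iota>1 \<iota>2 K"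
begin

section \<open>The factorisation for a fixed pair A, B\<close>

context
  fixes A B :: "'u tcat" assumes A: "A \<in> Obj TwoCat" and B: "B \<in> Obj TwoCat"
begin

interpretation A: ucat A using two_category_Obj[OF A] by (simp add: ucat_def)
interpretation B: ucat B using two_category_Obj[OF B] by (simp add: ucat_def)
interpretation G: cubical A B "g0 A B" "gL A B" "gR A B" "gX A B" by (rule g_cubical[OF A B])

lemmas GO = g0_Obj[OF A B]
lemmas gC = G.C.two_category_axioms
lemmas SO = st0_Obj[OF A B]
lemmas PO = prod_cat_Obj[OF A B]
lemmas PC = two_category_Obj[OF PO]

lemma P_in: "P A B \<in> Fun (st0 A B) (g0 A B)"
  and Q_in: "Q A B \<in> Fun (g0 A B) (prod_cat A B)"
  and K_in: "K A B \<in> Fun (st0 A B) (prod_cat A B)"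
  using isP isQ isK A B unfolding is_gray_P_def is_gray_Q_def is_comparison_K_def by blast+

text \<open>The defining property of P is evaluated at the identity of A \<otimes> B, whose
  transpose is the universal family.\<close>

lemma P_i: "b \<in> Ob B \<Longrightarrow> P A B \<bullet> iL A B b = gL A B b" "a \<in> Ob A \<Longrightarrow> P A B \<bullet> iR A B a = gR A B a"
proof -
  have "curry_funny A B (g0 A B) (\<iota>1 A B) (\<iota>2 A B) (fid (g0 A B) \<bullet> P A B) = J2 B (g0 A B) \<bullet> gU A B"
    using isP A B GO fid_in[OF gC] unfolding is_gray_P_def gU_def by blast
  then have E: "curry_funny A B (g0 A B) (\<iota>1 A B) (\<iota>2 A B) (P A B) = J2 B (g0 A B) \<bullet> gU A B"
    by (simp add: fcomp_fid(2)[OF P_in])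
  note U = gU_in[OF A B]
  note i = i_in[OF A B]
  have D: "Dom (gU A B) = A" using U by (rule Fun_Dom)
  show "P A B \<bullet> iR A B a = gR A B a" if a: "a \<in> Ob A"
  proof -
    have e: "on0 (curry_funny A B (g0 A B) (\<iota>1 A B) (\<iota>2 A B) (P A B)) a = gR A B a"
      unfolding E using a D G.RF_in[OF a] by (simp add: gR_def J_sel)
    show ?thesis
    proof (rule Fun_eqI[OF fcomp_in[OF B.two_category_axioms i(2)[OF a] P_in] G.RF_in[OF a]])
      fix b assume "b \<in> Ob B"
      then show "on0 (P A B \<bullet> iR A B a) b = on0 (gR A B a) b"
        using arg_cong[OF e, of "\<lambda>H. on0 H b"] a Fun_Dom[OF i(2)[OF a]] Fun_Dom[OF \<iota>_in(2)[OF A B]]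
        by (simp add: curry_funny_def curry_into_def Let_def iR_def)
    next
      fix b assume "b \<in> Ar B"
      then show "on1 (P A B \<bullet> iR A B a) b = on1 (gR A B a) b"
        using arg_cong[OF e, of "\<lambda>H. on1 H b"] a Fun_Dom[OF i(2)[OF a]] Fun_Dom[OF \<iota>_in(2)[OF A B]]
        by (simp add: curry_funny_def curry_into_def Let_def iR_def)
    next
      fix b assume "b \<in> Tw B"
      then show "on2 (P A B \<bullet> iR A B a) b = on2 (gR A B a) b"
        using arg_cong[OF e, of "\<lambda>H. on2 H b"] a Fun_Dom[OF i(2)[OF a]] Fun_Dom[OF \<iota>_in(2)[OF A B]]
        by (simp add: curry_funny_def curry_into_def Let_def iR_def)
    qed
  qed
  show "P A B \<bullet> iL A B b = gL A B b" if b: "b \<in> Ob B"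
  proof (rule Fun_eqI_Tw[OF fcomp_in[OF A.two_category_axioms i(1)[OF b] P_in] G.LF_in[OF b] A.two_category_axioms gC])
    fix \<tau> assume t: "\<tau> \<in> Tw A"
    have m: "ps_modification B (g0 A B) (on2 (gU A B) \<tau>)" using Fun_on(3)[OF U t] by simp
    have "cdat (on2 (curry_funny A B (g0 A B) (\<iota>1 A B) (\<iota>2 A B) (P A B)) \<tau>) b = on2 (gL A B b) \<tau>"
      unfolding E using t D m by (simp add: gL_def psL_sel[OF U] J_sel)
    then show "on2 (P A B \<bullet> iL A B b) \<tau> = on2 (gL A B b) \<tau>"
      using b t Fun_Dom[OF i(1)[OF b]] Fun_Dom[OF \<iota>_in(1)[OF A B]]
      by (simp add: curry_funny_def curry_into_def Let_def iL_def)
  qed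
qed

text \<open>The defining property of Q is evaluated at the identity of A x B. Currying that identity
  gives the copies of the two factors, and J1 supplies identities as structure 2-cells.\<close>

lemma Q_g: "b \<in> Ob B \<Longrightarrow> Q A B \<bullet> gL A B b = secL A B b" "a \<in> Ob A \<Longrightarrow> Q A B \<bullet> gR A B a = secR A B a"
  "f \<in> Ar A \<Longrightarrow> g \<in> Ar B \<Longrightarrow> on2 (Q A B) (gX A B f g) = id2 (prod_cat A B) (pair f g)"
proof -
  let ?X = "prod_cat A B"
  have "\<theta> A B ?X (fid ?X \<bullet> Q A B) = J1 B ?X \<bullet> curry_prod A B ?X (fid ?X)"
    using isQ A B PO fid_in[OF PC] unfolding is_gray_Q_def by blast
  then have E: "mkps A B ?X (\<lambda>b. Q A B \<bullet> gL A B b) (\<lambda>a. Q A B \<bullet> gR A B a) (\<lambda>f g. on2 (Q A B) (gX A B f g)) =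
      J1 B ?X \<bullet> curry_prod A B ?X (fid ?X)"
    by (simp add: fcomp_fid(2)[OF Q_in] \<theta>_mkps[OF A B PO Q_in])
  let ?c1 = "\<lambda>f. Cell (secR A B (src1 A f)) (secR A B (tgt1 A f)) (\<lambda>b\<in>Ob B. pair f (id1 B b))"
  let ?c2 = "\<lambda>\<tau>. Cell (?c1 (src2 A \<tau>)) (?c1 (tgt2 A \<tau>)) (\<lambda>b\<in>Ob B. pair \<tau> (id2 B (id1 B b)))"
  have c0: "on0 (curry_prod A B ?X (fid ?X)) a = secR A B a" if "a \<in> Ob A" for a
    using that by (simp add: curry_prod_def curry_into_def Let_def secR_def restrict_def fun_eq_iff)
  have c1: "on1 (curry_prod A B ?X (fid ?X)) f = ?c1 f" if "f \<in> Ar A" for f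
    using that by (simp add: curry_prod_def curry_into_def Let_def secR_def restrict_def fun_eq_iff)
  have c2: "on2 (curry_prod A B ?X (fid ?X)) f = ?c2 f" if "f \<in> Tw A" for f
    using that by (simp add: curry_prod_def curry_into_def Let_def secR_def restrict_def fun_eq_iff)
  have D: "Dom (curry_prod A B ?X (fid ?X)) = A" by (simp add: curry_prod_def curry_into_def Let_def)
  note sec = sec_in[OF A.two_category_axioms B.two_category_axioms]
  have ar: "?c1 f \<in> Ar (fun_hom B ?X)" if "f \<in> Ar A" for f
    using that by (auto simp: fun_hom_sets sec hom1_def)
  \<comment> \<open>\<open>J1\<close> is restricted to the cells of \<open>strict_hom\<close>, so
    these memberships are shown before its values are used.\<close>
  have n1: "two_natural B ?X (?c1 f)" if "f \<in> Ar A" for f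
    unfolding two_natural_def using ar[OF that] that by (auto simp: hom1_def hom2_def)
  have n2: "?c2 \<tau> \<in> Tw (strict_hom B ?X)" if "\<tau> \<in> Tw A" for \<tau>
    using ar[of "src2 A \<tau>"] ar[of "tgt2 A \<tau>"] n1[of "src2 A \<tau>"] n1[of "tgt2 A \<tau>"] that
    by (auto simp: strict_hom_sets fun_hom_sets(3) hom1_def hom2_def)
  show "Q A B \<bullet> gR A B a = secR A B a" if "a \<in> Ob A"
    using arg_cong[OF E, of "\<lambda>H. on0 H a"] that by (simp add: mkps_sel D c0 J_sel sec)
  show "on2 (Q A B) (gX A B f g) = id2 ?X (pair f g)" if "f \<in> Ar A" "g \<in> Ar B"
    using arg_cong[OF E, of "\<lambda>H. snd (cdat (on1 H f)) g"] that by (simp add: mkps_sel D c1 J_sel n1)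
  show "Q A B \<bullet> gL A B b = secL A B b" if b: "b \<in> Ob B"
  proof (rule Fun_eqI_Tw[OF fcomp_in[OF A.two_category_axioms G.LF_in[OF b] Q_in] sec(1)[OF b] A.two_category_axioms PC])
    fix \<tau> assume t: "\<tau> \<in> Tw A"
    then show "on2 (Q A B \<bullet> gL A B b) \<tau> = on2 (secL A B b) \<tau>"
      using arg_cong[OF E, of "\<lambda>H. cdat (on2 H \<tau>) b"] b Fun_Dom[OF G.LF_in[OF b]] J_sel(8)[OF n2[OF t]]
      by (simp add: mkps_sel D c2)
  qed
qed

lemma K_i: "b \<in> Ob B \<Longrightarrow> K A B \<bullet> iL A B b = secL A B b" "a \<in> Ob A \<Longrightarrow> K A B \<bullet> iR A B a = secR A B a"
proof -
  note two = A.two_category_axioms B.two_category_axioms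
  note d = A.two_category_disc B.two_category_disc
  have k: "K A B \<bullet> \<iota>1 A B = prod_fun (fid A) (incl B)" "K A B \<bullet> \<iota>2 A B = prod_fun (incl A) (fid B)"
    using isK A B unfolding is_comparison_K_def by blast+
  show "K A B \<bullet> iL A B b = secL A B b" if b: "b \<in> Ob B"
  proof -
    have b': "b \<in> Ob (disc B)" using b by simp
    have "K A B \<bullet> iL A B b = (K A B \<bullet> \<iota>1 A B) \<bullet> secL A (disc B) b"
      unfolding iL_def by (rule fcomp_assoc[symmetric, OF sec_in(1)[OF two(1) d(2) b'] Fun_Dom[OF \<iota>_in(1)[OF A B]]])
    also have "\<dots> = secL A B (on0 (incl B) b) \<bullet> fid A"
      unfolding k by (rule prod_fun_sec(1)[OF two(1) two(1) d(2) two(2) fid_in[OF two(1)] B.incl_in b'])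
    also have "\<dots> = secL A B b" using b by (simp add: incl_def fcomp_fid(1)[OF sec_in(1)[OF two b]])
    finally show ?thesis .
  qed
  show "K A B \<bullet> iR A B a = secR A B a" if a: "a \<in> Ob A"
  proof -
    have a': "a \<in> Ob (disc A)" using a by simp
    have "K A B \<bullet> iR A B a = (K A B \<bullet> \<iota>2 A B) \<bullet> secR (disc A) B a"
      unfolding iR_def by (rule fcomp_assoc[symmetric, OF sec_in(2)[OF d(1) two(2) a'] Fun_Dom[OF \<iota>_in(2)[OF A B]]])
    also have "\<dots> = secR A B (on0 (incl A) a) \<bullet> fid B"
      unfolding k by (rule prod_fun_sec(2)[OF d(1) two(1) two(2) two(2) A.incl_in fid_in[OF two(2)] a'])
    also have "\<dots> = secR A B a" using a by (simp add: incl_def fcomp_fid(1)[OF sec_in(2)[OF two a]])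
    finally show ?thesis .
  qed
qed

lemma QP: "Q A B \<bullet> P A B = K A B"
proof (rule f_unique[OF A B PO fcomp_in[OF two_category_Obj[OF SO] P_in Q_in] K_in])
  note i = i_in[OF A B]
  show "(Q A B \<bullet> P A B) \<bullet> iL A B b = K A B \<bullet> iL A B b" if "b \<in> Ob B" for b
    using that by (simp add: fcomp_assoc[OF i(1)[OF that] Fun_Dom[OF P_in]] P_i Q_g K_i)
  show "(Q A B \<bullet> P A B) \<bullet> iR A B a = K A B \<bullet> iR A B a" if "a \<in> Ob A" for a
    using that by (simp add: fcomp_assoc[OF i(2)[OF that] Fun_Dom[OF P_in]] P_i Q_g K_i)
qed

text \<open>The inverse is lifted, and the two inverse laws are reflected by local
  faithfulness.\<close>

lemma lff_invertible:
  assumes G: "G \<in> Fun X Y" "lff G" and two: "two_category X" "two_category Y" and t: "\<tau> \<in> Tw X" and inv: "invertible2 Y (on2 G \<tau>)"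
  shows "invertible2 X \<tau>"
proof -
  interpret X: two_category X by fact
  interpret Y: two_category Y by fact
  note [simp] = Fun_simps[OF G(1)]
  obtain \<sigma> where s: "\<sigma> \<in> Tw Y" "src2 Y \<sigma> = tgt2 Y (on2 G \<tau>)" "tgt2 Y \<sigma> = src2 Y (on2 G \<tau>)"
    "vcomp Y \<sigma> (on2 G \<tau>) = id2 Y (src2 Y (on2 G \<tau>))" "vcomp Y (on2 G \<tau>) \<sigma> = id2 Y (tgt2 Y (on2 G \<tau>))"
    using invertible2_inverse[OF two(2) inv] by metis
  obtain \<rho> where r: "\<rho> \<in> Tw X" "src2 X \<rho> = tgt2 X \<tau>" "tgt2 X \<rho> = src2 X \<tau>" "on2 G \<rho> = \<sigma>"
    by (rule lff_ex[OF G two(1), of "tgt2 X \<tau>" "src2 X \<tau>" \<sigma>]) (use s t in auto)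
  have "vcomp X \<rho> \<tau> = id2 X (src2 X \<tau>)" "vcomp X \<tau> \<rho> = id2 X (tgt2 X \<tau>)"
    by (rule lff_inj[OF G two(1)]; use r s t in simp)+
  then show ?thesis using r t by (intro invertible2I)
qed

lemma boba_P: "boba (P A B)"
proof (rule lorth_imp_boba[OF SO GO P_in])
  note i = i_in[OF A B]
  note two = A.two_category_axioms B.two_category_axioms
  show "lorth (P A B)"
    unfolding lorth_def Fun_Dom[OF P_in] Fun_Cod[OF P_in]
  proof (intro ballI impI)
    fix X Y :: "'u tcat" and H U V :: "'u tfun" assume X: "X \<in> Obj TwoCat" and Y: "Y \<in> Obj TwoCat" and H: "H \<in> Fun X Y"
      and U: "U \<in> Fun (st0 A B) X" and V: "V \<in> Fun (g0 A B) Y" and lff: "lff H" and sq: "H \<bullet> U = V \<bullet> P A B"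
    note XY = X[THEN two_category_Obj] Y[THEN two_category_Obj]
    interpret X: two_category X by (rule XY)
    interpret Y: two_category Y by (rule XY)
    interpret c: cubical A B Y "\<lambda>b. V \<bullet> gL A B b" "\<lambda>a. V \<bullet> gR A B a" "\<lambda>f g. on2 V (gX A B f g)"
      by (rule g_cubical_comp[OF A B Y V])
    have UL: "U \<bullet> iL A B b \<in> Fun A X" "H \<bullet> (U \<bullet> iL A B b) = V \<bullet> gL A B b" if "b \<in> Ob B" for b
    proof -
      show "U \<bullet> iL A B b \<in> Fun A X" by (rule fcomp_in[OF two(1) i(1)[OF that] U])
      have "H \<bullet> (U \<bullet> iL A B b) = (H \<bullet> U) \<bullet> iL A B b" by (rule fcomp_assoc[OF i(1)[OF that] Fun_Dom[OF U], symmetric])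
      also have "\<dots> = V \<bullet> P A B \<bullet> iL A B b" unfolding sq by (rule fcomp_assoc[OF i(1)[OF that] Fun_Dom[OF P_in]])
      finally show "H \<bullet> (U \<bullet> iL A B b) = V \<bullet> gL A B b" by (simp add: P_i that)
    qed
    have UR: "U \<bullet> iR A B a \<in> Fun B X" "H \<bullet> (U \<bullet> iR A B a) = V \<bullet> gR A B a" if "a \<in> Ob A" for a
    proof -
      show "U \<bullet> iR A B a \<in> Fun B X" by (rule fcomp_in[OF two(2) i(2)[OF that] U])
      have "H \<bullet> (U \<bullet> iR A B a) = (H \<bullet> U) \<bullet> iR A B a" by (rule fcomp_assoc[OF i(2)[OF that] Fun_Dom[OF U], symmetric])
      also have "\<dots> = V \<bullet> P A B \<bullet> iR A B a" unfolding sq by (rule fcomp_assoc[OF i(2)[OF that] Fun_Dom[OF P_in]])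
      finally show "H \<bullet> (U \<bullet> iR A B a) = V \<bullet> gR A B a" by (simp add: P_i that)
    qed
    define uL where "uL b = U \<bullet> iL A B b" for b
    define uR where "uR a = U \<bullet> iR A B a" for a
    note UL' = UL[folded uL_def] and UR' = UR[folded uR_def]
    note onL = Fun_simps[OF UL'(1)] and onR = Fun_simps[OF UR'(1)]
    have eq: "on0 (uL b) a = on0 (uR a) b" if "a \<in> Ob A" "b \<in> Ob B" for a b
      using i_on0[OF A B that] that Fun_Dom[OF i(1)[OF that(2)]] Fun_Dom[OF i(2)[OF that(1)]] by (simp add: uL_def uR_def)
    have HL1: "on1 H (on1 (uL b) f) = on1 (V \<bullet> gL A B b) f" if "b \<in> Ob B" "f \<in> Ar A" for b f
      using arg_cong[OF UL'(2)[OF that(1)], of "\<lambda>H. on1 H f"] that by (simp add: onL)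
    have HR1: "on1 H (on1 (uR a) g) = on1 (V \<bullet> gR A B a) g" if "a \<in> Ob A" "g \<in> Ar B" for a g
      using arg_cong[OF UR'(2)[OF that(1)], of "\<lambda>H. on1 H g"] that by (simp add: onR)
    let ?s = "\<lambda>f g. comp1 X (on1 (uL (tgt1 B g)) f) (on1 (uR (src1 A f)) g)"
    let ?t = "\<lambda>f g. comp1 X (on1 (uR (tgt1 A f)) g) (on1 (uL (src1 B g)) f)"
    have st: "?s f g \<in> Ar X" "?t f g \<in> Ar X" "src1 X (?s f g) = src1 X (?t f g)" "tgt1 X (?s f g) = tgt1 X (?t f g)"
      "on1 H (?s f g) = src2 Y (on2 V (gX A B f g))" "on1 H (?t f g) = tgt2 Y (on2 V (gX A B f g))"
      if "f \<in> Ar A" "g \<in> Ar B" for f g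
      using that by (simp_all add: onL onR eq HL1 HR1 c.X_src c.X_tgt Fun_simps[OF H])
    define ok where "ok f g \<tau> \<longleftrightarrow> \<tau> \<in> Tw X \<and> src2 X \<tau> = ?s f g \<and> tgt2 X \<tau> = ?t f g \<and> on2 H \<tau> = on2 V (gX A B f g)"
      for f g \<tau>
    \<comment> \<open>The unique lift along H of the 2-cell prescribed by V, between the two paths
      already prescribed by U.\<close>
    define x where "x f g = (SOME \<tau>. ok f g \<tau>)" for f g
    have "ok f g (x f g)" if fg: "f \<in> Ar A" "g \<in> Ar B" for f g
    proof -
      obtain \<tau> where "ok f g \<tau>"
        unfolding ok_def by (rule lff_ex[OF H lff XY(1) st(1-4)[OF fg] c.X_Tw[OF fg]]) (use st(5,6)[OF fg] in auto)
      then show ?thesis unfolding x_def by (rule someI)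
    qed
    then have x: "x f g \<in> Tw X" "src2 X (x f g) = ?s f g" "tgt2 X (x f g) = ?t f g" "on2 H (x f g) = on2 V (gX A B f g)"
      if "f \<in> Ar A" "g \<in> Ar B" for f g
      using that unfolding ok_def by blast+
    have cub: "cubical A B X uL uR x"
    proof (rule cubical_lift[OF two XY(1) H lff_inj[OF H lff XY(1)]])
      show "cubical A B Y (\<lambda>b. H \<bullet> uL b) (\<lambda>a. H \<bullet> uR a) (\<lambda>f g. on2 H (x f g))"
        by (rule cubical_cong[OF c.cubical_axioms]) (simp_all add: UL' UR' x)
      show "invertible2 X (x f g)" if "f \<in> Ar A" "g \<in> Ar B" for f g
        by (rule lff_invertible[OF H lff XY]) (use that x c.X_inv in simp_all)
    qed (use UL'(1) UR'(1) eq x in simp_all)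
    obtain W where W: "W \<in> Fun (g0 A B) X" "\<And>b. b \<in> Ob B \<Longrightarrow> W \<bullet> gL A B b = uL b"
      "\<And>a. a \<in> Ob A \<Longrightarrow> W \<bullet> gR A B a = uR a" "\<And>f g. f \<in> Ar A \<Longrightarrow> g \<in> Ar B \<Longrightarrow> on2 W (gX A B f g) = x f g"
      by (rule g_ex[OF A B X cub]) blast
    have "W \<bullet> P A B = U"
    proof (rule f_unique[OF A B X fcomp_in[OF two_category_Obj[OF SO] P_in W(1)] U])
      show "(W \<bullet> P A B) \<bullet> iL A B b = U \<bullet> iL A B b" if "b \<in> Ob B" for b
        using that by (simp add: fcomp_assoc[OF i(1)[OF that] Fun_Dom[OF P_in]] P_i W uL_def)
      show "(W \<bullet> P A B) \<bullet> iR A B a = U \<bullet> iR A B a" if "a \<in> Ob A" for a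
        using that by (simp add: fcomp_assoc[OF i(2)[OF that] Fun_Dom[OF P_in]] P_i W uR_def)
    qed
    moreover have "H \<bullet> W = V"
    proof (rule g_unique[OF A B Y fcomp_in[OF gC W(1) H] V])
      show "(H \<bullet> W) \<bullet> gL A B b = V \<bullet> gL A B b" if "b \<in> Ob B" for b
        using that by (simp add: fcomp_assoc[OF G.LF_in[OF that] Fun_Dom[OF W(1)]] W UL')
      show "(H \<bullet> W) \<bullet> gR A B a = V \<bullet> gR A B a" if "a \<in> Ob A" for a
        using that by (simp add: fcomp_assoc[OF G.RF_in[OF that] Fun_Dom[OF W(1)]] W UR')
      show "on2 (H \<bullet> W) (gX A B f g) = on2 V (gX A B f g)" if "f \<in> Ar A" "g \<in> Ar B" for f g
        using that by (simp add: Fun_Dom[OF W(1)] G.X_Tw W x)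
    qed
    ultimately show "\<exists>W\<in>Fun (g0 A B) X. W \<bullet> P A B = U \<and> H \<bullet> W = V" using W(1) by blast
  qed
qed

lemma lff_Q: "lff (Q A B)"
proof -
  note two = A.two_category_axioms B.two_category_axioms
  note pr = proj_in[OF two]
  let ?QA = "proj1 A B \<bullet> Q A B" and ?QB = "proj2 A B \<bullet> Q A B"
  note QQ = fcomp_in[OF gC Q_in pr(1)] fcomp_in[OF gC Q_in pr(2)]
  note D = Fun_Dom[OF Q_in]
  have L0: "on0 (Q A B) (on0 (gR A B a) b) = pair a b" if "b \<in> Ob B" "a \<in> Ob A" for a b
    using arg_cong[OF Q_g(2)[OF that(2)], of "\<lambda>H. on0 H b"] that by (simp add: G.R_simps)
  have L1: "on1 (Q A B) (on1 (gL A B b) f) = pair f (id1 B b)" if "b \<in> Ob B" "f \<in> Ar A" for b f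
    using arg_cong[OF Q_g(1)[OF that(1)], of "\<lambda>H. on1 H f"] that by (simp add: G.L_simps)
  have L2: "on2 (Q A B) (on2 (gL A B b) f) = pair f (id2 B (id1 B b))" if "b \<in> Ob B" "f \<in> Tw A" for b f
    using arg_cong[OF Q_g(1)[OF that(1)], of "\<lambda>H. on2 H f"] that by (simp add: G.L_simps)
  have R1: "on1 (Q A B) (on1 (gR A B b) f) = pair (id1 A b) f" if "b \<in> Ob A" "f \<in> Ar B" for b f
    using arg_cong[OF Q_g(2)[OF that(1)], of "\<lambda>H. on1 H f"] that by (simp add: G.R_simps)
  have R2: "on2 (Q A B) (on2 (gR A B b) f) = pair (id2 A (id1 A b)) f" if "b \<in> Ob A" "f \<in> Tw B" for b f
    using arg_cong[OF Q_g(2)[OF that(1)], of "\<lambda>H. on2 H f"] that by (simp add: G.R_simps)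
  \<comment> \<open>By \<open>Q_g\<close>, the two components of Q restrict on the copies of A and B
    to projections, and they send X to identities.\<close>
  interpret R: retract_cubical A B "g0 A B" "gL A B" "gR A B" "gX A B" ?QA ?QB
    by unfold_locales
      (use QQ in \<open>simp_all add: D L0 L1 L2 R1 R2 Q_g(3) G.L_simps G.R_simps G.X_simps, simp_all add: proj1_def proj2_def\<close>)
  \<comment> \<open>The universal property tests only against small 2-categories. The 1-cells of the
    normal forms are among the 2-cells of A \<otimes> B, which bounds them.\<close>
  have NO: "R.N.E \<in> Obj TwoCat"
  proof (rule R.N.E_Obj[OF GO])
    have "small (Ob (g0 A B))" "small (Tw (g0 A B))" using GO by (simp_all add: TwoCat_def)
    moreover have "Ob R.nform \<subseteq> Ob (g0 A B)" "Ar R.nform \<subseteq> Tw (g0 A B)"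
      using R.goodD R.normD(1) by auto
    ultimately show "small (Ob R.nform)" "small (Ar R.nform)" unfolding small_def using subset_lt by blast+
  qed
  obtain S where S: "S \<in> Fun (g0 A B) R.N.E" "\<And>b. b \<in> Ob B \<Longrightarrow> S \<bullet> gL A B b = R.sL b"
      "\<And>a. a \<in> Ob A \<Longrightarrow> S \<bullet> gR A B a = R.sR a" "\<And>f g. f \<in> Ar A \<Longrightarrow> g \<in> Ar B \<Longrightarrow> on2 S (gX A B f g) = R.sX f g"
    using g_ex[OF A B NO R.s_cubical] by metis
  \<comment> \<open>Both sides fix the universal family, so uniqueness makes S a section.\<close>
  have VS: "R.N.V \<bullet> S = fid (g0 A B)"
  proof (rule g_unique[OF A B GO fcomp_in[OF gC S(1) R.N.V_in] fid_in[OF gC]])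
    show "(R.N.V \<bullet> S) \<bullet> gL A B b = fid (g0 A B) \<bullet> gL A B b" if "b \<in> Ob B" for b
      using that by (simp add: fcomp_assoc[OF G.LF_in[OF that] Fun_Dom[OF S(1)]] S R.V_s fcomp_fid(2)[OF G.LF_in])
    show "(R.N.V \<bullet> S) \<bullet> gR A B a = fid (g0 A B) \<bullet> gR A B a" if "a \<in> Ob A" for a
      using that by (simp add: fcomp_assoc[OF G.RF_in[OF that] Fun_Dom[OF S(1)]] S R.V_s fcomp_fid(2)[OF G.RF_in])
    show "on2 (R.N.V \<bullet> S) (gX A B f g) = on2 (fid (g0 A B)) (gX A B f g)" if "f \<in> Ar A" "g \<in> Ar B" for f g
      using that by (simp add: Fun_Dom[OF S(1)] G.X_Tw S R.V_s)
  qed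
  show ?thesis
  proof (rule lffI[OF Q_in gC])
    fix \<tau> \<sigma> assume "\<tau> \<in> Tw (g0 A B)" "\<sigma> \<in> Tw (g0 A B)" "src2 (g0 A B) \<tau> = src2 (g0 A B) \<sigma>" "tgt2 (g0 A B) \<tau> = tgt2 (g0 A B) \<sigma>"
      "on2 (Q A B) \<tau> = on2 (Q A B) \<sigma>"
    then show "\<tau> = \<sigma>" by - (rule R.Q_faithful[OF S(1) VS], simp_all add: D)
  next
    fix c d \<rho> assume c: "c \<in> Ar (g0 A B)" "d \<in> Ar (g0 A B)" "src1 (g0 A B) c = src1 (g0 A B) d" "tgt1 (g0 A B) c = tgt1 (g0 A B) d"
      and r: "\<rho> \<in> Tw (prod_cat A B)" "src2 (prod_cat A B) \<rho> = on1 (Q A B) c" "tgt2 (prod_cat A B) \<rho> = on1 (Q A B) d"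
    obtain \<tau> \<sigma> where ts: "\<rho> = pair \<tau> \<sigma>" "\<tau> \<in> Tw A" "\<sigma> \<in> Tw B" using r(1) by (auto elim!: prod_catE)
    have q: "pair (src2 A \<tau>) (src2 B \<sigma>) = on1 (Q A B) c" "pair (tgt2 A \<tau>) (tgt2 B \<sigma>) = on1 (Q A B) d" using r ts by simp_all
    have Qc: "on1 ?QA c = src2 A \<tau>" "on1 ?QB c = src2 B \<sigma>" "on1 ?QA d = tgt2 A \<tau>" "on1 ?QB d = tgt2 B \<sigma>"
      using c ts by (simp_all add: D flip: q, simp_all add: proj1_def proj2_def)
    obtain t where t: "t \<in> Tw (g0 A B)" "src2 (g0 A B) t = c" "tgt2 (g0 A B) t = d" "on2 ?QA t = \<tau>" "on2 ?QB t = \<sigma>"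
      using R.Q_full[OF S(1) VS c ts(2,3)] Qc by auto
    have "on2 (Q A B) t = \<rho>"
      using Fun_on(3)[OF Q_in t(1)] t(1,4,5) ts(1) D by (auto simp: proj1_def proj2_def elim!: prod_catE)
    then show "\<exists>t. t \<in> Tw (g0 A B) \<and> src2 (g0 A B) t = c \<and> tgt2 (g0 A B) t = d \<and> on2 (Q A B) t = \<rho>" using t by blast
  qed
qed

end

section \<open>Naturality of P and Q\<close>

lemma P_natural:
  assumes A: "A \<in> Obj TwoCat" and B: "B \<in> Obj TwoCat" and A': "A' \<in> Obj TwoCat" and B': "B' \<in> Obj TwoCat"
    and F: "F \<in> Fun A A'" and G: "G \<in> Fun B B'"
  shows "P A' B' \<bullet> st1 F G = g1 F G \<bullet> P A B"
proof -
  note s = st1_in[OF A B A' B' F G] and g = g1_in[OF A B A' B' F G]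
  note S = two_category_Obj[OF st0_Obj[OF A B]]
  note i = i_in[OF A B] and i' = i_in[OF A' B']
  note on = Fun_simps[OF F] Fun_simps[OF G]
  show ?thesis
  proof (rule f_unique[OF A B g0_Obj[OF A' B'] fcomp_in[OF S s P_in[OF A' B']] fcomp_in[OF S P_in[OF A B] g]])
    fix b assume b: "b \<in> Ob B"
    have b': "on0 G b \<in> Ob B'" using b by (simp add: on)
    have "(P A' B' \<bullet> st1 F G) \<bullet> iL A B b = P A' B' \<bullet> iL A' B' (on0 G b) \<bullet> F"
      using b by (simp add: fcomp_assoc[OF i(1)[OF b] Fun_Dom[OF s]] st1_on[OF A B A' B' F G])
    also have "\<dots> = (P A' B' \<bullet> iL A' B' (on0 G b)) \<bullet> F"
      by (rule fcomp_assoc[OF F Fun_Dom[OF i'(1)[OF b']], symmetric])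
    also have "\<dots> = (g1 F G \<bullet> P A B) \<bullet> iL A B b"
      using b b' by (simp add: fcomp_assoc[OF i(1)[OF b] Fun_Dom[OF P_in[OF A B]]] P_i A B A' B' g1_on[OF A' B' A B F G])
    finally show "(P A' B' \<bullet> st1 F G) \<bullet> iL A B b = (g1 F G \<bullet> P A B) \<bullet> iL A B b" .
  next
    fix a assume a: "a \<in> Ob A"
    have a': "on0 F a \<in> Ob A'" using a by (simp add: on)
    have "(P A' B' \<bullet> st1 F G) \<bullet> iR A B a = P A' B' \<bullet> iR A' B' (on0 F a) \<bullet> G"
      using a by (simp add: fcomp_assoc[OF i(2)[OF a] Fun_Dom[OF s]] st1_on[OF A B A' B' F G])
    also have "\<dots> = (P A' B' \<bullet> iR A' B' (on0 F a)) \<bullet> G"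
      by (rule fcomp_assoc[OF G Fun_Dom[OF i'(2)[OF a']], symmetric])
    also have "\<dots> = (g1 F G \<bullet> P A B) \<bullet> iR A B a"
      using a a' by (simp add: fcomp_assoc[OF i(2)[OF a] Fun_Dom[OF P_in[OF A B]]] P_i A B A' B' g1_on[OF A' B' A B F G])
    finally show "(P A' B' \<bullet> st1 F G) \<bullet> iR A B a = (g1 F G \<bullet> P A B) \<bullet> iR A B a" .
  qed
qed

lemma Q_natural:
  assumes A: "A \<in> Obj TwoCat" and B: "B \<in> Obj TwoCat" and A': "A' \<in> Obj TwoCat" and B': "B' \<in> Obj TwoCat"
    and F: "F \<in> Fun A A'" and G: "G \<in> Fun B B'"
  shows "Q A' B' \<bullet> g1 F G = prod_fun F G \<bullet> Q A B"
proof -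
  note two = A[THEN two_category_Obj] B[THEN two_category_Obj] A'[THEN two_category_Obj] B'[THEN two_category_Obj]
  note g = g1_in[OF A B A' B' F G] and p = prod_fun_in[OF two(1,2) F G two(3,4)]
  note gt = two_category_Obj[OF g0_Obj[OF A B]]
  note on = Fun_simps[OF F] Fun_simps[OF G]
  note Qi = Q_in[OF A B] and Qi' = Q_in[OF A' B']
  interpret g: cubical A B "g0 A B" "gL A B" "gR A B" "gX A B" by (rule g_cubical[OF A B])
  interpret g': cubical A' B' "g0 A' B'" "gL A' B'" "gR A' B'" "gX A' B'" by (rule g_cubical[OF A' B'])
  show ?thesis
  proof (rule g_unique[OF A B prod_cat_Obj[OF A' B'] fcomp_in[OF gt g Qi'] fcomp_in[OF gt Qi p]])
    fix b assume b: "b \<in> Ob B"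
    have b': "on0 G b \<in> Ob B'" using b by (simp add: on)
    have "(Q A' B' \<bullet> g1 F G) \<bullet> gL A B b = Q A' B' \<bullet> gL A' B' (on0 G b) \<bullet> F"
      using b by (simp add: fcomp_assoc[OF g.LF_in[OF b] Fun_Dom[OF g]] g1_on[OF A' B' A B F G])
    also have "\<dots> = (Q A' B' \<bullet> gL A' B' (on0 G b)) \<bullet> F"
      by (rule fcomp_assoc[OF F Fun_Dom[OF g'.LF_in[OF b']], symmetric])
    also have "\<dots> = (prod_fun F G \<bullet> Q A B) \<bullet> gL A B b"
      using b b' by (simp add: fcomp_assoc[OF g.LF_in[OF b] Fun_Dom[OF Qi]] Q_g A B A' B' prod_fun_sec[OF two(1,3,2,4) F G])
    finally show "(Q A' B' \<bullet> g1 F G) \<bullet> gL A B b = (prod_fun F G \<bullet> Q A B) \<bullet> gL A B b" .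
  next
    fix a assume a: "a \<in> Ob A"
    have a': "on0 F a \<in> Ob A'" using a by (simp add: on)
    have "(Q A' B' \<bullet> g1 F G) \<bullet> gR A B a = Q A' B' \<bullet> gR A' B' (on0 F a) \<bullet> G"
      using a by (simp add: fcomp_assoc[OF g.RF_in[OF a] Fun_Dom[OF g]] g1_on[OF A' B' A B F G])
    also have "\<dots> = (Q A' B' \<bullet> gR A' B' (on0 F a)) \<bullet> G"
      by (rule fcomp_assoc[OF G Fun_Dom[OF g'.RF_in[OF a']], symmetric])
    also have "\<dots> = (prod_fun F G \<bullet> Q A B) \<bullet> gR A B a"
      using a a' by (simp add: fcomp_assoc[OF g.RF_in[OF a] Fun_Dom[OF Qi]] Q_g A B A' B' prod_fun_sec[OF two(1,3,2,4) F G])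
    finally show "(Q A' B' \<bullet> g1 F G) \<bullet> gR A B a = (prod_fun F G \<bullet> Q A B) \<bullet> gR A B a" .
  next
    \<comment> \<open>Q sends the structure 2-cells to identities, before as well as after
      reindexing, and 2-functors preserve identities.\<close>
    fix f h assume fh: "f \<in> Ar A" "h \<in> Ar B"
    then show "on2 (Q A' B' \<bullet> g1 F G) (gX A B f h) = on2 (prod_fun F G \<bullet> Q A B) (gX A B f h)"
      by (simp add: Fun_Dom[OF g] Fun_Dom[OF Qi] g.X_Tw g1_on[OF A' B' A B F G] Q_g A B A' B' on
          two[THEN two_category.id2_simps(1)])
  qed
qed

end

section \<open>Symmetric monoidal categories\<close>

text \<open>\<open>category\<close> has hom-sets but no source and target functions. With
  \<open>dom\<close> and \<open>cod\<close> the typing of a composite becomes an equation that the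
  simplifier can discharge.\<close>

locale typed_category =
  fixes C :: "('o, 'm) category" and dom cod :: "'m \<Rightarrow> 'o"
  assumes Hom_dom: "f \<in> Hom C X Y \<Longrightarrow> dom f = X" and Hom_cod: "f \<in> Hom C X Y \<Longrightarrow> cod f = Y"
    and Id_in: "X \<in> Obj C \<Longrightarrow> Id C X \<in> Hom C X X"
    and Comp_in: "\<lbrakk>X \<in> Obj C; Y \<in> Obj C; Z \<in> Obj C; f \<in> Hom C X Y; g \<in> Hom C Y Z\<rbrakk> \<Longrightarrow> g \<cdot>\<^bsub>C\<^esub> f \<in> Hom C X Z"
    and Id_right: "\<lbrakk>X \<in> Obj C; Y \<in> Obj C; f \<in> Hom C X Y\<rbrakk> \<Longrightarrow> f \<cdot>\<^bsub>C\<^esub> Id C X = f"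
    and Id_left: "\<lbrakk>X \<in> Obj C; Y \<in> Obj C; f \<in> Hom C X Y\<rbrakk> \<Longrightarrow> Id C Y \<cdot>\<^bsub>C\<^esub> f = f"
    and Comp_assoc: "\<lbrakk>W \<in> Obj C; X \<in> Obj C; Y \<in> Obj C; Z \<in> Obj C; f \<in> Hom C W X; g \<in> Hom C X Y; h \<in> Hom C Y Z\<rbrakk> \<Longrightarrow>
      (h \<cdot>\<^bsub>C\<^esub> g) \<cdot>\<^bsub>C\<^esub> f = h \<cdot>\<^bsub>C\<^esub> (g \<cdot>\<^bsub>C\<^esub> f)"
begin

abbreviation cmp (infixr \<open>\<circ>\<circ>\<close> 70) where "g \<circ>\<circ> f \<equiv> Comp C g f"

definition ar :: "'m \<Rightarrow> bool" where
  "ar f \<longleftrightarrow> dom f \<in> Obj C \<and> cod f \<in> Obj C \<and> f \<in> Hom C (dom f) (cod f)"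

lemma arI: "f \<in> Hom C X Y \<Longrightarrow> X \<in> Obj C \<Longrightarrow> Y \<in> Obj C \<Longrightarrow> ar f"
  by (simp add: ar_def Hom_dom Hom_cod)

lemma ar_Hom: "ar f \<Longrightarrow> dom f = X \<Longrightarrow> cod f = Y \<Longrightarrow> f \<in> Hom C X Y"
  by (auto simp: ar_def)

lemma ar_Obj [simp]: "ar f \<Longrightarrow> dom f \<in> Obj C" "ar f \<Longrightarrow> cod f \<in> Obj C"
  by (auto simp: ar_def)

lemma Id_ar [simp]: "X \<in> Obj C \<Longrightarrow> ar (Id C X)" "X \<in> Obj C \<Longrightarrow> dom (Id C X) = X" "X \<in> Obj C \<Longrightarrow> cod (Id C X) = X"
  using arI[OF Id_in] Hom_dom[OF Id_in] Hom_cod[OF Id_in] by blast+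

lemma cmp_ar [simp]:
  assumes "ar g" "ar f" "dom g = cod f"
  shows "ar (g \<circ>\<circ> f)" "dom (g \<circ>\<circ> f) = dom f" "cod (g \<circ>\<circ> f) = cod g"
proof -
  have m: "g \<circ>\<circ> f \<in> Hom C (dom f) (cod g)"
    using Comp_in[of "dom f" "cod f" "cod g" f g] assms unfolding ar_def by simp
  show "ar (g \<circ>\<circ> f)" "dom (g \<circ>\<circ> f) = dom f" "cod (g \<circ>\<circ> f) = cod g"
    using arI[OF m] Hom_dom[OF m] Hom_cod[OF m] assms(1,2) by simp_all
qed

lemma cmp_Id [simp]: "ar f \<Longrightarrow> dom f = X \<Longrightarrow> f \<circ>\<circ> Id C X = f" "ar f \<Longrightarrow> cod f = X \<Longrightarrow> Id C X \<circ>\<circ> f = f"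
  using Id_right[of "dom f" "cod f" f] Id_left[of "dom f" "cod f" f] unfolding ar_def by auto

lemma cmp_assoc [simp]:
  "ar h \<Longrightarrow> ar g \<Longrightarrow> ar f \<Longrightarrow> dom h = cod g \<Longrightarrow> dom g = cod f \<Longrightarrow> (h \<circ>\<circ> g) \<circ>\<circ> f = h \<circ>\<circ> (g \<circ>\<circ> f)"
  by (rule Comp_assoc[of "dom f" "cod f" "cod g" "cod h"]) (auto simp: ar_Hom)

text \<open>Composites are kept right-nested, where an equation for
  \<open>g \<circ>\<circ> f\<close> does not match in front of a further factor h; this is the form
  that applies there.\<close>

lemma cmp_reassoc:
  assumes "g \<circ>\<circ> f = g' \<circ>\<circ> f'" "ar g" "ar f" "dom g = cod f" "ar g'" "ar f'" "dom g' = cod f'" "ar h" "cod h = dom f" "dom f' = dom f"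
  shows "g \<circ>\<circ> (f \<circ>\<circ> h) = g' \<circ>\<circ> (f' \<circ>\<circ> h)"
proof -
  have "g \<circ>\<circ> (f \<circ>\<circ> h) = (g \<circ>\<circ> f) \<circ>\<circ> h" using assms(2-) by simp
  also have "\<dots> = (g' \<circ>\<circ> f') \<circ>\<circ> h" by (simp only: assms(1))
  finally show ?thesis using assms(2-) by simp
qed

lemma iso_ar:
  assumes "iso_in C A B f" "A \<in> Obj C" "B \<in> Obj C"
  shows "ar f" "dom f = A" "cod f = B"
proof -
  have m: "f \<in> Hom C A B" using assms(1) by (simp add: iso_in_def)
  show "ar f" "dom f = A" "cod f = B" using arI[OF m assms(2,3)] Hom_dom[OF m] Hom_cod[OF m] by simp_all
qed

lemma iso_inv:
  assumes "iso_in C A B f" "A \<in> Obj C" "B \<in> Obj C"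
  obtains g where "ar g" "dom g = B" "cod g = A" "g \<circ>\<circ> f = Id C A" "f \<circ>\<circ> g = Id C B" "iso_in C B A g"
proof -
  obtain g where g: "g \<in> Hom C B A" "g \<circ>\<circ> f = Id C A" "f \<circ>\<circ> g = Id C B"
    using assms(1) unfolding iso_in_def by blast
  moreover have "iso_in C B A g" using assms(1) g unfolding iso_in_def by blast
  ultimately show ?thesis using that[of g] arI[OF g(1) assms(3,2)] Hom_dom[OF g(1)] Hom_cod[OF g(1)] by blast
qed

lemma iso_cancel_right:
  assumes "iso_in C A B f" "A \<in> Obj C" "ar g" "ar h" "dom g = B" "dom h = B" "g \<circ>\<circ> f = h \<circ>\<circ> f"
  shows "g = h"
proof -
  have B: "B \<in> Obj C" using assms(3,5) by auto
  obtain k where k: "ar k" "dom k = B" "cod k = A" "k \<circ>\<circ> f = Id C A" "f \<circ>\<circ> k = Id C B"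
    using iso_inv[OF assms(1,2) B] by metis
  note f = iso_ar[OF assms(1,2) B]
  have "(g \<circ>\<circ> f) \<circ>\<circ> k = (h \<circ>\<circ> f) \<circ>\<circ> k" using assms(7) by simp
  then show ?thesis using k f assms(3-6) by simp
qed

lemma iso_cancel_left:
  assumes "iso_in C A B f" "A \<in> Obj C" "B \<in> Obj C" "ar g" "ar h" "cod g = A" "cod h = A" "f \<circ>\<circ> g = f \<circ>\<circ> h"
  shows "g = h"
proof -
  obtain k where k: "ar k" "dom k = B" "cod k = A" "k \<circ>\<circ> f = Id C A" "f \<circ>\<circ> k = Id C B"
    using iso_inv[OF assms(1-3)] by metis
  note f = iso_ar[OF assms(1-3)]
  have "k \<circ>\<circ> (f \<circ>\<circ> g) = k \<circ>\<circ> (f \<circ>\<circ> h)" using assms(8) by simp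
  then have "(k \<circ>\<circ> f) \<circ>\<circ> g = (k \<circ>\<circ> f) \<circ>\<circ> h" using k(1-3) f assms(4-7) by simp
  then show ?thesis using k(4) assms(4-7) by simp
qed

end

section \<open>Bifunctors on a typed category\<close>

locale tensor = typed_category C dom cod for C :: "('o, 'm) category" and dom cod +
  fixes T0 :: "'o \<Rightarrow> 'o \<Rightarrow> 'o" and T1 :: "'m \<Rightarrow> 'm \<Rightarrow> 'm"
  assumes bifunctor: "bifunctor C T0 T1"
begin

lemma T0_Obj [simp]: "A \<in> Obj C \<Longrightarrow> B \<in> Obj C \<Longrightarrow> T0 A B \<in> Obj C"
  and T1_Id [simp]: "A \<in> Obj C \<Longrightarrow> B \<in> Obj C \<Longrightarrow> T1 (Id C A) (Id C B) = Id C (T0 A B)"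
  using bifunctor by (auto simp: bifunctor_def)

lemma T1_ar [simp]:
  assumes "ar f" "ar g"
  shows "ar (T1 f g)" "dom (T1 f g) = T0 (dom f) (dom g)" "cod (T1 f g) = T0 (cod f) (cod g)"
proof -
  have "T1 f g \<in> Hom C (T0 (dom f) (dom g)) (T0 (cod f) (cod g))"
    using bifunctor[unfolded bifunctor_def, THEN conjunct2, THEN conjunct1, rule_format,
      of "dom f" "cod f" "dom g" "cod g" f g] assms unfolding ar_def by simp
  from arI[OF this] Hom_dom[OF this] Hom_cod[OF this]
  show "ar (T1 f g)" "dom (T1 f g) = T0 (dom f) (dom g)" "cod (T1 f g) = T0 (cod f) (cod g)"
    using assms by simp_all
qed

lemma T1_cmp:
  assumes "ar f'" "ar f" "ar g'" "ar g" "dom f' = cod f" "dom g' = cod g"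
  shows "T1 f' g' \<circ>\<circ> T1 f g = T1 (f' \<circ>\<circ> f) (g' \<circ>\<circ> g)"
  using bifunctor[unfolded bifunctor_def, THEN conjunct2, THEN conjunct2, rule_format,
      of "dom f" "cod f" "cod f'" "dom g" "cod g" "cod g'" f f' g g'] assms unfolding ar_def by simp

lemma T1_cmp':
  assumes "ar f'" "ar f" "ar g'" "ar g" "dom f' = cod f" "dom g' = cod g" "ar h" "cod h = T0 (dom f) (dom g)"
  shows "T1 f' g' \<circ>\<circ> (T1 f g \<circ>\<circ> h) = T1 (f' \<circ>\<circ> f) (g' \<circ>\<circ> g) \<circ>\<circ> h"
  using T1_cmp[OF assms(1-6)] assms by (simp flip: cmp_assoc)

end

section \<open>Unit coherence in a symmetric monoidal category\<close>

locale monoidal_category = typed_category C dom cod + symmetric_monoidal C M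
  for C :: "('o, 'm) category" and dom cod and M

sublocale monoidal_category \<subseteq> T: tensor C dom cod "tens0 M" "tens1 M"
  by unfold_locales (rule tens_bifunctor)

context monoidal_category begin

abbreviation "I \<equiv> unit_ob M"
lemmas [simp] = unit_ob_in

lemma coherence_ar [simp]:
  "\<lbrakk>X \<in> Obj C; Y \<in> Obj C; Z \<in> Obj C\<rbrakk> \<Longrightarrow> ar (assoc_map M X Y Z)"
  "\<lbrakk>X \<in> Obj C; Y \<in> Obj C; Z \<in> Obj C\<rbrakk> \<Longrightarrow> dom (assoc_map M X Y Z) = (X \<otimes>\<^bsub>M\<^esub> Y) \<otimes>\<^bsub>M\<^esub> Z"
  "\<lbrakk>X \<in> Obj C; Y \<in> Obj C; Z \<in> Obj C\<rbrakk> \<Longrightarrow> cod (assoc_map M X Y Z) = X \<otimes>\<^bsub>M\<^esub> (Y \<otimes>\<^bsub>M\<^esub> Z)"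
  "X \<in> Obj C \<Longrightarrow> ar (lunit_map M X)" "X \<in> Obj C \<Longrightarrow> dom (lunit_map M X) = I \<otimes>\<^bsub>M\<^esub> X" "X \<in> Obj C \<Longrightarrow> cod (lunit_map M X) = X"
  "X \<in> Obj C \<Longrightarrow> ar (runit_map M X)" "X \<in> Obj C \<Longrightarrow> dom (runit_map M X) = X \<otimes>\<^bsub>M\<^esub> I" "X \<in> Obj C \<Longrightarrow> cod (runit_map M X) = X"
  "\<lbrakk>X \<in> Obj C; Y \<in> Obj C\<rbrakk> \<Longrightarrow> ar (symm_map M X Y)"
  "\<lbrakk>X \<in> Obj C; Y \<in> Obj C\<rbrakk> \<Longrightarrow> dom (symm_map M X Y) = X \<otimes>\<^bsub>M\<^esub> Y"
  "\<lbrakk>X \<in> Obj C; Y \<in> Obj C\<rbrakk> \<Longrightarrow> cod (symm_map M X Y) = Y \<otimes>\<^bsub>M\<^esub> X"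
  by (rule iso_ar[OF assoc_iso] iso_ar[OF lunit_iso] iso_ar[OF runit_iso] iso_ar[OF symm_iso]; simp)+

lemma natural:
  "\<lbrakk>ar f; ar g; ar h; X = cod f; Y = cod g; Z = cod h\<rbrakk> \<Longrightarrow> assoc_map M X Y Z \<circ>\<circ> ((f \<odot>\<^bsub>M\<^esub> g) \<odot>\<^bsub>M\<^esub> h) =
     (f \<odot>\<^bsub>M\<^esub> (g \<odot>\<^bsub>M\<^esub> h)) \<circ>\<circ> assoc_map M (dom f) (dom g) (dom h)"
  "\<lbrakk>ar f; X = cod f\<rbrakk> \<Longrightarrow> lunit_map M X \<circ>\<circ> (Id C I \<odot>\<^bsub>M\<^esub> f) = f \<circ>\<circ> lunit_map M (dom f)"
  "\<lbrakk>ar f; X = cod f\<rbrakk> \<Longrightarrow> runit_map M X \<circ>\<circ> (f \<odot>\<^bsub>M\<^esub> Id C I) = f \<circ>\<circ> runit_map M (dom f)"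
  "\<lbrakk>ar f; ar g; X = cod f; Y = cod g\<rbrakk> \<Longrightarrow> symm_map M X Y \<circ>\<circ> (f \<odot>\<^bsub>M\<^esub> g) = (g \<odot>\<^bsub>M\<^esub> f) \<circ>\<circ> symm_map M (dom f) (dom g)"
  using assoc_natural[of "dom f" "dom g" "dom h" "cod f" "cod g" "cod h" f g h] lunit_natural[of "dom f" "cod f" f]
    runit_natural[of "dom f" "cod f" f] symm_natural[of "dom f" "dom g" "cod f" "cod g" f g]
  unfolding ar_def by blast+

text \<open>Tensoring with I is naturally isomorphic to the identity functor by the unit constraint,
  hence faithful.\<close>

lemma Id_tensor_cancel:
  assumes "ar f" "ar g" "dom f = dom g" "cod f = cod g" "Id C I \<odot>\<^bsub>M\<^esub> f = Id C I \<odot>\<^bsub>M\<^esub> g"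
  shows "f = g"
proof (rule iso_cancel_right[OF lunit_iso[of "dom f"]])
  have "f \<circ>\<circ> lunit_map M (dom f) = lunit_map M (cod f) \<circ>\<circ> (Id C I \<odot>\<^bsub>M\<^esub> f)"
    by (rule natural(2)[OF assms(1) refl, symmetric])
  also have "\<dots> = g \<circ>\<circ> lunit_map M (dom f)"
    unfolding assms(3-5) by (rule natural(2)[OF assms(2) refl])
  finally show "f \<circ>\<circ> lunit_map M (dom f) = g \<circ>\<circ> lunit_map M (dom f)" .
qed (use assms in simp_all)

lemma tensor_Id_cancel:
  assumes "ar f" "ar g" "dom f = dom g" "cod f = cod g" "f \<odot>\<^bsub>M\<^esub> Id C I = g \<odot>\<^bsub>M\<^esub> Id C I"
  shows "f = g"
proof (rule iso_cancel_right[OF runit_iso[of "dom f"]])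
  have "f \<circ>\<circ> runit_map M (dom f) = runit_map M (cod f) \<circ>\<circ> (f \<odot>\<^bsub>M\<^esub> Id C I)"
    by (rule natural(3)[OF assms(1) refl, symmetric])
  also have "\<dots> = g \<circ>\<circ> runit_map M (dom f)"
    unfolding assms(3-5) by (rule natural(3)[OF assms(2) refl])
  finally show "f \<circ>\<circ> runit_map M (dom f) = g \<circ>\<circ> runit_map M (dom f)" .
qed (use assms in simp_all)

lemma tensor_iso:
  assumes "iso_in C A B f" "A \<in> Obj C" "B \<in> Obj C" "Z \<in> Obj C"
  shows "iso_in C (A \<otimes>\<^bsub>M\<^esub> Z) (B \<otimes>\<^bsub>M\<^esub> Z) (f \<odot>\<^bsub>M\<^esub> Id C Z)"
proof -
  note f = iso_ar[OF assms(1-3)]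
  obtain g where g: "ar g" "dom g = B" "cod g = A" "g \<circ>\<circ> f = Id C A" "f \<circ>\<circ> g = Id C B"
    using iso_inv[OF assms(1-3)] by metis
  have "f \<odot>\<^bsub>M\<^esub> Id C Z \<in> Hom C (A \<otimes>\<^bsub>M\<^esub> Z) (B \<otimes>\<^bsub>M\<^esub> Z)" "g \<odot>\<^bsub>M\<^esub> Id C Z \<in> Hom C (B \<otimes>\<^bsub>M\<^esub> Z) (A \<otimes>\<^bsub>M\<^esub> Z)"
    using f g assms by (intro ar_Hom; simp)+
  moreover have "(g \<odot>\<^bsub>M\<^esub> Id C Z) \<circ>\<circ> (f \<odot>\<^bsub>M\<^esub> Id C Z) = Id C (A \<otimes>\<^bsub>M\<^esub> Z)" "(f \<odot>\<^bsub>M\<^esub> Id C Z) \<circ>\<circ> (g \<odot>\<^bsub>M\<^esub> Id C Z) = Id C (B \<otimes>\<^bsub>M\<^esub> Z)"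
    using f g assms by (simp_all add: T.T1_cmp)
  ultimately show ?thesis by (auto simp: iso_in_def)
qed

text \<open>Kelly's unit lemma: it suffices to check it after tensoring with \<open>I\<close>, where it follows from the
  pentagon for \<open>I, I, X, Y\<close>.\<close>

lemma lunit_tensor:
  assumes X [simp]: "X \<in> Obj C" and Y [simp]: "Y \<in> Obj C"
  shows "lunit_map M (X \<otimes>\<^bsub>M\<^esub> Y) \<circ>\<circ> assoc_map M I X Y = lunit_map M X \<odot>\<^bsub>M\<^esub> Id C Y"
proof -
  let ?a = "assoc_map M" and ?l = "lunit_map M" and ?r = "runit_map M"
  let ?w = "?a I (I \<otimes>\<^bsub>M\<^esub> X) Y \<circ>\<circ> (?a I I X \<odot>\<^bsub>M\<^esub> Id C Y)"
  have "(Id C I \<odot>\<^bsub>M\<^esub> (?l (X \<otimes>\<^bsub>M\<^esub> Y) \<circ>\<circ> ?a I X Y)) \<circ>\<circ> ?w =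
     (Id C I \<odot>\<^bsub>M\<^esub> ?l (X \<otimes>\<^bsub>M\<^esub> Y)) \<circ>\<circ> ((Id C I \<odot>\<^bsub>M\<^esub> ?a I X Y) \<circ>\<circ> ?w)"
    by (simp add: T.T1_cmp')
  also have "(Id C I \<odot>\<^bsub>M\<^esub> ?a I X Y) \<circ>\<circ> ?w = ?a I I (X \<otimes>\<^bsub>M\<^esub> Y) \<circ>\<circ> ?a (I \<otimes>\<^bsub>M\<^esub> I) X Y"
    by (rule pentagon[symmetric]) simp_all
  also have "(Id C I \<odot>\<^bsub>M\<^esub> ?l (X \<otimes>\<^bsub>M\<^esub> Y)) \<circ>\<circ> \<dots> = ((Id C I \<odot>\<^bsub>M\<^esub> ?l (X \<otimes>\<^bsub>M\<^esub> Y)) \<circ>\<circ> ?a I I (X \<otimes>\<^bsub>M\<^esub> Y)) \<circ>\<circ> ?a (I \<otimes>\<^bsub>M\<^esub> I) X Y"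
    by simp
  also have "\<dots> = (?r I \<odot>\<^bsub>M\<^esub> (Id C X \<odot>\<^bsub>M\<^esub> Id C Y)) \<circ>\<circ> ?a (I \<otimes>\<^bsub>M\<^esub> I) X Y"
    by (subst triangle) simp_all
  also have "\<dots> = ?a I X Y \<circ>\<circ> ((?r I \<odot>\<^bsub>M\<^esub> Id C X) \<odot>\<^bsub>M\<^esub> Id C Y)"
    using natural(1)[of "?r I" "Id C X" "Id C Y" I X Y] by simp
  also have "?r I \<odot>\<^bsub>M\<^esub> Id C X = (Id C I \<odot>\<^bsub>M\<^esub> ?l X) \<circ>\<circ> ?a I I X"
    by (rule triangle[symmetric]) simp_all
  also have "?a I X Y \<circ>\<circ> (((Id C I \<odot>\<^bsub>M\<^esub> ?l X) \<circ>\<circ> ?a I I X) \<odot>\<^bsub>M\<^esub> Id C Y) =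
     (?a I X Y \<circ>\<circ> ((Id C I \<odot>\<^bsub>M\<^esub> ?l X) \<odot>\<^bsub>M\<^esub> Id C Y)) \<circ>\<circ> (?a I I X \<odot>\<^bsub>M\<^esub> Id C Y)"
    by (simp add: T.T1_cmp)
  also have "\<dots> = (Id C I \<odot>\<^bsub>M\<^esub> (?l X \<odot>\<^bsub>M\<^esub> Id C Y)) \<circ>\<circ> ?w"
    by (subst natural(1)) simp_all
  finally have *: "(Id C I \<odot>\<^bsub>M\<^esub> (?l (X \<otimes>\<^bsub>M\<^esub> Y) \<circ>\<circ> ?a I X Y)) \<circ>\<circ> ?w = (Id C I \<odot>\<^bsub>M\<^esub> (?l X \<odot>\<^bsub>M\<^esub> Id C Y)) \<circ>\<circ> ?w" .
  have "(Id C I \<odot>\<^bsub>M\<^esub> (?l (X \<otimes>\<^bsub>M\<^esub> Y) \<circ>\<circ> ?a I X Y)) \<circ>\<circ> ?a I (I \<otimes>\<^bsub>M\<^esub> X) Y = (Id C I \<odot>\<^bsub>M\<^esub> (?l X \<odot>\<^bsub>M\<^esub> Id C Y)) \<circ>\<circ> ?a I (I \<otimes>\<^bsub>M\<^esub> X) Y"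
    by (rule iso_cancel_right[OF tensor_iso[OF assoc_iso, of I I X Y]]) (use * in simp_all)
  then have "Id C I \<odot>\<^bsub>M\<^esub> (?l (X \<otimes>\<^bsub>M\<^esub> Y) \<circ>\<circ> ?a I X Y) = Id C I \<odot>\<^bsub>M\<^esub> (?l X \<odot>\<^bsub>M\<^esub> Id C Y)"
    by - (rule iso_cancel_right[OF assoc_iso[of I "I \<otimes>\<^bsub>M\<^esub> X" Y]], simp_all)
  then show ?thesis by - (rule Id_tensor_cancel, simp_all)
qed

text \<open>The symmetry of X and I after the right unit constraint tensored with I is computed by
  the triangle, naturality, the hexagon for X, I, I and Kelly's lemma. Cancelling the symmetry and
  then the factor I leaves the claim.\<close>

lemma symm_unit:
  assumes X [simp]: "X \<in> Obj C"
  shows "lunit_map M X \<circ>\<circ> symm_map M X I = runit_map M X"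
proof -
  let ?a = "assoc_map M" and ?l = "lunit_map M" and ?r = "runit_map M" and ?s = "symm_map M"
  have "?s X I \<circ>\<circ> (?r X \<odot>\<^bsub>M\<^esub> Id C I) = ?s X I \<circ>\<circ> ((Id C X \<odot>\<^bsub>M\<^esub> ?l I) \<circ>\<circ> ?a X I I)"
    by (simp add: triangle)
  also have "\<dots> = (?s X I \<circ>\<circ> (Id C X \<odot>\<^bsub>M\<^esub> ?l I)) \<circ>\<circ> ?a X I I" by simp
  also have "\<dots> = (?l I \<odot>\<^bsub>M\<^esub> Id C X) \<circ>\<circ> ?s X (I \<otimes>\<^bsub>M\<^esub> I) \<circ>\<circ> ?a X I I"
    by (subst natural(4)) simp_all
  also have "\<dots> = ?l (I \<otimes>\<^bsub>M\<^esub> X) \<circ>\<circ> ?a I I X \<circ>\<circ> ?s X (I \<otimes>\<^bsub>M\<^esub> I) \<circ>\<circ> ?a X I I"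
    by (simp flip: lunit_tensor)
  also have "\<dots> = ?l (I \<otimes>\<^bsub>M\<^esub> X) \<circ>\<circ> (Id C I \<odot>\<^bsub>M\<^esub> ?s X I) \<circ>\<circ> ?a I X I \<circ>\<circ> (?s X I \<odot>\<^bsub>M\<^esub> Id C I)"
    by (simp add: hexagon)
  also have "\<dots> = (?l (I \<otimes>\<^bsub>M\<^esub> X) \<circ>\<circ> (Id C I \<odot>\<^bsub>M\<^esub> ?s X I)) \<circ>\<circ> ?a I X I \<circ>\<circ> (?s X I \<odot>\<^bsub>M\<^esub> Id C I)" by simp
  also have "\<dots> = ?s X I \<circ>\<circ> (?l (X \<otimes>\<^bsub>M\<^esub> I) \<circ>\<circ> ?a I X I) \<circ>\<circ> (?s X I \<odot>\<^bsub>M\<^esub> Id C I)"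
    by (subst natural(2)) simp_all
  also have "\<dots> = ?s X I \<circ>\<circ> ((?l X \<circ>\<circ> ?s X I) \<odot>\<^bsub>M\<^esub> Id C I)"
    by (simp add: lunit_tensor T.T1_cmp)
  finally have "?r X \<odot>\<^bsub>M\<^esub> Id C I = (?l X \<circ>\<circ> ?s X I) \<odot>\<^bsub>M\<^esub> Id C I"
    by - (rule iso_cancel_left[OF symm_iso[of X I]], simp_all)
  then show ?thesis by - (rule tensor_Id_cancel[symmetric], simp_all)
qed

lemma symm_unit':
  assumes X [simp]: "X \<in> Obj C"
  shows "runit_map M X \<circ>\<circ> symm_map M I X = lunit_map M X"
proof -
  have "runit_map M X \<circ>\<circ> symm_map M I X = lunit_map M X \<circ>\<circ> (symm_map M X I \<circ>\<circ> symm_map M I X)"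
    by (simp flip: symm_unit)
  then show ?thesis by (simp add: symm_symm)
qed

end

text \<open>Coherence data \<open>a, l, r, s\<close> for two tensors \<open>M\<close> and \<open>N\<close> related by a natural \<open>\<phi>: M \<rightarrow> N\<close>; the two
  sides of every coherence condition correspond under \<open>\<phi>\<close>.\<close>

locale comparison = typed_category C dom cod + M: tensor C dom cod "tens0 M" "tens1 M" + N: tensor C dom cod "tens0 N" "tens1 N"
  for C :: "('o, 'm) category" and dom cod and M N :: "('o, 'm) smon" +
  fixes \<phi> :: "'o \<Rightarrow> 'o \<Rightarrow> 'm"
  assumes \<phi>_ar [simp]: "\<lbrakk>X \<in> Obj C; Y \<in> Obj C\<rbrakk> \<Longrightarrow> ar (\<phi> X Y)"
      "\<lbrakk>X \<in> Obj C; Y \<in> Obj C\<rbrakk> \<Longrightarrow> dom (\<phi> X Y) = X \<otimes>\<^bsub>M\<^esub> Y" "\<lbrakk>X \<in> Obj C; Y \<in> Obj C\<rbrakk> \<Longrightarrow> cod (\<phi> X Y) = X \<otimes>\<^bsub>N\<^esub> Y"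
    and \<phi>_natural: "\<lbrakk>ar f; ar g; X = cod f; Y = cod g\<rbrakk> \<Longrightarrow> \<phi> X Y \<circ>\<circ> (f \<odot>\<^bsub>M\<^esub> g) = (f \<odot>\<^bsub>N\<^esub> g) \<circ>\<circ> \<phi> (dom f) (dom g)"
    and I_Obj [simp]: "unit_ob M \<in> Obj C" and unit_eq [simp]: "unit_ob N = unit_ob M"
    and M_ar [simp]: "\<lbrakk>X \<in> Obj C; Y \<in> Obj C; Z \<in> Obj C\<rbrakk> \<Longrightarrow> ar (assoc_map M X Y Z)"
      "\<lbrakk>X \<in> Obj C; Y \<in> Obj C; Z \<in> Obj C\<rbrakk> \<Longrightarrow> dom (assoc_map M X Y Z) = (X \<otimes>\<^bsub>M\<^esub> Y) \<otimes>\<^bsub>M\<^esub> Z"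
      "\<lbrakk>X \<in> Obj C; Y \<in> Obj C; Z \<in> Obj C\<rbrakk> \<Longrightarrow> cod (assoc_map M X Y Z) = X \<otimes>\<^bsub>M\<^esub> (Y \<otimes>\<^bsub>M\<^esub> Z)"
      "X \<in> Obj C \<Longrightarrow> ar (lunit_map M X)" "X \<in> Obj C \<Longrightarrow> dom (lunit_map M X) = unit_ob M \<otimes>\<^bsub>M\<^esub> X" "X \<in> Obj C \<Longrightarrow> cod (lunit_map M X) = X"
      "X \<in> Obj C \<Longrightarrow> ar (runit_map M X)" "X \<in> Obj C \<Longrightarrow> dom (runit_map M X) = X \<otimes>\<^bsub>M\<^esub> unit_ob M" "X \<in> Obj C \<Longrightarrow> cod (runit_map M X) = X"
      "\<lbrakk>X \<in> Obj C; Y \<in> Obj C\<rbrakk> \<Longrightarrow> ar (symm_map M X Y)"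
      "\<lbrakk>X \<in> Obj C; Y \<in> Obj C\<rbrakk> \<Longrightarrow> dom (symm_map M X Y) = X \<otimes>\<^bsub>M\<^esub> Y"
      "\<lbrakk>X \<in> Obj C; Y \<in> Obj C\<rbrakk> \<Longrightarrow> cod (symm_map M X Y) = Y \<otimes>\<^bsub>M\<^esub> X"
    and N_ar [simp]: "\<lbrakk>X \<in> Obj C; Y \<in> Obj C; Z \<in> Obj C\<rbrakk> \<Longrightarrow> ar (assoc_map N X Y Z)"
      "\<lbrakk>X \<in> Obj C; Y \<in> Obj C; Z \<in> Obj C\<rbrakk> \<Longrightarrow> dom (assoc_map N X Y Z) = (X \<otimes>\<^bsub>N\<^esub> Y) \<otimes>\<^bsub>N\<^esub> Z"
      "\<lbrakk>X \<in> Obj C; Y \<in> Obj C; Z \<in> Obj C\<rbrakk> \<Longrightarrow> cod (assoc_map N X Y Z) = X \<otimes>\<^bsub>N\<^esub> (Y \<otimes>\<^bsub>N\<^esub> Z)"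
      "X \<in> Obj C \<Longrightarrow> ar (lunit_map N X)" "X \<in> Obj C \<Longrightarrow> dom (lunit_map N X) = unit_ob M \<otimes>\<^bsub>N\<^esub> X" "X \<in> Obj C \<Longrightarrow> cod (lunit_map N X) = X"
      "X \<in> Obj C \<Longrightarrow> ar (runit_map N X)" "X \<in> Obj C \<Longrightarrow> dom (runit_map N X) = X \<otimes>\<^bsub>N\<^esub> unit_ob M" "X \<in> Obj C \<Longrightarrow> cod (runit_map N X) = X"
      "\<lbrakk>X \<in> Obj C; Y \<in> Obj C\<rbrakk> \<Longrightarrow> ar (symm_map N X Y)"
      "\<lbrakk>X \<in> Obj C; Y \<in> Obj C\<rbrakk> \<Longrightarrow> dom (symm_map N X Y) = X \<otimes>\<^bsub>N\<^esub> Y"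
      "\<lbrakk>X \<in> Obj C; Y \<in> Obj C\<rbrakk> \<Longrightarrow> cod (symm_map N X Y) = Y \<otimes>\<^bsub>N\<^esub> X"
    and compat_a: "\<lbrakk>X \<in> Obj C; Y \<in> Obj C; Z \<in> Obj C\<rbrakk> \<Longrightarrow>
          (Id C X \<odot>\<^bsub>N\<^esub> \<phi> Y Z) \<circ>\<circ> \<phi> X (Y \<otimes>\<^bsub>M\<^esub> Z) \<circ>\<circ> assoc_map M X Y Z =
          assoc_map N X Y Z \<circ>\<circ> (\<phi> X Y \<odot>\<^bsub>N\<^esub> Id C Z) \<circ>\<circ> \<phi> (X \<otimes>\<^bsub>M\<^esub> Y) Z"
    and compat_l: "X \<in> Obj C \<Longrightarrow> lunit_map N X \<circ>\<circ> \<phi> (unit_ob M) X = lunit_map M X"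
    and compat_r: "X \<in> Obj C \<Longrightarrow> runit_map N X \<circ>\<circ> \<phi> X (unit_ob M) = runit_map M X"
    and compat_s: "\<lbrakk>X \<in> Obj C; Y \<in> Obj C\<rbrakk> \<Longrightarrow> symm_map N X Y \<circ>\<circ> \<phi> X Y = \<phi> Y X \<circ>\<circ> symm_map M X Y"
begin

text \<open>Comparisons of the threefold tensors in the two bracketings; \<open>compat_a\<close>
  says that they carry one associativity to the other.\<close>

definition "\<phi>l X Y Z = (\<phi> X Y \<odot>\<^bsub>N\<^esub> Id C Z) \<circ>\<circ> \<phi> (X \<otimes>\<^bsub>M\<^esub> Y) Z"
definition "\<phi>r X Y Z = (Id C X \<odot>\<^bsub>N\<^esub> \<phi> Y Z) \<circ>\<circ> \<phi> X (Y \<otimes>\<^bsub>M\<^esub> Z)"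

lemma \<phi>lr_ar [simp]:
  assumes "X \<in> Obj C" "Y \<in> Obj C" "Z \<in> Obj C"
  shows "ar (\<phi>l X Y Z)" "dom (\<phi>l X Y Z) = (X \<otimes>\<^bsub>M\<^esub> Y) \<otimes>\<^bsub>M\<^esub> Z" "cod (\<phi>l X Y Z) = (X \<otimes>\<^bsub>N\<^esub> Y) \<otimes>\<^bsub>N\<^esub> Z"
    "ar (\<phi>r X Y Z)" "dom (\<phi>r X Y Z) = X \<otimes>\<^bsub>M\<^esub> (Y \<otimes>\<^bsub>M\<^esub> Z)" "cod (\<phi>r X Y Z) = X \<otimes>\<^bsub>N\<^esub> (Y \<otimes>\<^bsub>N\<^esub> Z)"
  using assms by (simp_all add: \<phi>l_def \<phi>r_def)

lemma \<phi>r_assoc: "\<lbrakk>X \<in> Obj C; Y \<in> Obj C; Z \<in> Obj C\<rbrakk> \<Longrightarrow> \<phi>r X Y Z \<circ>\<circ> assoc_map M X Y Z = assoc_map N X Y Z \<circ>\<circ> \<phi>l X Y Z"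
  using compat_a[of X Y Z] by (simp add: \<phi>l_def \<phi>r_def)

lemma \<phi>l_natural:
  assumes [simp]: "ar f" "ar g" "ar h"
  shows "\<phi>l (cod f) (cod g) (cod h) \<circ>\<circ> ((f \<odot>\<^bsub>M\<^esub> g) \<odot>\<^bsub>M\<^esub> h) = ((f \<odot>\<^bsub>N\<^esub> g) \<odot>\<^bsub>N\<^esub> h) \<circ>\<circ> \<phi>l (dom f) (dom g) (dom h)"
proof -
  have "\<phi>l (cod f) (cod g) (cod h) \<circ>\<circ> ((f \<odot>\<^bsub>M\<^esub> g) \<odot>\<^bsub>M\<^esub> h) =
    (\<phi> (cod f) (cod g) \<odot>\<^bsub>N\<^esub> Id C (cod h)) \<circ>\<circ> (\<phi> (cod f \<otimes>\<^bsub>M\<^esub> cod g) (cod h) \<circ>\<circ> ((f \<odot>\<^bsub>M\<^esub> g) \<odot>\<^bsub>M\<^esub> h))"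
    by (simp add: \<phi>l_def)
  also have "\<phi> (cod f \<otimes>\<^bsub>M\<^esub> cod g) (cod h) \<circ>\<circ> ((f \<odot>\<^bsub>M\<^esub> g) \<odot>\<^bsub>M\<^esub> h) = ((f \<odot>\<^bsub>M\<^esub> g) \<odot>\<^bsub>N\<^esub> h) \<circ>\<circ> \<phi> (dom f \<otimes>\<^bsub>M\<^esub> dom g) (dom h)"
    by (subst \<phi>_natural) simp_all
  also have "(\<phi> (cod f) (cod g) \<odot>\<^bsub>N\<^esub> Id C (cod h)) \<circ>\<circ> \<dots> = ((\<phi> (cod f) (cod g) \<circ>\<circ> (f \<odot>\<^bsub>M\<^esub> g)) \<odot>\<^bsub>N\<^esub> h) \<circ>\<circ> \<phi> (dom f \<otimes>\<^bsub>M\<^esub> dom g) (dom h)"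
    by (simp add: N.T1_cmp')
  also have "\<phi> (cod f) (cod g) \<circ>\<circ> (f \<odot>\<^bsub>M\<^esub> g) = (f \<odot>\<^bsub>N\<^esub> g) \<circ>\<circ> \<phi> (dom f) (dom g)"
    by (rule \<phi>_natural) simp_all
  also have "(((f \<odot>\<^bsub>N\<^esub> g) \<circ>\<circ> \<phi> (dom f) (dom g)) \<odot>\<^bsub>N\<^esub> h) \<circ>\<circ> \<phi> (dom f \<otimes>\<^bsub>M\<^esub> dom g) (dom h) = ((f \<odot>\<^bsub>N\<^esub> g) \<odot>\<^bsub>N\<^esub> h) \<circ>\<circ> \<phi>l (dom f) (dom g) (dom h)"
    by (simp add: \<phi>l_def N.T1_cmp')
  finally show ?thesis .
qed

lemma \<phi>r_natural:
  assumes [simp]: "ar f" "ar g" "ar h"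
  shows "\<phi>r (cod f) (cod g) (cod h) \<circ>\<circ> (f \<odot>\<^bsub>M\<^esub> (g \<odot>\<^bsub>M\<^esub> h)) = (f \<odot>\<^bsub>N\<^esub> (g \<odot>\<^bsub>N\<^esub> h)) \<circ>\<circ> \<phi>r (dom f) (dom g) (dom h)"
proof -
  have "\<phi>r (cod f) (cod g) (cod h) \<circ>\<circ> (f \<odot>\<^bsub>M\<^esub> (g \<odot>\<^bsub>M\<^esub> h)) =
    (Id C (cod f) \<odot>\<^bsub>N\<^esub> \<phi> (cod g) (cod h)) \<circ>\<circ> (\<phi> (cod f) (cod g \<otimes>\<^bsub>M\<^esub> cod h) \<circ>\<circ> (f \<odot>\<^bsub>M\<^esub> (g \<odot>\<^bsub>M\<^esub> h)))"
    by (simp add: \<phi>r_def)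
  also have "\<phi> (cod f) (cod g \<otimes>\<^bsub>M\<^esub> cod h) \<circ>\<circ> (f \<odot>\<^bsub>M\<^esub> (g \<odot>\<^bsub>M\<^esub> h)) = (f \<odot>\<^bsub>N\<^esub> (g \<odot>\<^bsub>M\<^esub> h)) \<circ>\<circ> \<phi> (dom f) (dom g \<otimes>\<^bsub>M\<^esub> dom h)"
    by (subst \<phi>_natural) simp_all
  also have "(Id C (cod f) \<odot>\<^bsub>N\<^esub> \<phi> (cod g) (cod h)) \<circ>\<circ> \<dots> = (f \<odot>\<^bsub>N\<^esub> (\<phi> (cod g) (cod h) \<circ>\<circ> (g \<odot>\<^bsub>M\<^esub> h))) \<circ>\<circ> \<phi> (dom f) (dom g \<otimes>\<^bsub>M\<^esub> dom h)"
    by (simp add: N.T1_cmp')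
  also have "\<phi> (cod g) (cod h) \<circ>\<circ> (g \<odot>\<^bsub>M\<^esub> h) = (g \<odot>\<^bsub>N\<^esub> h) \<circ>\<circ> \<phi> (dom g) (dom h)"
    by (rule \<phi>_natural) simp_all
  also have "(f \<odot>\<^bsub>N\<^esub> ((g \<odot>\<^bsub>N\<^esub> h) \<circ>\<circ> \<phi> (dom g) (dom h))) \<circ>\<circ> \<phi> (dom f) (dom g \<otimes>\<^bsub>M\<^esub> dom h) = (f \<odot>\<^bsub>N\<^esub> (g \<odot>\<^bsub>N\<^esub> h)) \<circ>\<circ> \<phi>r (dom f) (dom g) (dom h)"
    by (simp add: \<phi>r_def N.T1_cmp')
  finally show ?thesis .
qed

lemma assoc_natural_sides:
  assumes [simp]: "ar f" "ar g" "ar h"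
  shows "\<phi>r (cod f) (cod g) (cod h) \<circ>\<circ> (assoc_map M (cod f) (cod g) (cod h) \<circ>\<circ> ((f \<odot>\<^bsub>M\<^esub> g) \<odot>\<^bsub>M\<^esub> h)) =
      (assoc_map N (cod f) (cod g) (cod h) \<circ>\<circ> ((f \<odot>\<^bsub>N\<^esub> g) \<odot>\<^bsub>N\<^esub> h)) \<circ>\<circ> \<phi>l (dom f) (dom g) (dom h)" (is ?A)
    "\<phi>r (cod f) (cod g) (cod h) \<circ>\<circ> ((f \<odot>\<^bsub>M\<^esub> (g \<odot>\<^bsub>M\<^esub> h)) \<circ>\<circ> assoc_map M (dom f) (dom g) (dom h)) =
      ((f \<odot>\<^bsub>N\<^esub> (g \<odot>\<^bsub>N\<^esub> h)) \<circ>\<circ> assoc_map N (dom f) (dom g) (dom h)) \<circ>\<circ> \<phi>l (dom f) (dom g) (dom h)" (is ?B)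
proof -
  have "\<phi>r (cod f) (cod g) (cod h) \<circ>\<circ> (assoc_map M (cod f) (cod g) (cod h) \<circ>\<circ> ((f \<odot>\<^bsub>M\<^esub> g) \<odot>\<^bsub>M\<^esub> h)) =
     assoc_map N (cod f) (cod g) (cod h) \<circ>\<circ> (\<phi>l (cod f) (cod g) (cod h) \<circ>\<circ> ((f \<odot>\<^bsub>M\<^esub> g) \<odot>\<^bsub>M\<^esub> h))"
    by (rule cmp_reassoc[OF \<phi>r_assoc]) simp_all
  then show ?A by (simp add: \<phi>l_natural)
  have "\<phi>r (cod f) (cod g) (cod h) \<circ>\<circ> ((f \<odot>\<^bsub>M\<^esub> (g \<odot>\<^bsub>M\<^esub> h)) \<circ>\<circ> assoc_map M (dom f) (dom g) (dom h)) =
     (f \<odot>\<^bsub>N\<^esub> (g \<odot>\<^bsub>N\<^esub> h)) \<circ>\<circ> (\<phi>r (dom f) (dom g) (dom h) \<circ>\<circ> assoc_map M (dom f) (dom g) (dom h))"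
    by (rule cmp_reassoc[OF \<phi>r_natural]) simp_all
  then show ?B by (simp add: \<phi>r_assoc)
qed

lemma triangle_sides:
  assumes [simp]: "X \<in> Obj C" "Y \<in> Obj C"
  shows "\<phi> X Y \<circ>\<circ> ((Id C X \<odot>\<^bsub>M\<^esub> lunit_map M Y) \<circ>\<circ> assoc_map M X (unit_ob M) Y) =
      ((Id C X \<odot>\<^bsub>N\<^esub> lunit_map N Y) \<circ>\<circ> assoc_map N X (unit_ob M) Y) \<circ>\<circ> \<phi>l X (unit_ob M) Y" (is ?A)
    "\<phi> X Y \<circ>\<circ> (runit_map M X \<odot>\<^bsub>M\<^esub> Id C Y) = (runit_map N X \<odot>\<^bsub>N\<^esub> Id C Y) \<circ>\<circ> \<phi>l X (unit_ob M) Y" (is ?B)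
proof -
  let ?I = "unit_ob M"
  have "\<phi> X Y \<circ>\<circ> ((Id C X \<odot>\<^bsub>M\<^esub> lunit_map M Y) \<circ>\<circ> assoc_map M X ?I Y) =
    (Id C X \<odot>\<^bsub>N\<^esub> lunit_map M Y) \<circ>\<circ> (\<phi> X (?I \<otimes>\<^bsub>M\<^esub> Y) \<circ>\<circ> assoc_map M X ?I Y)"
    by (rule cmp_reassoc) (simp_all add: \<phi>_natural)
  also have "\<dots> = (Id C X \<odot>\<^bsub>N\<^esub> lunit_map N Y) \<circ>\<circ> (\<phi>r X ?I Y \<circ>\<circ> assoc_map M X ?I Y)"
    by (simp add: \<phi>r_def N.T1_cmp' flip: compat_l)
  also have "\<dots> = ((Id C X \<odot>\<^bsub>N\<^esub> lunit_map N Y) \<circ>\<circ> assoc_map N X ?I Y) \<circ>\<circ> \<phi>l X ?I Y"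
    by (simp add: \<phi>r_assoc)
  finally show ?A .
  have "\<phi> X Y \<circ>\<circ> (runit_map M X \<odot>\<^bsub>M\<^esub> Id C Y) = (runit_map M X \<odot>\<^bsub>N\<^esub> Id C Y) \<circ>\<circ> \<phi> (X \<otimes>\<^bsub>M\<^esub> ?I) Y"
    by (subst \<phi>_natural) simp_all
  also have "\<dots> = (runit_map N X \<odot>\<^bsub>N\<^esub> Id C Y) \<circ>\<circ> \<phi>l X ?I Y"
    by (simp add: \<phi>l_def N.T1_cmp' flip: compat_r)
  finally show ?B .
qed

lemma symm_symm_side:
  assumes [simp]: "X \<in> Obj C" "Y \<in> Obj C"
  shows "\<phi> X Y \<circ>\<circ> (symm_map M Y X \<circ>\<circ> symm_map M X Y) = (symm_map N Y X \<circ>\<circ> symm_map N X Y) \<circ>\<circ> \<phi> X Y"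
proof -
  have "\<phi> X Y \<circ>\<circ> (symm_map M Y X \<circ>\<circ> symm_map M X Y) = symm_map N Y X \<circ>\<circ> (\<phi> Y X \<circ>\<circ> symm_map M X Y)"
    by (rule cmp_reassoc[OF compat_s[symmetric]]) simp_all
  then show ?thesis by (simp flip: compat_s)
qed

lemma symm_natural_sides:
  assumes [simp]: "ar f" "ar g"
  shows "\<phi> (cod g) (cod f) \<circ>\<circ> (symm_map M (cod f) (cod g) \<circ>\<circ> (f \<odot>\<^bsub>M\<^esub> g)) = (symm_map N (cod f) (cod g) \<circ>\<circ> (f \<odot>\<^bsub>N\<^esub> g)) \<circ>\<circ> \<phi> (dom f) (dom g)" (is ?A)
    "\<phi> (cod g) (cod f) \<circ>\<circ> ((g \<odot>\<^bsub>M\<^esub> f) \<circ>\<circ> symm_map M (dom f) (dom g)) = ((g \<odot>\<^bsub>N\<^esub> f) \<circ>\<circ> symm_map N (dom f) (dom g)) \<circ>\<circ> \<phi> (dom f) (dom g)" (is ?B)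
proof -
  have "\<phi> (cod g) (cod f) \<circ>\<circ> (symm_map M (cod f) (cod g) \<circ>\<circ> (f \<odot>\<^bsub>M\<^esub> g)) = symm_map N (cod f) (cod g) \<circ>\<circ> (\<phi> (cod f) (cod g) \<circ>\<circ> (f \<odot>\<^bsub>M\<^esub> g))"
    by (rule cmp_reassoc[OF compat_s[symmetric]]) simp_all
  then show ?A by (simp add: \<phi>_natural)
  have "\<phi> (cod g) (cod f) \<circ>\<circ> ((g \<odot>\<^bsub>M\<^esub> f) \<circ>\<circ> symm_map M (dom f) (dom g)) = (g \<odot>\<^bsub>N\<^esub> f) \<circ>\<circ> (\<phi> (dom g) (dom f) \<circ>\<circ> symm_map M (dom f) (dom g))"
    by (rule cmp_reassoc[OF \<phi>_natural]) simp_all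
  then show ?B by (simp flip: compat_s)
qed

text \<open>Comparisons at the two ends of the pentagon.\<close>

definition "\<phi>ll W X Y Z = (\<phi>l W X Y \<odot>\<^bsub>N\<^esub> Id C Z) \<circ>\<circ> \<phi> ((W \<otimes>\<^bsub>M\<^esub> X) \<otimes>\<^bsub>M\<^esub> Y) Z"
definition "\<phi>rr W X Y Z = (Id C W \<odot>\<^bsub>N\<^esub> \<phi>r X Y Z) \<circ>\<circ> \<phi> W (X \<otimes>\<^bsub>M\<^esub> (Y \<otimes>\<^bsub>M\<^esub> Z))"

text \<open>For the pentagon and the hexagon an inner \<phi> has to be moved through the
  associativity or the symmetry of N. Naturality of these is a hypothesis of this context and not of
  the locale: when N is the middle tensor of a factorisation, its naturality is itself derived from
  the locale.\<close>

context
  assumes N_assoc_natural: "\<And>f g h. \<lbrakk>ar f; ar g; ar h\<rbrakk> \<Longrightarrow> assoc_map N (cod f) (cod g) (cod h) \<circ>\<circ> ((f \<odot>\<^bsub>N\<^esub> g) \<odot>\<^bsub>N\<^esub> h) =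
     (f \<odot>\<^bsub>N\<^esub> (g \<odot>\<^bsub>N\<^esub> h)) \<circ>\<circ> assoc_map N (dom f) (dom g) (dom h)"
   and N_symm_natural: "\<And>f g. \<lbrakk>ar f; ar g\<rbrakk> \<Longrightarrow> symm_map N (cod f) (cod g) \<circ>\<circ> (f \<odot>\<^bsub>N\<^esub> g) = (g \<odot>\<^bsub>N\<^esub> f) \<circ>\<circ> symm_map N (dom f) (dom g)"
begin

lemma pentagon_sides:
  assumes [simp]: "W \<in> Obj C" "X \<in> Obj C" "Y \<in> Obj C" "Z \<in> Obj C"
  shows "\<phi>rr W X Y Z \<circ>\<circ> (assoc_map M W X (Y \<otimes>\<^bsub>M\<^esub> Z) \<circ>\<circ> assoc_map M (W \<otimes>\<^bsub>M\<^esub> X) Y Z) =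
      (assoc_map N W X (Y \<otimes>\<^bsub>N\<^esub> Z) \<circ>\<circ> assoc_map N (W \<otimes>\<^bsub>N\<^esub> X) Y Z) \<circ>\<circ> \<phi>ll W X Y Z" (is ?A)
    "\<phi>rr W X Y Z \<circ>\<circ> ((Id C W \<odot>\<^bsub>M\<^esub> assoc_map M X Y Z) \<circ>\<circ> assoc_map M W (X \<otimes>\<^bsub>M\<^esub> Y) Z \<circ>\<circ> (assoc_map M W X Y \<odot>\<^bsub>M\<^esub> Id C Z)) =
      ((Id C W \<odot>\<^bsub>N\<^esub> assoc_map N X Y Z) \<circ>\<circ> assoc_map N W (X \<otimes>\<^bsub>N\<^esub> Y) Z \<circ>\<circ> (assoc_map N W X Y \<odot>\<^bsub>N\<^esub> Id C Z)) \<circ>\<circ> \<phi>ll W X Y Z" (is ?B)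
proof -
  let ?a = "assoc_map M" and ?b = "assoc_map N"
  have "\<phi>rr W X Y Z \<circ>\<circ> (?a W X (Y \<otimes>\<^bsub>M\<^esub> Z) \<circ>\<circ> ?a (W \<otimes>\<^bsub>M\<^esub> X) Y Z) =
    (Id C W \<odot>\<^bsub>N\<^esub> (Id C X \<odot>\<^bsub>N\<^esub> \<phi> Y Z)) \<circ>\<circ> ((\<phi>r W X (Y \<otimes>\<^bsub>M\<^esub> Z) \<circ>\<circ> ?a W X (Y \<otimes>\<^bsub>M\<^esub> Z)) \<circ>\<circ> ?a (W \<otimes>\<^bsub>M\<^esub> X) Y Z)"
    by (simp add: \<phi>rr_def \<phi>r_def N.T1_cmp')
  also have "\<phi>r W X (Y \<otimes>\<^bsub>M\<^esub> Z) \<circ>\<circ> ?a W X (Y \<otimes>\<^bsub>M\<^esub> Z) = ?b W X (Y \<otimes>\<^bsub>M\<^esub> Z) \<circ>\<circ> \<phi>l W X (Y \<otimes>\<^bsub>M\<^esub> Z)"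
    by (rule \<phi>r_assoc) simp_all
  also have "(Id C W \<odot>\<^bsub>N\<^esub> (Id C X \<odot>\<^bsub>N\<^esub> \<phi> Y Z)) \<circ>\<circ> ((?b W X (Y \<otimes>\<^bsub>M\<^esub> Z) \<circ>\<circ> \<phi>l W X (Y \<otimes>\<^bsub>M\<^esub> Z)) \<circ>\<circ> ?a (W \<otimes>\<^bsub>M\<^esub> X) Y Z) =
     ((Id C W \<odot>\<^bsub>N\<^esub> (Id C X \<odot>\<^bsub>N\<^esub> \<phi> Y Z)) \<circ>\<circ> ?b W X (Y \<otimes>\<^bsub>M\<^esub> Z)) \<circ>\<circ> (\<phi>l W X (Y \<otimes>\<^bsub>M\<^esub> Z) \<circ>\<circ> ?a (W \<otimes>\<^bsub>M\<^esub> X) Y Z)"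
    by simp
  also have "(Id C W \<odot>\<^bsub>N\<^esub> (Id C X \<odot>\<^bsub>N\<^esub> \<phi> Y Z)) \<circ>\<circ> ?b W X (Y \<otimes>\<^bsub>M\<^esub> Z) = ?b W X (Y \<otimes>\<^bsub>N\<^esub> Z) \<circ>\<circ> ((Id C W \<odot>\<^bsub>N\<^esub> Id C X) \<odot>\<^bsub>N\<^esub> \<phi> Y Z)"
    using N_assoc_natural[of "Id C W" "Id C X" "\<phi> Y Z"] by simp
  also have "(?b W X (Y \<otimes>\<^bsub>N\<^esub> Z) \<circ>\<circ> ((Id C W \<odot>\<^bsub>N\<^esub> Id C X) \<odot>\<^bsub>N\<^esub> \<phi> Y Z)) \<circ>\<circ> (\<phi>l W X (Y \<otimes>\<^bsub>M\<^esub> Z) \<circ>\<circ> ?a (W \<otimes>\<^bsub>M\<^esub> X) Y Z) =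
     ?b W X (Y \<otimes>\<^bsub>N\<^esub> Z) \<circ>\<circ> (\<phi> W X \<odot>\<^bsub>N\<^esub> Id C (Y \<otimes>\<^bsub>N\<^esub> Z)) \<circ>\<circ> (\<phi>r (W \<otimes>\<^bsub>M\<^esub> X) Y Z \<circ>\<circ> ?a (W \<otimes>\<^bsub>M\<^esub> X) Y Z)"
    by (simp add: \<phi>l_def \<phi>r_def N.T1_cmp')
  also have "\<phi>r (W \<otimes>\<^bsub>M\<^esub> X) Y Z \<circ>\<circ> ?a (W \<otimes>\<^bsub>M\<^esub> X) Y Z = ?b (W \<otimes>\<^bsub>M\<^esub> X) Y Z \<circ>\<circ> \<phi>l (W \<otimes>\<^bsub>M\<^esub> X) Y Z"
    by (rule \<phi>r_assoc) simp_all
  also have "?b W X (Y \<otimes>\<^bsub>N\<^esub> Z) \<circ>\<circ> (\<phi> W X \<odot>\<^bsub>N\<^esub> Id C (Y \<otimes>\<^bsub>N\<^esub> Z)) \<circ>\<circ> \<dots> =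
     ?b W X (Y \<otimes>\<^bsub>N\<^esub> Z) \<circ>\<circ> ((\<phi> W X \<odot>\<^bsub>N\<^esub> (Id C Y \<odot>\<^bsub>N\<^esub> Id C Z)) \<circ>\<circ> ?b (W \<otimes>\<^bsub>M\<^esub> X) Y Z) \<circ>\<circ> \<phi>l (W \<otimes>\<^bsub>M\<^esub> X) Y Z"
    by simp
  also have "(\<phi> W X \<odot>\<^bsub>N\<^esub> (Id C Y \<odot>\<^bsub>N\<^esub> Id C Z)) \<circ>\<circ> ?b (W \<otimes>\<^bsub>M\<^esub> X) Y Z = ?b (W \<otimes>\<^bsub>N\<^esub> X) Y Z \<circ>\<circ> ((\<phi> W X \<odot>\<^bsub>N\<^esub> Id C Y) \<odot>\<^bsub>N\<^esub> Id C Z)"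
    using N_assoc_natural[of "\<phi> W X" "Id C Y" "Id C Z"] by simp
  finally show ?A by (simp add: \<phi>ll_def \<phi>l_def N.T1_cmp')
  have "\<phi>rr W X Y Z \<circ>\<circ> ((Id C W \<odot>\<^bsub>M\<^esub> ?a X Y Z) \<circ>\<circ> ?a W (X \<otimes>\<^bsub>M\<^esub> Y) Z \<circ>\<circ> (?a W X Y \<odot>\<^bsub>M\<^esub> Id C Z)) =
    (Id C W \<odot>\<^bsub>N\<^esub> \<phi>r X Y Z) \<circ>\<circ> (\<phi> W (X \<otimes>\<^bsub>M\<^esub> (Y \<otimes>\<^bsub>M\<^esub> Z)) \<circ>\<circ> (Id C W \<odot>\<^bsub>M\<^esub> ?a X Y Z)) \<circ>\<circ> ?a W (X \<otimes>\<^bsub>M\<^esub> Y) Z \<circ>\<circ> (?a W X Y \<odot>\<^bsub>M\<^esub> Id C Z)"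
    by (simp add: \<phi>rr_def)
  also have "\<phi> W (X \<otimes>\<^bsub>M\<^esub> (Y \<otimes>\<^bsub>M\<^esub> Z)) \<circ>\<circ> (Id C W \<odot>\<^bsub>M\<^esub> ?a X Y Z) = (Id C W \<odot>\<^bsub>N\<^esub> ?a X Y Z) \<circ>\<circ> \<phi> W ((X \<otimes>\<^bsub>M\<^esub> Y) \<otimes>\<^bsub>M\<^esub> Z)"
    by (subst \<phi>_natural) simp_all
  also have "(Id C W \<odot>\<^bsub>N\<^esub> \<phi>r X Y Z) \<circ>\<circ> ((Id C W \<odot>\<^bsub>N\<^esub> ?a X Y Z) \<circ>\<circ> \<phi> W ((X \<otimes>\<^bsub>M\<^esub> Y) \<otimes>\<^bsub>M\<^esub> Z)) \<circ>\<circ> ?a W (X \<otimes>\<^bsub>M\<^esub> Y) Z \<circ>\<circ> (?a W X Y \<odot>\<^bsub>M\<^esub> Id C Z) =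
     (Id C W \<odot>\<^bsub>N\<^esub> (\<phi>r X Y Z \<circ>\<circ> ?a X Y Z)) \<circ>\<circ> \<phi> W ((X \<otimes>\<^bsub>M\<^esub> Y) \<otimes>\<^bsub>M\<^esub> Z) \<circ>\<circ> ?a W (X \<otimes>\<^bsub>M\<^esub> Y) Z \<circ>\<circ> (?a W X Y \<odot>\<^bsub>M\<^esub> Id C Z)"
    by (simp add: N.T1_cmp')
  also have "\<phi>r X Y Z \<circ>\<circ> ?a X Y Z = ?b X Y Z \<circ>\<circ> \<phi>l X Y Z"
    by (rule \<phi>r_assoc) simp_all
  also have "(Id C W \<odot>\<^bsub>N\<^esub> (?b X Y Z \<circ>\<circ> \<phi>l X Y Z)) \<circ>\<circ> \<phi> W ((X \<otimes>\<^bsub>M\<^esub> Y) \<otimes>\<^bsub>M\<^esub> Z) \<circ>\<circ> ?a W (X \<otimes>\<^bsub>M\<^esub> Y) Z \<circ>\<circ> (?a W X Y \<odot>\<^bsub>M\<^esub> Id C Z) =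
     (Id C W \<odot>\<^bsub>N\<^esub> ?b X Y Z) \<circ>\<circ> (Id C W \<odot>\<^bsub>N\<^esub> (\<phi> X Y \<odot>\<^bsub>N\<^esub> Id C Z)) \<circ>\<circ> (\<phi>r W (X \<otimes>\<^bsub>M\<^esub> Y) Z \<circ>\<circ> ?a W (X \<otimes>\<^bsub>M\<^esub> Y) Z) \<circ>\<circ> (?a W X Y \<odot>\<^bsub>M\<^esub> Id C Z)"
    by (simp add: \<phi>l_def \<phi>r_def N.T1_cmp')
  also have "\<phi>r W (X \<otimes>\<^bsub>M\<^esub> Y) Z \<circ>\<circ> ?a W (X \<otimes>\<^bsub>M\<^esub> Y) Z = ?b W (X \<otimes>\<^bsub>M\<^esub> Y) Z \<circ>\<circ> \<phi>l W (X \<otimes>\<^bsub>M\<^esub> Y) Z"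
    by (rule \<phi>r_assoc) simp_all
  also have "(Id C W \<odot>\<^bsub>N\<^esub> ?b X Y Z) \<circ>\<circ> (Id C W \<odot>\<^bsub>N\<^esub> (\<phi> X Y \<odot>\<^bsub>N\<^esub> Id C Z)) \<circ>\<circ> (?b W (X \<otimes>\<^bsub>M\<^esub> Y) Z \<circ>\<circ> \<phi>l W (X \<otimes>\<^bsub>M\<^esub> Y) Z) \<circ>\<circ> (?a W X Y \<odot>\<^bsub>M\<^esub> Id C Z) =
     (Id C W \<odot>\<^bsub>N\<^esub> ?b X Y Z) \<circ>\<circ> ((Id C W \<odot>\<^bsub>N\<^esub> (\<phi> X Y \<odot>\<^bsub>N\<^esub> Id C Z)) \<circ>\<circ> ?b W (X \<otimes>\<^bsub>M\<^esub> Y) Z) \<circ>\<circ> (\<phi> W (X \<otimes>\<^bsub>M\<^esub> Y) \<odot>\<^bsub>N\<^esub> Id C Z) \<circ>\<circ> (\<phi> (W \<otimes>\<^bsub>M\<^esub> (X \<otimes>\<^bsub>M\<^esub> Y)) Z \<circ>\<circ> (?a W X Y \<odot>\<^bsub>M\<^esub> Id C Z))"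
    by (simp add: \<phi>l_def)
  also have "(Id C W \<odot>\<^bsub>N\<^esub> (\<phi> X Y \<odot>\<^bsub>N\<^esub> Id C Z)) \<circ>\<circ> ?b W (X \<otimes>\<^bsub>M\<^esub> Y) Z = ?b W (X \<otimes>\<^bsub>N\<^esub> Y) Z \<circ>\<circ> ((Id C W \<odot>\<^bsub>N\<^esub> \<phi> X Y) \<odot>\<^bsub>N\<^esub> Id C Z)"
    using N_assoc_natural[of "Id C W" "\<phi> X Y" "Id C Z"] by simp
  also have "\<phi> (W \<otimes>\<^bsub>M\<^esub> (X \<otimes>\<^bsub>M\<^esub> Y)) Z \<circ>\<circ> (?a W X Y \<odot>\<^bsub>M\<^esub> Id C Z) = (?a W X Y \<odot>\<^bsub>N\<^esub> Id C Z) \<circ>\<circ> \<phi> ((W \<otimes>\<^bsub>M\<^esub> X) \<otimes>\<^bsub>M\<^esub> Y) Z"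
    by (subst \<phi>_natural) simp_all
  also have "(Id C W \<odot>\<^bsub>N\<^esub> ?b X Y Z) \<circ>\<circ> (?b W (X \<otimes>\<^bsub>N\<^esub> Y) Z \<circ>\<circ> ((Id C W \<odot>\<^bsub>N\<^esub> \<phi> X Y) \<odot>\<^bsub>N\<^esub> Id C Z)) \<circ>\<circ> (\<phi> W (X \<otimes>\<^bsub>M\<^esub> Y) \<odot>\<^bsub>N\<^esub> Id C Z) \<circ>\<circ> \<dots> =
     (Id C W \<odot>\<^bsub>N\<^esub> ?b X Y Z) \<circ>\<circ> ?b W (X \<otimes>\<^bsub>N\<^esub> Y) Z \<circ>\<circ> ((\<phi>r W X Y \<circ>\<circ> ?a W X Y) \<odot>\<^bsub>N\<^esub> Id C Z) \<circ>\<circ> \<phi> ((W \<otimes>\<^bsub>M\<^esub> X) \<otimes>\<^bsub>M\<^esub> Y) Z"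
    by (simp add: \<phi>r_def N.T1_cmp')
  also have "\<phi>r W X Y \<circ>\<circ> ?a W X Y = ?b W X Y \<circ>\<circ> \<phi>l W X Y"
    by (rule \<phi>r_assoc) simp_all
  finally show ?B by (simp add: \<phi>ll_def N.T1_cmp')
qed

lemma hexagon_sides:
  assumes [simp]: "X \<in> Obj C" "Y \<in> Obj C" "Z \<in> Obj C"
  shows "\<phi>r Y Z X \<circ>\<circ> (assoc_map M Y Z X \<circ>\<circ> symm_map M X (Y \<otimes>\<^bsub>M\<^esub> Z) \<circ>\<circ> assoc_map M X Y Z) =
      (assoc_map N Y Z X \<circ>\<circ> symm_map N X (Y \<otimes>\<^bsub>N\<^esub> Z) \<circ>\<circ> assoc_map N X Y Z) \<circ>\<circ> \<phi>l X Y Z" (is ?A)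
    "\<phi>r Y Z X \<circ>\<circ> ((Id C Y \<odot>\<^bsub>M\<^esub> symm_map M X Z) \<circ>\<circ> assoc_map M Y X Z \<circ>\<circ> (symm_map M X Y \<odot>\<^bsub>M\<^esub> Id C Z)) =
      ((Id C Y \<odot>\<^bsub>N\<^esub> symm_map N X Z) \<circ>\<circ> assoc_map N Y X Z \<circ>\<circ> (symm_map N X Y \<odot>\<^bsub>N\<^esub> Id C Z)) \<circ>\<circ> \<phi>l X Y Z" (is ?B)
proof -
  let ?a = "assoc_map M" and ?b = "assoc_map N" and ?s = "symm_map M" and ?t = "symm_map N"
  have "\<phi>r Y Z X \<circ>\<circ> (?a Y Z X \<circ>\<circ> ?s X (Y \<otimes>\<^bsub>M\<^esub> Z) \<circ>\<circ> ?a X Y Z) = (\<phi>r Y Z X \<circ>\<circ> ?a Y Z X) \<circ>\<circ> ?s X (Y \<otimes>\<^bsub>M\<^esub> Z) \<circ>\<circ> ?a X Y Z"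
    by simp
  also have "\<phi>r Y Z X \<circ>\<circ> ?a Y Z X = ?b Y Z X \<circ>\<circ> \<phi>l Y Z X"
    by (rule \<phi>r_assoc) simp_all
  also have "(?b Y Z X \<circ>\<circ> \<phi>l Y Z X) \<circ>\<circ> ?s X (Y \<otimes>\<^bsub>M\<^esub> Z) \<circ>\<circ> ?a X Y Z =
     ?b Y Z X \<circ>\<circ> (\<phi> Y Z \<odot>\<^bsub>N\<^esub> Id C X) \<circ>\<circ> (\<phi> (Y \<otimes>\<^bsub>M\<^esub> Z) X \<circ>\<circ> ?s X (Y \<otimes>\<^bsub>M\<^esub> Z)) \<circ>\<circ> ?a X Y Z"
    by (simp add: \<phi>l_def)
  also have "\<phi> (Y \<otimes>\<^bsub>M\<^esub> Z) X \<circ>\<circ> ?s X (Y \<otimes>\<^bsub>M\<^esub> Z) = ?t X (Y \<otimes>\<^bsub>M\<^esub> Z) \<circ>\<circ> \<phi> X (Y \<otimes>\<^bsub>M\<^esub> Z)"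
    by (rule compat_s[symmetric]) simp_all
  also have "?b Y Z X \<circ>\<circ> (\<phi> Y Z \<odot>\<^bsub>N\<^esub> Id C X) \<circ>\<circ> (?t X (Y \<otimes>\<^bsub>M\<^esub> Z) \<circ>\<circ> \<phi> X (Y \<otimes>\<^bsub>M\<^esub> Z)) \<circ>\<circ> ?a X Y Z =
     ?b Y Z X \<circ>\<circ> ((\<phi> Y Z \<odot>\<^bsub>N\<^esub> Id C X) \<circ>\<circ> ?t X (Y \<otimes>\<^bsub>M\<^esub> Z)) \<circ>\<circ> \<phi> X (Y \<otimes>\<^bsub>M\<^esub> Z) \<circ>\<circ> ?a X Y Z"
    by simp
  also have "(\<phi> Y Z \<odot>\<^bsub>N\<^esub> Id C X) \<circ>\<circ> ?t X (Y \<otimes>\<^bsub>M\<^esub> Z) = ?t X (Y \<otimes>\<^bsub>N\<^esub> Z) \<circ>\<circ> (Id C X \<odot>\<^bsub>N\<^esub> \<phi> Y Z)"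
    using N_symm_natural[of "Id C X" "\<phi> Y Z"] by simp
  also have "?b Y Z X \<circ>\<circ> (?t X (Y \<otimes>\<^bsub>N\<^esub> Z) \<circ>\<circ> (Id C X \<odot>\<^bsub>N\<^esub> \<phi> Y Z)) \<circ>\<circ> \<phi> X (Y \<otimes>\<^bsub>M\<^esub> Z) \<circ>\<circ> ?a X Y Z =
     ?b Y Z X \<circ>\<circ> ?t X (Y \<otimes>\<^bsub>N\<^esub> Z) \<circ>\<circ> (\<phi>r X Y Z \<circ>\<circ> ?a X Y Z)"
    by (simp add: \<phi>r_def)
  also have "\<phi>r X Y Z \<circ>\<circ> ?a X Y Z = ?b X Y Z \<circ>\<circ> \<phi>l X Y Z"
    by (rule \<phi>r_assoc) simp_all
  finally show ?A by simp
  have "\<phi>r Y Z X \<circ>\<circ> ((Id C Y \<odot>\<^bsub>M\<^esub> ?s X Z) \<circ>\<circ> ?a Y X Z \<circ>\<circ> (?s X Y \<odot>\<^bsub>M\<^esub> Id C Z)) =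
     (Id C Y \<odot>\<^bsub>N\<^esub> \<phi> Z X) \<circ>\<circ> (\<phi> Y (Z \<otimes>\<^bsub>M\<^esub> X) \<circ>\<circ> (Id C Y \<odot>\<^bsub>M\<^esub> ?s X Z)) \<circ>\<circ> ?a Y X Z \<circ>\<circ> (?s X Y \<odot>\<^bsub>M\<^esub> Id C Z)"
    by (simp add: \<phi>r_def)
  also have "\<phi> Y (Z \<otimes>\<^bsub>M\<^esub> X) \<circ>\<circ> (Id C Y \<odot>\<^bsub>M\<^esub> ?s X Z) = (Id C Y \<odot>\<^bsub>N\<^esub> ?s X Z) \<circ>\<circ> \<phi> Y (X \<otimes>\<^bsub>M\<^esub> Z)"
    by (subst \<phi>_natural) simp_all
  also have "(Id C Y \<odot>\<^bsub>N\<^esub> \<phi> Z X) \<circ>\<circ> ((Id C Y \<odot>\<^bsub>N\<^esub> ?s X Z) \<circ>\<circ> \<phi> Y (X \<otimes>\<^bsub>M\<^esub> Z)) \<circ>\<circ> ?a Y X Z \<circ>\<circ> (?s X Y \<odot>\<^bsub>M\<^esub> Id C Z) =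
     (Id C Y \<odot>\<^bsub>N\<^esub> (\<phi> Z X \<circ>\<circ> ?s X Z)) \<circ>\<circ> \<phi> Y (X \<otimes>\<^bsub>M\<^esub> Z) \<circ>\<circ> ?a Y X Z \<circ>\<circ> (?s X Y \<odot>\<^bsub>M\<^esub> Id C Z)"
    by (simp add: N.T1_cmp')
  also have "\<phi> Z X \<circ>\<circ> ?s X Z = ?t X Z \<circ>\<circ> \<phi> X Z"
    by (rule compat_s[symmetric]) simp_all
  also have "(Id C Y \<odot>\<^bsub>N\<^esub> (?t X Z \<circ>\<circ> \<phi> X Z)) \<circ>\<circ> \<phi> Y (X \<otimes>\<^bsub>M\<^esub> Z) \<circ>\<circ> ?a Y X Z \<circ>\<circ> (?s X Y \<odot>\<^bsub>M\<^esub> Id C Z) =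
     (Id C Y \<odot>\<^bsub>N\<^esub> ?t X Z) \<circ>\<circ> (\<phi>r Y X Z \<circ>\<circ> ?a Y X Z) \<circ>\<circ> (?s X Y \<odot>\<^bsub>M\<^esub> Id C Z)"
    by (simp add: \<phi>r_def N.T1_cmp')
  also have "\<phi>r Y X Z \<circ>\<circ> ?a Y X Z = ?b Y X Z \<circ>\<circ> \<phi>l Y X Z"
    by (rule \<phi>r_assoc) simp_all
  also have "(Id C Y \<odot>\<^bsub>N\<^esub> ?t X Z) \<circ>\<circ> (?b Y X Z \<circ>\<circ> \<phi>l Y X Z) \<circ>\<circ> (?s X Y \<odot>\<^bsub>M\<^esub> Id C Z) =
     (Id C Y \<odot>\<^bsub>N\<^esub> ?t X Z) \<circ>\<circ> ?b Y X Z \<circ>\<circ> (\<phi> Y X \<odot>\<^bsub>N\<^esub> Id C Z) \<circ>\<circ> (\<phi> (Y \<otimes>\<^bsub>M\<^esub> X) Z \<circ>\<circ> (?s X Y \<odot>\<^bsub>M\<^esub> Id C Z))"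
    by (simp add: \<phi>l_def)
  also have "\<phi> (Y \<otimes>\<^bsub>M\<^esub> X) Z \<circ>\<circ> (?s X Y \<odot>\<^bsub>M\<^esub> Id C Z) = (?s X Y \<odot>\<^bsub>N\<^esub> Id C Z) \<circ>\<circ> \<phi> (X \<otimes>\<^bsub>M\<^esub> Y) Z"
    by (subst \<phi>_natural) simp_all
  also have "(Id C Y \<odot>\<^bsub>N\<^esub> ?t X Z) \<circ>\<circ> ?b Y X Z \<circ>\<circ> (\<phi> Y X \<odot>\<^bsub>N\<^esub> Id C Z) \<circ>\<circ> \<dots> =
     (Id C Y \<odot>\<^bsub>N\<^esub> ?t X Z) \<circ>\<circ> ?b Y X Z \<circ>\<circ> ((\<phi> Y X \<circ>\<circ> ?s X Y) \<odot>\<^bsub>N\<^esub> Id C Z) \<circ>\<circ> \<phi> (X \<otimes>\<^bsub>M\<^esub> Y) Z"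
    by (simp add: N.T1_cmp')
  also have "\<phi> Y X \<circ>\<circ> ?s X Y = ?t X Y \<circ>\<circ> \<phi> X Y"
    by (rule compat_s[symmetric]) simp_all
  finally show ?B by (simp add: \<phi>l_def N.T1_cmp')
qed

end

end

section \<open>Lifting a monoidal structure along a factorisation\<close>

text \<open>\<open>E\<close> and \<open>R\<close> are the two classes of an orthogonal factorisation system, \<open>P\<close> and \<open>Q\<close> the factors of
  \<open>K\<close>. All coherence maps of the middle tensor are diagonal fillers, and two maps agree as soon as they
  agree after an \<open>E\<close>-map and before an \<open>R\<close>-map.\<close>

locale lifting = S: monoidal_category C dom cod S + N: monoidal_category C dom cod N + G: tensor C dom cod g0 g1
  for C :: "('o, 'm) category" and dom cod and S N :: "('o, 'm) smon" and g0 g1 +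
  fixes K P Q :: "'o \<Rightarrow> 'o \<Rightarrow> 'm" and E R :: "'m \<Rightarrow> bool"
  assumes unit_eq [simp]: "unit_ob N = unit_ob S"
    and K: "oplax_symmetric_id C S N K (Id C (unit_ob S))"
    and P_ar [simp]: "\<lbrakk>X \<in> Obj C; Y \<in> Obj C\<rbrakk> \<Longrightarrow> S.ar (P X Y)" "\<lbrakk>X \<in> Obj C; Y \<in> Obj C\<rbrakk> \<Longrightarrow> dom (P X Y) = X \<otimes>\<^bsub>S\<^esub> Y"
      "\<lbrakk>X \<in> Obj C; Y \<in> Obj C\<rbrakk> \<Longrightarrow> cod (P X Y) = g0 X Y"
    and Q_ar [simp]: "\<lbrakk>X \<in> Obj C; Y \<in> Obj C\<rbrakk> \<Longrightarrow> S.ar (Q X Y)" "\<lbrakk>X \<in> Obj C; Y \<in> Obj C\<rbrakk> \<Longrightarrow> dom (Q X Y) = g0 X Y"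
      "\<lbrakk>X \<in> Obj C; Y \<in> Obj C\<rbrakk> \<Longrightarrow> cod (Q X Y) = X \<otimes>\<^bsub>N\<^esub> Y"
    and P_natural: "\<lbrakk>S.ar f; S.ar g; X = cod f; Y = cod g\<rbrakk> \<Longrightarrow> S.cmp (P X Y) (f \<odot>\<^bsub>S\<^esub> g) = S.cmp (g1 f g) (P (dom f) (dom g))"
    and Q_natural: "\<lbrakk>S.ar f; S.ar g; X = cod f; Y = cod g\<rbrakk> \<Longrightarrow> S.cmp (Q X Y) (g1 f g) = S.cmp (f \<odot>\<^bsub>N\<^esub> g) (Q (dom f) (dom g))"
    and QP: "\<lbrakk>X \<in> Obj C; Y \<in> Obj C\<rbrakk> \<Longrightarrow> S.cmp (Q X Y) (P X Y) = K X Y"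
    and E_P: "\<lbrakk>X \<in> Obj C; Y \<in> Obj C\<rbrakk> \<Longrightarrow> E (P X Y)" and R_Q: "\<lbrakk>X \<in> Obj C; Y \<in> Obj C\<rbrakk> \<Longrightarrow> R (Q X Y)"
    and E_Id: "X \<in> Obj C \<Longrightarrow> E (Id C X)" and R_Id: "X \<in> Obj C \<Longrightarrow> R (Id C X)"
    and E_cmp: "\<lbrakk>S.ar f; S.ar g; dom g = cod f; E f; E g\<rbrakk> \<Longrightarrow> E (S.cmp g f)"
    and R_cmp: "\<lbrakk>S.ar f; S.ar g; dom g = cod f; R f; R g\<rbrakk> \<Longrightarrow> R (S.cmp g f)"
    and E_tensor: "\<lbrakk>S.ar f; S.ar g; E f; E g\<rbrakk> \<Longrightarrow> E (f \<odot>\<^bsub>S\<^esub> g)"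
    and R_tensor: "\<lbrakk>S.ar f; S.ar g; R f; R g\<rbrakk> \<Longrightarrow> R (f \<odot>\<^bsub>N\<^esub> g)"
    and filler: "\<lbrakk>S.ar e; S.ar r; S.ar p; S.ar q; E e; R r; dom p = dom e; cod p = dom r; dom q = cod e; cod q = cod r;
      S.cmp r p = S.cmp q e\<rbrakk> \<Longrightarrow> \<exists>w. S.ar w \<and> dom w = cod e \<and> cod w = dom r \<and> S.cmp w e = p \<and> S.cmp r w = q"
    and filler_unique: "\<lbrakk>S.ar e; S.ar r; S.ar w; S.ar w'; E e; R r; dom w = cod e; cod w = dom r; dom w' = cod e; cod w' = dom r;
      S.cmp w e = S.cmp w' e; S.cmp r w = S.cmp r w'\<rbrakk> \<Longrightarrow> w = w'"
begin

notation S.cmp (infixr \<open>\<circ>\<circ>\<close> 70)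
abbreviation "ar \<equiv> S.ar"
abbreviation "I \<equiv> unit_ob S"

lemma K_ar [simp]:
  assumes "X \<in> Obj C" "Y \<in> Obj C"
  shows "ar (K X Y)" "dom (K X Y) = X \<otimes>\<^bsub>S\<^esub> Y" "cod (K X Y) = X \<otimes>\<^bsub>N\<^esub> Y"
  unfolding QP[OF assms, symmetric] using assms by simp_all

lemma K_facts:
  "\<lbrakk>X \<in> Obj C; Y \<in> Obj C\<rbrakk> \<Longrightarrow> symm_map N X Y \<circ>\<circ> K X Y = K Y X \<circ>\<circ> symm_map S X Y"
  "X \<in> Obj C \<Longrightarrow> lunit_map N X \<circ>\<circ> K I X = lunit_map S X"
  "X \<in> Obj C \<Longrightarrow> runit_map N X \<circ>\<circ> K X I = runit_map S X"
  "\<lbrakk>X \<in> Obj C; Y \<in> Obj C; Z \<in> Obj C\<rbrakk> \<Longrightarrow> (Id C X \<odot>\<^bsub>N\<^esub> K Y Z) \<circ>\<circ> K X (Y \<otimes>\<^bsub>S\<^esub> Z) \<circ>\<circ> assoc_map S X Y Z =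
          assoc_map N X Y Z \<circ>\<circ> (K X Y \<odot>\<^bsub>N\<^esub> Id C Z) \<circ>\<circ> K (X \<otimes>\<^bsub>S\<^esub> Y) Z"
proof -
  interpret K: oplax_symmetric_id C S N K "Id C I" by (rule K)
  show "\<lbrakk>X \<in> Obj C; Y \<in> Obj C\<rbrakk> \<Longrightarrow> symm_map N X Y \<circ>\<circ> K X Y = K Y X \<circ>\<circ> symm_map S X Y"
    by (rule K.symm_compat)
  show "X \<in> Obj C \<Longrightarrow> lunit_map N X \<circ>\<circ> K I X = lunit_map S X"
    using K.lunit_compat[of X] by (simp flip: unit_eq)
  show "X \<in> Obj C \<Longrightarrow> runit_map N X \<circ>\<circ> K X I = runit_map S X"
    using K.runit_compat[of X] by (simp flip: unit_eq)
  show "\<lbrakk>X \<in> Obj C; Y \<in> Obj C; Z \<in> Obj C\<rbrakk> \<Longrightarrow> (Id C X \<odot>\<^bsub>N\<^esub> K Y Z) \<circ>\<circ> K X (Y \<otimes>\<^bsub>S\<^esub> Z) \<circ>\<circ> assoc_map S X Y Z =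
          assoc_map N X Y Z \<circ>\<circ> (K X Y \<odot>\<^bsub>N\<^esub> Id C Z) \<circ>\<circ> K (X \<otimes>\<^bsub>S\<^esub> Y) Z"
    by (rule K.assoc_compat)
qed

text \<open>Comparisons of threefold tensors: a leading e marks those made from P, which lie in E,
  and a leading r those made from Q, which lie in R. The second letter is the side of the inner
  bracket.\<close>

definition "el X Y Z = g1 (P X Y) (Id C Z) \<circ>\<circ> P (X \<otimes>\<^bsub>S\<^esub> Y) Z"
definition "er X Y Z = g1 (Id C X) (P Y Z) \<circ>\<circ> P X (Y \<otimes>\<^bsub>S\<^esub> Z)"
definition "rl X Y Z = (Q X Y \<odot>\<^bsub>N\<^esub> Id C Z) \<circ>\<circ> Q (g0 X Y) Z"
definition "rr X Y Z = (Id C X \<odot>\<^bsub>N\<^esub> Q Y Z) \<circ>\<circ> Q X (g0 Y Z)"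

text \<open>E is closed under the tensor of S only. Naturality of P moves the inner P into that
  tensor, which is how \<open>el\<close> and \<open>er\<close> are seen to lie in E.\<close>

lemma el_alt: "\<lbrakk>X \<in> Obj C; Y \<in> Obj C; Z \<in> Obj C\<rbrakk> \<Longrightarrow> el X Y Z = P (g0 X Y) Z \<circ>\<circ> (P X Y \<odot>\<^bsub>S\<^esub> Id C Z)"
  and er_alt: "\<lbrakk>X \<in> Obj C; Y \<in> Obj C; Z \<in> Obj C\<rbrakk> \<Longrightarrow> er X Y Z = P X (g0 Y Z) \<circ>\<circ> (Id C X \<odot>\<^bsub>S\<^esub> P Y Z)"
  by (simp_all add: el_def er_def P_natural)

lemma elr_ar [simp]:
  assumes "X \<in> Obj C" "Y \<in> Obj C" "Z \<in> Obj C"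
  shows "ar (el X Y Z)" "dom (el X Y Z) = (X \<otimes>\<^bsub>S\<^esub> Y) \<otimes>\<^bsub>S\<^esub> Z" "cod (el X Y Z) = g0 (g0 X Y) Z" "E (el X Y Z)"
    "ar (er X Y Z)" "dom (er X Y Z) = X \<otimes>\<^bsub>S\<^esub> (Y \<otimes>\<^bsub>S\<^esub> Z)" "cod (er X Y Z) = g0 X (g0 Y Z)" "E (er X Y Z)"
    "ar (rl X Y Z)" "dom (rl X Y Z) = g0 (g0 X Y) Z" "cod (rl X Y Z) = (X \<otimes>\<^bsub>N\<^esub> Y) \<otimes>\<^bsub>N\<^esub> Z" "R (rl X Y Z)"
    "ar (rr X Y Z)" "dom (rr X Y Z) = g0 X (g0 Y Z)" "cod (rr X Y Z) = X \<otimes>\<^bsub>N\<^esub> (Y \<otimes>\<^bsub>N\<^esub> Z)" "R (rr X Y Z)"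
  using assms by (simp_all add: el_alt er_alt rl_def rr_def E_cmp R_cmp E_tensor R_tensor E_P R_Q E_Id R_Id)

lemma rl_el:
  assumes [simp]: "X \<in> Obj C" "Y \<in> Obj C" "Z \<in> Obj C"
  shows "rl X Y Z \<circ>\<circ> el X Y Z = (K X Y \<odot>\<^bsub>N\<^esub> Id C Z) \<circ>\<circ> K (X \<otimes>\<^bsub>S\<^esub> Y) Z"
proof -
  have "rl X Y Z \<circ>\<circ> el X Y Z = (Q X Y \<odot>\<^bsub>N\<^esub> Id C Z) \<circ>\<circ> (Q (g0 X Y) Z \<circ>\<circ> g1 (P X Y) (Id C Z)) \<circ>\<circ> P (X \<otimes>\<^bsub>S\<^esub> Y) Z"
    by (simp add: rl_def el_def)
  also have "Q (g0 X Y) Z \<circ>\<circ> g1 (P X Y) (Id C Z) = (P X Y \<odot>\<^bsub>N\<^esub> Id C Z) \<circ>\<circ> Q (X \<otimes>\<^bsub>S\<^esub> Y) Z"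
    by (subst Q_natural) simp_all
  finally show ?thesis by (simp add: N.T.T1_cmp' QP)
qed

lemma rr_er:
  assumes [simp]: "X \<in> Obj C" "Y \<in> Obj C" "Z \<in> Obj C"
  shows "rr X Y Z \<circ>\<circ> er X Y Z = (Id C X \<odot>\<^bsub>N\<^esub> K Y Z) \<circ>\<circ> K X (Y \<otimes>\<^bsub>S\<^esub> Z)"
proof -
  have "rr X Y Z \<circ>\<circ> er X Y Z = (Id C X \<odot>\<^bsub>N\<^esub> Q Y Z) \<circ>\<circ> (Q X (g0 Y Z) \<circ>\<circ> g1 (Id C X) (P Y Z)) \<circ>\<circ> P X (Y \<otimes>\<^bsub>S\<^esub> Z)"
    by (simp add: rr_def er_def)
  also have "Q X (g0 Y Z) \<circ>\<circ> g1 (Id C X) (P Y Z) = (Id C X \<odot>\<^bsub>N\<^esub> P Y Z) \<circ>\<circ> Q X (Y \<otimes>\<^bsub>S\<^esub> Z)"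
    by (subst Q_natural) simp_all
  finally show ?thesis by (simp add: N.T.T1_cmp' QP)
qed

text \<open>The square is filled once with i and j and once with their inverses. Both composites of
  the two fillers solve a filling problem that identities solve too.\<close>

lemma iso_filler:
  assumes e: "ar e" "E e" and r: "ar r" "R r" "dom r = cod e" and e': "ar e'" "E e'" and r': "ar r'" "R r'" "dom r' = cod e'"
    and i: "iso_in C (dom e) (dom e') i" and j: "iso_in C (cod r) (cod r') j" and sq: "r' \<circ>\<circ> (e' \<circ>\<circ> i) = (j \<circ>\<circ> r) \<circ>\<circ> e"
  shows "\<exists>w. iso_in C (cod e) (cod e') w \<and> w \<circ>\<circ> e = e' \<circ>\<circ> i \<and> r' \<circ>\<circ> w = j \<circ>\<circ> r"
proof -
  note [simp] = e r e' r'
  note i' [simp] = S.iso_ar[OF i] and j' [simp] = S.iso_ar[OF j]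
  obtain i1 where i1: "ar i1" "dom i1 = dom e'" "cod i1 = dom e" "i1 \<circ>\<circ> i = Id C (dom e)" "i \<circ>\<circ> i1 = Id C (dom e')"
    by (rule S.iso_inv[OF i]) simp_all
  obtain j1 where j1: "ar j1" "dom j1 = cod r'" "cod j1 = cod r" "j1 \<circ>\<circ> j = Id C (cod r)" "j \<circ>\<circ> j1 = Id C (cod r')"
    by (rule S.iso_inv[OF j]) simp_all
  note [simp] = i1(1-3) j1(1-3)
  obtain w where w: "ar w" "dom w = cod e" "cod w = cod e'" "w \<circ>\<circ> e = e' \<circ>\<circ> i" "r' \<circ>\<circ> w = j \<circ>\<circ> r"
    using filler[of e r' "e' \<circ>\<circ> i" "j \<circ>\<circ> r"] sq by auto
  have "r \<circ>\<circ> (e \<circ>\<circ> i1) = (j1 \<circ>\<circ> j) \<circ>\<circ> (r \<circ>\<circ> e) \<circ>\<circ> i1" by (simp add: j1(4))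
  also have "\<dots> = j1 \<circ>\<circ> ((j \<circ>\<circ> r) \<circ>\<circ> e) \<circ>\<circ> i1" by simp
  also have "\<dots> = (j1 \<circ>\<circ> r') \<circ>\<circ> e' \<circ>\<circ> (i \<circ>\<circ> i1)" by (simp flip: sq)
  finally have sq': "r \<circ>\<circ> (e \<circ>\<circ> i1) = (j1 \<circ>\<circ> r') \<circ>\<circ> e'" by (simp add: i1(5))
  obtain v where v: "ar v" "dom v = cod e'" "cod v = cod e" "v \<circ>\<circ> e' = e \<circ>\<circ> i1" "r \<circ>\<circ> v = j1 \<circ>\<circ> r'"
    using filler[of e' r "e \<circ>\<circ> i1" "j1 \<circ>\<circ> r'"] sq' by auto
  note [simp] = w(1-3) v(1-3)
  have "v \<circ>\<circ> w = Id C (cod e)"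
  proof (rule filler_unique[of e r])
    have "(v \<circ>\<circ> w) \<circ>\<circ> e = (v \<circ>\<circ> e') \<circ>\<circ> i" by (simp add: w(4))
    then show "(v \<circ>\<circ> w) \<circ>\<circ> e = Id C (cod e) \<circ>\<circ> e" by (simp add: v(4) i1(4))
    have "r \<circ>\<circ> (v \<circ>\<circ> w) = (r \<circ>\<circ> v) \<circ>\<circ> w" by simp
    also have "\<dots> = j1 \<circ>\<circ> (r' \<circ>\<circ> w)" by (simp add: v(5))
    also have "\<dots> = (j1 \<circ>\<circ> j) \<circ>\<circ> r" by (simp add: w(5))
    finally show "r \<circ>\<circ> (v \<circ>\<circ> w) = r \<circ>\<circ> Id C (cod e)" by (simp add: j1(4))
  qed simp_all
  moreover have "w \<circ>\<circ> v = Id C (cod e')"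
  proof (rule filler_unique[of e' r'])
    have "(w \<circ>\<circ> v) \<circ>\<circ> e' = (w \<circ>\<circ> e) \<circ>\<circ> i1" by (simp add: v(4))
    then show "(w \<circ>\<circ> v) \<circ>\<circ> e' = Id C (cod e') \<circ>\<circ> e'" by (simp add: w(4) i1(5))
    have "r' \<circ>\<circ> (w \<circ>\<circ> v) = (r' \<circ>\<circ> w) \<circ>\<circ> v" by simp
    also have "\<dots> = j \<circ>\<circ> (r \<circ>\<circ> v)" by (simp add: w(5))
    also have "\<dots> = (j \<circ>\<circ> j1) \<circ>\<circ> r'" by (simp add: v(5))
    finally show "r' \<circ>\<circ> (w \<circ>\<circ> v) = r' \<circ>\<circ> Id C (cod e')" by (simp add: j1(5))
  qed simp_all
  moreover have "w \<in> Hom C (cod e) (cod e')" "v \<in> Hom C (cod e') (cod e)" by (simp_all add: S.ar_Hom)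
  ultimately show ?thesis using w(4,5) unfolding iso_in_def by blast
qed

definition "is_a X Y Z w \<longleftrightarrow> iso_in C (g0 (g0 X Y) Z) (g0 X (g0 Y Z)) w \<and> w \<circ>\<circ> el X Y Z = er X Y Z \<circ>\<circ> assoc_map S X Y Z \<and>
   rr X Y Z \<circ>\<circ> w = assoc_map N X Y Z \<circ>\<circ> rl X Y Z"
definition "is_s X Y w \<longleftrightarrow> iso_in C (g0 X Y) (g0 Y X) w \<and> w \<circ>\<circ> P X Y = P Y X \<circ>\<circ> symm_map S X Y \<and>
   Q Y X \<circ>\<circ> w = symm_map N X Y \<circ>\<circ> Q X Y"

text \<open>The square to be filled commutes because QP = K and K respects the associativities of S
  and N.\<close>

lemma ex_a:
  assumes [simp]: "X \<in> Obj C" "Y \<in> Obj C" "Z \<in> Obj C"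
  shows "is_a X Y Z (SOME w. is_a X Y Z w)"
proof -
  have "rr X Y Z \<circ>\<circ> (er X Y Z \<circ>\<circ> assoc_map S X Y Z) = (rr X Y Z \<circ>\<circ> er X Y Z) \<circ>\<circ> assoc_map S X Y Z" by simp
  also have "\<dots> = (assoc_map N X Y Z \<circ>\<circ> (K X Y \<odot>\<^bsub>N\<^esub> Id C Z) \<circ>\<circ> K (X \<otimes>\<^bsub>S\<^esub> Y) Z)"
    unfolding rr_er[OF assms] K_facts(4)[OF assms, symmetric] by (simp flip: QP)
  also have "\<dots> = assoc_map N X Y Z \<circ>\<circ> (rl X Y Z \<circ>\<circ> el X Y Z)"
    by (simp only: rl_el[OF assms])
  finally have "rr X Y Z \<circ>\<circ> (er X Y Z \<circ>\<circ> assoc_map S X Y Z) = (assoc_map N X Y Z \<circ>\<circ> rl X Y Z) \<circ>\<circ> el X Y Z" by simp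
  then have "\<exists>w. is_a X Y Z w"
    using iso_filler[of "el X Y Z" "rl X Y Z" "er X Y Z" "rr X Y Z" "assoc_map S X Y Z" "assoc_map N X Y Z"]
      S.assoc_iso[of X Y Z] N.assoc_iso[of X Y Z] by (simp add: is_a_def)
  then show ?thesis by (rule someI_ex)
qed

lemma ex_s:
  assumes [simp]: "X \<in> Obj C" "Y \<in> Obj C"
  shows "is_s X Y (SOME w. is_s X Y w)"
proof -
  have "Q Y X \<circ>\<circ> (P Y X \<circ>\<circ> symm_map S X Y) = (Q Y X \<circ>\<circ> P Y X) \<circ>\<circ> symm_map S X Y" by simp
  also have "\<dots> = symm_map N X Y \<circ>\<circ> (Q X Y \<circ>\<circ> P X Y)" by (simp only: QP assms K_facts(1))
  finally have "Q Y X \<circ>\<circ> (P Y X \<circ>\<circ> symm_map S X Y) = (symm_map N X Y \<circ>\<circ> Q X Y) \<circ>\<circ> P X Y" by simp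
  then have "\<exists>w. is_s X Y w"
    using iso_filler[of "P X Y" "Q X Y" "P Y X" "Q Y X" "symm_map S X Y" "symm_map N X Y"]
      S.symm_iso[of X Y] N.symm_iso[of X Y] by (simp add: is_s_def E_P R_Q)
  then show ?thesis by (rule someI_ex)
qed

text \<open>The associativity and symmetry are chosen fillers. The unit constraints are written
  down, because compatibility with Q leaves no other possibility.\<close>

definition M :: "('o, 'm) smon" where
  "M = \<lparr>tens0 = g0, tens1 = g1, unit_ob = I, assoc_map = (\<lambda>X Y Z. SOME w. is_a X Y Z w),
    lunit_map = (\<lambda>X. lunit_map N X \<circ>\<circ> Q I X), runit_map = (\<lambda>X. runit_map N X \<circ>\<circ> Q X I),
    symm_map = (\<lambda>X Y. SOME w. is_s X Y w)\<rparr>"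

lemma M_sel [simp]: "tens0 M = g0" "tens1 M = g1" "unit_ob M = I" "lunit_map M X = lunit_map N X \<circ>\<circ> Q I X"
  "runit_map M X = runit_map N X \<circ>\<circ> Q X I"
  by (simp_all add: M_def)

lemma M_a:
  assumes "X \<in> Obj C" "Y \<in> Obj C" "Z \<in> Obj C"
  shows "iso_in C (g0 (g0 X Y) Z) (g0 X (g0 Y Z)) (assoc_map M X Y Z)"
    "assoc_map M X Y Z \<circ>\<circ> el X Y Z = er X Y Z \<circ>\<circ> assoc_map S X Y Z"
    "rr X Y Z \<circ>\<circ> assoc_map M X Y Z = assoc_map N X Y Z \<circ>\<circ> rl X Y Z"
proof -
  have "is_a X Y Z (assoc_map M X Y Z)" using ex_a[OF assms] by (simp add: M_def)
  then show "iso_in C (g0 (g0 X Y) Z) (g0 X (g0 Y Z)) (assoc_map M X Y Z)"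
    "assoc_map M X Y Z \<circ>\<circ> el X Y Z = er X Y Z \<circ>\<circ> assoc_map S X Y Z"
    "rr X Y Z \<circ>\<circ> assoc_map M X Y Z = assoc_map N X Y Z \<circ>\<circ> rl X Y Z"
    unfolding is_a_def by blast+
qed

lemma M_s:
  assumes "X \<in> Obj C" "Y \<in> Obj C"
  shows "iso_in C (g0 X Y) (g0 Y X) (symm_map M X Y)"
    "symm_map M X Y \<circ>\<circ> P X Y = P Y X \<circ>\<circ> symm_map S X Y"
    "Q Y X \<circ>\<circ> symm_map M X Y = symm_map N X Y \<circ>\<circ> Q X Y"
proof -
  have "is_s X Y (symm_map M X Y)" using ex_s[OF assms] by (simp add: M_def)
  then show "iso_in C (g0 X Y) (g0 Y X) (symm_map M X Y)"
    "symm_map M X Y \<circ>\<circ> P X Y = P Y X \<circ>\<circ> symm_map S X Y"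
    "Q Y X \<circ>\<circ> symm_map M X Y = symm_map N X Y \<circ>\<circ> Q X Y"
    unfolding is_s_def by blast+
qed

lemma M_ar [simp]:
  "\<lbrakk>X \<in> Obj C; Y \<in> Obj C; Z \<in> Obj C\<rbrakk> \<Longrightarrow> ar (assoc_map M X Y Z)"
  "\<lbrakk>X \<in> Obj C; Y \<in> Obj C; Z \<in> Obj C\<rbrakk> \<Longrightarrow> dom (assoc_map M X Y Z) = g0 (g0 X Y) Z"
  "\<lbrakk>X \<in> Obj C; Y \<in> Obj C; Z \<in> Obj C\<rbrakk> \<Longrightarrow> cod (assoc_map M X Y Z) = g0 X (g0 Y Z)"
  "\<lbrakk>X \<in> Obj C; Y \<in> Obj C\<rbrakk> \<Longrightarrow> ar (symm_map M X Y)"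
  "\<lbrakk>X \<in> Obj C; Y \<in> Obj C\<rbrakk> \<Longrightarrow> dom (symm_map M X Y) = g0 X Y"
  "\<lbrakk>X \<in> Obj C; Y \<in> Obj C\<rbrakk> \<Longrightarrow> cod (symm_map M X Y) = g0 Y X"
  using S.iso_ar[OF M_a(1)[of X Y Z]] S.iso_ar[OF M_s(1)[of X Y]] by simp_all

lemma M_unit_P: "X \<in> Obj C \<Longrightarrow> lunit_map M X \<circ>\<circ> P I X = lunit_map S X" "X \<in> Obj C \<Longrightarrow> runit_map M X \<circ>\<circ> P X I = runit_map S X"
  by (simp_all add: QP K_facts)

text \<open>The middle tensor is the target of the comparison P and the source of the comparison Q,
  so each coherence equation for it is related to one for S and to one for N.\<close>

sublocale PC: comparison C dom cod S M P
  apply unfold_locales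
                      apply (simp_all add: P_natural G.bifunctor M_s)
  subgoal for X Y Z using M_a(2)[of X Y Z] by (simp add: el_def er_def)
  subgoal for X using M_unit_P[of X] by simp
  subgoal for X using M_unit_P[of X] by simp
  done

sublocale QC: comparison C dom cod M N Q
  apply unfold_locales
                      apply (simp_all add: Q_natural M_s)
  subgoal for X Y Z using M_a(3)[of X Y Z] by (simp add: rl_def rr_def)
  done

lemma PC_QC: "PC.\<phi>l X Y Z = el X Y Z" "PC.\<phi>r X Y Z = er X Y Z" "QC.\<phi>l X Y Z = rl X Y Z" "QC.\<phi>r X Y Z = rr X Y Z"
  by (simp_all add: PC.\<phi>l_def PC.\<phi>r_def QC.\<phi>l_def QC.\<phi>r_def el_def er_def rl_def rr_def)

text \<open>Two parallel maps of the middle tensor agree if their counterparts for \<open>S\<close> and \<open>N\<close> do.\<close>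

lemma transfer:
  assumes "ar e" "E e" "ar r" "R r" "ar x" "ar y" "dom x = cod e" "dom y = cod e" "cod x = dom r" "cod y = dom r"
    "ar e'" "ar r'" "cod e' = dom r" "dom r' = cod e"
    and xs: "e' \<circ>\<circ> s = x \<circ>\<circ> e" "e' \<circ>\<circ> t = y \<circ>\<circ> e" "s = t" and xn: "r \<circ>\<circ> x = n \<circ>\<circ> r'" "r \<circ>\<circ> y = m \<circ>\<circ> r'" "n = m"
  shows "x = y"
  by (rule filler_unique[of e r x y]) (use assms in simp_all)

section \<open>The axioms for the middle tensor\<close>

lemma M_assoc_natural:
  assumes [simp]: "ar f" "ar g" "ar h"
  shows "assoc_map M (cod f) (cod g) (cod h) \<circ>\<circ> g1 (g1 f g) h = g1 f (g1 g h) \<circ>\<circ> assoc_map M (dom f) (dom g) (dom h)"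
proof (rule transfer)
  note p = PC.assoc_natural_sides[OF assms] and q = QC.assoc_natural_sides[OF assms]
  note p' = p[unfolded PC_QC M_sel] and q' = q[unfolded PC_QC M_sel]
  show "er (cod f) (cod g) (cod h) \<circ>\<circ> (assoc_map S (cod f) (cod g) (cod h) \<circ>\<circ> ((f \<odot>\<^bsub>S\<^esub> g) \<odot>\<^bsub>S\<^esub> h)) =
     (assoc_map M (cod f) (cod g) (cod h) \<circ>\<circ> g1 (g1 f g) h) \<circ>\<circ> el (dom f) (dom g) (dom h)" by (rule p'(1))
  show "er (cod f) (cod g) (cod h) \<circ>\<circ> ((f \<odot>\<^bsub>S\<^esub> (g \<odot>\<^bsub>S\<^esub> h)) \<circ>\<circ> assoc_map S (dom f) (dom g) (dom h)) =
     (g1 f (g1 g h) \<circ>\<circ> assoc_map M (dom f) (dom g) (dom h)) \<circ>\<circ> el (dom f) (dom g) (dom h)" by (rule p'(2))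
  show "rr (cod f) (cod g) (cod h) \<circ>\<circ> (assoc_map M (cod f) (cod g) (cod h) \<circ>\<circ> g1 (g1 f g) h) =
    (assoc_map N (cod f) (cod g) (cod h) \<circ>\<circ> ((f \<odot>\<^bsub>N\<^esub> g) \<odot>\<^bsub>N\<^esub> h)) \<circ>\<circ> rl (dom f) (dom g) (dom h)" by (rule q'(1))
  show "rr (cod f) (cod g) (cod h) \<circ>\<circ> (g1 f (g1 g h) \<circ>\<circ> assoc_map M (dom f) (dom g) (dom h)) =
    ((f \<odot>\<^bsub>N\<^esub> (g \<odot>\<^bsub>N\<^esub> h)) \<circ>\<circ> assoc_map N (dom f) (dom g) (dom h)) \<circ>\<circ> rl (dom f) (dom g) (dom h)" by (rule q'(2))
qed (simp_all add: S.natural(1) N.natural(1))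

lemma M_symm_natural:
  assumes [simp]: "ar f" "ar g"
  shows "symm_map M (cod f) (cod g) \<circ>\<circ> g1 f g = g1 g f \<circ>\<circ> symm_map M (dom f) (dom g)"
proof (rule transfer)
  note p = PC.symm_natural_sides[OF assms] and q = QC.symm_natural_sides[OF assms]
  note p' = p[unfolded M_sel] and q' = q[unfolded M_sel]
  show "P (cod g) (cod f) \<circ>\<circ> (symm_map S (cod f) (cod g) \<circ>\<circ> (f \<odot>\<^bsub>S\<^esub> g)) = (symm_map M (cod f) (cod g) \<circ>\<circ> g1 f g) \<circ>\<circ> P (dom f) (dom g)"
    by (rule p'(1))
  show "P (cod g) (cod f) \<circ>\<circ> ((g \<odot>\<^bsub>S\<^esub> f) \<circ>\<circ> symm_map S (dom f) (dom g)) = (g1 g f \<circ>\<circ> symm_map M (dom f) (dom g)) \<circ>\<circ> P (dom f) (dom g)"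
    by (rule p'(2))
  show "Q (cod g) (cod f) \<circ>\<circ> (symm_map M (cod f) (cod g) \<circ>\<circ> g1 f g) = (symm_map N (cod f) (cod g) \<circ>\<circ> (f \<odot>\<^bsub>N\<^esub> g)) \<circ>\<circ> Q (dom f) (dom g)"
    by (rule q'(1))
  show "Q (cod g) (cod f) \<circ>\<circ> (g1 g f \<circ>\<circ> symm_map M (dom f) (dom g)) = ((g \<odot>\<^bsub>N\<^esub> f) \<circ>\<circ> symm_map N (dom f) (dom g)) \<circ>\<circ> Q (dom f) (dom g)"
    by (rule q'(2))
qed (simp_all add: S.natural(4) N.natural(4) E_P R_Q)

lemma M_triangle:
  assumes [simp]: "X \<in> Obj C" "Y \<in> Obj C"
  shows "g1 (Id C X) (lunit_map M Y) \<circ>\<circ> assoc_map M X I Y = g1 (runit_map M X) (Id C Y)"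
proof (rule transfer)
  note p' = PC.triangle_sides[OF assms, unfolded PC_QC M_sel(1-3)] and q' = QC.triangle_sides[OF assms, unfolded PC_QC M_sel(1-3)]
  show "P X Y \<circ>\<circ> ((Id C X \<odot>\<^bsub>S\<^esub> lunit_map S Y) \<circ>\<circ> assoc_map S X I Y) = (g1 (Id C X) (lunit_map M Y) \<circ>\<circ> assoc_map M X I Y) \<circ>\<circ> el X I Y" by (rule p'(1))
  show "P X Y \<circ>\<circ> (runit_map S X \<odot>\<^bsub>S\<^esub> Id C Y) = g1 (runit_map M X) (Id C Y) \<circ>\<circ> el X I Y" by (rule p'(2))
  show "Q X Y \<circ>\<circ> (g1 (Id C X) (lunit_map M Y) \<circ>\<circ> assoc_map M X I Y) = ((Id C X \<odot>\<^bsub>N\<^esub> lunit_map N Y) \<circ>\<circ> assoc_map N X I Y) \<circ>\<circ> rl X I Y" by (rule q'(1))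
  show "Q X Y \<circ>\<circ> g1 (runit_map M X) (Id C Y) = (runit_map N X \<odot>\<^bsub>N\<^esub> Id C Y) \<circ>\<circ> rl X I Y" by (rule q'(2))
  show "(Id C X \<odot>\<^bsub>S\<^esub> lunit_map S Y) \<circ>\<circ> assoc_map S X I Y = runit_map S X \<odot>\<^bsub>S\<^esub> Id C Y" by (rule S.triangle) simp_all
  show "(Id C X \<odot>\<^bsub>N\<^esub> lunit_map N Y) \<circ>\<circ> assoc_map N X I Y = runit_map N X \<odot>\<^bsub>N\<^esub> Id C Y" using N.triangle[of X Y] by simp
qed (simp_all add: R_Q)

lemma M_symm_symm:
  assumes [simp]: "X \<in> Obj C" "Y \<in> Obj C"
  shows "symm_map M Y X \<circ>\<circ> symm_map M X Y = Id C (g0 X Y)"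
proof (rule transfer)
  show "P X Y \<circ>\<circ> (symm_map S Y X \<circ>\<circ> symm_map S X Y) = (symm_map M Y X \<circ>\<circ> symm_map M X Y) \<circ>\<circ> P X Y" by (rule PC.symm_symm_side) simp_all
  show "Q X Y \<circ>\<circ> (symm_map M Y X \<circ>\<circ> symm_map M X Y) = (symm_map N Y X \<circ>\<circ> symm_map N X Y) \<circ>\<circ> Q X Y" by (rule QC.symm_symm_side) simp_all
  show "P X Y \<circ>\<circ> Id C (X \<otimes>\<^bsub>S\<^esub> Y) = Id C (g0 X Y) \<circ>\<circ> P X Y" "Q X Y \<circ>\<circ> Id C (g0 X Y) = Id C (X \<otimes>\<^bsub>N\<^esub> Y) \<circ>\<circ> Q X Y" by simp_all
qed (simp_all add: E_P R_Q S.symm_symm N.symm_symm)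

lemma M_hexagon:
  assumes [simp]: "X \<in> Obj C" "Y \<in> Obj C" "Z \<in> Obj C"
  shows "assoc_map M Y Z X \<circ>\<circ> symm_map M X (g0 Y Z) \<circ>\<circ> assoc_map M X Y Z =
    g1 (Id C Y) (symm_map M X Z) \<circ>\<circ> assoc_map M Y X Z \<circ>\<circ> g1 (symm_map M X Y) (Id C Z)"
proof (rule transfer)
  \<comment> \<open>Along P the middle tensor is the target, so its own naturality, already
    established, is what \<open>hexagon_sides\<close> asks for; along Q it is the naturality of
    N.\<close>
  have PA: "\<And>f g h. \<lbrakk>ar f; ar g; ar h\<rbrakk> \<Longrightarrow> assoc_map M (cod f) (cod g) (cod h) \<circ>\<circ> ((f \<odot>\<^bsub>M\<^esub> g) \<odot>\<^bsub>M\<^esub> h) =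
     (f \<odot>\<^bsub>M\<^esub> (g \<odot>\<^bsub>M\<^esub> h)) \<circ>\<circ> assoc_map M (dom f) (dom g) (dom h)"
    and PS: "\<And>f g. \<lbrakk>ar f; ar g\<rbrakk> \<Longrightarrow> symm_map M (cod f) (cod g) \<circ>\<circ> (f \<odot>\<^bsub>M\<^esub> g) = (g \<odot>\<^bsub>M\<^esub> f) \<circ>\<circ> symm_map M (dom f) (dom g)"
    by (simp_all add: M_assoc_natural M_symm_natural)
  note p = PC.hexagon_sides[OF PA PS assms] and q = QC.hexagon_sides[OF N.natural(1)[OF _ _ _ refl refl refl] N.natural(4)[OF _ _ refl refl] assms]
  note p' = p[unfolded PC_QC M_sel(1-3)] and q' = q[unfolded PC_QC M_sel(1-3)]
  show "er Y Z X \<circ>\<circ> (assoc_map S Y Z X \<circ>\<circ> symm_map S X (Y \<otimes>\<^bsub>S\<^esub> Z) \<circ>\<circ> assoc_map S X Y Z) =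
      (assoc_map M Y Z X \<circ>\<circ> symm_map M X (g0 Y Z) \<circ>\<circ> assoc_map M X Y Z) \<circ>\<circ> el X Y Z" by (rule p'(1))
  show "er Y Z X \<circ>\<circ> ((Id C Y \<odot>\<^bsub>S\<^esub> symm_map S X Z) \<circ>\<circ> assoc_map S Y X Z \<circ>\<circ> (symm_map S X Y \<odot>\<^bsub>S\<^esub> Id C Z)) =
      (g1 (Id C Y) (symm_map M X Z) \<circ>\<circ> assoc_map M Y X Z \<circ>\<circ> g1 (symm_map M X Y) (Id C Z)) \<circ>\<circ> el X Y Z" by (rule p'(2))
  show "rr Y Z X \<circ>\<circ> (assoc_map M Y Z X \<circ>\<circ> symm_map M X (g0 Y Z) \<circ>\<circ> assoc_map M X Y Z) =
      (assoc_map N Y Z X \<circ>\<circ> symm_map N X (Y \<otimes>\<^bsub>N\<^esub> Z) \<circ>\<circ> assoc_map N X Y Z) \<circ>\<circ> rl X Y Z" by (rule q'(1))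
  show "rr Y Z X \<circ>\<circ> (g1 (Id C Y) (symm_map M X Z) \<circ>\<circ> assoc_map M Y X Z \<circ>\<circ> g1 (symm_map M X Y) (Id C Z)) =
      ((Id C Y \<odot>\<^bsub>N\<^esub> symm_map N X Z) \<circ>\<circ> assoc_map N Y X Z \<circ>\<circ> (symm_map N X Y \<odot>\<^bsub>N\<^esub> Id C Z)) \<circ>\<circ> rl X Y Z" by (rule q'(2))
qed (simp_all add: S.hexagon N.hexagon)

text \<open>The fourfold comparisons for the pentagon. The filler is taken between
  \<open>ell\<close>, which lies in E, and \<open>rrr\<close>, which lies in R; the other two close
  the squares.\<close>

definition "ell W X Y Z = g1 (el W X Y) (Id C Z) \<circ>\<circ> P ((W \<otimes>\<^bsub>S\<^esub> X) \<otimes>\<^bsub>S\<^esub> Y) Z"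
definition "err W X Y Z = g1 (Id C W) (er X Y Z) \<circ>\<circ> P W (X \<otimes>\<^bsub>S\<^esub> (Y \<otimes>\<^bsub>S\<^esub> Z))"
definition "rll W X Y Z = (rl W X Y \<odot>\<^bsub>N\<^esub> Id C Z) \<circ>\<circ> Q (g0 (g0 W X) Y) Z"
definition "rrr W X Y Z = (Id C W \<odot>\<^bsub>N\<^esub> rr X Y Z) \<circ>\<circ> Q W (g0 X (g0 Y Z))"

lemma PC_QC': "PC.\<phi>ll W X Y Z = ell W X Y Z" "PC.\<phi>rr W X Y Z = err W X Y Z" "QC.\<phi>ll W X Y Z = rll W X Y Z" "QC.\<phi>rr W X Y Z = rrr W X Y Z"
  by (simp_all add: PC.\<phi>ll_def PC.\<phi>rr_def QC.\<phi>ll_def QC.\<phi>rr_def ell_def err_def rll_def rrr_def PC_QC)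

lemma ell_alt: "\<lbrakk>W \<in> Obj C; X \<in> Obj C; Y \<in> Obj C; Z \<in> Obj C\<rbrakk> \<Longrightarrow> ell W X Y Z = P (g0 (g0 W X) Y) Z \<circ>\<circ> (el W X Y \<odot>\<^bsub>S\<^esub> Id C Z)"
  by (simp add: ell_def P_natural)

lemma M_pentagon:
  assumes [simp]: "W \<in> Obj C" "X \<in> Obj C" "Y \<in> Obj C" "Z \<in> Obj C"
  shows "assoc_map M W X (g0 Y Z) \<circ>\<circ> assoc_map M (g0 W X) Y Z =
    g1 (Id C W) (assoc_map M X Y Z) \<circ>\<circ> assoc_map M W (g0 X Y) Z \<circ>\<circ> g1 (assoc_map M W X Y) (Id C Z)"
proof (rule transfer)
  have PA: "\<And>f g h. \<lbrakk>ar f; ar g; ar h\<rbrakk> \<Longrightarrow> assoc_map M (cod f) (cod g) (cod h) \<circ>\<circ> ((f \<odot>\<^bsub>M\<^esub> g) \<odot>\<^bsub>M\<^esub> h) =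
     (f \<odot>\<^bsub>M\<^esub> (g \<odot>\<^bsub>M\<^esub> h)) \<circ>\<circ> assoc_map M (dom f) (dom g) (dom h)"
    and PS: "\<And>f g. \<lbrakk>ar f; ar g\<rbrakk> \<Longrightarrow> symm_map M (cod f) (cod g) \<circ>\<circ> (f \<odot>\<^bsub>M\<^esub> g) = (g \<odot>\<^bsub>M\<^esub> f) \<circ>\<circ> symm_map M (dom f) (dom g)"
    by (simp_all add: M_assoc_natural M_symm_natural)
  note p = PC.pentagon_sides[OF PA PS assms] and q = QC.pentagon_sides[OF N.natural(1)[OF _ _ _ refl refl refl] N.natural(4)[OF _ _ refl refl] assms]
  note p' = p[unfolded PC_QC' M_sel(1-3)] and q' = q[unfolded PC_QC' M_sel(1-3)]
  show "err W X Y Z \<circ>\<circ> (assoc_map S W X (Y \<otimes>\<^bsub>S\<^esub> Z) \<circ>\<circ> assoc_map S (W \<otimes>\<^bsub>S\<^esub> X) Y Z) =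
    (assoc_map M W X (g0 Y Z) \<circ>\<circ> assoc_map M (g0 W X) Y Z) \<circ>\<circ> ell W X Y Z" by (rule p'(1))
  show "err W X Y Z \<circ>\<circ> ((Id C W \<odot>\<^bsub>S\<^esub> assoc_map S X Y Z) \<circ>\<circ> assoc_map S W (X \<otimes>\<^bsub>S\<^esub> Y) Z \<circ>\<circ> (assoc_map S W X Y \<odot>\<^bsub>S\<^esub> Id C Z)) =
    (g1 (Id C W) (assoc_map M X Y Z) \<circ>\<circ> assoc_map M W (g0 X Y) Z \<circ>\<circ> g1 (assoc_map M W X Y) (Id C Z)) \<circ>\<circ> ell W X Y Z" by (rule p'(2))
  show "rrr W X Y Z \<circ>\<circ> (assoc_map M W X (g0 Y Z) \<circ>\<circ> assoc_map M (g0 W X) Y Z) =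
    (assoc_map N W X (Y \<otimes>\<^bsub>N\<^esub> Z) \<circ>\<circ> assoc_map N (W \<otimes>\<^bsub>N\<^esub> X) Y Z) \<circ>\<circ> rll W X Y Z" by (rule q'(1))
  show "rrr W X Y Z \<circ>\<circ> (g1 (Id C W) (assoc_map M X Y Z) \<circ>\<circ> assoc_map M W (g0 X Y) Z \<circ>\<circ> g1 (assoc_map M W X Y) (Id C Z)) =
    ((Id C W \<odot>\<^bsub>N\<^esub> assoc_map N X Y Z) \<circ>\<circ> assoc_map N W (X \<otimes>\<^bsub>N\<^esub> Y) Z \<circ>\<circ> (assoc_map N W X Y \<odot>\<^bsub>N\<^esub> Id C Z)) \<circ>\<circ> rll W X Y Z" by (rule q'(2))
  show "E (ell W X Y Z)" by (simp add: ell_alt E_cmp E_tensor E_P E_Id)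
  show "R (rrr W X Y Z)" by (simp add: rrr_def R_cmp R_tensor R_Q R_Id)
qed (simp_all add: S.pentagon N.pentagon ell_def err_def rll_def rrr_def)

text \<open>\<open>iso_filler\<close> with identities on the side of X: any filler is then equal to
  the unit constraint of N after Q, which is the one of M.\<close>

lemma M_unit_iso:
  assumes [simp]: "X \<in> Obj C"
  shows "iso_in C (g0 I X) X (lunit_map M X)" "iso_in C (g0 X I) X (runit_map M X)"
proof -
  have "iso_in C (I \<otimes>\<^bsub>N\<^esub> X) X (lunit_map N X)" using N.lunit_iso[of X] by simp
  then show "iso_in C (g0 I X) X (lunit_map M X)"
    using iso_filler[of "P I X" "Q I X" "Id C X" "Id C X" "lunit_map S X" "lunit_map N X"] S.lunit_iso[of X]
    by (auto simp: E_P R_Q E_Id R_Id QP K_facts S.iso_ar)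
  have "iso_in C (X \<otimes>\<^bsub>N\<^esub> I) X (runit_map N X)" using N.runit_iso[of X] by simp
  then show "iso_in C (g0 X I) X (runit_map M X)"
    using iso_filler[of "P X I" "Q X I" "Id C X" "Id C X" "runit_map S X" "runit_map N X"] S.runit_iso[of X]
    by (auto simp: E_P R_Q E_Id R_Id QP K_facts S.iso_ar)
qed

lemma M_unit_natural:
  assumes [simp]: "ar f"
  shows "lunit_map M (cod f) \<circ>\<circ> g1 (Id C I) f = f \<circ>\<circ> lunit_map M (dom f)"
    "runit_map M (cod f) \<circ>\<circ> g1 f (Id C I) = f \<circ>\<circ> runit_map M (dom f)"
proof -
  have "lunit_map N (cod f) \<circ>\<circ> (Q I (cod f) \<circ>\<circ> g1 (Id C I) f) = (lunit_map N (cod f) \<circ>\<circ> (Id C I \<odot>\<^bsub>N\<^esub> f)) \<circ>\<circ> Q I (dom f)"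
    by (simp add: Q_natural)
  also have "lunit_map N (cod f) \<circ>\<circ> (Id C I \<odot>\<^bsub>N\<^esub> f) = f \<circ>\<circ> lunit_map N (dom f)"
    using N.natural(2)[of f] by simp
  finally show "lunit_map M (cod f) \<circ>\<circ> g1 (Id C I) f = f \<circ>\<circ> lunit_map M (dom f)" by simp
  have "runit_map N (cod f) \<circ>\<circ> (Q (cod f) I \<circ>\<circ> g1 f (Id C I)) = (runit_map N (cod f) \<circ>\<circ> (f \<odot>\<^bsub>N\<^esub> Id C I)) \<circ>\<circ> Q (dom f) I"
    by (simp add: Q_natural)
  also have "runit_map N (cod f) \<circ>\<circ> (f \<odot>\<^bsub>N\<^esub> Id C I) = f \<circ>\<circ> runit_map N (dom f)"
    using N.natural(3)[of f] by simp
  finally show "runit_map M (cod f) \<circ>\<circ> g1 f (Id C I) = f \<circ>\<circ> runit_map M (dom f)" by simp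
qed

lemma natural_Hom: "\<lbrakk>X \<in> Obj C; Y \<in> Obj C; f \<in> Hom C X Y\<rbrakk> \<Longrightarrow> ar f \<and> dom f = X \<and> cod f = Y"
  using S.arI S.Hom_dom S.Hom_cod by blast

lemma symmetric_monoidal_M: "symmetric_monoidal C M"
proof (rule symmetric_monoidal.intro, goal_cases)
  case 1 show ?case using G.bifunctor by simp
next case 2 show ?case by simp
next case (3 X Y Z) then show ?case using M_a(1)[of X Y Z] by simp
next case (4 X Y Z X' Y' Z' f g h)
  then have "ar f \<and> dom f = X \<and> cod f = X'" "ar g \<and> dom g = Y \<and> cod g = Y'" "ar h \<and> dom h = Z \<and> cod h = Z'"
    by (simp_all add: natural_Hom)
  then show ?case using M_assoc_natural[of f g h] by simp
next case (5 X) then show ?case using M_unit_iso(1)[of X] by simp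
next case (6 X Y f)
  then have "ar f \<and> dom f = X \<and> cod f = Y" by (simp add: natural_Hom)
  then show ?case using M_unit_natural(1)[of f] by simp
next case (7 X) then show ?case using M_unit_iso(2)[of X] by simp
next case (8 X Y f)
  then have "ar f \<and> dom f = X \<and> cod f = Y" by (simp add: natural_Hom)
  then show ?case using M_unit_natural(2)[of f] by simp
next case (9 X Y) then show ?case using M_s(1)[of X Y] by simp
next case (10 X Y X' Y' f g)
  then have "ar f \<and> dom f = X \<and> cod f = X'" "ar g \<and> dom g = Y \<and> cod g = Y'" by (simp_all add: natural_Hom)
  then show ?case using M_symm_natural[of f g] by simp
next case (11 W X Y Z) then show ?case using M_pentagon[of W X Y Z] by simp
next case (12 X Y) then show ?case using M_triangle[of X Y] by simp
next case (13 X Y Z) then show ?case using M_hexagon[of X Y Z] by simp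
next case (14 X Y) then show ?case using M_symm_symm[of X Y] by simp
qed

section \<open>Compatibility with P and Q, and uniqueness\<close>

lemma oplax_P: "oplax_id C S M P (Id C I)"
proof (rule oplax_id.intro, goal_cases)
  case (1 X Y) then show ?case by (simp add: S.ar_Hom)
next case (2 X Y X' Y' f g)
  then have "ar f \<and> dom f = X \<and> cod f = X'" "ar g \<and> dom g = Y \<and> cod g = Y'" by (simp_all add: natural_Hom)
  then show ?case using P_natural[of f g] by simp
next case 3 show ?case by (simp add: S.ar_Hom)
next case (4 X) then show ?case using M_unit_P(1)[of X] by simp
next case (5 X) then show ?case using M_unit_P(2)[of X] by simp
next case (6 X Y Z) then show ?case using M_a(2)[of X Y Z] by (simp add: el_def er_def)
qed

lemma oplax_Q: "oplax_id C M N Q (Id C I)"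
proof (rule oplax_id.intro, goal_cases)
  case (1 X Y) then show ?case by (simp add: S.ar_Hom)
next case (2 X Y X' Y' f g)
  then have "ar f \<and> dom f = X \<and> cod f = X'" "ar g \<and> dom g = Y \<and> cod g = Y'" by (simp_all add: natural_Hom)
  then show ?case using Q_natural[of f g] by simp
next case 3 show ?case by (simp add: S.ar_Hom)
next case (4 X) then show ?case using N.T.T1_Id[of I X] by simp
next case (5 X) then show ?case using N.T.T1_Id[of X I] by simp
next case (6 X Y Z) then show ?case using M_a(3)[of X Y Z] by (simp add: rl_def rr_def)
qed

text \<open>Compatibility with Q gives the unit constraints outright. An associativity compatible
  with both P and Q fills the same square as that of M.\<close>

lemma coherence_unique:
  assumes T: "tens0 T = g0" "tens1 T = g1" "unit_ob T = I" "symmetric_monoidal C T"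
    and TP: "oplax_id C S T P (Id C I)" and TQ: "oplax_id C T N Q (Id C I)"
  shows "X \<in> Obj C \<Longrightarrow> lunit_map T X = lunit_map M X" "X \<in> Obj C \<Longrightarrow> runit_map T X = runit_map M X"
    "\<lbrakk>X \<in> Obj C; Y \<in> Obj C; Z \<in> Obj C\<rbrakk> \<Longrightarrow> assoc_map T X Y Z = assoc_map M X Y Z"
proof -
  interpret T: symmetric_monoidal C T by (rule T)
  interpret TP: oplax_id C S T P "Id C I" by (rule TP)
  interpret TQ: oplax_id C T N Q "Id C I" by (rule TQ)
  note [simp] = T(1-3)
  show "X \<in> Obj C \<Longrightarrow> lunit_map T X = lunit_map M X" using TQ.lunit_compat[of X] N.T.T1_Id[of I X] by simp
  show "X \<in> Obj C \<Longrightarrow> runit_map T X = runit_map M X" using TQ.runit_compat[of X] N.T.T1_Id[of X I] by simp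
  assume [simp]: "X \<in> Obj C" "Y \<in> Obj C" "Z \<in> Obj C"
  have a: "ar (assoc_map T X Y Z)" "dom (assoc_map T X Y Z) = g0 (g0 X Y) Z" "cod (assoc_map T X Y Z) = g0 X (g0 Y Z)"
    using S.iso_ar[OF T.assoc_iso[of X Y Z]] by simp_all
  note [simp] = a
  have e: "er X Y Z \<circ>\<circ> assoc_map S X Y Z = assoc_map T X Y Z \<circ>\<circ> el X Y Z"
    using TP.assoc_compat[of X Y Z] by (simp add: el_def er_def)
  have r: "rr X Y Z \<circ>\<circ> assoc_map T X Y Z = assoc_map N X Y Z \<circ>\<circ> rl X Y Z"
    using TQ.assoc_compat[of X Y Z] by (simp add: rl_def rr_def)
  show "assoc_map T X Y Z = assoc_map M X Y Z"
    by (rule filler_unique[of "el X Y Z" "rr X Y Z"]) (simp_all add: r M_a flip: e)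
qed

end

section \<open>Closedness\<close>

text \<open>Transport of structure along injections on the three sets of cells. Ps(B, C) has records
  and functions for cells, so only a copy with cells in \<open>'u\<close> can be an object of
  \<open>TwoCat\<close>.\<close>

definition relabel :: "('o \<Rightarrow> 'p) \<Rightarrow> ('a \<Rightarrow> 'b) \<Rightarrow> ('t \<Rightarrow> 's) \<Rightarrow> ('o, 'a, 't) twocat \<Rightarrow> ('p, 'b, 's) twocat" where
  "relabel p q r C = (let q' = inv_into (Ar C) q; r' = inv_into (Tw C) r in
     trim \<lparr>Ob = p ` Ob C, Ar = q ` Ar C, Tw = r ` Tw C,
       src1 = (\<lambda>f. p (src1 C (q' f))), tgt1 = (\<lambda>f. p (tgt1 C (q' f))), id1 = (\<lambda>x. q (id1 C (inv_into (Ob C) p x))),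
       comp1 = (\<lambda>g f. q (comp1 C (q' g) (q' f))),
       src2 = (\<lambda>\<tau>. q (src2 C (r' \<tau>))), tgt2 = (\<lambda>\<tau>. q (tgt2 C (r' \<tau>))), id2 = (\<lambda>f. r (id2 C (q' f))),
       vcomp = (\<lambda>\<tau> \<sigma>. r (vcomp C (r' \<tau>) (r' \<sigma>))), hcomp = (\<lambda>\<tau> \<sigma>. r (hcomp C (r' \<tau>) (r' \<sigma>)))\<rparr>)"

locale relabelling = two_category C for C :: "('o, 'a, 't) twocat" +
  fixes p :: "'o \<Rightarrow> 'p" and q :: "'a \<Rightarrow> 'b" and r :: "'t \<Rightarrow> 's"
  assumes p: "inj_on p (Ob C)" and q: "inj_on q (Ar C)" and r: "inj_on r (Tw C)"
begin

abbreviation "D \<equiv> relabel p q r C"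

lemma eq_iff [simp]:
  "x \<in> Ob C \<Longrightarrow> y \<in> Ob C \<Longrightarrow> p x = p y \<longleftrightarrow> x = y" "f \<in> Ar C \<Longrightarrow> g \<in> Ar C \<Longrightarrow> q f = q g \<longleftrightarrow> f = g"
  "\<tau> \<in> Tw C \<Longrightarrow> \<sigma> \<in> Tw C \<Longrightarrow> r \<tau> = r \<sigma> \<longleftrightarrow> \<tau> = \<sigma>"
  using p q r by (auto dest: inj_onD)

lemma inv_simps [simp]:
  "x \<in> Ob C \<Longrightarrow> inv_into (Ob C) p (p x) = x" "f \<in> Ar C \<Longrightarrow> inv_into (Ar C) q (q f) = f"
  "\<tau> \<in> Tw C \<Longrightarrow> inv_into (Tw C) r (r \<tau>) = \<tau>"
  using p q r by (auto intro: inv_into_f_f)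

lemma relabel_simps [simp]:
  "Ob D = p ` Ob C" "Ar D = q ` Ar C" "Tw D = r ` Tw C"
  "f \<in> Ar C \<Longrightarrow> src1 D (q f) = p (src1 C f)" "f \<in> Ar C \<Longrightarrow> tgt1 D (q f) = p (tgt1 C f)"
  "x \<in> Ob C \<Longrightarrow> id1 D (p x) = q (id1 C x)"
  "\<lbrakk>g \<in> Ar C; f \<in> Ar C; src1 C g = tgt1 C f\<rbrakk> \<Longrightarrow> comp1 D (q g) (q f) = q (comp1 C g f)"
  "\<tau> \<in> Tw C \<Longrightarrow> src2 D (r \<tau>) = q (src2 C \<tau>)" "\<tau> \<in> Tw C \<Longrightarrow> tgt2 D (r \<tau>) = q (tgt2 C \<tau>)"
  "f \<in> Ar C \<Longrightarrow> id2 D (q f) = r (id2 C f)"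
  "\<lbrakk>\<tau> \<in> Tw C; \<sigma> \<in> Tw C; src2 C \<tau> = tgt2 C \<sigma>\<rbrakk> \<Longrightarrow> vcomp D (r \<tau>) (r \<sigma>) = r (vcomp C \<tau> \<sigma>)"
  "\<lbrakk>\<tau> \<in> Tw C; \<sigma> \<in> Tw C; src1 C (src2 C \<tau>) = tgt1 C (src2 C \<sigma>)\<rbrakk> \<Longrightarrow> hcomp D (r \<tau>) (r \<sigma>) = r (hcomp C \<tau> \<sigma>)"
  by (simp_all add: relabel_def Let_def trim_ops)

lemma two_category_relabel: "two_category D"
  unfolding relabel_def Let_def by (rule two_category_trimI; simp; (elim imageE)?; clarsimp simp: interchange')

definition relabel_to :: "('o, 'a, 't, 'p, 'b, 's) twofun" where
  "relabel_to = \<lparr>Dom = C, Cod = D, on0 = restrict p (Ob C), on1 = restrict q (Ar C), on2 = restrict r (Tw C)\<rparr>"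

definition relabel_from :: "('p, 'b, 's, 'o, 'a, 't) twofun" where
  "relabel_from = \<lparr>Dom = D, Cod = C, on0 = restrict (inv_into (Ob C) p) (Ob D),
     on1 = restrict (inv_into (Ar C) q) (Ar D), on2 = restrict (inv_into (Tw C) r) (Tw D)\<rparr>"

lemma relabel_to_in: "relabel_to \<in> Fun C D"
  unfolding relabel_to_def by (rule FunI) auto

lemma relabel_from_in: "relabel_from \<in> Fun D C"
  unfolding relabel_from_def by (rule FunI) auto

lemma relabel_iso: "relabel_from \<bullet> relabel_to = fid C" "relabel_to \<bullet> relabel_from = fid D"
proof -
  note two = two_category_axioms two_category_relabel
  show "relabel_from \<bullet> relabel_to = fid C"
    by (rule Fun_eqI[OF fcomp_in[OF two(1) relabel_to_in relabel_from_in] fid_in[OF two(1)]])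
      (auto simp: relabel_to_def relabel_from_def)
  show "relabel_to \<bullet> relabel_from = fid D"
    by (rule Fun_eqI[OF fcomp_in[OF two(2) relabel_from_in relabel_to_in] fid_in[OF two(2)]])
      (auto simp: relabel_to_def relabel_from_def)
qed

end

section \<open>Small copies of Ps(B, C)\<close>

context univ begin

lemma small_copy:
  fixes C :: "('o, 'a, 't) twocat"
  assumes "two_category C" and lt: "Ob C \<prec> (UNIV :: 'u set)" "Ar C \<prec> (UNIV :: 'u set)" "Tw C \<prec> (UNIV :: 'u set)"
  obtains D :: "'u tcat" and T S where "D \<in> Obj TwoCat" "T \<in> Fun C D" "S \<in> Fun D C" "S \<bullet> T = fid C" "T \<bullet> S = fid D"
proof -
  obtain p :: "'o \<Rightarrow> 'u" and q :: "'a \<Rightarrow> 'u" and r :: "'t \<Rightarrow> 'u"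
    where "inj_on p (Ob C)" "inj_on q (Ar C)" "inj_on r (Tw C)"
    using lt[THEN lesspoll_imp_lepoll] unfolding lepoll_def by metis
  then interpret relabelling C p q r
    using assms(1) by (simp add: relabelling_def relabelling_axioms_def)
  have "D \<in> Obj TwoCat"
    using two_category_relabel lt by (simp add: TwoCat_def small_def image_lt)
  then show ?thesis by (rule that[OF _ relabel_to_in relabel_from_in relabel_iso])
qed

lemma inj_lt:
  assumes "inj_on f X" "f ` X \<subseteq> Y" "Y \<prec> (UNIV :: 'u set)"
  shows "X \<prec> (UNIV :: 'u set)"
  by (rule lesspoll_trans1[OF _ assms(3)]) (use assms(1,2) in \<open>auto simp: lepoll_def\<close>)

text \<open>Each cell is coded injectively by its boundary and extensional functions between small
  sets, and sets of such functions are small by \<open>PiE_lt\<close>.\<close>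

lemma ps_hom_lt:
  fixes B C :: "'u tcat"
  assumes "B \<in> Obj TwoCat" "C \<in> Obj TwoCat"
  shows "Ob (ps_hom B C) \<prec> (UNIV :: 'u set)" "Ar (ps_hom B C) \<prec> (UNIV :: 'u set)" "Tw (ps_hom B C) \<prec> (UNIV :: 'u set)"
proof -
  have lt: "Ob B \<prec> (UNIV :: 'u set)" "Ar B \<prec> (UNIV :: 'u set)" "Tw B \<prec> (UNIV :: 'u set)"
    "Ob C \<prec> (UNIV :: 'u set)" "Ar C \<prec> (UNIV :: 'u set)" "Tw C \<prec> (UNIV :: 'u set)"
    using assms by (auto simp: TwoCat_def small_def)
  let ?Fs = "(Ob B \<rightarrow>\<^sub>E Ob C) \<times> (Ar B \<rightarrow>\<^sub>E Ar C) \<times> (Tw B \<rightarrow>\<^sub>E Tw C)"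
  have Ob: "Fun B C \<prec> (UNIV :: 'u set)"
  proof (rule inj_lt)
    show "inj_on (\<lambda>F. (on0 F, on1 F, on2 F)) (Fun B C)"
    proof (rule inj_onI)
      fix F G assume "F \<in> Fun B C" "G \<in> Fun B C" "(on0 F, on1 F, on2 F) = (on0 G, on1 G, on2 G)"
      then show "F = G" by (cases F; cases G) (simp add: Fun_def)
    qed
    show "(\<lambda>F. (on0 F, on1 F, on2 F)) ` Fun B C \<subseteq> ?Fs"
      by (auto simp: Fun_def two_functor_def Let_def)
    show "?Fs \<prec> (UNIV :: 'u set)" by (intro Times_lt PiE_lt lt)
  qed
  have Ar: "{\<alpha>. pseudonatural B C \<alpha>} \<prec> (UNIV :: 'u set)"
  proof (rule inj_lt)
    show "inj_on (\<lambda>\<alpha>. (csrc \<alpha>, ctgt \<alpha>, cdat \<alpha>)) {\<alpha>. pseudonatural B C \<alpha>}"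
      by (rule inj_onI) (auto intro: cell.expand)
    show "(\<lambda>\<alpha>. (csrc \<alpha>, ctgt \<alpha>, cdat \<alpha>)) ` {\<alpha>. pseudonatural B C \<alpha>} \<subseteq>
       Fun B C \<times> Fun B C \<times> ((Ob B \<rightarrow>\<^sub>E Ar C) \<times> (Ar B \<rightarrow>\<^sub>E Tw C))" (is "_ \<subseteq> ?Y")
    proof (rule image_subsetI)
      fix \<alpha> assume "\<alpha> \<in> {\<alpha>. pseudonatural B C \<alpha>}"
      then have "csrc \<alpha> \<in> Fun B C" "ctgt \<alpha> \<in> Fun B C" "fst (cdat \<alpha>) \<in> Ob B \<rightarrow>\<^sub>E Ar C" "snd (cdat \<alpha>) \<in> Ar B \<rightarrow>\<^sub>E Tw C"
        by (auto simp: pseudonatural_def Let_def hom1_def hom2_def PiE_iff)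
      then show "(csrc \<alpha>, ctgt \<alpha>, cdat \<alpha>) \<in> ?Y" by (simp only: mem_Times_iff fst_conv snd_conv)
    qed
    show "?Y \<prec> (UNIV :: 'u set)" by (intro Times_lt PiE_lt lt Ob)
  qed
  have Tw: "{\<Gamma>. ps_modification B C \<Gamma>} \<prec> (UNIV :: 'u set)"
  proof (rule inj_lt)
    show "inj_on (\<lambda>\<alpha>. (csrc \<alpha>, ctgt \<alpha>, cdat \<alpha>)) {\<Gamma>. ps_modification B C \<Gamma>}"
      by (rule inj_onI) (auto intro: cell.expand)
    show "(\<lambda>\<alpha>. (csrc \<alpha>, ctgt \<alpha>, cdat \<alpha>)) ` {\<Gamma>. ps_modification B C \<Gamma>} \<subseteq>
       {\<alpha>. pseudonatural B C \<alpha>} \<times> {\<alpha>. pseudonatural B C \<alpha>} \<times> (Ob B \<rightarrow>\<^sub>E Tw C)" (is "_ \<subseteq> ?Y")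
    proof (rule image_subsetI)
      fix \<Gamma> assume "\<Gamma> \<in> {\<Gamma>. ps_modification B C \<Gamma>}"
      then have "pseudonatural B C (csrc \<Gamma>)" "pseudonatural B C (ctgt \<Gamma>)" "cdat \<Gamma> \<in> Ob B \<rightarrow>\<^sub>E Tw C"
        by (auto simp: ps_modification_def Let_def hom2_def PiE_iff)
      then show "(csrc \<Gamma>, ctgt \<Gamma>, cdat \<Gamma>) \<in> ?Y" by (simp add: mem_Times_iff)
    qed
    show "?Y \<prec> (UNIV :: 'u set)" by (intro Times_lt PiE_lt lt Ar)
  qed
  have "Ar (ps_hom B C) = {\<alpha>. pseudonatural B C \<alpha>}" "Tw (ps_hom B C) = {\<Gamma>. ps_modification B C \<Gamma>}"
    unfolding set_eq_iff by simp_all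
  then show "Ob (ps_hom B C) \<prec> (UNIV :: 'u set)" "Ar (ps_hom B C) \<prec> (UNIV :: 'u set)" "Tw (ps_hom B C) \<prec> (UNIV :: 'u set)"
    using Ob Ar Tw by simp_all
qed

end

text \<open>The representing bijections are composed with isomorphisms T from Ps(B, Y) to small
  copies \<open>R0 Y\<close>, and the action of Ps(B, -) on 2-functors is conjugated by
  these.\<close>

lemma (in gray) gray_right_adjoint:
  assumes B: "B \<in> Obj TwoCat"
  shows "has_right_adjoint TwoCat (\<lambda>X. g0 X B) (\<lambda>f. g1 f (fid B))"
proof -
  note tB = two_category_Obj[OF B]
  have tP: "two_category (ps_hom B Y)" if "Y \<in> Obj TwoCat" for Y :: "'u tcat"
    by (rule two_category_ps_hom[OF tB two_category_Obj[OF that]])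
  have "\<exists>D :: 'u tcat. \<exists>T S. D \<in> Obj TwoCat \<and> T \<in> Fun (ps_hom B Y) D \<and> S \<in> Fun D (ps_hom B Y) \<and> S \<bullet> T = fid (ps_hom B Y) \<and> T \<bullet> S = fid D"
    if Y: "Y \<in> Obj TwoCat" for Y :: "'u tcat"
    by (rule small_copy[OF tP[OF Y] ps_hom_lt[OF B Y]]) blast
  then obtain R0 :: "'u tcat \<Rightarrow> 'u tcat" and T S where RTS: "\<And>Y. Y \<in> Obj TwoCat \<Longrightarrow> R0 Y \<in> Obj TwoCat \<and>
     T Y \<in> Fun (ps_hom B Y) (R0 Y) \<and> S Y \<in> Fun (R0 Y) (ps_hom B Y) \<and> S Y \<bullet> T Y = fid (ps_hom B Y) \<and> T Y \<bullet> S Y = fid (R0 Y)"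
    by metis
  note R0 = RTS[THEN conjunct1] and T = RTS[THEN conjunct2, THEN conjunct1]
    and S = RTS[THEN conjunct2, THEN conjunct2, THEN conjunct1]
    and ST = RTS[THEN conjunct2, THEN conjunct2, THEN conjunct2, THEN conjunct1]
    and TS = RTS[THEN conjunct2, THEN conjunct2, THEN conjunct2, THEN conjunct2]
  note tR = two_category_Obj[OF R0]
  define m where "m g = ps_map (fid B) g" for g :: "'u tfun"
  have m: "m g \<in> Fun (ps_hom B X) (ps_hom B Y)" if "X \<in> Obj TwoCat" "Y \<in> Obj TwoCat" "g \<in> Fun X Y" for X Y :: "'u tcat" and g
    unfolding m_def by (rule ps_map_in[OF tB tB that(1,2)[THEN two_category_Obj] fid_in[OF tB] that(3)])
  define R1 where "R1 g = T (Cod g) \<bullet> m g \<bullet> S (Dom g)" for g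
  have R1: "R1 g = T Y \<bullet> m g \<bullet> S X" if "g \<in> Fun X Y" for X Y g
    using that by (simp add: R1_def Fun_Dom Fun_Cod)
  have R1_in: "R1 g \<in> Fun (R0 X) (R0 Y)" if "X \<in> Obj TwoCat" "Y \<in> Obj TwoCat" "g \<in> Fun X Y" for X Y g
    unfolding R1[OF that(3)] by (rule fcomp_in[OF tR[OF that(1)] fcomp_in[OF tR[OF that(1)] S[OF that(1)] m[OF that]] T[OF that(2)]])
  \<comment> \<open>Naturality of T, with a further factor h because composites are nested to the
    right.\<close>
  have R1_T: "R1 g \<bullet> T X \<bullet> h = T Y \<bullet> m g \<bullet> h" if X: "X \<in> Obj TwoCat" and Y: "Y \<in> Obj TwoCat" and g: "g \<in> Fun X Y"
      and Z: "two_category Z" and h: "h \<in> Fun Z (ps_hom B X)" for X Y :: "'u tcat" and g h and Z :: "('o, 'a, 't) twocat"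
  proof -
    note Th = fcomp_in[OF Z h T[OF X]]
    have "R1 g \<bullet> T X \<bullet> h = T Y \<bullet> m g \<bullet> S X \<bullet> T X \<bullet> h"
      unfolding R1[OF g] using Fun_Dom[OF S[OF X]] Fun_Dom[OF m[OF X Y g]]
      by (simp add: fcomp_assoc[OF Th] fcomp_assoc[OF fcomp_in[OF Z Th S[OF X]]])
    also have "S X \<bullet> T X \<bullet> h = (S X \<bullet> T X) \<bullet> h"
      by (rule fcomp_assoc[OF h Fun_Dom[OF T[OF X]], symmetric])
    finally show ?thesis by (simp add: ST[OF X] fcomp_fid(2)[OF h])
  qed
  have endo: "endofunctor TwoCat R0 R1"
    unfolding endofunctor_def TwoCat_simps
  proof (intro conjI ballI)
    fix X :: "'u tcat" assume X: "X \<in> Obj TwoCat"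
    show "R0 X \<in> Obj TwoCat" by (rule R0[OF X])
    show "R1 (fid X) = fid (R0 X)"
      by (simp add: R1[OF fid_in[OF two_category_Obj[OF X]]] m_def ps_map_fid[OF tB two_category_Obj[OF X]]
          fcomp_fid(2)[OF S[OF X]] TS[OF X])
  next
    fix X Y :: "'u tcat" and f :: "'u tfun" assume "X \<in> Obj TwoCat" "Y \<in> Obj TwoCat" "f \<in> Fun X Y"
    then show "R1 f \<in> Fun (R0 X) (R0 Y)" by (rule R1_in)
  next
    fix X Y Z :: "'u tcat" and f g :: "'u tfun"
    assume X: "X \<in> Obj TwoCat" and Y: "Y \<in> Obj TwoCat" and Z: "Z \<in> Obj TwoCat" and f: "f \<in> Fun X Y" and g: "g \<in> Fun Y Z"
    note t = X[THEN two_category_Obj] Y[THEN two_category_Obj] Z[THEN two_category_Obj]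
    have "R1 (g \<bullet> f) = T Z \<bullet> (m g \<bullet> m f) \<bullet> S X"
      by (simp add: R1[OF fcomp_in[OF t(1) f g]] m_def ps_map_fcomp[OF tB t f g])
    also have "\<dots> = T Z \<bullet> m g \<bullet> m f \<bullet> S X"
      by (simp only: fcomp_assoc[OF S[OF X] Fun_Dom[OF m[OF X Y f]]])
    also have "\<dots> = R1 g \<bullet> T Y \<bullet> m f \<bullet> S X"
      by (rule R1_T[OF Y Z g tR[OF X] fcomp_in[OF tR[OF X] S[OF X] m[OF X Y f]], symmetric])
    finally show "R1 (g \<bullet> f) = R1 g \<bullet> R1 f" by (simp add: R1[OF f])
  qed
  have bij: "bij_betw (\<lambda>h. T Y \<bullet> \<theta> X B Y h) (Fun (g0 X B) Y) (Fun X (R0 Y))" if X: "X \<in> Obj TwoCat" and Y: "Y \<in> Obj TwoCat" for X Y :: "'u tcat"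
  proof -
    note tX = two_category_Obj[OF X]
    have "bij_betw ((\<bullet>) (T Y)) (Fun X (ps_hom B Y)) (Fun X (R0 Y))"
    proof (rule bij_betw_byWitness[where f' = "(\<bullet>) (S Y)"])
      show "\<forall>h \<in> Fun X (ps_hom B Y). S Y \<bullet> T Y \<bullet> h = h"
        by (simp add: fcomp_assoc[OF _ Fun_Dom[OF T[OF Y]], symmetric] ST[OF Y] fcomp_fid(2))
      show "\<forall>h \<in> Fun X (R0 Y). T Y \<bullet> S Y \<bullet> h = h"
        by (simp add: fcomp_assoc[OF _ Fun_Dom[OF S[OF Y]], symmetric] TS[OF Y] fcomp_fid(2))
    qed (use fcomp_in[OF tX _ T[OF Y]] fcomp_in[OF tX _ S[OF Y]] in auto)
    then show ?thesis
      using bij_betw_trans[OF represents[OF X B Y]] by (simp add: comp_def)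
  qed
  have nat: "T Y' \<bullet> \<theta> X' B Y' (g \<bullet> h \<bullet> g1 f (fid B)) = R1 g \<bullet> (T Y \<bullet> \<theta> X B Y h) \<bullet> f"
    if X: "X \<in> Obj TwoCat" and X': "X' \<in> Obj TwoCat" and Y: "Y \<in> Obj TwoCat" and Y': "Y' \<in> Obj TwoCat"
      and f: "f \<in> Fun X' X" and g: "g \<in> Fun Y Y'" and h: "h \<in> Fun (g0 X B) Y" for X X' Y Y' :: "'u tcat" and f g h
  proof -
    have \<theta>: "\<theta> X B Y h \<in> Fun X (ps_hom B Y)" using represents[OF X B Y] h by (auto simp: bij_betw_def)
    note tX' = two_category_Obj[OF X']
    have "T Y' \<bullet> \<theta> X' B Y' (g \<bullet> h \<bullet> g1 f (fid B)) = T Y' \<bullet> m g \<bullet> \<theta> X B Y h \<bullet> f"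
      by (simp add: \<theta>_natural[OF X B Y X' B Y' f fid_in[OF tB] g h] m_def)
    also have "\<dots> = R1 g \<bullet> T Y \<bullet> \<theta> X B Y h \<bullet> f"
      by (rule R1_T[OF Y Y' g tX' fcomp_in[OF tX' f \<theta>], symmetric])
    also have "T Y \<bullet> \<theta> X B Y h \<bullet> f = (T Y \<bullet> \<theta> X B Y h) \<bullet> f"
      by (rule fcomp_assoc[OF f Fun_Dom[OF \<theta>], symmetric])
    finally show ?thesis .
  qed
  show ?thesis
    unfolding has_right_adjoint_def TwoCat_simps
    by (intro exI[of _ R0] exI[of _ R1] exI[of _ "\<lambda>X Y h. T Y \<bullet> \<theta> X B Y h"] conjI ballI endo bij nat)
qed

section \<open>The Gray monoidal structure\<close>

context monoidal_category begin

text \<open>Naturality of the symmetry along a map f into I, followed by the unit law for the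
  symmetry. The right-hand sides no longer mention a symmetry.\<close>

lemma symm_natural_unit:
  assumes [simp]: "ar f" "cod f = I" "X \<in> Obj C"
  shows "runit_map M X \<circ>\<circ> (Id C X \<odot>\<^bsub>M\<^esub> f) \<circ>\<circ> symm_map M (dom f) X = lunit_map M X \<circ>\<circ> (f \<odot>\<^bsub>M\<^esub> Id C X)"
    "lunit_map M X \<circ>\<circ> (f \<odot>\<^bsub>M\<^esub> Id C X) \<circ>\<circ> symm_map M X (dom f) = runit_map M X \<circ>\<circ> (Id C X \<odot>\<^bsub>M\<^esub> f)"
proof -
  have "runit_map M X \<circ>\<circ> ((Id C X \<odot>\<^bsub>M\<^esub> f) \<circ>\<circ> symm_map M (dom f) X) = (runit_map M X \<circ>\<circ> symm_map M I X) \<circ>\<circ> (f \<odot>\<^bsub>M\<^esub> Id C X)"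
    using natural(4)[of f "Id C X" I X] by simp
  then show "runit_map M X \<circ>\<circ> (Id C X \<odot>\<^bsub>M\<^esub> f) \<circ>\<circ> symm_map M (dom f) X = lunit_map M X \<circ>\<circ> (f \<odot>\<^bsub>M\<^esub> Id C X)"
    by (simp only: symm_unit'[OF assms(3)])
  have "lunit_map M X \<circ>\<circ> ((f \<odot>\<^bsub>M\<^esub> Id C X) \<circ>\<circ> symm_map M X (dom f)) = (lunit_map M X \<circ>\<circ> symm_map M X I) \<circ>\<circ> (Id C X \<odot>\<^bsub>M\<^esub> f)"
    using natural(4)[of "Id C X" f X I] by simp
  then show "lunit_map M X \<circ>\<circ> (f \<odot>\<^bsub>M\<^esub> Id C X) \<circ>\<circ> symm_map M X (dom f) = runit_map M X \<circ>\<circ> (Id C X \<odot>\<^bsub>M\<^esub> f)"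
    by (simp only: symm_unit[OF assms(3)])
qed

text \<open>The unit constraints are invertible, so the unit law can be solved for the
  symmetry.\<close>

lemma symm_unit_unique:
  assumes X [simp]: "X \<in> Obj C"
  shows "\<lbrakk>ar s; dom s = X \<otimes>\<^bsub>M\<^esub> I; cod s = I \<otimes>\<^bsub>M\<^esub> X; lunit_map M X \<circ>\<circ> s = runit_map M X\<rbrakk> \<Longrightarrow> s = symm_map M X I"
    "\<lbrakk>ar s; dom s = I \<otimes>\<^bsub>M\<^esub> X; cod s = X \<otimes>\<^bsub>M\<^esub> I; runit_map M X \<circ>\<circ> s = lunit_map M X\<rbrakk> \<Longrightarrow> s = symm_map M I X"
  by (rule iso_cancel_left[OF lunit_iso[OF X]]; simp add: symm_unit)
    (rule iso_cancel_left[OF runit_iso[OF X]]; simp add: symm_unit')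

end

section \<open>2-Cat as an instance of the lifting\<close>

lemma boba_fcomp:
  assumes F: "F \<in> Fun A B" "boba F" and G: "G \<in> Fun B C" "boba G"
  shows "boba (G \<bullet> F)"
proof -
  note f = bobaD[OF F] and g = bobaD[OF G]
  note D = Fun_Dom[OF F(1)] Fun_Cod[OF G(1)]
  have "bij_betw (on0 (G \<bullet> F)) (Ob A) (Ob C)"
    by (rule bij_betw_cong[THEN iffD2, OF _ bij_betw_trans[OF f(1) g(1)]]) (simp add: D)
  moreover have "bij_betw (on1 (G \<bullet> F)) (Ar A) (Ar C)"
    by (rule bij_betw_cong[THEN iffD2, OF _ bij_betw_trans[OF f(2) g(2)]]) (simp add: D)
  ultimately show ?thesis by (simp add: boba_def D)
qed

lemma lff_fcomp:
  assumes A: "two_category A" and F: "F \<in> Fun A B" "lff F" and G: "G \<in> Fun B C" "lff G"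
  shows "lff (G \<bullet> F)"
  unfolding lff_def
proof (intro ballI)
  interpret A: two_category A by fact
  note D = Fun_Dom[OF F(1)] Fun_Cod[OF F(1)] Fun_Dom[OF G(1)] Fun_Cod[OF G(1)]
  fix x y f g assume x: "x \<in> Ob (Dom (G \<bullet> F))" and y: "y \<in> Ob (Dom (G \<bullet> F))" and f: "f \<in> hom1 (Dom (G \<bullet> F)) x y" and g: "g \<in> hom1 (Dom (G \<bullet> F)) x y"
  have 1: "bij_betw (on2 F) (hom2 A f g) (hom2 B (on1 F f) (on1 F g))"
    using F(2) x y f g unfolding lff_def by (simp add: D)
  have "on0 F x \<in> Ob B" "on0 F y \<in> Ob B" "on1 F f \<in> hom1 B (on0 F x) (on0 F y)" "on1 F g \<in> hom1 B (on0 F x) (on0 F y)"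
    using x y f g by (auto simp: hom1_def D Fun_on[OF F(1)])
  then have 2: "bij_betw (on2 G) (hom2 B (on1 F f) (on1 F g)) (hom2 C (on1 G (on1 F f)) (on1 G (on1 F g)))"
    using G(2) unfolding lff_def by (simp add: D)
  have e: "on2 (G \<bullet> F) \<tau> = (on2 G \<circ> on2 F) \<tau>" if "\<tau> \<in> hom2 A f g" for \<tau>
    using that by (simp add: D hom2_def)
  show "bij_betw (on2 (G \<bullet> F)) (hom2 (Dom (G \<bullet> F)) f g) (hom2 (Cod (G \<bullet> F)) (on1 (G \<bullet> F) f) (on1 (G \<bullet> F) g))"
    using bij_betw_cong[THEN iffD2, OF e bij_betw_trans[OF 1 2]] f g by (simp add: D hom1_def)
qed

lemma boba_fid: "boba (fid A)" and lff_fid: "lff (fid A)"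
  by (auto simp: boba_def lff_def fid_def bij_betw_def inj_on_def hom1_def hom2_def)

lemma typed_category_TwoCat: "typed_category (TwoCat :: ('u tcat, 'u tfun) category) Dom Cod"
  by unfold_locales (auto simp: Fun_Dom Fun_Cod fcomp_fid two_category_Obj intro: fcomp_assoc)

lemma ar_TwoCat: "typed_category.ar TwoCat Dom Cod f \<longleftrightarrow> Dom f \<in> Obj TwoCat \<and> Cod f \<in> Obj TwoCat \<and> f \<in> Fun (Dom f) (Cod f)"
  by (simp add: typed_category.ar_def[OF typed_category_TwoCat])

lemma ar_TwoCatI: "\<lbrakk>f \<in> Fun X Y; X \<in> Obj TwoCat; Y \<in> Obj TwoCat\<rbrakk> \<Longrightarrow> typed_category.ar TwoCat Dom Cod f"
  by (simp add: ar_TwoCat Fun_Dom Fun_Cod)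

locale gray_setup = gray "tens0 S" "tens1 S" \<iota>1 \<iota>2 g0 g1 \<theta> P Q K
  for S :: "('u tcat, 'u tfun) smon" and \<iota>1 \<iota>2 and g0 :: "'u tcat \<Rightarrow> 'u tcat \<Rightarrow> 'u tcat" and g1 \<theta> P Q K +
  assumes S_unit: "unit_ob S = one_cat" and S_mon: "symmetric_monoidal TwoCat S"
    and K_oplax: "oplax_symmetric_id TwoCat S cartesian K (fid one_cat)"

text \<open>The two classes are the boba and the lff 2-functors. Their closure under the outer
  tensors is \<open>boba_st1\<close> and \<open>lff_prod_fun\<close>; fillers come from
  \<open>boba_lff_filler\<close>, their uniqueness from \<open>boba_lff_unique\<close>.\<close>

sublocale gray_setup \<subseteq> L: lifting TwoCat Dom Cod S cartesian g0 g1 K P Q boba lff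
proof (intro lifting.intro monoidal_category.intro tensor.intro tensor_axioms.intro typed_category_TwoCat S_mon
    symmetric_monoidal_cartesian gray_bifunctor lifting_axioms.intro, unfold TwoCat_simps cartesian_sel ar_TwoCat S_unit, goal_cases)
  case 1 show ?case by simp
next case 2 show ?case by (rule K_oplax)
next case (3 X Y) then show ?case using P_in[of X Y] st0_Obj[of X Y] g0_Obj[of X Y] by (simp add: Fun_Dom Fun_Cod)
next case (4 X Y) then show ?case using P_in[of X Y] by (simp add: Fun_Dom)
next case (5 X Y) then show ?case using P_in[of X Y] by (simp add: Fun_Cod)
next case (6 X Y) then show ?case using Q_in[of X Y] prod_cat_Obj[of X Y] g0_Obj[of X Y] by (simp add: Fun_Dom Fun_Cod)
next case (7 X Y) then show ?case using Q_in[of X Y] by (simp add: Fun_Dom)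
next case (8 X Y) then show ?case using Q_in[of X Y] by (simp add: Fun_Cod)
next case (9 f g X Y) then show ?case using P_natural[of "Dom f" "Dom g" X Y f g] by simp
next case (10 f g X Y) then show ?case using Q_natural[of "Dom f" "Dom g" X Y f g] by simp
next case (11 X Y) then show ?case by (rule QP)
next case (12 X Y) then show ?case by (rule boba_P)
next case (13 X Y) then show ?case by (rule lff_Q)
next case 14 show ?case by (rule boba_fid)
next case 15 show ?case by (rule lff_fid)
next case (16 f g) then show ?case using boba_fcomp[of f "Dom f" "Cod f" g "Cod g"] by simp
next case (17 f g) then show ?case using lff_fcomp[of "Dom f" f "Cod f" g "Cod g"] two_category_Obj[of "Dom f"] by simp
next case (18 f g) then show ?case using boba_st1[of "Dom f" "Dom g" "Cod f" "Cod g" f g] by simp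
next case (19 f g)
  then show ?case using lff_prod_fun[of "Dom f" "Dom g" "Cod f" "Cod g" f g]
    two_category_Obj[of "Dom f"] two_category_Obj[of "Dom g"] two_category_Obj[of "Cod f"] two_category_Obj[of "Cod g"] by simp
next case (20 e r p q)
  note t = two_category_Obj[of "Dom e"] two_category_Obj[of "Cod e"] two_category_Obj[of "Dom r"] two_category_Obj[of "Cod r"]
  obtain W where "W \<in> Fun (Cod e) (Dom r)" "W \<bullet> e = p" "r \<bullet> W = q"
    by (rule boba_lff_filler[of "Dom e" "Cod e" "Dom r" "Cod r" e r p q]) (use t 20 in auto)
  then show ?case using 20 by (intro exI[of _ W]) (simp add: Fun_Dom Fun_Cod)
next case (21 e r w w')
  note t = two_category_Obj[of "Dom e"] two_category_Obj[of "Cod e"] two_category_Obj[of "Dom r"] two_category_Obj[of "Cod r"]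
  show ?case by (rule boba_lff_unique[of "Dom e" "Cod e" "Dom r" "Cod r" e r w w']) (use t 21 in auto)
qed

section \<open>Uniqueness of the symmetry\<close>

definition bang :: "'u tcat \<Rightarrow> 'u tfun" where
  "bang A = cellwise A one_cat (\<lambda>_. undefined)"

definition point :: "'u tcat \<Rightarrow> 'u \<Rightarrow> 'u tfun" where
  "point A a = \<lparr>Dom = one_cat, Cod = A, on0 = (\<lambda>x \<in> Ob one_cat. a), on1 = (\<lambda>x \<in> Ar one_cat. id1 A a),
     on2 = (\<lambda>x \<in> Tw one_cat. id2 A (id1 A a))\<rparr>"

context univ begin

lemma bang_in:
  fixes A :: "'u tcat" assumes "two_category A" shows "bang A \<in> Fun A one_cat"
proof -
  interpret two_category A by fact
  show ?thesis unfolding bang_def by (rule FunI) simp_all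
qed

lemma point_in:
  fixes A :: "'u tcat" assumes "two_category A" "a \<in> Ob A" shows "point A a \<in> Fun one_cat A" "on0 (point A a) undefined = a"
proof -
  interpret two_category A by fact
  show "point A a \<in> Fun one_cat A" unfolding point_def using assms(2) by (intro FunI) simp_all
  show "on0 (point A a) undefined = a" by (simp add: point_def)
qed

text \<open>This brings the projections within reach of naturality: they are unit constraints after
  tensoring with a map to 1.\<close>

lemma proj_unit:
  fixes A B :: "'u tcat"
  assumes "two_category A" "two_category B"
  shows "runit_map cartesian A \<bullet> prod_fun (fid A) (bang B) = proj1 A B"
    "lunit_map cartesian B \<bullet> prod_fun (bang A) (fid B) = proj2 A B"
proof -
  note two = assms two_category_one_cat
  note p = prod_fun_in[OF assms fid_in[OF assms(1)] bang_in[OF assms(2)] two(1,3)]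
    prod_fun_in[OF assms bang_in[OF assms(1)] fid_in[OF assms(2)] two(3,2)]
  note P = two_category_prod_cat[OF assms]
  show "runit_map cartesian A \<bullet> prod_fun (fid A) (bang B) = proj1 A B"
    by (rule Fun_eqI[OF fcomp_in[OF P p(1)] proj_in(1)[OF assms]])
      (use assms unit_cell_in in \<open>auto simp: proj1_def bang_def elim!: prod_catE\<close>)
  show "lunit_map cartesian B \<bullet> prod_fun (bang A) (fid B) = proj2 A B"
    by (rule Fun_eqI[OF fcomp_in[OF P p(2)] proj_in(2)[OF assms]])
      (use assms unit_cell_in in \<open>auto simp: proj2_def bang_def elim!: prod_catE\<close>)
qed

end

context gray_setup begin

text \<open>The right-hand sides involve only the bifunctor, the universal family and the structure
  M, and not T. So any two structures with these unit constraints have symmetries with the same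
  projections after Q and the same restrictions to the copies of A and B.\<close>

lemma symm_sides:
  assumes T: "tens0 T = g0" "tens1 T = g1" "unit_ob T = one_cat" "symmetric_monoidal TwoCat T"
    and units: "\<forall>A \<in> Obj TwoCat. lunit_map T A = lunit_map L.M A \<and> runit_map T A = runit_map L.M A"
    and A: "A \<in> Obj TwoCat" and B: "B \<in> Obj TwoCat"
  shows "symm_map T A B \<in> Fun (g0 A B) (g0 B A)"
    "proj1 B A \<bullet> Q B A \<bullet> symm_map T A B = lunit_map L.M B \<bullet> g1 (bang A) (fid B)"
    "proj2 B A \<bullet> Q B A \<bullet> symm_map T A B = runit_map L.M A \<bullet> g1 (fid A) (bang B)"
    "b \<in> Ob B \<Longrightarrow> symm_map T A B \<bullet> gL A B b = g1 (point B b) (fid A) \<bullet> symm_map L.M A one_cat \<bullet> gL A one_cat undefined"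
    "a \<in> Ob A \<Longrightarrow> symm_map T A B \<bullet> gR A B a = g1 (fid B) (point A a) \<bullet> symm_map L.M one_cat B \<bullet> gR one_cat B undefined"
proof -
  note one = one_cat_Obj
  interpret T: monoidal_category TwoCat Dom Cod T
    by (intro monoidal_category.intro typed_category_TwoCat T(4))
  interpret M: monoidal_category TwoCat Dom Cod L.M
    by (intro monoidal_category.intro typed_category_TwoCat L.symmetric_monoidal_M)
  note two = A[THEN two_category_Obj] B[THEN two_category_Obj]
  have s: "symm_map T X Y \<in> Fun (g0 X Y) (g0 Y X)" if "X \<in> Obj TwoCat" "Y \<in> Obj TwoCat" for X Y
    using T.symm_iso[OF that] by (simp add: iso_in_def T)
  show sAB: "symm_map T A B \<in> Fun (g0 A B) (g0 B A)" by (rule s[OF A B])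
  note tg = two_category_Obj[OF g0_Obj[OF A B]]
  note Qs = fcomp_in[OF tg sAB Q_in[OF B A]]
  have bang: "bang X \<in> Fun X one_cat" "typed_category.ar TwoCat Dom Cod (bang X)" "Dom (bang X) = X" "Cod (bang X) = one_cat" if "X \<in> Obj TwoCat" for X :: "'u tcat"
    using ar_TwoCatI[OF bang_in[OF two_category_Obj[OF that]] that one] bang_in[OF two_category_Obj[OF that]] by (simp_all add: Fun_Dom Fun_Cod)
  have assoc3: "(h \<bullet> k) \<bullet> q \<bullet> symm_map T A B = h \<bullet> (k \<bullet> q) \<bullet> symm_map T A B" if "q \<in> Fun (g0 B A) Y" "Dom k = Y" for h k q :: "'u tfun" and Y
    by (simp only: fcomp_assoc[OF fcomp_in[OF tg sAB that(1)] that(2)] fcomp_assoc[OF sAB Fun_Dom[OF that(1)]])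
  note unit_Q = L.M_sel(4,5)[unfolded TwoCat_simps S_unit]
  have prod_B: "prod_fun (fid B) (bang A) \<in> Fun (prod_cat B A) (prod_cat B one_cat)" "prod_fun (bang B) (fid A) \<in> Fun (prod_cat B A) (prod_cat one_cat A)"
    by (rule prod_fun_in[OF two(2,1) _ _ _ _]; (rule fid_in two bang(1) A B two_category_one_cat)+)+
  have g_B: "g1 (fid B) (bang A) \<in> Fun (g0 B A) (g0 B one_cat)" "g1 (bang B) (fid A) \<in> Fun (g0 B A) (g0 one_cat A)"
    by (rule g1_in[OF B A B one fid_in[OF two(2)] bang(1)[OF A]], rule g1_in[OF B A one A bang(1)[OF B] fid_in[OF two(1)]])
  have "proj1 B A \<bullet> Q B A \<bullet> symm_map T A B = runit_map cartesian B \<bullet> (prod_fun (fid B) (bang A) \<bullet> Q B A) \<bullet> symm_map T A B"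
    unfolding proj_unit(1)[OF two(2,1), symmetric] by (rule assoc3[OF Q_in[OF B A] Fun_Dom[OF prod_B(1)]])
  also have "prod_fun (fid B) (bang A) \<bullet> Q B A = Q B one_cat \<bullet> g1 (fid B) (bang A)"
    by (rule Q_natural[OF B A B one fid_in[OF two(2)] bang(1)[OF A], symmetric])
  also have "runit_map cartesian B \<bullet> (Q B one_cat \<bullet> g1 (fid B) (bang A)) \<bullet> symm_map T A B = runit_map L.M B \<bullet> g1 (fid B) (bang A) \<bullet> symm_map T A B"
    unfolding unit_Q by (rule assoc3[OF g_B(1) Fun_Dom[OF Q_in[OF B one]], symmetric])
  also have "\<dots> = lunit_map L.M B \<bullet> g1 (bang A) (fid B)"
    using T.symm_natural_unit(1)[of "bang A" B] bang[OF A] B by (simp add: T units del: L.M_sel)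
  finally show "proj1 B A \<bullet> Q B A \<bullet> symm_map T A B = lunit_map L.M B \<bullet> g1 (bang A) (fid B)" .
  have "proj2 B A \<bullet> Q B A \<bullet> symm_map T A B = lunit_map cartesian A \<bullet> (prod_fun (bang B) (fid A) \<bullet> Q B A) \<bullet> symm_map T A B"
    unfolding proj_unit(2)[OF two(2,1), symmetric] by (rule assoc3[OF Q_in[OF B A] Fun_Dom[OF prod_B(2)]])
  also have "prod_fun (bang B) (fid A) \<bullet> Q B A = Q one_cat A \<bullet> g1 (bang B) (fid A)"
    by (rule Q_natural[OF B A one A bang(1)[OF B] fid_in[OF two(1)], symmetric])
  also have "lunit_map cartesian A \<bullet> (Q one_cat A \<bullet> g1 (bang B) (fid A)) \<bullet> symm_map T A B = lunit_map L.M A \<bullet> g1 (bang B) (fid A) \<bullet> symm_map T A B"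
    unfolding unit_Q by (rule assoc3[OF g_B(2) Fun_Dom[OF Q_in[OF one A]], symmetric])
  also have "\<dots> = runit_map L.M A \<bullet> g1 (fid A) (bang B)"
    using T.symm_natural_unit(2)[of "bang B" A] bang[OF B] A by (simp add: T units del: L.M_sel)
  finally show "proj2 B A \<bullet> Q B A \<bullet> symm_map T A B = runit_map L.M A \<bullet> g1 (fid A) (bang B)" .
  \<comment> \<open>Symmetries with the unit are forced by the unit constraints, which T and M
    share.\<close>
  have u: "symm_map T X one_cat = symm_map L.M X one_cat" "symm_map T one_cat X = symm_map L.M one_cat X" if X: "X \<in> Obj TwoCat" for X
  proof -
    have "lunit_map L.M X \<bullet> symm_map T X one_cat = runit_map L.M X" "runit_map L.M X \<bullet> symm_map T one_cat X = lunit_map L.M X"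
      using T.symm_unit[OF X] T.symm_unit'[OF X] by (simp_all add: T units X del: L.M_sel)
    then show "symm_map T X one_cat = symm_map L.M X one_cat" "symm_map T one_cat X = symm_map L.M one_cat X"
      using M.symm_unit_unique[OF X] ar_TwoCatI[OF s[OF X one] g0_Obj[OF X one] g0_Obj[OF one X]]
        ar_TwoCatI[OF s[OF one X] g0_Obj[OF one X] g0_Obj[OF X one]] s[OF X one] s[OF one X]
      by (simp_all add: S_unit Fun_Dom Fun_Cod del: L.M_sel(4,5))
  qed
  \<comment> \<open>The copy of A at b is the image of the copy of A in A \<otimes> 1 under the
    point b of B, so naturality along that point reduces to the symmetry with the unit.\<close>
  { assume b: "b \<in> Ob B"
    note p = point_in[OF two(2) b]
    interpret G: cubical A one_cat "g0 A one_cat" "gL A one_cat" "gR A one_cat" "gX A one_cat" by (rule g_cubical[OF A one])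
    note l = G.LF_in[of undefined, simplified]
    note g = g1_in[OF A one A B fid_in[OF two(1)] p(1)] g1_in[OF one A B A p(1) fid_in[OF two(1)]]
    have gl: "gL A B b = g1 (fid A) (point B b) \<bullet> gL A one_cat undefined"
      using g1_on(1)[OF A B A one fid_in[OF two(1)] p(1), of undefined] fcomp_fid(1)[OF cubical.LF_in[OF g_cubical[OF A B] b]] by (simp add: p(2))
    have "symm_map T A B \<bullet> g1 (fid A) (point B b) = g1 (point B b) (fid A) \<bullet> symm_map T A one_cat"
      using T.symm_natural[OF A one A B, of "fid A" "point B b"] fid_in[OF two(1)] p(1) by (simp add: T)
    then show "symm_map T A B \<bullet> gL A B b = g1 (point B b) (fid A) \<bullet> symm_map L.M A one_cat \<bullet> gL A one_cat undefined"
      unfolding gl u(1)[OF A, symmetric]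
      using fcomp_assoc[OF l Fun_Dom[OF g(1)]] fcomp_assoc[OF l Fun_Dom[OF s[OF A one]]] by metis }
  { assume a: "a \<in> Ob A"
    note p = point_in[OF two(1) a]
    interpret G: cubical one_cat B "g0 one_cat B" "gL one_cat B" "gR one_cat B" "gX one_cat B" by (rule g_cubical[OF one B])
    note l = G.RF_in[of undefined, simplified]
    note g = g1_in[OF one B A B p(1) fid_in[OF two(2)]] g1_in[OF B one B A fid_in[OF two(2)] p(1)]
    have gl: "gR A B a = g1 (point A a) (fid B) \<bullet> gR one_cat B undefined"
      using g1_on(2)[OF A B one B p(1) fid_in[OF two(2)], of undefined] fcomp_fid(1)[OF cubical.RF_in[OF g_cubical[OF A B] a]] by (simp add: p(2))
    have "symm_map T A B \<bullet> g1 (point A a) (fid B) = g1 (fid B) (point A a) \<bullet> symm_map T one_cat B"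
      using T.symm_natural[OF one B A B, of "point A a" "fid B"] fid_in[OF two(2)] p(1) by (simp add: T)
    then show "symm_map T A B \<bullet> gR A B a = g1 (fid B) (point A a) \<bullet> symm_map L.M one_cat B \<bullet> gR one_cat B undefined"
      unfolding gl u(2)[OF B, symmetric]
      using fcomp_assoc[OF l Fun_Dom[OF g(1)]] fcomp_assoc[OF l Fun_Dom[OF s[OF one B]]] by metis }
qed

text \<open>P is boba and Q is lff, so a 2-functor from A \<otimes> B to B \<otimes> A is determined
  by its composites with P before and Q after. \<open>symm_sides\<close> has computed the first on
  the copies of A and B and the second on the two projections.\<close>

lemma symm_unique:
  assumes T: "tens0 T = g0" "tens1 T = g1" "unit_ob T = one_cat" "symmetric_monoidal TwoCat T"
    and units: "\<forall>A \<in> Obj TwoCat. lunit_map T A = lunit_map L.M A \<and> runit_map T A = runit_map L.M A"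
    and A: "A \<in> Obj TwoCat" and B: "B \<in> Obj TwoCat"
  shows "symm_map T A B = symm_map L.M A B"
proof -
  have M: "tens0 L.M = g0" "tens1 L.M = g1" "unit_ob L.M = one_cat" by (simp_all add: S_unit)
  note sT = symm_sides[OF T units A B]
  have uM: "\<forall>A \<in> Obj TwoCat. lunit_map L.M A = lunit_map L.M A \<and> runit_map L.M A = runit_map L.M A" by blast
  note sM = symm_sides[OF M L.symmetric_monoidal_M uM A B]
  note two = A[THEN two_category_Obj] B[THEN two_category_Obj]
  note g = g0_Obj[OF A B] g0_Obj[OF B A]
  note tg = g[THEN two_category_Obj]
  note S = st0_Obj[OF A B] and P = P_in[OF A B] and i = i_in[OF A B]
  show ?thesis
  proof (rule boba_lff_unique[OF two_category_Obj[OF S] tg two_category_Obj[OF prod_cat_Obj[OF B A]] P boba_P[OF A B]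
      Q_in[OF B A] lff_Q[OF B A] sT(1) sM(1)])
    show "Q B A \<bullet> symm_map T A B = Q B A \<bullet> symm_map L.M A B"
      by (rule prod_cat_eqI[OF two(2,1) fcomp_in[OF tg(1) sT(1) Q_in[OF B A]] fcomp_in[OF tg(1) sM(1) Q_in[OF B A]]])
        (simp_all only: sT(2,3) sM(2,3))
    show "symm_map T A B \<bullet> P A B = symm_map L.M A B \<bullet> P A B"
    proof (rule f_unique[OF A B g(2) fcomp_in[OF two_category_Obj[OF S] P sT(1)] fcomp_in[OF two_category_Obj[OF S] P sM(1)]])
      fix b assume b: "b \<in> Ob B"
      show "(symm_map T A B \<bullet> P A B) \<bullet> iL A B b = (symm_map L.M A B \<bullet> P A B) \<bullet> iL A B b"
        by (simp only: fcomp_assoc[OF i(1)[OF b] Fun_Dom[OF P]] P_i(1)[OF A B b] sT(4)[OF b] sM(4)[OF b])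
    next
      fix a assume a: "a \<in> Ob A"
      show "(symm_map T A B \<bullet> P A B) \<bullet> iR A B a = (symm_map L.M A B \<bullet> P A B) \<bullet> iR A B a"
        by (simp only: fcomp_assoc[OF i(2)[OF a] Fun_Dom[OF P]] P_i(2)[OF A B a] sT(5)[OF a] sM(5)[OF a])
    qed
  qed
qed

lemma gray_monoidal_M: "gray_monoidal S g0 g1 P Q L.M"
  using L.symmetric_monoidal_M L.oplax_P L.oplax_Q gray_right_adjoint
  unfolding gray_monoidal_def closed_monoidal_def by (simp add: S_unit del: L.M_sel(4,5))

lemma gray_monoidal_unique:
  assumes "gray_monoidal S g0 g1 P Q T" "A \<in> Obj TwoCat" "B \<in> Obj TwoCat" "C \<in> Obj TwoCat"
  shows "assoc_map T A B C = assoc_map L.M A B C" "lunit_map T A = lunit_map L.M A" "runit_map T A = runit_map L.M A"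
    "symm_map T A B = symm_map L.M A B"
proof -
  have T: "tens0 T = g0" "tens1 T = g1" "unit_ob T = one_cat" "symmetric_monoidal TwoCat T"
    and TP: "oplax_id TwoCat S T P (fid one_cat)" and TQ: "oplax_id TwoCat T cartesian Q (fid one_cat)"
    using assms(1) by (simp_all add: gray_monoidal_def)
  note u = L.coherence_unique[OF T(1,2) _ T(4), unfolded S_unit TwoCat_simps, OF T(3) TP TQ]
  show "assoc_map T A B C = assoc_map L.M A B C" "lunit_map T A = lunit_map L.M A" "runit_map T A = runit_map L.M A"
    by (rule u; fact)+
  show "symm_map T A B = symm_map L.M A B"
    by (rule symm_unique[OF T _ assms(2,3)]) (use u(1,2) in blast)
qed

end

theorem theorem3p16:
  fixes S :: "('u tcat, 'u tfun) smon"
    and \<iota>1 \<iota>2 K :: "'u tcat \<Rightarrow> 'u tcat \<Rightarrow> 'u tfun"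
    and gray0 :: "'u tcat \<Rightarrow> 'u tcat \<Rightarrow> 'u tcat"
    and gray1 :: "'u tfun \<Rightarrow> 'u tfun \<Rightarrow> 'u tfun"
    and \<theta> :: "'u tcat \<Rightarrow> 'u tcat \<Rightarrow> 'u tcat \<Rightarrow> 'u tfun \<Rightarrow>
      ('u, 'u, 'u, 'u tfun, 'u ptrans, ('u ptrans, 'u \<Rightarrow> 'u) cell) twofun"
    and P Q :: "'u tcat \<Rightarrow> 'u tcat \<Rightarrow> 'u tfun"
  assumes "universe TYPE('u)"
    and "funny_monoidal S \<iota>1 \<iota>2 K"
    and "gray_tensor gray0 gray1 \<theta>"
    and "is_gray_P (tens0 S) \<iota>1 \<iota>2 gray0 \<theta> P"
    and "is_gray_Q gray0 \<theta> Q"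
  shows "(\<forall>A \<in> Obj TwoCat. \<forall>B \<in> Obj TwoCat.
            Q A B \<bullet> P A B = K A B \<and> boba (P A B) \<and> lff (Q A B)) \<and>
         (\<exists>M. gray_monoidal S gray0 gray1 P Q M) \<and>
         (\<forall>M M'. gray_monoidal S gray0 gray1 P Q M \<longrightarrow> gray_monoidal S gray0 gray1 P Q M' \<longrightarrow>
            coherence_agree TwoCat M M')"
proof -
  interpret gray_setup S \<iota>1 \<iota>2 gray0 gray1 \<theta> P Q K
    using assms unfolding funny_monoidal_def
    by (simp add: gray_setup_def gray_setup_axioms_def gray_def gray_axioms_def funny_def univ_def)
  show ?thesis
  proof (intro conjI ballI allI impI)
    fix A B :: "'u tcat" assume AB: "A \<in> Obj TwoCat" "B \<in> Obj TwoCat"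
    show "Q A B \<bullet> P A B = K A B" "boba (P A B)" "lff (Q A B)"
      by (rule QP[OF AB], rule boba_P[OF AB], rule lff_Q[OF AB])
  next
    show "\<exists>M. gray_monoidal S gray0 gray1 P Q M" using gray_monoidal_M by blast
  next
    fix M M' assume M: "gray_monoidal S gray0 gray1 P Q M" and M': "gray_monoidal S gray0 gray1 P Q M'"
    show "coherence_agree TwoCat M M'"
      unfolding coherence_agree_def by (simp add: gray_monoidal_unique[OF M] gray_monoidal_unique[OF M'])
  qed
qed

end
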